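(* Suppose that $\int_0^\infty x\,dF(x)<\infty$ and let $h:\mathbb{N}\to\mathbb{R}^+$ satisfy $\lim_{n\to\infty}h(n)=+\infty$. Let $\vec v$ be a unit vector and $A$ a non-degenerate hyperrectangle orthogonal to $\vec v$. Then $$\lim_{n\to\infty}\frac{\tau(nA,h(n))}{\mathcal{H}^{d-1}(nA)}=\nu(\vec v)\quad\text{in }L^1.$$ Moreover, if $0\in A$ (where $0$ is the origin of $\mathbb{Z}^d$), or if $\int_0^\infty x^{1+\frac1{d-1}}\,dF(x)<\infty$, then $$\lim_{n\to\infty}\frac{\tau(nA,h(n))}{\mathcal{H}^{d-1}(nA)}=\nu(\vec v)\quad\text{almost surely}.$$
   Context: Let $d\ge 2$ and let $\mathbb{E}^d$ be the set of edges between nearest neighbours of $\mathbb{Z}^d$. The capacities $(t(e))_{e\in\mathbb{E}^d}$ are i.i.d. nonnegative real random variables with common distribution function $F$, $F(x)=\mathbb{P}(t(e)\le x)$. $\mathcal{H}^s$ is the $s$-dimensional Hausdorff measure; unit vectors are for the Euclidean norm. Maximal flow: for a finite graph $G=(V,\mathcal{E})$ with capacities $t$ and disjoint non-empty vertex sets $Y,Z$, a flow from $Y$ to $Z$ is an antisymmetric function $\theta$ on oriented edges with $\sum_{y\sim x}\theta(\overrightarrow{xy})=0$ for $x\in V\setminus(Y\cup Z)$ and $|\theta(e)|\le t(e)$ for all edges $e$; its strength is the total flow out of $Y$ (equal to the total flow into $Z$). $\phi_t(G,Y,Z)$ is the maximal strength of a flow from $Y$ to $Z$; by max-flow min-cut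 it equals the minimum of $V(E)=\sum_{e\in E}t(e)$ over sets $E\subset\mathcal{E}$ that meet every path from $Y$ to $Z$ in $G$. A (non-degenerate, closed) hyperrectangle $A\subset\mathbb{R}^d$ is the image by an isometry of $\mathbb{R}^d$ of $\prod_{i=1}^{d-1}[0,k_i]\times\{0\}$ with all $k_i>0$; $nA=\{nx:x\in A\}$. Let $\operatorname{hyp}(A)$ be the hyperplane spanned by $A$, $\vec v$ a unit vector orthogonal to it, and $\operatorname{cyl}(A,h)=\{x+s\vec v: x\in A,\ s\in[-h,h]\}$ for $h>0$. The set $\operatorname{cyl}(A,h)\setminus\operatorname{hyp}(A)$ has two connected components $\mathcal{C}_1(A,h),\mathcal{C}_2(A,h)$; for $i=1,2$, $A_i^h$ is the set of points of $\mathcal{C}_i(A,h)\cap\mathbb{Z}^d$ having a nearest neighbour in $\mathbb{Z}^d\setminus\operatorname{cyl}(A,h)$. Define $\tau(A,h)=\phi_t(\operatorname{cyl}(A,h)\cap\mathbb{Z}^d,A_1^h,A_2^h)$, where $\operatorname{cyl}(A,h)\cap\mathbb{Z}^d$ is the induced subgraph of $\mathbb{Z}^d$; if $A_1^h$ or $A_2^h$ is empty, $\tau(A,h)=0$. For a unit vector $\vec v$, $\nu(\vec v)=\lim_{n\to\infty}\mathbb{E}(\tau(nA,h(n)))/\mathcal{H}^{d-1}(nA)$ for any non-degenerate hyperrectangle $A$ orthogonal to $\vec v$ and any $h$ with $h(n)\to\infty$ (when $\int_0^\infty x\,dF(x)<\infty$ this limit exists and depends only on $\vec v$, $F$, $d$).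 *)

theory Defs
  imports "HOL-Probability.Probability"
begin

(* Countable covers by bounded sets only: diameter is meaningless on unbounded sets.
   The normalization makes the n-dimensional measure of a unit n-cube equal to 1. *)
definition hausdorff_measure :: "nat \<Rightarrow> 'a::metric_space set \<Rightarrow> ennreal" where
  "hausdorff_measure s S =
     (SUP \<delta>\<in>{0::real<..}.
        INF U\<in>{U :: nat \<Rightarrow> 'a set. S \<subseteq> (\<Union>i. U i) \<and> (\<forall>i. bounded (U i) \<and> diameter (U i) \<le> \<delta>)}.
          (\<Sum>i. if U i = {} then 0 else ennreal (unit_ball_vol (real s) * (diameter (U i) / 2) ^ s)))"

definition integer_points :: "(real^'d) set" where
  "integer_points = {x. \<forall>i. x $ i \<in> \<int>}"

definition lattice_edges :: "(real^'d) set set" where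
  "lattice_edges = {{x, y} | x y. x \<in> integer_points \<and> y \<in> integer_points \<and> dist x y = 1}"

definition induced_edges :: "(real^'d) set \<Rightarrow> (real^'d) set set" where
  "induced_edges V = {e \<in> lattice_edges. e \<subseteq> V}"

(* A graph is given by its vertex set V and its set E of undirected edges {x, y};
   \<theta> x y is the value of the flow on the oriented edge from x to y. *)
definition is_flow ::
  "'v set \<Rightarrow> 'v set set \<Rightarrow> ('v set \<Rightarrow> real) \<Rightarrow> 'v set \<Rightarrow> 'v set \<Rightarrow> ('v \<Rightarrow> 'v \<Rightarrow> real) \<Rightarrow> bool" where
  "is_flow V E c Y Z \<theta> \<longleftrightarrow>
     (\<forall>x y. {x, y} \<in> E \<longrightarrow> \<theta> x y = - \<theta> y x \<and> \<bar>\<theta> x y\<bar> \<le> c {x, y}) \<and>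
     (\<forall>x \<in> V - (Y \<union> Z). (\<Sum>y | {x, y} \<in> E. \<theta> x y) = 0)"

(* Edges with both endpoints in Y contribute 0 by antisymmetry. *)
definition flow_strength :: "'v set set \<Rightarrow> 'v set \<Rightarrow> ('v \<Rightarrow> 'v \<Rightarrow> real) \<Rightarrow> real" where
  "flow_strength E Y \<theta> = (\<Sum>x\<in>Y. \<Sum>y | {x, y} \<in> E. \<theta> x y)"

definition max_flow ::
  "'v set \<Rightarrow> 'v set set \<Rightarrow> ('v set \<Rightarrow> real) \<Rightarrow> 'v set \<Rightarrow> 'v set \<Rightarrow> real" where
  "max_flow V E c Y Z = Sup {flow_strength E Y \<theta> | \<theta>. is_flow V E c Y Z \<theta>}"

(* The distinguished coordinate j may be arbitrary, since permuting coordinates is an isometry. *)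
definition hyperrectangle :: "(real^'d) set \<Rightarrow> bool" where
  "hyperrectangle A \<longleftrightarrow>
     (\<exists>(f :: real^'d \<Rightarrow> real^'d) j k. (\<forall>x y. dist (f x) (f y) = dist x y) \<and> (\<forall>i. i \<noteq> j \<longrightarrow> 0 < k i) \<and>
        A = f ` {x. x $ j = 0 \<and> (\<forall>i. i \<noteq> j \<longrightarrow> 0 \<le> x $ i \<and> x $ i \<le> k i)})"

definition unit_normal :: "real^'d \<Rightarrow> (real^'d) set \<Rightarrow> bool" where
  "unit_normal v A \<longleftrightarrow>
     norm v = 1 \<and> (\<forall>x\<in>affine hull A. \<forall>y\<in>affine hull A. orthogonal v (x - y))"

definition cyl :: "real^'d \<Rightarrow> (real^'d) set \<Rightarrow> real \<Rightarrow> (real^'d) set" where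
  "cyl v A h = {x + s *\<^sub>R v | x s. x \<in> A \<and> s \<in> {-h..h}}"

(* The labelling of the two components is immaterial: exchanging source and sink
   does not change the maximal flow. *)
definition cyl_sides :: "real^'d \<Rightarrow> (real^'d) set \<Rightarrow> real \<Rightarrow> (real^'d) set \<times> (real^'d) set" where
  "cyl_sides v A h =
     (SOME C. fst C \<noteq> snd C \<and> components (cyl v A h - affine hull A) = {fst C, snd C})"

definition side_boundary ::
  "real^'d \<Rightarrow> (real^'d) set \<Rightarrow> real \<Rightarrow> (real^'d) set \<Rightarrow> (real^'d) set" where
  "side_boundary v A h C =
     {x \<in> C \<inter> integer_points. \<exists>y \<in> integer_points - cyl v A h. {x, y} \<in> lattice_edges}"

definition tau :: "((real^'d) set \<Rightarrow> real) \<Rightarrow> real^'d \<Rightarrow> (real^'d) set \<Rightarrow> real \<Rightarrow> real" where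
  "tau c v A h =
     (let V = cyl v A h \<inter> integer_points;
          A1 = side_boundary v A h (fst (cyl_sides v A h));
          A2 = side_boundary v A h (snd (cyl_sides v A h))
      in if A1 = {} \<or> A2 = {} then 0 else max_flow V (induced_edges V) c A1 A2)"

(* For n = 0 the denominator vanishes and the quotient is 0 by convention. *)
definition rescaled_flow ::
  "((real^'d) set \<Rightarrow> 'w \<Rightarrow> real) \<Rightarrow> real^'d \<Rightarrow> (real^'d) set \<Rightarrow> (nat \<Rightarrow> real) \<Rightarrow> nat \<Rightarrow> 'w \<Rightarrow> real" where
  "rescaled_flow t v A h n \<omega> =
     tau (\<lambda>e. t e \<omega>) v ((*\<^sub>R) (real n) ` A) (h n) /
     enn2real (hausdorff_measure (CARD('d) - 1) ((*\<^sub>R) (real n) ` A))"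

definition flow_constant ::
  "'w measure \<Rightarrow> ((real^'d) set \<Rightarrow> 'w \<Rightarrow> real) \<Rightarrow> real^'d \<Rightarrow> real" where
  "flow_constant M t v =
     (THE L. \<forall>A h. hyperrectangle A \<and> unit_normal v A \<and> (\<forall>n. 0 < h n) \<and> filterlim h at_top sequentially
        \<longrightarrow> (\<lambda>n. \<integral>\<omega>. rescaled_flow t v A h n \<omega> \<partial>M) \<longlonglongrightarrow> L)"

(* Integrability is required explicitly since the Bochner integral of a
   non-integrable function is 0. *)
definition tendsto_L1 :: "'w measure \<Rightarrow> (nat \<Rightarrow> 'w \<Rightarrow> real) \<Rightarrow> real \<Rightarrow> bool" where
  "tendsto_L1 M X c \<longleftrightarrow>
     (\<forall>n. integrable M (X n)) \<and> (\<lambda>n. \<integral>\<omega>. \<bar>X n \<omega> - c\<bar> \<partial>M) \<longlonglongrightarrow> 0"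

end

theory Submission
  imports Defs
begin

text \<open>
By the max-flow min-cut theorem the flow through a cylinder is the least capacity of a set of edges
that separates the upper part of its lateral boundary from the lower part. Such cuts can be glued.
If a large flat cylinder contains disjoint small ones whose middle levels lie near its own, their
minimal cuts together with the edges near the uncovered part of the hyperplane and near the walls of
the small cylinders form a cut of the large one (\<open>min_cut_gluing\<close>). Hence the flow is subadditive up
to a number of edges of the order of the uncovered area and the wall area (\<open>card_interface_edges\<close>).

Tiling by integer translates of one cylinder gives independent copies of its flow
(\<open>tiling_inequality\<close>, \<open>flows_iid\<close>). So the mean flow per area converges to an infimum over tiles, and
this number depends on the direction alone, because the tiles of one rectangle may be used for any
other one (\<open>mean_flow_tendsto\<close>). The weak law for the tiles bounds the positive part of the deviation,
and together with the convergence of the means this gives convergence in \<open>L\<^sup>1\<close> (\<open>flow_L1_tendsto\<close>).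

The almost sure upper bound needs a strong law for the sums over the tiles and over the gaps
(\<open>bounded_averages\<close>). The tiles move with \<open>n\<close> in general, and a strong law for arrays with arbitrary
dependence between the rows holds under the moment of order \<open>1 + 1 / (d - 1)\<close>; if \<open>0 \<in> A\<close>, everything
takes place in a fixed slab around the hyperplane, and the first moment suffices.

The almost sure lower bound is first proved along powers of two. Doubling a rectangle replaces the
flow by at most the average of \<open>2 ^ (d - 1)\<close> independent copies plus a summable error. For a strictly convex
function of linear growth the Jensen gaps of these averages are summable. They control the variances
of a bounded function of the flow, and Borel-Cantelli applies (\<open>averaging_variances_summable\<close>). For other \<open>n\<close>
the rectangle is enclosed in a dyadic one that is larger by a factor close to 1, and gluing a single cylinder compares the two
flows (\<open>flow_lower_bound_as\<close>).

The Hausdorff measure of a rectangle is a positive multiple of its area, which is seen by covering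
and packing it with small cubes (\<open>hausdorff_measure_flat_box\<close>).
\<close>

abbreviation eventually_seq (binder "EV " 10) where
 "eventually_seq P == eventually P sequentially"

section \<open>Max-flow min-cut for finite graphs\<close>

definition cut_edges :: "'v set set => 'v set => 'v set set" where
 "cut_edges E S = {e \<in> E. e \<inter> S ~= {} & \<not> e \<subseteq> S}"

definition cut_cost :: "'v set set => ('v set => real) => 'v set => real" where
 "cut_cost E c S = (\<Sum>e\<in>cut_edges E S. c e)"

text \<open>Subsequences are extracted for one point after the other.\<close>

lemma pointwise_convergent_subsequence:
 fixes f :: "nat => 'p => real"
 assumes "finite P" and "!!n p. p \<in> P ==> \<bar>f n p\<bar> <= B p"
 shows "\<exists>r. strict_mono r & (\<forall>p\<in>P. convergent (%n. f (r n) p))"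
 using assms
proof (induction P rule: finite_induct)
 case empty
 then show ?case by (intro exI[of _ id]) (auto simp: strict_mono_def)
next
 case (insert p P)
 then obtain r where r: "strict_mono r" "\<forall>p\<in>P. convergent (%n. f (r n) p)"
  by blast
 have "bounded (range (%n. f (r n) p))"
  using insert.prems by (auto simp: bounded_iff)
 then obtain l s where s: "strict_mono s" "((%n. f (r n) p) \<circ> s) \<longlonglongrightarrow> l"
  using bounded_imp_convergent_subsequence by blast
 have "\<forall>q\<in>insert p P. convergent (%n. f ((r \<circ> s) n) q)"
 proof
  fix q assume "q \<in> insert p P"
  then consider "q = p" | "q \<in> P" by blast
  then show "convergent (%n. f ((r \<circ> s) n) q)"
  proof cases
   case 1
   then show ?thesis using s(2) by (auto simp: convergent_def o_def)
  next
   case 2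
   then obtain l' where "(%n. f (r n) q) \<longlonglongrightarrow> l'" using r(2) by (auto simp: convergent_def)
   from LIMSEQ_subseq_LIMSEQ[OF this s(1)] show ?thesis
    by (auto simp: convergent_def o_def)
  qed
 qed
 then show ?case using strict_mono_o[OF r(1) s(1)] by blast
qed

lemma double_sum_antisym:
 fixes a :: "'v => 'v => real"
 assumes "!!x y. a x y = - a y x"
 shows "(\<Sum>x\<in>S. \<Sum>y\<in>S. a x y) = 0"
proof -
 have "(\<Sum>x\<in>S. \<Sum>y\<in>S. a x y) = (\<Sum>x\<in>S. \<Sum>y\<in>S. a y x)"
  by (rule sum.swap)
 also have "... = - (\<Sum>x\<in>S. \<Sum>y\<in>S. a x y)"
  unfolding sum_negf[symmetric] by (intro sum.cong refl) (rule assms)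
 finally show ?thesis by simp
qed

locale capacity_graph =
 fixes V :: "'v set" and E :: "'v set set" and c :: "'v set => real" and Y Z :: "'v set"
 assumes finV: "finite V"
  and E: "!!e. e \<in> E ==> \<exists>x y. e = {x, y} & x \<in> V & y \<in> V & x ~= y"
  and c: "!!e. e \<in> E ==> 0 <= c e"
  and YZ: "Y \<subseteq> V" "Z \<subseteq> V" "Y \<inter> Z = {}"
begin

lemma edgeD: "{x, y} \<in> E ==> x \<in> V & y \<in> V & x ~= y"
 using E[of "{x,y}"] by (auto simp: doubleton_eq_iff)

definition net :: "('v => 'v => real) => 'v => real" where
 "net \<theta> x = (\<Sum>y | {x, y} \<in> E. \<theta> x y)"

definition onE :: "('v => 'v => real) => 'v => 'v => real" where
 "onE \<theta> x y = (if {x, y} \<in> E then \<theta> x y else 0)"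

lemma flow_bound: "is_flow V E c Y Z \<theta> ==> {x, y} \<in> E ==> \<bar>\<theta> x y\<bar> <= c {x, y}"
 unfolding is_flow_def by blast

lemma flow_anti: "is_flow V E c Y Z \<theta> ==> {x, y} \<in> E ==> \<theta> x y = - \<theta> y x"
 unfolding is_flow_def by blast

lemma net_onE: "net \<theta> x = (\<Sum>y\<in>V. onE \<theta> x y)"
 unfolding net_def onE_def using finV edgeD
 by (intro sum.mono_neutral_cong_left) auto

lemma net_sum:
 assumes anti: "!!x y. {x, y} \<in> E ==> \<theta> x y = - \<theta> y x" and S: "S \<subseteq> V"
 shows "(\<Sum>x\<in>S. net \<theta> x) = (\<Sum>x\<in>S. \<Sum>y\<in>V - S. onE \<theta> x y)"
proof -
 have anti': "onE \<theta> x y = - onE \<theta> y x" for x y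
  using anti[of x y] by (auto simp: onE_def insert_commute)
 have "(\<Sum>x\<in>S. net \<theta> x) = (\<Sum>x\<in>S. (\<Sum>y\<in>V - S. onE \<theta> x y) + (\<Sum>y\<in>S. onE \<theta> x y))"
  unfolding net_onE using S finV by (intro sum.cong refl) (simp add: sum.subset_diff)
 also have "... = (\<Sum>x\<in>S. \<Sum>y\<in>V - S. onE \<theta> x y)"
  by (simp add: sum.distrib double_sum_antisym[OF anti'])
 finally show ?thesis .
qed

lemma cut_cost_pairs:
 assumes S: "S \<subseteq> V"
 shows "cut_cost E c S = (\<Sum>x\<in>S. \<Sum>y\<in>V - S. onE (%x y. c {x, y}) x y)"
proof -
 let ?P = "{p \<in> S \<times> (V - S). {fst p, snd p} \<in> E}"
 have fin: "finite S" using S finV finite_subset by blast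
 have "(\<Sum>x\<in>S. \<Sum>y\<in>V - S. onE (%x y. c {x, y}) x y)
   = (\<Sum>p\<in>S \<times> (V - S). onE (%x y. c {x, y}) (fst p) (snd p))"
  by (simp add: sum.cartesian_product case_prod_beta)
 also have "... = (\<Sum>p\<in>?P. c {fst p, snd p})"
  using fin finV by (intro sum.mono_neutral_cong_right) (auto simp: onE_def)
 also have "... = (\<Sum>e\<in>cut_edges E S. c e)"
 proof (rule sum.reindex_cong[symmetric, of "%p. {fst p, snd p}"])
  show "inj_on (%p. {fst p, snd p}) ?P"
   by (auto simp: inj_on_def doubleton_eq_iff)
  show "cut_edges E S = (%p. {fst p, snd p}) ` ?P"
  proof (intro equalityI subsetI)
   fix e assume e: "e \<in> cut_edges E S"
   then have "e \<in> E" by (simp add: cut_edges_def)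
   with E[OF this] obtain x y where xy: "e = {x, y}" "x \<in> V" "y \<in> V" "x ~= y" "e \<in> E"
    by blast
   then have "(x \<in> S & y \<notin> S) \<or> (y \<in> S & x \<notin> S)"
    using e by (auto simp: cut_edges_def)
   then show "e \<in> (%p. {fst p, snd p}) ` ?P"
   proof
    assume "x \<in> S & y \<notin> S"
    then show ?thesis using xy by (intro image_eqI[of _ _ "(x, y)"]) auto
   next
    assume "y \<in> S & x \<notin> S"
    then show ?thesis using xy
     by (intro image_eqI[of _ _ "(y, x)"]) (auto simp: insert_commute)
   qed
  qed (auto simp: cut_edges_def)
 qed simp
 finally show ?thesis by (simp add: cut_cost_def)
qed

text \<open>The net outflow vanishes off sources and sinks, and summing it over one side of a cut cancels
  the edges inside that side.\<close>

lemma strength_cut: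
 assumes \<theta>: "is_flow V E c Y Z \<theta>" and S: "Y \<subseteq> S" "S \<subseteq> V - Z"
 shows "flow_strength E Y \<theta> = (\<Sum>x\<in>S. \<Sum>y\<in>V - S. onE \<theta> x y)"
proof -
 have fin: "finite S" using S finV finite_subset by blast
 have "(\<Sum>x\<in>Y. net \<theta> x) = (\<Sum>x\<in>S. net \<theta> x)"
  using \<theta> S fin by (intro sum.mono_neutral_left) (auto simp: is_flow_def net_def)
 also have "... = (\<Sum>x\<in>S. \<Sum>y\<in>V - S. onE \<theta> x y)"
  using flow_anti[OF \<theta>] S by (intro net_sum) blast+
 finally show ?thesis by (simp add: flow_strength_def net_def)
qed

lemma strength_le_cut:
 assumes \<theta>: "is_flow V E c Y Z \<theta>" and S: "Y \<subseteq> S" "S \<subseteq> V - Z"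
 shows "flow_strength E Y \<theta> <= cut_cost E c S"
proof -
 have "S \<subseteq> V" using S by blast
 show ?thesis
  unfolding strength_cut[OF assms] cut_cost_pairs[OF \<open>S \<subseteq> V\<close>]
 proof (intro sum_mono)
  fix x y
  show "onE \<theta> x y <= onE (%x y. c {x, y}) x y"
   using flow_bound[OF \<theta>, of x y] by (auto simp: onE_def abs_le_iff)
 qed
qed

lemma zero_flow: "is_flow V E c Y Z (%_ _. 0)"
 using c by (auto simp: is_flow_def)

lemma YinV: "Y \<subseteq> V - Z" using YZ by blast

text \<open>A maximal flow exists because the flows restricted to the finitely many edges form a
  compact set.\<close>

lemma max_flow_attained:
 obtains \<theta> where "is_flow V E c Y Z \<theta>"
  "!!\<theta>'. is_flow V E c Y Z \<theta>' ==> flow_strength E Y \<theta>' <= flow_strength E Y \<theta>"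
proof -
 define F where "F = {flow_strength E Y \<theta> | \<theta>. is_flow V E c Y Z \<theta>}"
 have ne: "F ~= {}" using zero_flow by (auto simp: F_def)
 have bdd: "bdd_above F"
  unfolding F_def using strength_le_cut[OF _ order_refl YinV] by (intro bdd_aboveI) blast
 have "\<exists>s\<in>F. Sup F - 1/real (Suc n) < s" for n
  using less_cSup_iff[OF ne bdd, of "Sup F - 1/real (Suc n)"] by simp
 then obtain s where s: "!!n. s n \<in> F" "!!n. Sup F - 1/real (Suc n) < s n"
  by metis
 then have "\<forall>n. \<exists>\<theta>. is_flow V E c Y Z \<theta> & s n = flow_strength E Y \<theta>"
  by (auto simp: F_def)
 then obtain \<Theta> where \<Theta>: "!!n. is_flow V E c Y Z (\<Theta> n)" "!!n. s n = flow_strength E Y (\<Theta> n)"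
  by metis
 let ?P = "{p \<in> V \<times> V. {fst p, snd p} \<in> E}"
 have "\<exists>r. strict_mono r & (\<forall>p\<in>?P. convergent (%n. (%n p. \<Theta> n (fst p) (snd p)) (r n) p))"
 proof (rule pointwise_convergent_subsequence[where B = "%p. c {fst p, snd p}"])
  show "finite ?P" using finV by simp
  show "\<bar>\<Theta> n (fst p) (snd p)\<bar> <= c {fst p, snd p}" if "p \<in> ?P" for n p
   using that by (intro flow_bound[OF \<Theta>(1)]) simp
 qed
 then obtain r where r: "strict_mono r" "!!p. p \<in> ?P ==> convergent (%n. \<Theta> (r n) (fst p) (snd p))"
  by auto
 define \<theta> where "\<theta> x y = lim (%n. \<Theta> (r n) x y)" for x y
 have lim: "(%n. \<Theta> (r n) x y) \<longlonglongrightarrow> \<theta> x y" if "{x, y} \<in> E" for x y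
  using r(2)[of "(x, y)"] that edgeD[OF that] by (simp add: \<theta>_def convergent_LIMSEQ_iff)
 have flow: "is_flow V E c Y Z \<theta>"
  unfolding is_flow_def
 proof (intro conjI allI impI ballI)
  fix x y assume e: "{x, y} \<in> E"
  then have e': "{y, x} \<in> E" by (simp add: insert_commute)
  have "(%n. \<Theta> (r n) x y) \<longlonglongrightarrow> - \<theta> y x"
   using tendsto_minus[OF lim[OF e']] by (subst flow_anti[OF \<Theta>(1) e])
  then show "\<theta> x y = - \<theta> y x" using lim[OF e] LIMSEQ_unique by blast
  show "\<bar>\<theta> x y\<bar> <= c {x, y}"
  proof (rule LIMSEQ_le_const2[OF tendsto_rabs[OF lim[OF e]]])
   show "\<exists>N. \<forall>n\<ge>N. \<bar>\<Theta> (r n) x y\<bar> <= c {x, y}"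
    using flow_bound[OF \<Theta>(1) e] by simp
  qed
 next
  fix x assume x: "x \<in> V - (Y \<union> Z)"
  have "(%n. \<Sum>y | {x, y} \<in> E. \<Theta> (r n) x y) \<longlonglongrightarrow> (\<Sum>y | {x, y} \<in> E. \<theta> x y)"
   by (intro tendsto_sum lim) auto
  moreover have "(\<Sum>y | {x, y} \<in> E. \<Theta> (r n) x y) = 0" for n
   using \<Theta>(1)[of "r n"] x by (auto simp: is_flow_def)
  ultimately show "(\<Sum>y | {x, y} \<in> E. \<theta> x y) = 0"
   by (simp add: LIMSEQ_const_iff)
 qed
 have "(%n. flow_strength E Y (\<Theta> (r n))) \<longlonglongrightarrow> flow_strength E Y \<theta>"
  unfolding flow_strength_def by (intro tendsto_sum lim) auto
 moreover have "s \<longlonglongrightarrow> Sup F"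
 proof (rule tendsto_sandwich)
  show "EV n. Sup F - 1/real (Suc n) <= s n"
   using s(2) by (intro always_eventually allI less_imp_le)
  show "EV n. s n <= Sup F"
   using s(1) bdd by (intro always_eventually allI cSup_upper)
  show "(%n. Sup F - 1/real (Suc n)) \<longlonglongrightarrow> Sup F"
   using tendsto_diff[OF tendsto_const LIMSEQ_inverse_real_of_nat, of "Sup F"]
   by (simp add: inverse_eq_divide)
 qed auto
 from LIMSEQ_subseq_LIMSEQ[OF this r(1)]
 have "(%n. flow_strength E Y (\<Theta> (r n))) \<longlonglongrightarrow> Sup F" by (simp add: o_def \<Theta>(2))
 ultimately have "flow_strength E Y \<theta> = Sup F" using LIMSEQ_unique by blast
 moreover have "flow_strength E Y \<theta>' <= Sup F" if "is_flow V E c Y Z \<theta>'" for \<theta>'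
  using that bdd by (intro cSup_upper) (auto simp: F_def)
 ultimately show ?thesis using that[OF flow] by simp
qed

text \<open>The vertices that can be reached from the sources along edges which the flow does not
  saturate.\<close>

inductive residual :: "('v \<Rightarrow> 'v \<Rightarrow> real) \<Rightarrow> 'v \<Rightarrow> bool" for \<theta> where
  source: "y \<in> Y \<Longrightarrow> residual \<theta> y"
| step: "residual \<theta> x \<Longrightarrow> {x, y} \<in> E \<Longrightarrow> \<theta> x y < c {x, y} \<Longrightarrow> residual \<theta> y"

text \<open>Instead of a simple augmenting path it is enough to keep a perturbation that transports
  one unit from the sources and is positive only on unsaturated edges: it is extended edge by
  edge, and cancellations do no harm.\<close>

lemma residual_perturbation:
 assumes "residual \<theta> x"
 shows "\<exists>g. (\<forall>u w. g u w = - g w u) & (\<forall>u w. 0 < g u w --> {u, w} \<in> E & \<theta> u w < c {u, w}) &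
   (\<forall>w\<in>V - Y. net g w = (if w = x then -1 else 0))"
 using assms
proof (induction rule: residual.induct)
 case (source y)
 then show ?case by (intro exI[of _ "%_ _. 0"]) (auto simp: net_def)
next
 case (step x y)
 then obtain g where g: "!!u w. g u w = - g w u"
   "!!u w. 0 < g u w ==> {u, w} \<in> E & \<theta> u w < c {u, w}"
   "!!w. w \<in> V - Y ==> net g w = (if w = x then -1 else 0)"
  by blast
 have xy: "x \<in> V" "y \<in> V" "x ~= y" using edgeD step.hyps by auto
 define b where "b u w = (if u = x & w = y then 1 else if u = y & w = x then -1 else (0::real))" for u w
 define g' where "g' u w = g u w + b u w" for u w
 have netb: "net b w = (if w = x then 1 else if w = y then -1 else 0)" for w
 proof -
  have fin: "finite {u. {w, u} \<in> E}" by (rule finite_subset[OF _ finV]) (use edgeD in auto)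
  have "net b w = (\<Sum>u | {w, u} \<in> E. (if w = x then (if u = y then 1 else 0) else 0)
    + (if w = y then (if u = x then -1 else 0) else 0))"
   unfolding net_def by (intro sum.cong refl) (use xy in \<open>auto simp: b_def\<close>)
  also have "... = (if w = x then 1 else if w = y then -1 else 0)"
   using fin step.hyps(2) xy by (auto simp: sum.distrib sum.delta insert_commute)
  finally show ?thesis .
 qed
 have "net g' w = net g w + net b w" for w
  by (simp add: net_def g'_def sum.distrib)
 then have "net g' w = (if w = y then -1 else 0)" if "w \<in> V - Y" for w
  using g(3)[OF that] netb[of w] xy by auto
 moreover have "g' u w = - g' w u" for u w using g(1)[of u w] xy by (auto simp: g'_def b_def)
 moreover have "{u, w} \<in> E & \<theta> u w < c {u, w}" if "0 < g' u w" for u w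
 proof (cases "u = x & w = y")
  case True then show ?thesis using step.hyps by auto
 next
  case False
  then have "0 < g u w" using that by (auto simp: g'_def b_def split: if_splits)
  then show ?thesis by (rule g(2))
 qed
 ultimately show ?case by blast
qed

lemma residual_in_V: "residual \<theta> x ==> x \<in> V"
 by (induction rule: residual.induct) (use YZ edgeD in auto)

text \<open>A small multiple of the perturbation respects all capacities and would increase a maximal
  flow.\<close>

lemma max_flow_no_residual_sink:
 assumes \<theta>: "is_flow V E c Y Z \<theta>"
  and max: "!!\<theta>'. is_flow V E c Y Z \<theta>' ==> flow_strength E Y \<theta>' <= flow_strength E Y \<theta>"
  and z: "residual \<theta> z" "z \<in> Z"
 shows False
proof -
 obtain g where g: "!!u w. g u w = - g w u"
   "!!u w. 0 < g u w ==> {u, w} \<in> E & \<theta> u w < c {u, w}"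
   "!!w. w \<in> V - Y ==> net g w = (if w = z then -1 else 0)"
  using residual_perturbation[OF z(1)] by blast
 let ?P = "{p \<in> V \<times> V. 0 < g (fst p) (snd p)}"
 have "finite ?P" using finV by simp
 have ex: "\<exists>eps>0. \<forall>p\<in>Q. eps*g (fst p) (snd p) <= c {fst p, snd p} - \<theta> (fst p) (snd p)"
  if "finite Q" "Q \<subseteq> ?P" for Q
  using that
 proof (induction Q rule: finite_induct)
  case empty then show ?case by (intro exI[of _ 1]) auto
 next
  case (insert p Q)
  then obtain eps where eps: "eps > 0"
   "\<forall>p\<in>Q. eps*g (fst p) (snd p) <= c {fst p, snd p} - \<theta> (fst p) (snd p)" by auto
  have gp: "0 < g (fst p) (snd p)" using insert.prems by auto
  define dl where "dl = (c {fst p, snd p} - \<theta> (fst p) (snd p))/g (fst p) (snd p)"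
  have "dl > 0" using g(2)[OF gp] gp by (simp add: dl_def)
  have "min eps dl*g (fst q) (snd q) <= c {fst q, snd q} - \<theta> (fst q) (snd q)"
   if "q \<in> insert p Q" for q
  proof (cases "q = p")
   case True
   have "min eps dl*g (fst p) (snd p) <= dl*g (fst p) (snd p)"
    using gp by (intro mult_right_mono) auto
   also have "... = c {fst p, snd p} - \<theta> (fst p) (snd p)" using gp by (simp add: dl_def)
   finally show ?thesis using True by simp
  next
   case False
   then have q: "q \<in> Q" using that by blast
   then have "0 < g (fst q) (snd q)" using insert.prems by auto
   then have "min eps dl*g (fst q) (snd q) <= eps*g (fst q) (snd q)"
    by (intro mult_right_mono) auto
   then show ?thesis using eps(2) q by force
  qed
  moreover have "min eps dl > 0" using eps \<open>dl > 0\<close> by simp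
  ultimately show ?case by blast
 qed
 from ex[OF \<open>finite ?P\<close>]
 obtain eps where eps: "eps > 0"
  "!!p. p \<in> ?P ==> eps*g (fst p) (snd p) <= c {fst p, snd p} - \<theta> (fst p) (snd p)"
  by blast
 have \<theta>': "\<theta> x y = - \<theta> y x" "\<bar>\<theta> x y\<bar> <= c {x, y}" if "{x, y} \<in> E" for x y
  using flow_anti[OF \<theta> that] flow_bound[OF \<theta> that] by simp_all
 define \<eta> where "\<eta> u w = \<theta> u w + eps*g u w" for u w
 have up: "\<eta> u w <= c {u, w}" if "{u, w} \<in> E" for u w
 proof (cases "0 < g u w")
  case True
  then show ?thesis using eps(2)[of "(u, w)"] edgeD[OF that] by (simp add: \<eta>_def)
 next
  case False
  then have "eps*g u w <= 0" using eps(1) by (simp add: mult_nonneg_nonpos)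
  then show ?thesis using \<theta>'(2)[OF that] by (simp add: \<eta>_def)
 qed
 have net\<eta>: "net \<eta> x = net \<theta> x + eps*net g x" for x
  by (simp add: net_def \<eta>_def sum.distrib sum_distrib_left)
 have anti: "\<eta> x y = - \<eta> y x" if "{x, y} \<in> E" for x y
  using \<theta>'(1)[OF that] g(1)[of x y] by (simp add: \<eta>_def)
 have flow: "is_flow V E c Y Z \<eta>"
  unfolding is_flow_def
 proof (intro conjI allI impI ballI)
  fix x y assume e: "{x, y} \<in> E"
  show "\<eta> x y = - \<eta> y x" by (rule anti[OF e])
  show "\<bar>\<eta> x y\<bar> <= c {x, y}"
   using up[OF e] up[of y x] anti[OF e] e by (auto simp: insert_commute abs_le_iff)
 next
  fix x assume x: "x \<in> V - (Y \<union> Z)"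
  then have "net \<theta> x = 0" using \<theta> by (auto simp: is_flow_def net_def)
  moreover have "net g x = 0" using g(3)[of x] x z(2) by auto
  ultimately show "(\<Sum>y | {x, y} \<in> E. \<eta> x y) = 0"
   using net\<eta>[of x] by (simp add: net_def)
 qed
 have finY: "finite Y" using finV YZ finite_subset by blast
 have "(\<Sum>x\<in>V. net g x) = 0"
  using net_sum[OF g(1) order_refl] by simp
 moreover have "(\<Sum>x\<in>V. net g x) = (\<Sum>x\<in>V - Y. net g x) + (\<Sum>x\<in>Y. net g x)"
  using finV YZ by (simp add: sum.subset_diff)
 moreover have "(\<Sum>x\<in>V - Y. net g x) = -1"
 proof -
  have "z \<in> V - Y" using z YZ by auto
  have "(\<Sum>x\<in>V - Y. net g x) = (\<Sum>x\<in>V - Y. if x = z then -1 else 0)"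
   by (intro sum.cong refl g(3))
  then show ?thesis using finV \<open>z \<in> V - Y\<close> by simp
 qed
 ultimately have "(\<Sum>x\<in>Y. net g x) = 1" by simp
 then have "flow_strength E Y \<eta> = flow_strength E Y \<theta> + eps"
  unfolding flow_strength_def net_def[symmetric]
  by (simp add: net\<eta> sum.distrib sum_distrib_left[symmetric])
 then show False using max[OF flow] eps(1) by simp
qed

text \<open>The residual vertices of a maximal flow form a cut all of whose edges are saturated.\<close>

theorem max_flow_min_cut:
 shows "max_flow V E c Y Z = Min (cut_cost E c ` {S. Y \<subseteq> S & S \<subseteq> V - Z})"
proof -
 let ?C = "cut_cost E c ` {S. Y \<subseteq> S & S \<subseteq> V - Z}"
 obtain \<theta> where \<theta>: "is_flow V E c Y Z \<theta>"
  "!!\<theta>'. is_flow V E c Y Z \<theta>' ==> flow_strength E Y \<theta>' <= flow_strength E Y \<theta>"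
  using max_flow_attained by blast
 have mf: "max_flow V E c Y Z = flow_strength E Y \<theta>"
  unfolding max_flow_def using \<theta> by (intro cSup_eq_maximum) auto
 define S where "S = {x. residual \<theta> x}"
 have SV: "S \<subseteq> V" using residual_in_V by (auto simp: S_def)
 have S: "Y \<subseteq> S" "S \<subseteq> V - Z"
  using max_flow_no_residual_sink[OF \<theta>] SV by (auto simp: S_def intro: residual.source)
 have "flow_strength E Y \<theta> = cut_cost E c S"
  unfolding strength_cut[OF \<theta>(1) S] cut_cost_pairs[OF SV]
 proof (intro sum.cong refl)
  fix x y assume "x \<in> S" "y \<in> V - S"
  then have "\<not> \<theta> x y < c {x, y}" if "{x, y} \<in> E"
   using residual.step[of \<theta> x y] that by (auto simp: S_def)
  moreover have "\<theta> x y <= c {x, y}" if "{x, y} \<in> E"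
   using flow_bound[OF \<theta>(1) that] by simp
  ultimately show "onE \<theta> x y = onE (%x y. c {x, y}) x y"
   by (force simp: onE_def)
 qed
 moreover have "finite ?C"
  by (rule finite_imageI, rule finite_subset[of _ "Pow V"]) (use finV in auto)
 moreover have "flow_strength E Y \<theta> <= b" if "b \<in> ?C" for b
  using that strength_le_cut[OF \<theta>(1)] by auto
 ultimately show ?thesis
  unfolding mf using S by (intro Min_eqI[symmetric]) auto
qed

end

section \<open>Cylinders and their minimal cuts\<close>

definition lattice_points :: "real^'d => (real^'d) set => real => real => (real^'d) set" where
 "lattice_points v B r h = {y \<in> B \<inter> integer_points. \<bar>v \<bullet> y - r\<bar> <= h}"

definition boundary_vertex :: "(real^'d) set => real^'d => bool" where
 "boundary_vertex V x \<longleftrightarrow> (\<exists>y\<in>integer_points - V. {x, y} \<in> lattice_edges)"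

text \<open>A cut is described by the set of vertices on the side of the upper boundary.  Vertices
  lying exactly at the height \<open>r\<close> are unconstrained.\<close>

definition separating :: "real^'d => (real^'d) set => real => (real^'d) set => bool" where
 "separating v V r S \<longleftrightarrow>
   S \<subseteq> V & (\<forall>x\<in>V. boundary_vertex V x --> (v \<bullet> x > r --> x \<in> S) & (v \<bullet> x < r --> x \<notin> S))"

definition min_cut ::
 "real^'d => (real^'d) set => real => ((real^'d) set => real) => real" where
 "min_cut v V r c = Min (cut_cost (induced_edges V) c ` {S. separating v V r S})"

definition prism :: "(real^'d => real^'d) => 'd => ('d => real) => ('d => real) => (real^'d) set" where
 "prism Q j lo hi = {y. \<forall>i. i ~= j --> lo i <= Q y $ i & Q y $ i <= hi i}"

definition rect ::
 "(real^'d => real^'d) => 'd => ('d => real) => ('d => real) => real => (real^'d) set" where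
 "rect Q j lo hi r = {y \<in> prism Q j lo hi. Q y $ j = r}"

lemma lattice_edgeD:
 assumes "{x, y} \<in> lattice_edges"
 shows "x \<in> integer_points" "y \<in> integer_points" "dist x y = 1" "x ~= y"
 using assms by (auto simp: lattice_edges_def doubleton_eq_iff dist_commute)

lemma lattice_edge_cases:
 assumes "e \<in> lattice_edges"
 obtains x y where "e = {x, y}" "x \<in> integer_points" "y \<in> integer_points" "dist x y = 1" "x ~= y"
proof -
 from assms obtain x y where "e = {x, y}" "x \<in> integer_points" "y \<in> integer_points" "dist x y = 1"
  by (auto simp: lattice_edges_def)
 moreover from this have "x ~= y" by auto
 ultimately show ?thesis by (rule that)
qed

lemma finite_integer_points_cball: "finite {x \<in> integer_points. norm (x :: real^'d) <= R}"
proof (rule finite_subset)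
 let ?N = "\<lceil>R\<rceil>"
 show "{x \<in> integer_points. norm (x :: real^'d) <= R}
   \<subseteq> (%f. \<chi> i. real_of_int (f i)) ` (UNIV \<rightarrow>\<^sub>E {-?N..?N})"
 proof
  fix x :: "real^'d" assume x: "x \<in> {x \<in> integer_points. norm x <= R}"
  define f where "f i = \<lfloor>x $ i\<rfloor>" for i
  have f: "x $ i = of_int (f i)" for i
   using x by (auto simp: f_def integer_points_def of_int_floor_cancel)
  have "f i \<in> {-?N..?N}" for i
  proof -
   have "\<bar>x $ i\<bar> <= R" using x component_le_norm_cart[of x i] by auto
   then have "\<bar>real_of_int (f i)\<bar> <= R" by (simp add: f)
   then have "real_of_int (f i) <= of_int ?N" "- real_of_int (f i) <= of_int ?N"
    using le_of_int_ceiling[of R] by linarith+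
   then show ?thesis by (simp add: of_int_minus[symmetric] del: of_int_minus)
  qed
  then show "x \<in> (%f. \<chi> i. real_of_int (f i)) ` (UNIV \<rightarrow>\<^sub>E {-?N..?N})"
   by (intro image_eqI[of _ _ f]) (auto simp: f vec_eq_iff)
 qed
 show "finite ((%f. (\<chi> i. real_of_int (f i)) :: real^'d) ` (UNIV \<rightarrow>\<^sub>E {-?N..?N}))"
  by (intro finite_imageI finite_PiE) auto
qed

lemma finite_integer_points: "bounded B ==> finite (B \<inter> (integer_points :: (real^'d) set))"
proof -
 assume "bounded B"
 then obtain R where "!!x. x \<in> B ==> norm x <= R" by (auto simp: bounded_iff)
 then show ?thesis
  by (intro finite_subset[OF _ finite_integer_points_cball[of R]]) auto
qed

lemma induced_edgesD:
 assumes "e \<in> induced_edges V"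
 shows "\<exists>x y. e = {x, y} & x \<in> V & y \<in> V & x ~= y"
proof -
 have e: "e \<in> lattice_edges" "e \<subseteq> V" using assms by (auto simp: induced_edges_def)
 from e(1) obtain x y where "e = {x, y}" "x ~= y" by (rule lattice_edge_cases)
 with e(2) show ?thesis by blast
qed

lemma finite_induced_edges: "finite V ==> finite (induced_edges V)"
 by (rule finite_subset[of _ "Pow V"]) (auto simp: induced_edges_def)

lemma finite_separating: "finite V ==> finite {S. separating v V r S}"
 by (rule finite_subset[of _ "Pow V"]) (auto simp: separating_def)

lemma separating_upper: "separating v V r {x \<in> V. v \<bullet> x > r}"
 by (auto simp: separating_def)

lemma min_cut_le: "finite V ==> separating v V r S ==> min_cut v V r c <= cut_cost (induced_edges V) c S"
 unfolding min_cut_def by (intro Min_le) (auto simp: finite_separating)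

lemma min_cut_attained:
 assumes "finite V"
 obtains S where "separating v V r S" "min_cut v V r c = cut_cost (induced_edges V) c S"
proof -
 have "min_cut v V r c \<in> cut_cost (induced_edges V) c ` {S. separating v V r S}"
  unfolding min_cut_def using separating_upper[of v V r] assms
  by (intro Min_in) (auto simp: finite_separating)
 then show ?thesis using that by auto
qed

lemma cut_cost_nonneg: "(!!e. e \<in> E ==> 0 <= c e) ==> 0 <= cut_cost E c S"
 unfolding cut_cost_def by (intro sum_nonneg) (auto simp: cut_edges_def)

lemma min_cut_nonneg:
 assumes "finite V" "!!e. e \<in> lattice_edges ==> 0 <= c e"
 shows "0 <= min_cut v V r c"
proof -
 obtain S where "min_cut v V r c = cut_cost (induced_edges V) c S"
  using min_cut_attained[OF assms(1)] by metis
 moreover have "0 <= cut_cost (induced_edges V) c S"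
  using assms(2) by (intro cut_cost_nonneg) (auto simp: induced_edges_def)
 ultimately show ?thesis by simp
qed

lemma axis_frame:
 assumes "orthogonal_transformation Q" "Q v = axis j 1"
 shows "v \<bullet> y = Q y $ j"
proof -
 have "v \<bullet> y = Q v \<bullet> Q y" using assms(1) by (simp add: orthogonal_transformation_def)
 then show ?thesis using assms(2) by (simp add: inner_axis')
qed

lemma bounded_slab:
 assumes Q: "orthogonal_transformation Q" "Q v = axis j 1"
 shows "bounded {y \<in> prism Q j lo hi. \<bar>v \<bullet> y - r\<bar> <= h}"
proof -
 let ?M = "%i. if i = j then \<bar>r\<bar> + \<bar>h\<bar> else \<bar>lo i\<bar> + \<bar>hi i\<bar>"
 have "norm y <= (\<Sum>i\<in>UNIV. ?M i)" if y: "y \<in> prism Q j lo hi" "\<bar>v \<bullet> y - r\<bar> <= h" for y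
 proof -
  have "norm y = norm (Q y)" using Q(1) by (simp add: orthogonal_transformation_norm)
  also have "... <= (\<Sum>i\<in>UNIV. \<bar>Q y $ i\<bar>)" by (rule norm_le_l1_cart)
  also have "... <= (\<Sum>i\<in>UNIV. ?M i)"
  proof (rule sum_mono)
   fix i
   show "\<bar>Q y $ i\<bar> <= ?M i"
   proof (cases "i = j")
    case True
    then show ?thesis using y(2) axis_frame[OF Q, of y] by simp
   next
    case False
    then have "lo i <= Q y $ i" "Q y $ i <= hi i" using y(1) by (auto simp: prism_def)
    then show ?thesis using False by simp
   qed
  qed
  finally show ?thesis .
 qed
 then show ?thesis unfolding bounded_iff by blast
qed

lemma finite_lattice_points:
 assumes "orthogonal_transformation Q" "Q v = axis j 1"
 shows "finite (lattice_points v (prism Q j lo hi) r h)"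
 by (rule finite_subset[OF _ finite_integer_points[OF bounded_slab[OF assms, of lo hi r h]]])
  (auto simp: lattice_points_def)

text \<open>Any hyperrectangle orthogonal to \<open>v\<close> can be described in orthonormal coordinates whose
  distinguished axis, the same one for all hyperrectangles, points in the direction \<open>v\<close>.\<close>

lemma hyperrectangle_coords:
 fixes A :: "(real^'d) set" and j :: 'd
 assumes A: "hyperrectangle A" and v: "unit_normal v A"
 obtains Q lo hi r where "orthogonal_transformation Q" "Q v = axis j 1"
  "!!i. i ~= j ==> lo i < hi i" "A = rect Q j lo hi r"
proof -
 obtain f :: "real^'d => real^'d" and j' k where f: "!!x y. dist (f x) (f y) = dist x y"
  and k: "!!i. i ~= j' ==> 0 < k i"
  and Af: "A = f ` {x. x $ j' = 0 & (\<forall>i. i ~= j' --> 0 <= x $ i & x $ i <= k i)}"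
  using A unfolding hyperrectangle_def by blast
 define \<Phi> where "\<Phi> x = f x - f 0" for x
 have \<Phi>: "orthogonal_transformation \<Phi>"
  unfolding orthogonal_transformation_isometry
 proof (intro conjI allI)
  fix x y
  have "dist (\<Phi> x) (\<Phi> y) = dist (f x) (f y)" by (simp add: \<Phi>_def dist_norm)
  then show "dist (\<Phi> x) (\<Phi> y) = dist x y" by (simp add: f)
 qed (simp add: \<Phi>_def)
 then obtain \<Psi> where \<Psi>: "orthogonal_transformation \<Psi>" "!!x. \<Psi> (\<Phi> x) = x" "!!x. \<Phi> (\<Psi> x) = x"
  by (metis bij_inv_eq_iff orthogonal_transformation_bij orthogonal_transformation_inv)
 have lin: "linear \<Psi>" using \<Psi>(1) by (simp add: orthogonal_transformation_linear)
 have v1: "norm v = 1" and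
  orth: "!!x y. x \<in> affine hull A ==> y \<in> affine hull A ==> orthogonal v (x - y)"
  using v by (auto simp: unit_normal_def)
 have \<Psi>v: "\<Psi> v $ i = 0" if i: "i ~= j'" for i
 proof -
  have k0: "0 <= k m" if "m ~= j'" for m using k[OF that] by simp
  have "f (axis i (k i)) \<in> A" "f 0 \<in> A"
   unfolding Af using k0 i by (auto simp: axis_def intro!: imageI)
  then have "f (axis i (k i)) \<in> affine hull A" "f 0 \<in> affine hull A"
   using hull_subset[of A affine] by auto
  from orth[OF this] have "v \<bullet> \<Phi> (axis i (k i)) = 0"
   by (simp add: orthogonal_def \<Phi>_def)
  moreover have "v \<bullet> \<Phi> (axis i (k i)) = \<Psi> v \<bullet> axis i (k i)"
   using \<Psi> by (metis orthogonal_transformation_def)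
  ultimately show ?thesis using k[OF i] by (simp add: inner_axis)
 qed
 define \<sigma> where "\<sigma> = \<Psi> v $ j'"
 have \<Psi>v': "\<Psi> v = axis j' \<sigma>" using \<Psi>v by (auto simp: vec_eq_iff axis_def \<sigma>_def)
 have "norm (\<Psi> v) = 1" using \<Psi>(1) v1 by (simp add: orthogonal_transformation_norm)
 then have \<sigma>\<sigma>: "\<sigma>*\<sigma> = 1" by (simp add: norm_eq_1 \<Psi>v' inner_axis)
 then have \<sigma>1: "\<sigma> ~= 0" by auto
 define \<tau> where "\<tau> = Transposition.transpose j j'"
 define s where "s i = (if i = j then \<sigma> else 1)" for i
 have ss: "s i * s i = 1" for i using \<sigma>\<sigma> by (simp add: s_def)
 define P :: "real^'d => real^'d" where "P x = (\<chi> i. s i*x $ (\<tau> i))" for x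
 have "linear P"
  by (rule linearI) (auto simp: P_def vec_eq_iff algebra_simps)
 moreover have "P x \<bullet> P y = x \<bullet> y" for x y
 proof -
  have "P x \<bullet> P y = (\<Sum>i\<in>UNIV. (s i * s i)*(x $ \<tau> i*y $ \<tau> i))"
   by (simp add: inner_vec_def P_def mult_ac)
  also have "... = (\<Sum>i\<in>UNIV. x $ \<tau> i*y $ \<tau> i)" by (simp add: ss)
  also have "... = (\<Sum>i\<in>UNIV. x $ i*y $ i)"
   by (rule sum.reindex_bij_betw) (simp add: \<tau>_def)
  finally show ?thesis by (simp add: inner_vec_def)
 qed
 ultimately have P: "orthogonal_transformation P" by (simp add: orthogonal_transformation_def)
 define Q where "Q = P \<circ> \<Psi>"
 have Q: "orthogonal_transformation Q"
  unfolding Q_def using P \<Psi>(1) by (rule orthogonal_transformation_compose)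
 have linQ: "linear Q" using Q by (simp add: orthogonal_transformation_linear)
 have Qv: "Q v = axis j 1"
 proof -
  have "s i*axis j' \<sigma> $ \<tau> i = axis j 1 $ i" for i
  proof (cases "i = j")
   case True then show ?thesis using \<sigma>\<sigma> by (simp add: s_def \<tau>_def axis_def)
  next
   case False
   then have "\<tau> i ~= j'" by (metis \<tau>_def transpose_apply_first transpose_involutory)
   then show ?thesis using False by (simp add: axis_def)
  qed
  then show ?thesis by (simp add: Q_def \<Psi>v' P_def vec_eq_iff)
 qed
 define lo where "lo i = Q (f 0) $ i" for i
 define hi where "hi i = lo i + k (\<tau> i)" for i
 define r where "r = lo j"
 have \<tau>j': "\<tau> j = j'" by (simp add: \<tau>_def)
 have \<tau>j: "\<tau> i ~= j' \<longleftrightarrow> i ~= j" for i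
  by (metis \<tau>_def transpose_apply_first transpose_involutory)
 have \<tau>\<tau>: "\<tau> (\<tau> i) = i" for i by (simp add: \<tau>_def)
 have Qf: "Q (f x) $ i = lo i + s i*x $ \<tau> i" for x i
 proof -
  have "Q (f x) = Q (f 0) + Q (\<Phi> x)" by (simp add: \<Phi>_def linear_diff[OF linQ])
  also have "Q (\<Phi> x) = P x" by (simp add: Q_def \<Psi>(2))
  finally show ?thesis by (simp add: lo_def P_def)
 qed
 have "A = rect Q j lo hi r"
 proof (intro equalityI subsetI)
  fix y assume "y \<in> A"
  then obtain x where x: "y = f x" "x $ j' = 0" "!!i. i ~= j' ==> 0 <= x $ i & x $ i <= k i"
   unfolding Af by auto
  have "lo i <= Q y $ i & Q y $ i <= hi i" if "i ~= j" for i
   using x(3)[of "\<tau> i"] that \<tau>j[of i] by (simp add: x(1) Qf s_def hi_def)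
  moreover have "Q y $ j = r" using x(2) by (simp add: x(1) Qf r_def \<tau>j')
  ultimately show "y \<in> rect Q j lo hi r" by (simp add: rect_def prism_def)
 next
  fix y assume y: "y \<in> rect Q j lo hi r"
  define x where "x = \<Psi> (y - f 0)"
  have yx: "y = f x" using \<Psi>(3)[of "y - f 0"] by (simp add: x_def \<Phi>_def)
  have "x $ j' = 0" using y \<sigma>1 Qf[of x j] by (auto simp: rect_def yx r_def s_def \<tau>j')
  moreover have "0 <= x $ i & x $ i <= k i" if "i ~= j'" for i
  proof -
   have "\<tau> i ~= j" using \<tau>j[of "\<tau> i"] that by (simp add: \<tau>\<tau>)
   then show ?thesis using y Qf[of x "\<tau> i"] 
    by (auto simp: rect_def prism_def yx hi_def s_def \<tau>\<tau> dest!: spec[of _ "\<tau> i"])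
  qed
  ultimately show "y \<in> A" unfolding Af yx by blast
 qed
 moreover have "lo i < hi i" if "i ~= j" for i using k[of "\<tau> i"] \<tau>j[of i] that by (simp add: hi_def)
 ultimately show ?thesis using that[OF Q Qv] by blast
qed

lemma rect_scale:
 assumes "orthogonal_transformation Q" "0 < a"
 shows "(*\<^sub>R) a ` rect Q j lo hi r = rect Q j (%i. a*lo i) (%i. a*hi i) (a*r)"
proof (intro equalityI subsetI)
 have lin: "linear Q" using assms(1) by (simp add: orthogonal_transformation_linear)
 fix y assume "y \<in> (*\<^sub>R) a ` rect Q j lo hi r"
 then show "y \<in> rect Q j (%i. a*lo i) (%i. a*hi i) (a*r)"
  using assms(2) by (auto simp: rect_def prism_def linear_cmul[OF lin])
next
 have lin: "linear Q" using assms(1) by (simp add: orthogonal_transformation_linear)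
 fix y assume y: "y \<in> rect Q j (%i. a*lo i) (%i. a*hi i) (a*r)"
 have "(1/a) *\<^sub>R y \<in> rect Q j lo hi r"
  using y assms(2) by (auto simp: rect_def prism_def linear_cmul[OF lin] field_simps)
 then show "y \<in> (*\<^sub>R) a ` rect Q j lo hi r"
  using assms(2) by (intro image_eqI[of _ _ "(1/a) *\<^sub>R y"]) auto
qed

lemma components_split:
 fixes v :: "'a::euclidean_space"
 assumes con: "connected {x \<in> X. v \<bullet> x > r}" "connected {x \<in> X. v \<bullet> x < r}"
  and ne: "{x \<in> X. v \<bullet> x > r} ~= {}" "{x \<in> X. v \<bullet> x < r} ~= {}"
  and X: "!!x. x \<in> X ==> v \<bullet> x ~= r"
 shows "components X = {{x \<in> X. v \<bullet> x > r}, {x \<in> X. v \<bullet> x < r}}"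
proof -
 let ?U = "{x \<in> X. v \<bullet> x > r}" and ?L = "{x \<in> X. v \<bullet> x < r}"
 have same: "v \<bullet> x > r \<longleftrightarrow> v \<bullet> y > r" if "y \<in> connected_component_set X x" for x y
 proof -
  have xy: "x \<in> X" "y \<in> X" using that connected_component_in by auto
  let ?C = "connected_component_set X x"
  have C: "connected ?C" "x \<in> ?C" "y \<in> ?C" "?C \<subseteq> X"
   using that xy by (auto simp: connected_component_refl connected_component_subset)
  show ?thesis
  proof (rule ccontr)
   assume "\<not> ?thesis"
   then have "\<exists>z\<in>?C. v \<bullet> z = r"
    using connected_ivt_hyperplane[OF C(1,2,3), of v r]
     connected_ivt_hyperplane[OF C(1,3,2), of v r] by force
   then show False using C(4) X by auto
  qed
 qed
 have U: "connected_component_set X x = ?U" if x: "x \<in> ?U" for x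
 proof
  show "?U \<subseteq> connected_component_set X x"
   using x by (intro connected_component_maximal con) auto
  show "connected_component_set X x \<subseteq> ?U"
   using same[of _ x] x connected_component_in by fastforce
 qed
 have L: "connected_component_set X x = ?L" if x: "x \<in> ?L" for x
 proof
  show "?L \<subseteq> connected_component_set X x"
   using x by (intro connected_component_maximal con) auto
  show "connected_component_set X x \<subseteq> ?L"
  proof
   fix y assume y: "y \<in> connected_component_set X x"
   then have "y \<in> X" using connected_component_in by auto
   moreover have "\<not> v \<bullet> y > r" using same[OF y] x by auto
   ultimately show "y \<in> ?L" using X[of y] by auto
  qed
 qed
 have "x \<in> ?U \<or> x \<in> ?L" if "x \<in> X" for x using X[OF that] that by auto
 then have "components X \<subseteq> {?U, ?L}"
  unfolding components_def using U L by blast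
 moreover have "?U \<in> components X"
  unfolding components_def using ne(1) U by blast
 moreover have "?L \<in> components X"
  unfolding components_def using ne(2) L by blast
 ultimately show ?thesis by blast
qed

context
 fixes Q :: "real^'d => real^'d" and v :: "real^'d" and j :: 'd and lo hi :: "'d => real"
  and r h :: real
 assumes Q: "orthogonal_transformation Q" "Q v = axis j 1"
  and lohi: "!!i. i ~= j ==> lo i < hi i" and h: "0 < h"
begin

lemma linQ: "linear Q" using Q(1) by (simp add: orthogonal_transformation_linear)

lemma prism_shift: "y + s *\<^sub>R v \<in> prism Q j lo hi \<longleftrightarrow> y \<in> prism Q j lo hi"
proof -
 have "Q (y + s *\<^sub>R v) $ i = Q y $ i" if "i ~= j" for i
  using that by (simp add: linear_add[OF linQ] linear_cmul[OF linQ] Q(2) axis_def)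
 then show ?thesis by (auto simp: prism_def)
qed

lemma vv: "v \<bullet> v = 1"
 using axis_frame[OF Q, of v] Q(2) by simp

lemma cyl_rect: "cyl v (rect Q j lo hi r) h = {y \<in> prism Q j lo hi. \<bar>v \<bullet> y - r\<bar> <= h}"
proof (intro equalityI subsetI)
 fix y assume "y \<in> cyl v (rect Q j lo hi r) h"
 then obtain x s where xs: "y = x + s *\<^sub>R v" "x \<in> prism Q j lo hi" "Q x $ j = r" "\<bar>s\<bar> <= h"
  by (auto simp: cyl_def rect_def)
 moreover have "v \<bullet> y - r = s"
  using xs axis_frame[OF Q, of x] by (simp add: inner_right_distrib vv)
 ultimately show "y \<in> {y \<in> prism Q j lo hi. \<bar>v \<bullet> y - r\<bar> <= h}"
  using prism_shift by auto
next
 fix y assume y: "y \<in> {y \<in> prism Q j lo hi. \<bar>v \<bullet> y - r\<bar> <= h}"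
 let ?s = "v \<bullet> y - r" and ?x = "y + (r - v \<bullet> y) *\<^sub>R v"
 have "Q ?x $ j = r" unfolding axis_frame[OF Q, symmetric] by (simp add: inner_right_distrib vv)
 then have "?x \<in> rect Q j lo hi r" using y prism_shift by (auto simp: rect_def)
 moreover have "y = ?x + ?s *\<^sub>R v" by (simp add: algebra_simps)
 moreover have "?s \<in> {-h..h}" using y by auto
 ultimately show "y \<in> cyl v (rect Q j lo hi r) h" unfolding cyl_def by blast
qed

lemma cyl_minus_hull:
 "cyl v (rect Q j lo hi r) h - affine hull (rect Q j lo hi r)
  = {y \<in> prism Q j lo hi. \<bar>v \<bullet> y - r\<bar> <= h & v \<bullet> y ~= r}"
proof -
 have "rect Q j lo hi r \<subseteq> {y. v \<bullet> y = r}"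
  using axis_frame[OF Q] by (auto simp: rect_def)
 then have "affine hull (rect Q j lo hi r) \<subseteq> {y. v \<bullet> y = r}"
  by (intro hull_minimal affine_hyperplane)
 moreover have "y \<in> affine hull (rect Q j lo hi r)"
  if "y \<in> prism Q j lo hi" "v \<bullet> y = r" for y
  using that axis_frame[OF Q, of y] by (intro hull_inc) (auto simp: rect_def)
 ultimately show ?thesis unfolding cyl_rect by blast
qed

lemma convex_column: "convex (prism Q j lo hi)"
proof -
 have "lo i <= Q (a *\<^sub>R x + b *\<^sub>R y) $ i & Q (a *\<^sub>R x + b *\<^sub>R y) $ i <= hi i"
  if "x \<in> prism Q j lo hi" "y \<in> prism Q j lo hi" "0 <= a" "0 <= b" "a + b = 1" "i ~= j" for x y a b i
 proof -
  have "Q x $ i \<in> {lo i..hi i}" "Q y $ i \<in> {lo i..hi i}"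
   using that by (auto simp: prism_def)
  from convexD[OF convex_real_interval(5) this that(3,4,5)] show ?thesis
   by (simp add: linear_add[OF linQ] linear_cmul[OF linQ])
 qed
 then show ?thesis unfolding convex_def prism_def by blast
qed

lemma prism_point: obtains y where "y \<in> prism Q j lo hi" "v \<bullet> y = a"
proof -
 obtain y where y: "Q y = (\<chi> i. if i = j then a else lo i)"
  using orthogonal_transformation_surj[OF Q(1)] by (metis surjD)
 have "lo i <= hi i" if "i ~= j" for i using lohi[OF that] by simp
 then have "y \<in> prism Q j lo hi" by (auto simp: prism_def y)
 moreover have "v \<bullet> y = a" using axis_frame[OF Q, of y] y by simp
 ultimately show ?thesis using that by blast
qed

lemma cyl_components:
 defines "X == {y \<in> prism Q j lo hi. \<bar>v \<bullet> y - r\<bar> <= h & v \<bullet> y ~= r}"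
 shows "components X = {{x \<in> X. v \<bullet> x > r}, {x \<in> X. v \<bullet> x < r}}"
  "{x \<in> X. v \<bullet> x > r} ~= {x \<in> X. v \<bullet> x < r}"
proof -
 have U: "{x \<in> X. v \<bullet> x > r} = prism Q j lo hi \<inter> {x. v \<bullet> x > r} \<inter> {x. v \<bullet> x <= r + h}"
  using h by (auto simp: X_def)
 have L: "{x \<in> X. v \<bullet> x < r} = prism Q j lo hi \<inter> {x. v \<bullet> x < r} \<inter> {x. v \<bullet> x >= r - h}"
  using h by (auto simp: X_def)
 have con: "connected {x \<in> X. v \<bullet> x > r}" "connected {x \<in> X. v \<bullet> x < r}"
  unfolding U L by (intro convex_connected convex_Int convex_column convex_halfspace_gt
    convex_halfspace_lt convex_halfspace_le convex_halfspace_ge)+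
 obtain y where y: "y \<in> prism Q j lo hi" "v \<bullet> y = r + h" using prism_point by blast
 obtain z where z: "z \<in> prism Q j lo hi" "v \<bullet> z = r - h" using prism_point by blast
 have ne: "y \<in> {x \<in> X. v \<bullet> x > r}" "z \<in> {x \<in> X. v \<bullet> x < r}"
  unfolding U L using y z h by auto
 show "components X = {{x \<in> X. v \<bullet> x > r}, {x \<in> X. v \<bullet> x < r}}"
  using con ne by (intro components_split) (auto simp: X_def)
 show "{x \<in> X. v \<bullet> x > r} ~= {x \<in> X. v \<bullet> x < r}" using ne by force
qed

text \<open>The two sides of the cylinder enter the definition of \<open>tau\<close> in an unspecified order;
  exchanging them replaces a cut by its complement.\<close>

lemma tau_eq_min_cut:
 assumes c: "!!e. e \<in> lattice_edges ==> 0 <= c e"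
 shows "tau c v (rect Q j lo hi r) h
  = min_cut v (lattice_points v (prism Q j lo hi) r h) r c"
proof -
 let ?A = "rect Q j lo hi r"
 define V where "V = lattice_points v (prism Q j lo hi) r h"
 define X where "X = {y \<in> prism Q j lo hi. \<bar>v \<bullet> y - r\<bar> <= h & v \<bullet> y ~= r}"
 define A1 where "A1 = {x \<in> V. boundary_vertex V x & v \<bullet> x > r}"
 define A2 where "A2 = {x \<in> V. boundary_vertex V x & v \<bullet> x < r}"
 have V: "V = cyl v ?A h \<inter> integer_points"
  by (auto simp: V_def lattice_points_def cyl_rect)
 have finV: "finite V" unfolding V_def by (rule finite_lattice_points[OF Q])
 have sb: "side_boundary v ?A h {x \<in> X. v \<bullet> x > r} = A1"
  "side_boundary v ?A h {x \<in> X. v \<bullet> x < r} = A2"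
  by (auto simp: side_boundary_def A1_def A2_def X_def V_def lattice_points_def cyl_rect
    boundary_vertex_def)
 have comp: "components (cyl v ?A h - affine hull ?A) = {{x \<in> X. v \<bullet> x > r}, {x \<in> X. v \<bullet> x < r}}"
  unfolding cyl_minus_hull X_def by (rule cyl_components(1))
 have "fst (cyl_sides v ?A h) ~= snd (cyl_sides v ?A h) &
   components (cyl v ?A h - affine hull ?A) = {fst (cyl_sides v ?A h), snd (cyl_sides v ?A h)}"
  unfolding cyl_sides_def
  by (rule someI[of _ "({x \<in> X. v \<bullet> x > r}, {x \<in> X. v \<bullet> x < r})"])
   (use comp cyl_components(2) in \<open>simp add: X_def\<close>)
 then have sides: "(side_boundary v ?A h (fst (cyl_sides v ?A h)) = A1 &
    side_boundary v ?A h (snd (cyl_sides v ?A h)) = A2) \<or>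
   (side_boundary v ?A h (fst (cyl_sides v ?A h)) = A2 &
    side_boundary v ?A h (snd (cyl_sides v ?A h)) = A1)"
  unfolding comp using sb by (auto simp: doubleton_eq_iff)
 have sep: "separating v V r S \<longleftrightarrow> A1 \<subseteq> S & S \<subseteq> V - A2" for S
  unfolding separating_def A1_def A2_def by blast
 have dis: "A1 \<inter> A2 = {}" "A1 \<subseteq> V" "A2 \<subseteq> V" by (auto simp: A1_def A2_def)
 have cI: "0 <= c e" if "e \<in> induced_edges V" for e using that c by (auto simp: induced_edges_def)
 have g12: "capacity_graph V (induced_edges V) c A1 A2"
  by unfold_locales (use finV dis cI induced_edgesD in auto)
 have g21: "capacity_graph V (induced_edges V) c A2 A1"
  by unfold_locales (use finV dis cI induced_edgesD in auto)
 have m12: "max_flow V (induced_edges V) c A1 A2 = min_cut v V r c"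
  unfolding capacity_graph.max_flow_min_cut[OF g12] min_cut_def sep ..
 have m21: "max_flow V (induced_edges V) c A2 A1 = min_cut v V r c"
 proof -
  let ?E = "induced_edges V"
  have compl: "cut_cost ?E c (V - S) = cut_cost ?E c S" if "S \<subseteq> V" for S
  proof -
   have "cut_edges ?E (V - S) = cut_edges ?E S"
    unfolding cut_edges_def induced_edges_def using that by blast
   then show ?thesis by (simp add: cut_cost_def)
  qed
  have "cut_cost ?E c ` {S. A2 \<subseteq> S & S \<subseteq> V - A1} = cut_cost ?E c ` {S. A1 \<subseteq> S & S \<subseteq> V - A2}"
  proof (intro equalityI subsetI)
   fix b assume "b \<in> cut_cost ?E c ` {S. A2 \<subseteq> S & S \<subseteq> V - A1}"
   then obtain S where S: "A2 \<subseteq> S" "S \<subseteq> V - A1" "b = cut_cost ?E c S" by auto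
   then show "b \<in> cut_cost ?E c ` {S. A1 \<subseteq> S & S \<subseteq> V - A2}"
    using dis compl[of S, symmetric] by (intro image_eqI[of _ _ "V - S"]) blast+
  next
   fix b assume "b \<in> cut_cost ?E c ` {S. A1 \<subseteq> S & S \<subseteq> V - A2}"
   then obtain S where S: "A1 \<subseteq> S" "S \<subseteq> V - A2" "b = cut_cost ?E c S" by auto
   then show "b \<in> cut_cost ?E c ` {S. A2 \<subseteq> S & S \<subseteq> V - A1}"
    using dis compl[of S, symmetric] by (intro image_eqI[of _ _ "V - S"]) blast+
  qed
  then show ?thesis
   unfolding capacity_graph.max_flow_min_cut[OF g21] min_cut_def sep by simp
 qed
 have nonneg: "0 <= min_cut v V r c" by (rule min_cut_nonneg[OF finV c])
 have zero: "min_cut v V r c = 0" if e: "A1 = {} \<or> A2 = {}"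
 proof -
  have "\<exists>S. separating v V r S & cut_edges (induced_edges V) S = {}"
  proof (cases "A1 = {}")
   case True
   then show ?thesis by (intro exI[of _ "{}"]) (auto simp: sep cut_edges_def)
  next
   case False
   then have "A2 = {}" using e by simp
   then show ?thesis
    using dis by (intro exI[of _ V]) (auto simp: sep cut_edges_def induced_edges_def)
  qed
  then obtain S where "separating v V r S" "cut_edges (induced_edges V) S = {}" by blast
  then have "min_cut v V r c <= 0" using min_cut_le[OF finV, of v r S c] by (simp add: cut_cost_def)
  with nonneg show ?thesis by simp
 qed
 show ?thesis
  using sides
 proof
  assume "side_boundary v ?A h (fst (cyl_sides v ?A h)) = A1 &
    side_boundary v ?A h (snd (cyl_sides v ?A h)) = A2"
  then have "tau c v ?A h = (if A1 = {} \<or> A2 = {} then 0 else max_flow V (induced_edges V) c A1 A2)"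
   unfolding tau_def Let_def V[symmetric] by auto
  then show ?thesis using m12 zero by (auto simp: V_def)
 next
  assume "side_boundary v ?A h (fst (cyl_sides v ?A h)) = A2 &
    side_boundary v ?A h (snd (cyl_sides v ?A h)) = A1"
  then have "tau c v ?A h = (if A2 = {} \<or> A1 = {} then 0 else max_flow V (induced_edges V) c A2 A1)"
   unfolding tau_def Let_def V[symmetric] by auto
  then show ?thesis using m21 zero by (auto simp: V_def)
 qed
qed

end

section \<open>Gluing cuts of small cylinders\<close>

definition flat_edges :: "real^'d => (real^'d) set => real => (real^'d) set set" where
 "flat_edges v U r = {{x, y} | x y. {x, y} \<in> lattice_edges & x \<in> U & y \<in> U & r < v \<bullet> x & v \<bullet> y <= r}"

definition wall_edges ::
 "real^'d => (real^'d) set => real => (real^'d) set => real => (real^'d) set set" where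
 "wall_edges v V r W \<kappa> =
   {{x, y} | x y. {x, y} \<in> lattice_edges & x \<in> W & y \<in> V - W & \<bar>v \<bullet> x - r\<bar> <= \<kappa> + 1}"

text \<open>The edges besides those of the minimal cuts of the small cylinders \<open>W i\<close> that a
  glued cut may use.\<close>

definition interface_edges ::
 "real^'d => (real^'d) set => real => 'j set => ('j => (real^'d) set) => ('j => real) => (real^'d) set set" where
 "interface_edges v V r J W \<kappa> =
   flat_edges v (V - (\<Union>i\<in>J. W i)) r \<union> (\<Union>i\<in>J. wall_edges v V r (W i) (\<kappa> i))"

lemma height_neighbour:
 assumes "norm v = 1" "{x, y} \<in> lattice_edges"
 shows "\<bar>v \<bullet> x - v \<bullet> y\<bar> <= 1"
proof -
 have "\<bar>v \<bullet> (x - y)\<bar> <= norm v * norm (x - y)" by (rule Cauchy_Schwarz_ineq2)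
 then show ?thesis using assms lattice_edgeD(3)[OF assms(2)] by (simp add: dist_norm inner_diff_right)
qed

lemma sum_Un_le:
 fixes c :: "'e => real"
 assumes "finite A" "finite B" "!!e. e \<in> B ==> 0 <= c e"
 shows "sum c (A \<union> B) <= sum c A + sum c B"
proof -
 have "0 <= sum c (A \<inter> B)" using assms(3) by (intro sum_nonneg) auto
 then show ?thesis using sum_Un[OF assms(1,2), of c] by simp
qed

lemma sum_UN_le:
 fixes c :: "'e => real"
 assumes "finite J" "!!i. i \<in> J ==> finite (A i)" "!!i e. i \<in> J ==> e \<in> A i ==> 0 <= c e"
 shows "sum c (\<Union>i\<in>J. A i) <= (\<Sum>i\<in>J. sum c (A i))"
 using assms
proof (induction J rule: finite_induct)
 case (insert i J)
 have "sum c (A i \<union> (\<Union>i\<in>J. A i)) <= sum c (A i) + sum c (\<Union>i\<in>J. A i)"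
  using insert.hyps insert.prems by (intro sum_Un_le) auto
 then show ?case using insert by force
qed simp

text \<open>Inside each \<open>W i\<close> the glued cut follows the minimal cut there, elsewhere the
  hyperplane. Along a wall a minimal cut is already given by the height relative to \<open>\<rho> i\<close>,
  so the two disagree only at heights between \<open>\<rho> i\<close> and \<open>r\<close>, up to the length
  of an edge.\<close>

lemma min_cut_gluing:
 fixes v :: "real^'d" and W :: "'j => (real^'d) set"
 assumes v: "norm v = 1" and V: "finite V" "V \<subseteq> integer_points" and J: "finite J"
  and W: "!!i. i \<in> J ==> W i \<subseteq> V" "disjoint_family_on W J"
  and \<rho>: "!!i. i \<in> J ==> \<bar>\<rho> i - r\<bar> <= \<kappa> i"
  and bd: "!!i x. i \<in> J ==> x \<in> W i ==> boundary_vertex V x ==> \<rho> i = r"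
  and c: "!!e. e \<in> lattice_edges ==> 0 <= c e"
 shows "min_cut v V r c
  <= (\<Sum>i\<in>J. min_cut v (W i) (\<rho> i) c) + (\<Sum>e\<in>interface_edges v V r J W \<kappa>. c e)"
proof -
 let ?U = "V - (\<Union>i\<in>J. W i)" and ?G = "interface_edges v V r J W \<kappa>"
 have finW: "finite (W i)" if "i \<in> J" for i using W(1)[OF that] V(1) finite_subset by blast
 have "\<forall>i\<in>J. \<exists>S. separating v (W i) (\<rho> i) S &
   min_cut v (W i) (\<rho> i) c = cut_cost (induced_edges (W i)) c S"
  using min_cut_attained[OF finW] by metis
 then obtain S where S: "!!i. i \<in> J ==> separating v (W i) (\<rho> i) (S i)"
  "!!i. i \<in> J ==> min_cut v (W i) (\<rho> i) c = cut_cost (induced_edges (W i)) c (S i)"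
  by metis
 have SW: "S i \<subseteq> W i" if "i \<in> J" for i using S(1)[OF that] by (simp add: separating_def)
 define T where "T = (\<Union>i\<in>J. S i) \<union> {x \<in> ?U. v \<bullet> x > r}"
 have TW: "x \<in> T \<longleftrightarrow> x \<in> S i" if iW: "i \<in> J" "x \<in> W i" for i x
 proof
  assume "x \<in> T"
  then obtain k where k: "k \<in> J" "x \<in> S k" using iW by (auto simp: T_def)
  then have "x \<in> W k" using SW by auto
  then have "k = i" using iW k(1) W(2) by (auto simp: disjoint_family_on_def)
  then show "x \<in> S i" using k by simp
 qed (use that in \<open>auto simp: T_def\<close>)
 have TU: "x \<in> T \<longleftrightarrow> v \<bullet> x > r" if "x \<in> ?U" for x
  using that SW by (auto simp: T_def)
 have bdW: "boundary_vertex (W i) x" if "i \<in> J" "boundary_vertex V x" for i x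
  using that W(1) unfolding boundary_vertex_def by blast
 have sepT: "separating v V r T"
  unfolding separating_def
 proof (intro conjI ballI impI)
  show "T \<subseteq> V" using SW W(1) by (fastforce simp: T_def)
  fix x assume x: "x \<in> V" "boundary_vertex V x"
  have sides: "(v \<bullet> x > r --> x \<in> T) & (v \<bullet> x < r --> x \<notin> T)"
  proof (cases "x \<in> ?U")
   case True then show ?thesis using TU[OF True] by auto
  next
   case False
   then obtain i where i: "i \<in> J" "x \<in> W i" using x by auto
   have "\<rho> i = r" using bd[OF i x(2)] .
   then show ?thesis
    using S(1)[OF i(1)] i(2) bdW[OF i(1) x(2)] TW[OF i] by (auto simp: separating_def)
  qed
  show "x \<in> T" if "v \<bullet> x > r" using sides that by blast
  show "x \<notin> T" if "v \<bullet> x < r" using sides that by blast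
 qed
 have finC: "finite (cut_edges (induced_edges (W i)) (S i))" if "i \<in> J" for i
  using finite_induced_edges[OF finW[OF that]]
  by (rule finite_subset[rotated]) (auto simp: cut_edges_def)
 have Clat: "cut_edges (induced_edges (W i)) (S i) \<subseteq> lattice_edges" for i
  by (auto simp: cut_edges_def induced_edges_def)
 have finG: "finite ?G"
 proof (rule finite_subset)
  show "?G \<subseteq> Pow V"
   using W(1) by (fastforce simp: interface_edges_def flat_edges_def wall_edges_def)
 qed (use V in simp)
 have Glat: "?G \<subseteq> lattice_edges"
  by (auto simp: interface_edges_def flat_edges_def wall_edges_def)
 \<comment> \<open>Far from the interface every vertex is on the side of the hyperplane given by its height.\<close>
 have side: "x \<in> T \<longleftrightarrow> v \<bullet> x > r"
  if xy: "{x, y} \<in> lattice_edges" "x \<in> V" "y \<in> V" "{x, y} \<notin> ?G" "!!i. i \<in> J ==> \<not> {x, y} \<subseteq> W i" for x y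
 proof (cases "x \<in> ?U")
  case True then show ?thesis by (rule TU)
 next
  case False
  then obtain i where i: "i \<in> J" "x \<in> W i" using xy by auto
  then have y: "y \<in> V - W i" using xy(3) xy(5)[OF i(1)] by auto
  have "\<not> \<bar>v \<bullet> x - r\<bar> <= \<kappa> i + 1"
   using xy(1,4) i y by (auto simp: interface_edges_def wall_edges_def)
  then have far: "\<bar>v \<bullet> x - r\<bar> > \<kappa> i + 1" by simp
  have "boundary_vertex (W i) x"
   unfolding boundary_vertex_def using xy(1) y V(2) by blast
  then have "(v \<bullet> x > \<rho> i --> x \<in> S i) & (v \<bullet> x < \<rho> i --> x \<notin> S i)"
   using S(1)[OF i(1)] i(2) by (auto simp: separating_def)
  then show ?thesis using far \<rho>[OF i(1)] TW[OF i] by force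
 qed
 have far: "\<bar>v \<bullet> x - r\<bar> > 1"
  if xy: "{x, y} \<in> lattice_edges" "x \<in> V" "y \<in> V" "{x, y} \<notin> ?G" "!!i. i \<in> J ==> \<not> {x, y} \<subseteq> W i"
   and i: "i \<in> J" "x \<in> W i" for x y i
 proof -
  have y: "y \<in> V - W i" using xy(3) xy(5)[OF i(1)] i(2) by auto
  have "\<not> \<bar>v \<bullet> x - r\<bar> <= \<kappa> i + 1"
   using xy(1,4) i y by (auto simp: interface_edges_def wall_edges_def)
  moreover have "0 <= \<kappa> i" using \<rho>[OF i(1)] by simp
  ultimately show ?thesis by simp
 qed
 have cutsub: "cut_edges (induced_edges V) T \<subseteq> (\<Union>i\<in>J. cut_edges (induced_edges (W i)) (S i)) \<union> ?G"
 proof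
  fix e assume e: "e \<in> cut_edges (induced_edges V) T"
  then have eV: "e \<in> lattice_edges" "e \<subseteq> V" and cut: "e \<inter> T ~= {}" "\<not> e \<subseteq> T"
   by (auto simp: cut_edges_def induced_edges_def)
  obtain x y where xy: "e = {x, y}" "x \<in> T" "y \<notin> T"
  proof -
   obtain a b where ab: "e = {a, b}" using eV(1) by (rule lattice_edge_cases)
   show ?thesis
    using cut ab that[of a b] that[of b a] by (auto simp: insert_commute)
  qed
  show "e \<in> (\<Union>i\<in>J. cut_edges (induced_edges (W i)) (S i)) \<union> ?G"
  proof (cases "\<exists>i\<in>J. e \<subseteq> W i")
   case True
   then obtain i where i: "i \<in> J" "e \<subseteq> W i" by blast
   then have "e \<in> cut_edges (induced_edges (W i)) (S i)"
    using TW[OF i(1), of x] TW[OF i(1), of y] xy eV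
    by (auto simp: cut_edges_def induced_edges_def)
   then show ?thesis using i by blast
  next
   case False
   show ?thesis
   proof (rule ccontr)
    assume "\<not> ?thesis"
    then have nG: "e \<notin> ?G" by blast
    have xy': "{x, y} \<in> lattice_edges" "{y, x} \<in> lattice_edges" "x \<in> V" "y \<in> V"
     "{x, y} \<notin> ?G" "{y, x} \<notin> ?G" "!!i. i \<in> J ==> \<not> {x, y} \<subseteq> W i" "!!i. i \<in> J ==> \<not> {y, x} \<subseteq> W i"
     using eV nG False xy(1) by (auto simp: insert_commute)
    have hx: "v \<bullet> x > r" using side[OF xy'(1,3,4,5,7)] xy by blast
    have hy: "v \<bullet> y <= r" using side[OF xy'(2,4,3,6,8)] xy by force
    have near: "\<bar>v \<bullet> x - v \<bullet> y\<bar> <= 1" by (rule height_neighbour[OF v xy'(1)])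
    have "x \<in> ?U"
    proof (rule ccontr)
     assume "x \<notin> ?U"
     then obtain i where "i \<in> J" "x \<in> W i" using xy' by auto
     from far[OF xy'(1,3,4,5,7) this] show False using hx hy near by linarith
    qed
    moreover have "y \<in> ?U"
    proof (rule ccontr)
     assume "y \<notin> ?U"
     then obtain i where "i \<in> J" "y \<in> W i" using xy' by auto
     from far[OF xy'(2,4,3,6,8) this] show False using hx hy near by linarith
    qed
    ultimately have "e \<in> ?G"
     using xy(1) xy'(1) hx hy unfolding interface_edges_def flat_edges_def by blast
    with nG show False by blast
   qed
  qed
 qed
 have "cut_cost (induced_edges V) c T
   <= (\<Sum>e\<in>(\<Union>i\<in>J. cut_edges (induced_edges (W i)) (S i)) \<union> ?G. c e)"
  unfolding cut_cost_def
 proof (rule sum_mono2[OF _ cutsub])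
  show "finite ((\<Union>i\<in>J. cut_edges (induced_edges (W i)) (S i)) \<union> ?G)"
   using J finC finG by blast
  show "0 <= c e" if "e \<in> (\<Union>i\<in>J. cut_edges (induced_edges (W i)) (S i)) \<union> ?G
    - cut_edges (induced_edges V) T" for e
   using that Clat Glat c by blast
 qed
 also have "... <= (\<Sum>e\<in>(\<Union>i\<in>J. cut_edges (induced_edges (W i)) (S i)). c e) + (\<Sum>e\<in>?G. c e)"
  using J finC finG Clat Glat c by (intro sum_Un_le) blast+
 also have "(\<Sum>e\<in>(\<Union>i\<in>J. cut_edges (induced_edges (W i)) (S i)). c e)
   <= (\<Sum>i\<in>J. \<Sum>e\<in>cut_edges (induced_edges (W i)) (S i). c e)"
  using J finC Clat c by (intro sum_UN_le) blast+
 also have "... = (\<Sum>i\<in>J. min_cut v (W i) (\<rho> i) c)"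
  by (intro sum.cong refl) (simp add: S(2) cut_cost_def)
 finally show ?thesis
  using min_cut_le[OF V(1) sepT, of c] by (simp add: cut_cost_def)
qed

section \<open>Counting lattice points by volume\<close>

text \<open>Rotation invariance of Lebesgue measure follows from Tonelli's theorem: averaging the translates of a
  rotated set against a ball, which is rotation invariant, gives the same as averaging those of the set itself.\<close>

lemma lborel_translate: "(\<integral>\<^sup>+x. f (x + c) \<partial>lborel) = (\<integral>\<^sup>+x. f x \<partial>lborel)"
 if [measurable]: "f \<in> borel_measurable borel" for f :: "'a::euclidean_space => ennreal"
proof -
 have "(\<integral>\<^sup>+x. f x \<partial>lborel) = (\<integral>\<^sup>+x. f x \<partial>distr lborel borel ((+) c))"
  by (simp add: lborel_distr_plus)
 also have "... = (\<integral>\<^sup>+x. f (c + x) \<partial>lborel)"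
  by (subst nn_integral_distr) auto
 finally show ?thesis by (simp add: add.commute)
qed

lemma orthogonal_measurable:
 fixes Q :: "'a::euclidean_space => 'a"
 assumes "orthogonal_transformation Q"
 shows "Q \<in> borel_measurable borel"
 using assms by (intro borel_measurable_continuous_onI linear_continuous_on
   linear_conv_bounded_linear[THEN iffD1] orthogonal_transformation_linear)

lemma emeasure_orthogonal_vimage:
 fixes Q :: "'a::euclidean_space => 'a"
 assumes Q: "orthogonal_transformation Q" and A[measurable]: "A \<in> sets borel"
 shows "emeasure lborel (Q -` A) = emeasure lborel A"
proof -
 have Qm[measurable]: "Q \<in> borel_measurable borel" by (rule orthogonal_measurable[OF Q])
 have lin: "linear Q" using Q by (simp add: orthogonal_transformation_linear)
 obtain P where P: "!!x. Q (P x) = x"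
  using orthogonal_transformation_surj[OF Q] by (metis surj_f_inv_f)
 define g :: "'a => ennreal" where "g = indicator (ball 0 1)"
 have [measurable]: "g \<in> borel_measurable borel" by (auto simp: g_def intro!: borel_measurable_indicator)
 have gQ: "g (y - Q x) = g (x - P y)" for x y
 proof -
  have "norm (y - Q x) = norm (Q (P y - x))" by (simp add: P linear_diff[OF lin])
  also have "... = norm (x - P y)"
   by (simp add: orthogonal_transformation_norm[OF Q] norm_minus_commute)
  finally show ?thesis by (simp add: g_def indicator_def mem_ball_0)
 qed
 define a where "a x = (indicator A x :: ennreal)" for x
 have [measurable]: "a \<in> borel_measurable borel" by (simp add: a_def[abs_def])
 define I where "I = (\<integral>\<^sup>+x. g x \<partial>lborel)"
 have I: "I = emeasure lborel (ball (0::'a) 1)" by (simp add: I_def g_def)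
 have I0: "I ~= 0" "I ~= \<top>"
  unfolding I by (auto simp: emeasure_ball ennreal_eq_0_iff not_le)
 have shift: "(\<integral>\<^sup>+x. a (Q x) \<partial>lborel) = (\<integral>\<^sup>+x. a (Q x + y) \<partial>lborel)" for y
 proof -
  have "Q x + y = Q (x + P y)" for x by (simp add: linear_add[OF lin] P)
  then show ?thesis using lborel_translate[of "%x. a (Q x)" "P y"] by simp
 qed
 have "I*(\<integral>\<^sup>+x. a (Q x) \<partial>lborel) = (\<integral>\<^sup>+y. g y*(\<integral>\<^sup>+x. a (Q x) \<partial>lborel) \<partial>lborel)"
  unfolding I_def by (subst nn_integral_multc) auto
 also have "... = (\<integral>\<^sup>+y. (\<integral>\<^sup>+x. g y*a (Q x + y) \<partial>lborel) \<partial>lborel)"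
  by (intro nn_integral_cong, subst shift, subst nn_integral_cmult) auto
 also have "... = (\<integral>\<^sup>+x. (\<integral>\<^sup>+y. g y*a (Q x + y) \<partial>lborel) \<partial>lborel)"
  by (rule lborel_pair.Fubini') measurable
 also have "... = (\<integral>\<^sup>+x. (\<integral>\<^sup>+y. g (y - Q x)*a y \<partial>lborel) \<partial>lborel)"
 proof (rule nn_integral_cong)
  fix x
  show "(\<integral>\<^sup>+y. g y*a (Q x + y) \<partial>lborel) = (\<integral>\<^sup>+y. g (y - Q x)*a y \<partial>lborel)"
   using lborel_translate[of "%y. g (y - Q x)*a y" "Q x"] by (simp add: add.commute)
 qed
 also have "... = (\<integral>\<^sup>+y. (\<integral>\<^sup>+x. g (y - Q x)*a y \<partial>lborel) \<partial>lborel)"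
  by (rule lborel_pair.Fubini') measurable
 also have "... = (\<integral>\<^sup>+y. I*a y \<partial>lborel)"
 proof (intro nn_integral_cong)
  fix y
  have "(\<integral>\<^sup>+x. g (y - Q x)*a y \<partial>lborel) = (\<integral>\<^sup>+x. g (x - P y) \<partial>lborel)*a y"
   unfolding gQ by (rule nn_integral_multc) measurable
  also have "(\<integral>\<^sup>+x. g (x - P y) \<partial>lborel) = I"
   using lborel_translate[of g "- P y"] by (simp add: I_def)
  finally show "(\<integral>\<^sup>+x. g (y - Q x)*a y \<partial>lborel) = I*a y" .
 qed
 also have "... = I*(\<integral>\<^sup>+y. a y \<partial>lborel)" by (rule nn_integral_cmult) measurable
 finally have "(\<integral>\<^sup>+x. a (Q x) \<partial>lborel) = (\<integral>\<^sup>+y. a y \<partial>lborel)"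
  using I0 by (simp add: ennreal_mult_cancel_left)
 moreover have "(\<integral>\<^sup>+x. a (Q x) \<partial>lborel) = (\<integral>\<^sup>+x. indicator (Q -` A) x \<partial>lborel)"
  by (simp add: a_def indicator_def vimage_def)
 moreover have "Q -` A \<in> sets borel" using measurable_sets[OF Qm A] by simp
 ultimately show ?thesis by (simp add: a_def[abs_def])
qed

definition rotated_box :: "(real^'d => real^'d) => ('d => real) => ('d => real) => (real^'d) set" where
 "rotated_box Q lo hi = {y. \<forall>i. lo i <= Q y $ i & Q y $ i <= hi i}"

lemma rotated_box:
 assumes Q: "orthogonal_transformation Q" and le: "!!i. lo i <= hi i"
 shows "rotated_box Q lo hi \<in> sets borel"
  "emeasure lborel (rotated_box Q lo hi) = ennreal (\<Prod>i\<in>UNIV. hi i - lo i)"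
proof -
 have eq: "rotated_box Q lo hi = Q -` cbox (\<chi> i. lo i) (\<chi> i. hi i)"
  by (auto simp: rotated_box_def mem_box_cart)
 then show "rotated_box Q lo hi \<in> sets borel"
  using measurable_sets[OF orthogonal_measurable[OF Q], of "cbox (\<chi> i. lo i) (\<chi> i. hi i)"] by simp
 have "emeasure lborel (cbox (\<chi> i. lo i) (\<chi> i. hi i) :: (real^'a) set)
   = ennreal (measure lborel (cbox (\<chi> i. lo i) (\<chi> i. hi i) :: (real^'a) set))"
  by (intro emeasure_eq_ennreal_measure) (simp add: emeasure_lborel_cbox_eq)
 also have "measure lborel (cbox (\<chi> i. lo i) (\<chi> i. hi i) :: (real^'a) set) = (\<Prod>i\<in>UNIV. hi i - lo i)"
 proof -
  have "cbox (\<chi> i. lo i) (\<chi> i. hi i) ~= ({} :: (real^'a) set)"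
   using le by (simp add: interval_ne_empty_cart)
  from content_cbox_cart[OF this] show ?thesis by simp
 qed
 finally show "emeasure lborel (rotated_box Q lo hi) = ennreal (\<Prod>i\<in>UNIV. hi i - lo i)"
  unfolding eq by (subst emeasure_orthogonal_vimage[OF Q]) auto
qed

text \<open>The unit cells at the lattice points do not overlap, so their number is at most the volume of a
  region that contains them.\<close>

lemma card_lattice_le_volume:
 fixes X :: "(real^'d) set"
 assumes X: "finite X" "X \<subseteq> integer_points" and P: "P \<in> sets borel" "N \<in> sets borel" "N \<subseteq> P"
  and vol: "emeasure lborel P = ennreal p" "emeasure lborel N = ennreal n" "0 <= p" "0 <= n"
  and cover: "!!x y. x \<in> X ==> dist x y <= real CARD('d) ==> y \<in> P & y \<notin> N"
 shows "real (card X) <= p - n"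
proof -
 let ?C = "%x :: real^'d. box x (x + 1)"
 have near: "dist x y <= real CARD('d)" if "y \<in> ?C x" for x y
 proof -
  have "norm (y - x) <= (\<Sum>i\<in>UNIV. \<bar>(y - x) $ i\<bar>)" by (rule norm_le_l1_cart)
  also have "... <= (\<Sum>i\<in>(UNIV :: 'd set). 1)"
   using that by (intro sum_mono) (auto simp: mem_box_cart abs_le_iff algebra_simps less_imp_le)
  finally show ?thesis by (simp add: dist_norm norm_minus_commute)
 qed
 have dis: "disjoint_family_on ?C X"
  unfolding disjoint_family_on_def
 proof (intro ballI impI)
  fix x x' assume x: "x \<in> X" "x' \<in> X" "x ~= x'"
  show "?C x \<inter> ?C x' = {}"
  proof (rule ccontr)
   assume "?C x \<inter> ?C x' ~= {}"
   then obtain y where y: "y \<in> ?C x" "y \<in> ?C x'" by blast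
   have "x $ i = x' $ i" for i
   proof -
    obtain a b where ab: "x $ i = of_int a" "x' $ i = of_int b"
     using x X(2) by (auto simp: integer_points_def Ints_def) blast
    have "of_int a < y $ i" "y $ i < of_int a + 1" "of_int b < y $ i" "y $ i < of_int b + 1"
     using y ab by (auto simp: mem_box_cart dest!: spec[of _ i])
    then have "a = b" by linarith
    then show ?thesis using ab by simp
   qed
   then show False using x(3) by (simp add: vec_eq_iff)
  qed
 qed
 have one: "emeasure lborel (?C x) = 1" for x
 proof -
  have "emeasure lborel (?C x) = ennreal (\<Prod>b\<in>Basis. (x + 1 - x) \<bullet> b)"
   by (rule emeasure_lborel_box) (auto simp: Basis_vec_def inner_axis)
  also have "(\<Prod>b\<in>(Basis :: (real^'d) set). (x + 1 - x) \<bullet> b) = 1"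
   by (intro prod.neutral) (auto simp: Basis_vec_def inner_axis)
  finally show ?thesis by simp
 qed
 have "of_nat (card X) = (\<Sum>x\<in>X. emeasure lborel (?C x))" by (simp add: one)
 also have "... = emeasure lborel (\<Union>x\<in>X. ?C x)"
  using X(1) dis by (intro sum_emeasure) auto
 also have "... <= emeasure lborel (P - N)"
  using cover near P by (intro emeasure_mono) auto
 also have "... = ennreal p - ennreal n"
  using P vol by (subst emeasure_Diff) auto
 also have "... = ennreal (p - n)" using vol by (simp add: ennreal_minus)
 finally have le: "of_nat (card X) <= ennreal (p - n)" .
 have "ennreal n <= ennreal p" using emeasure_mono[OF P(3), of lborel] P(1) vol by simp
 then have "n <= p" using vol by (simp add: ennreal_le_iff)
 then show ?thesis using le by (simp add: ennreal_of_nat_eq_real_of_nat ennreal_le_iff)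
qed

definition lattice_degree :: "'d::finite itself => real" where
 "lattice_degree _ = real (card {z \<in> integer_points. norm (z :: real^'d) <= 1})"

lemma lattice_degree_nonneg: "0 <= lattice_degree T" by (simp add: lattice_degree_def)

lemma card_incident_edges:
 fixes X :: "(real^'d) set"
 assumes "finite X" "G \<subseteq> lattice_edges" "!!e. e \<in> G ==> \<exists>x\<in>X. x \<in> e"
 shows "finite G" "real (card G) <= lattice_degree TYPE('d)*real (card X)"
proof -
 let ?N = "{z \<in> integer_points. norm (z :: real^'d) <= 1}"
 have sub: "G \<subseteq> (%(x, z). {x, x + z}) ` (X \<times> ?N)"
 proof
  fix e assume e: "e \<in> G"
  then obtain x where x: "x \<in> X" "x \<in> e" using assms(3) by blast
  have "e \<in> lattice_edges" using e assms(2) by blast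
  then obtain a b where ab: "e = {a, b}" "a \<in> integer_points" "b \<in> integer_points" "dist a b = 1"
   by (rule lattice_edge_cases)
  obtain y where y: "e = {x, y}" "x \<in> integer_points" "y \<in> integer_points" "dist x y = 1"
  proof (cases "x = a")
   case True then show ?thesis using ab that[of b] by simp
  next
   case False
   then have "x = b" using x ab by simp
   then show ?thesis using ab that[of a] by (simp add: insert_commute dist_commute)
  qed
  then have "y - x \<in> ?N"
   by (auto simp: integer_points_def dist_norm norm_minus_commute)
  then show "e \<in> (%(x, z). {x, x + z}) ` (X \<times> ?N)"
   using x(1) y(1) by (intro image_eqI[of _ _ "(x, y - x)"]) auto
 qed
 have fin: "finite (X \<times> ?N)" using assms(1) finite_integer_points_cball by blast
 show "finite G" using finite_subset[OF sub] fin by blast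
 have "card G <= card (X \<times> ?N)" using surj_card_le[OF fin sub] .
 then show "real (card G) <= lattice_degree TYPE('d)*real (card X)"
  unfolding lattice_degree_def by (simp add: card_cartesian_product mult.commute flip: of_nat_mult)
qed

section \<open>The size of the interface\<close>

lemma frame_dist:
 fixes Q :: "real^'d => real^'d"
 assumes "orthogonal_transformation Q"
 shows "\<bar>Q x $ k - Q y $ k\<bar> <= dist x y"
proof -
 have lin: "linear Q" using assms by (simp add: orthogonal_transformation_linear)
 have "\<bar>(Q (x - y)) $ k\<bar> <= norm (Q (x - y))" by (rule component_le_norm_cart)
 also have "... = dist x y" by (simp only: orthogonal_transformation_norm[OF assms] dist_norm)
 finally show ?thesis by (simp add: linear_diff[OF lin])
qed

lemma frame_norm:
 fixes Q :: "real^'d => real^'d"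
 shows "orthogonal_transformation Q ==> Q v = axis j 1 ==> norm v = 1"
proof -
 assume Q: "orthogonal_transformation Q" "Q v = axis j 1"
 have "norm v = norm (Q v)" by (rule orthogonal_transformation_norm[OF Q(1), symmetric])
 also have "... = 1" unfolding Q(2) norm_eq_1 by (simp add: inner_axis)
 finally show ?thesis .
qed

lemma inner_dist: "norm v = 1 ==> \<bar>v \<bullet> x - v \<bullet> y\<bar> <= dist x y"
 using Cauchy_Schwarz_ineq2[of v "x - y"] by (simp add: inner_diff_right dist_norm)

definition slab ::
 "(real^'d => real^'d) => real^'d => 'd => ('d => real) => ('d => real) => real => real => (real^'d) set" where
 "slab Q v j lo hi r w = {y \<in> prism Q j lo hi. \<bar>v \<bullet> y - r\<bar> <= w}"

lemma slab_volume:
 fixes Q :: "real^'d => real^'d"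
 assumes Q: "orthogonal_transformation Q" "Q v = axis j 1"
  and le: "!!k. k ~= j ==> lo k <= hi k" "0 <= w"
 shows "slab Q v j lo hi r w \<in> sets borel"
  "emeasure lborel (slab Q v j lo hi r w) = ennreal (2*w*(\<Prod>k\<in>-{j}. hi k - lo k))"
  "0 <= 2*w*(\<Prod>k\<in>-{j}. hi k - lo k)"
proof -
 let ?lo = "%k. if k = j then r - w else lo k" and ?hi = "%k. if k = j then r + w else hi k"
 have eq: "slab Q v j lo hi r w = rotated_box Q ?lo ?hi"
  unfolding slab_def rotated_box_def prism_def axis_frame[OF Q]
  by (auto simp: abs_le_iff)
 have le': "?lo k <= ?hi k" for k using le by simp
 show "slab Q v j lo hi r w \<in> sets borel" unfolding eq by (rule rotated_box(1)[OF Q(1) le'])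
 have "(\<Prod>k\<in>UNIV. ?hi k - ?lo k) = (?hi j - ?lo j)*(\<Prod>k\<in>UNIV - {j}. ?hi k - ?lo k)"
  by (rule prod.remove) auto
 also have "(\<Prod>k\<in>UNIV - {j}. ?hi k - ?lo k) = (\<Prod>k\<in>-{j}. hi k - lo k)"
  by (rule prod.cong) auto
 finally show "emeasure lborel (slab Q v j lo hi r w) = ennreal (2*w*(\<Prod>k\<in>-{j}. hi k - lo k))"
  unfolding eq by (simp add: rotated_box(2)[OF Q(1) le'] mult_ac)
 show "0 <= 2*w*(\<Prod>k\<in>-{j}. hi k - lo k)"
  using le by (intro mult_nonneg_nonneg prod_nonneg) auto
qed

lemma prism_near:
 fixes Q :: "real^'d => real^'d"
 assumes "orthogonal_transformation Q" "x \<in> prism Q j lo hi" "dist x y <= w"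
 shows "y \<in> prism Q j (%k. lo k - w) (%k. hi k + w)"
 unfolding prism_def
proof (intro CollectI allI impI)
 fix k assume k: "k ~= j"
 have "\<bar>Q x $ k - Q y $ k\<bar> <= w" using frame_dist[OF assms(1), of x k y] assms(3) by simp
 moreover have "lo k <= Q x $ k" "Q x $ k <= hi k" using assms(2) k by (auto simp: prism_def)
 ultimately show "lo k - w <= Q y $ k & Q y $ k <= hi k + w" by (auto simp: abs_le_iff)
qed

lemma prism_near':
 fixes Q :: "real^'d => real^'d"
 assumes "orthogonal_transformation Q" "x \<in> prism Q j (%k. lo k + w) (%k. hi k - w)" "dist x y <= w"
 shows "y \<in> prism Q j lo hi"
 using prism_near[OF assms] by simp

lemma prism_mono:
 "(!!k. k ~= j ==> lo' k <= lo k) ==> (!!k. k ~= j ==> hi k <= hi' k) ==>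
  prism Q j lo hi \<subseteq> prism Q j lo' hi'"
 unfolding prism_def by (auto intro: order_trans)

lemma flat_vertices_count:
 fixes Q :: "real^'d => real^'d" and P :: "'j => real^'d => real^'d" and v :: "real^'d"
 defines "dl == real CARD('d)"
 assumes Q: "orthogonal_transformation Q" "Q v = axis j 1"
  and P: "!!i. i \<in> J ==> orthogonal_transformation (P i)" "!!i. i \<in> J ==> P i v = axis j 1"
  and J: "finite J"
  and sub: "!!i. i \<in> J ==> prism (P i) j (a i) (b i) \<subseteq> prism Q j lo hi"
  and dis: "disjoint_family_on (%i. prism (P i) j (a i) (b i)) J"
  and le: "!!k. k ~= j ==> lo k <= hi k" "!!i k. i \<in> J ==> k ~= j ==> a i k + 2*dl <= b i k"
  and h: "!!i. i \<in> J ==> \<bar>\<rho> i - r\<bar> + 1 <= \<eta> i"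
 shows "real (card {x \<in> lattice_points v (prism Q j lo hi) r h -
    (\<Union>i\<in>J. lattice_points v (prism (P i) j (a i) (b i)) (\<rho> i) (\<eta> i)). \<bar>v \<bullet> x - r\<bar> <= 1})
  <= 2*(1 + dl)*((\<Prod>k\<in>-{j}. hi k - lo k + 2*dl) - (\<Sum>i\<in>J. \<Prod>k\<in>-{j}. b i k - a i k - 2*dl))"
  (is "real (card ?X) <= _")
proof -
 have dl: "0 < dl" by (simp add: dl_def)
 have v1: "norm v = 1" by (rule frame_norm[OF Q])
 let ?P = "slab Q v j (%k. lo k - dl) (%k. hi k + dl) r (1 + dl)"
 let ?N = "%i. slab (P i) v j (%k. a i k + dl) (%k. b i k - dl) r (1 + dl)"
 have le1: "lo k - dl <= hi k + dl" if "k ~= j" for k using le(1)[OF that] dl by simp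
 have le2: "a i k + dl <= b i k - dl" if "i \<in> J" "k ~= j" for i k using le(2)[OF that] by simp
 note vP = slab_volume(1,2)[OF Q le1, where w = "1 + dl" and r = r]
  slab_volume(3)[OF Q le1, where w = "1 + dl"]
 have vN: "?N i \<in> sets borel"
   "emeasure lborel (?N i) = ennreal (2*(1 + dl)*(\<Prod>k\<in>-{j}. b i k - a i k - 2*dl))"
   "0 <= 2*(1 + dl)*(\<Prod>k\<in>-{j}. b i k - a i k - 2*dl)" if "i \<in> J" for i
  using slab_volume(1,2)[OF P[OF that] le2[OF that], where w = "1 + dl" and r = r]
   slab_volume(3)[OF P[OF that] le2[OF that], where w = "1 + dl"] dl by (simp_all add: algebra_simps)
 have Nsub: "?N i \<subseteq> prism (P i) j (a i) (b i)" for i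
  using dl prism_mono[of j "a i" "%k. a i k + dl" "%k. b i k - dl" "b i" "P i"] by (auto simp: slab_def)
 have eN: "emeasure lborel (\<Union>i\<in>J. ?N i)
   = ennreal (2*(1 + dl)*(\<Sum>i\<in>J. \<Prod>k\<in>-{j}. b i k - a i k - 2*dl))"
 proof -
  have "disjoint_family_on ?N J"
   using dis Nsub unfolding disjoint_family_on_def by blast
  then have "emeasure lborel (\<Union>i\<in>J. ?N i) = (\<Sum>i\<in>J. emeasure lborel (?N i))"
   using J vN(1) by (intro sum_emeasure[symmetric]) auto
  also have "... = (\<Sum>i\<in>J. ennreal (2*(1 + dl)*(\<Prod>k\<in>-{j}. b i k - a i k - 2*dl)))"
   by (intro sum.cong refl vN)
  also have "... = ennreal (\<Sum>i\<in>J. 2*(1 + dl)*(\<Prod>k\<in>-{j}. b i k - a i k - 2*dl))"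
   using vN(3) by (intro sum_ennreal) auto
  finally show ?thesis by (simp add: sum_distrib_left)
 qed
 have fin: "finite ?X" using finite_lattice_points[OF Q] by simp
 have "real (card ?X) <= 2*(1 + dl)*(\<Prod>k\<in>-{j}. (hi k + dl) - (lo k - dl))
   - 2*(1 + dl)*(\<Sum>i\<in>J. \<Prod>k\<in>-{j}. b i k - a i k - 2*dl)"
 proof (rule card_lattice_le_volume[OF fin])
  show "?X \<subseteq> integer_points" by (auto simp: lattice_points_def)
  show "?P \<in> sets borel" "emeasure lborel ?P = ennreal (2*(1 + dl)*(\<Prod>k\<in>-{j}. (hi k + dl) - (lo k - dl)))"
   "0 <= 2*(1 + dl)*(\<Prod>k\<in>-{j}. (hi k + dl) - (lo k - dl))"
   using vP dl by simp_all
  show "(\<Union>i\<in>J. ?N i) \<in> sets borel" using J vN(1) by (intro sets.finite_UN) auto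
  show "emeasure lborel (\<Union>i\<in>J. ?N i)
   = ennreal (2*(1 + dl)*(\<Sum>i\<in>J. \<Prod>k\<in>-{j}. b i k - a i k - 2*dl))" by (rule eN)
  show "0 <= 2*(1 + dl)*(\<Sum>i\<in>J. \<Prod>k\<in>-{j}. b i k - a i k - 2*dl)"
   unfolding sum_distrib_left using vN(3) by (intro sum_nonneg) auto
  show "(\<Union>i\<in>J. ?N i) \<subseteq> ?P"
  proof
   fix y assume "y \<in> (\<Union>i\<in>J. ?N i)"
   then obtain i where i: "i \<in> J" "y \<in> ?N i" by blast
   then have "y \<in> prism Q j lo hi" using Nsub[of i] sub[OF i(1)] by blast
   then have "y \<in> prism Q j (%k. lo k - dl) (%k. hi k + dl)"
    using dl prism_mono[of j "%k. lo k - dl" lo hi "%k. hi k + dl" Q] by auto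
   then show "y \<in> ?P" using i(2) by (auto simp: slab_def)
  qed
  fix x y assume x: "x \<in> ?X" and xy: "dist x y <= real CARD('d)"
  have d: "dist x y <= dl" "dist y x <= dl" using xy by (simp_all add: dl_def dist_commute)
  have hx: "\<bar>v \<bullet> x - r\<bar> <= 1" using x by simp
  have "y \<in> ?P"
   using x prism_near[OF Q(1) _ d(1), of j lo hi] inner_dist[OF v1, of x y] d
   by (auto simp: slab_def lattice_points_def)
  moreover have "y \<notin> ?N i" if i: "i \<in> J" for i
  proof
   assume "y \<in> ?N i"
   then have "x \<in> prism (P i) j (a i) (b i)"
    using prism_near'[OF P(1)[OF i] _ d(2), of j "a i" "b i"] by (auto simp: slab_def)
   then have "x \<in> lattice_points v (prism (P i) j (a i) (b i)) (\<rho> i) (\<eta> i)"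
    using x hx h[OF i] by (auto simp: lattice_points_def)
   then show False using x i by blast
  qed
  ultimately show "y \<in> ?P & y \<notin> (\<Union>i\<in>J. ?N i)" by blast
 qed
 then show ?thesis by (simp add: algebra_simps)
qed

lemma wall_vertices_count:
 fixes P :: "real^'d => real^'d" and v :: "real^'d"
 defines "dl == real CARD('d)"
 assumes P: "orthogonal_transformation P" "P v = axis j 1"
  and le: "!!k. k ~= j ==> a k + 2 + 2*dl <= b k"
  and \<rho>: "\<bar>\<rho> - r\<bar> <= \<kappa>" "2*\<kappa> + 2 <= \<eta>" and V: "V \<subseteq> integer_points"
 defines "W == lattice_points v (prism P j a b) \<rho> \<eta>"
 shows "real (card {x \<in> W. \<bar>v \<bullet> x - r\<bar> <= \<kappa> + 1 & (\<exists>y\<in>V - W. {x, y} \<in> lattice_edges)})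
  <= 2*(\<kappa> + 1 + dl)*((\<Prod>k\<in>-{j}. b k - a k + 2*dl) - (\<Prod>k\<in>-{j}. b k - a k - 2 - 2*dl))"
  (is "real (card ?X) <= _")
proof -
 have dl: "0 < dl" by (simp add: dl_def)
 have \<kappa>: "0 <= \<kappa>" using \<rho> by simp
 have v1: "norm v = 1" by (rule frame_norm[OF P])
 let ?w = "\<kappa> + 1 + dl"
 let ?P = "slab P v j (%k. a k - dl) (%k. b k + dl) r ?w"
 let ?N = "slab P v j (%k. a k + (1 + dl)) (%k. b k - (1 + dl)) r ?w"
 have le1: "a k - dl <= b k + dl" if "k ~= j" for k using le[OF that] dl by simp
 have le2: "a k + (1 + dl) <= b k - (1 + dl)" if "k ~= j" for k using le[OF that] by simp
 have w: "0 <= ?w" using \<kappa> dl by simp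
 note vP = slab_volume(1,2)[OF P le1 w, where r = r] slab_volume(3)[OF P le1 w]
 note vN = slab_volume(1,2)[OF P le2 w, where r = r] slab_volume(3)[OF P le2 w]
 have fin: "finite ?X" unfolding W_def using finite_lattice_points[OF P] by simp
 have "real (card ?X) <= 2*?w*(\<Prod>k\<in>-{j}. (b k + dl) - (a k - dl))
   - 2*?w*(\<Prod>k\<in>-{j}. (b k - (1 + dl)) - (a k + (1 + dl)))"
 proof (rule card_lattice_le_volume[OF fin _ vP(1) vN(1) _ vP(2) vN(2) vP(3) vN(3)])
  show "?X \<subseteq> integer_points" by (auto simp: W_def lattice_points_def)
  show "?N \<subseteq> ?P" unfolding slab_def
   using dl prism_mono[of j "%k. a k - dl" "%k. a k + (1 + dl)" "%k. b k - (1 + dl)" "%k. b k + dl" P] by auto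
  fix x y assume x: "x \<in> ?X" and xy: "dist x y <= real CARD('d)"
  have d: "dist x y <= dl" "dist y x <= dl" using xy by (simp_all add: dl_def dist_commute)
  have hx: "\<bar>v \<bullet> x - r\<bar> <= \<kappa> + 1" "x \<in> prism P j a b" using x by (auto simp: W_def lattice_points_def)
  obtain z where z: "z \<in> V - W" "{x, z} \<in> lattice_edges" using x by auto
  have "y \<in> ?P"
   using hx prism_near[OF P(1) _ d(1), of j a b] inner_dist[OF v1, of x y] d
   by (auto simp: slab_def)
  moreover have "y \<notin> ?N"
  proof
   assume "y \<in> ?N"
   then have "y \<in> prism P j (%k. (a k + 1) + dl) (%k. (b k - 1) - dl)"
    by (auto simp: slab_def algebra_simps prism_def)
   then have "x \<in> prism P j (%k. a k + 1) (%k. b k - 1)"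
    using prism_near'[OF P(1) _ d(2), of j "%k. a k + 1" "%k. b k - 1"] by blast
   then have "z \<in> prism P j a b"
    using prism_near'[OF P(1), of x j a 1 b z] lattice_edgeD(3)[OF z(2)] by simp
   moreover have "\<bar>v \<bullet> z - \<rho>\<bar> <= \<eta>"
    using height_neighbour[OF v1 z(2)] hx(1) \<rho> by linarith
   ultimately show False using z V by (auto simp: W_def lattice_points_def)
  qed
  ultimately show "y \<in> ?P & y \<notin> ?N" by blast
 qed
 then show ?thesis by (simp add: algebra_simps)
qed

text \<open>The volume by which the unit cells around the interface can exceed the big slab minus the
  small ones; \<open>L\<close> and \<open>l i\<close> are the side lengths and \<open>\<kappa> i\<close> bounds the vertical offsets.\<close>

definition interface_bound ::
 "real => 'd::finite => ('d => real) => 'j set => ('j => 'd => real) => ('j => real) => real" where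
 "interface_bound dl j L J l \<kappa> =
   2*dl*((\<Prod>k\<in>-{j}. L k + 2*dl) - (\<Sum>i\<in>J. \<Prod>k\<in>-{j}. l i k - 2*dl))
   + (\<Sum>i\<in>J. 2*(\<kappa> i + dl)*((\<Prod>k\<in>-{j}. l i k + 2*dl) - (\<Prod>k\<in>-{j}. l i k - 2*dl)))"

definition cell_margin :: "'d::finite itself => real" where
 "cell_margin _ = real CARD('d) + 1"

text \<open>The edges have an endpoint near the uncovered part of the hyperplane or near a wall, and the
  lattice points there are counted by the volumes of their cells: the big slab without the small ones, and
  thin shells around the small prisms.\<close>

lemma card_interface_edges:
 fixes Q :: "real^'d => real^'d" and P :: "'j => real^'d => real^'d" and v :: "real^'d" and h :: real
 defines "dl == cell_margin TYPE('d)"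
 assumes Q: "orthogonal_transformation Q" "Q v = axis j 1"
  and P: "!!i. i \<in> J ==> orthogonal_transformation (P i)" "!!i. i \<in> J ==> P i v = axis j 1"
  and J: "finite J"
  and sub: "!!i. i \<in> J ==> prism (P i) j (a i) (b i) \<subseteq> prism Q j lo hi"
  and dis: "disjoint_family_on (%i. prism (P i) j (a i) (b i)) J"
  and le: "!!k. k ~= j ==> lo k <= hi k" "!!i k. i \<in> J ==> k ~= j ==> a i k + 2*dl <= b i k"
  and \<rho>: "!!i. i \<in> J ==> \<bar>\<rho> i - r\<bar> <= \<kappa> i" and \<eta>: "!!i. i \<in> J ==> 2*\<kappa> i + 2 <= \<eta> i"
 defines "V == lattice_points v (prism Q j lo hi) r h"
  and "W == %i. lattice_points v (prism (P i) j (a i) (b i)) (\<rho> i) (\<eta> i)"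
 shows "real (card (interface_edges v V r J W \<kappa>))
  <= lattice_degree TYPE('d)*interface_bound dl j (%k. hi k - lo k) J (%i k. b i k - a i k) \<kappa>"
  (is "real (card ?G) <= ?D*_")
proof -
 let ?dl = "real CARD('d)"
 have dl: "dl = ?dl + 1" by (simp add: dl_def cell_margin_def)
 have v1: "norm v = 1" by (rule frame_norm[OF Q])
 have Vi: "V \<subseteq> integer_points" by (auto simp: V_def lattice_points_def)
 have finV: "finite V" unfolding V_def by (rule finite_lattice_points[OF Q])
 have finW: "finite (W i)" if "i \<in> J" for i
  unfolding W_def by (rule finite_lattice_points[OF P[OF that]])
 have \<kappa>0: "0 <= \<kappa> i" if "i \<in> J" for i using \<rho>[OF that] by simp
 let ?X = "{x \<in> V - (\<Union>i\<in>J. W i). \<bar>v \<bullet> x - r\<bar> <= 1}"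
 let ?F = "flat_edges v (V - (\<Union>i\<in>J. W i)) r"
 let ?Y = "%i. {x \<in> W i. \<bar>v \<bullet> x - r\<bar> <= \<kappa> i + 1 & (\<exists>y\<in>V - W i. {x, y} \<in> lattice_edges)}"
 let ?w = "%i. wall_edges v V r (W i) (\<kappa> i)"
 have F: "real (card ?F) <= ?D*real (card ?X)"
 proof (rule card_incident_edges(2))
  show "finite ?X" using finV by simp
  show "?F \<subseteq> lattice_edges" by (auto simp: flat_edges_def)
  fix e assume "e \<in> ?F"
  then obtain x y where e: "e = {x, y}" "{x, y} \<in> lattice_edges" "x \<in> V - (\<Union>i\<in>J. W i)"
   "r < v \<bullet> x" "v \<bullet> y <= r" by (auto simp: flat_edges_def)
  then have "x \<in> ?X" using height_neighbour[OF v1 e(2)] by auto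
  then show "\<exists>x\<in>?X. x \<in> e" using e(1) by blast
 qed
 have w: "real (card (?w i)) <= ?D*real (card (?Y i))" if i: "i \<in> J" for i
 proof (rule card_incident_edges(2))
  show "finite (?Y i)" using finW[OF i] by simp
  show "?w i \<subseteq> lattice_edges" by (auto simp: wall_edges_def)
  show "\<exists>x\<in>?Y i. x \<in> e" if "e \<in> ?w i" for e
   using that unfolding wall_edges_def by fastforce
 qed
 have cX: "real (card ?X) <= 2*dl*((\<Prod>k\<in>-{j}. hi k - lo k + 2*dl) - (\<Sum>i\<in>J. \<Prod>k\<in>-{j}. b i k - a i k - 2*dl))"
 proof -
  have "real (card ?X) <= 2*(1 + ?dl)*((\<Prod>k\<in>-{j}. hi k - lo k + 2*?dl) - (\<Sum>i\<in>J. \<Prod>k\<in>-{j}. b i k - a i k - 2*?dl))"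
   unfolding V_def W_def
  proof (rule flat_vertices_count[OF Q P J sub dis le(1)])
   show "a i k + 2*real CARD('d) <= b i k" if "i \<in> J" "k ~= j" for i k
    using le(2)[OF that] dl by simp
   show "\<bar>\<rho> i - r\<bar> + 1 <= \<eta> i" if "i \<in> J" for i
    using \<rho>[OF that] \<eta>[OF that] \<kappa>0[OF that] by simp
  qed
  also have "... <= 2*dl*((\<Prod>k\<in>-{j}. hi k - lo k + 2*dl) - (\<Sum>i\<in>J. \<Prod>k\<in>-{j}. b i k - a i k - 2*dl))"
  proof -
   have m1: "(\<Prod>k\<in>-{j}. hi k - lo k + 2*?dl) <= (\<Prod>k\<in>-{j}. hi k - lo k + 2*dl)"
    using le(1) dl by (intro prod_mono) auto
   have m2: "(\<Sum>i\<in>J. \<Prod>k\<in>-{j}. b i k - a i k - 2*dl) <= (\<Sum>i\<in>J. \<Prod>k\<in>-{j}. b i k - a i k - 2*?dl)"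
    using le(2) dl by (intro sum_mono prod_mono) force
   have e: "1 + ?dl = dl" "0 <= 2*dl" using dl by simp_all
   show ?thesis unfolding e(1) by (intro mult_left_mono diff_mono m1 m2 e(2))
  qed
  finally show ?thesis .
 qed
 have cY: "real (card (?Y i)) <= 2*(\<kappa> i + dl)*((\<Prod>k\<in>-{j}. b i k - a i k + 2*dl) - (\<Prod>k\<in>-{j}. b i k - a i k - 2*dl))"
  if i: "i \<in> J" for i
 proof -
  have "real (card (?Y i)) <= 2*(\<kappa> i + 1 + ?dl)*((\<Prod>k\<in>-{j}. b i k - a i k + 2*?dl) - (\<Prod>k\<in>-{j}. b i k - a i k - 2 - 2*?dl))"
   unfolding W_def
   by (rule wall_vertices_count[OF P[OF i] _ \<rho>[OF i] \<eta>[OF i] Vi])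
    (use le(2)[OF i] dl in \<open>force simp: algebra_simps\<close>)
  also have "... <= 2*(\<kappa> i + dl)*((\<Prod>k\<in>-{j}. b i k - a i k + 2*dl) - (\<Prod>k\<in>-{j}. b i k - a i k - 2*dl))"
  proof -
   have eq: "\<kappa> i + 1 + ?dl = \<kappa> i + dl" "b i k - a i k - 2 - 2*?dl = b i k - a i k - 2*dl" for k
    using dl by simp_all
   have "(\<Prod>k\<in>-{j}. b i k - a i k + 2*?dl) <= (\<Prod>k\<in>-{j}. b i k - a i k + 2*dl)"
   proof (intro prod_mono conjI)
    fix k assume k: "k \<in> -{j}"
    show "0 <= b i k - a i k + 2*?dl" "b i k - a i k + 2*?dl <= b i k - a i k + 2*dl"
     using le(2)[OF i, of k] k dl by auto
   qed
   then show ?thesis unfolding eq using \<kappa>0[OF i] dl by (intro mult_left_mono) auto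
  qed
  finally show ?thesis .
 qed
 have "card ?G <= card ?F + card (\<Union>i\<in>J. ?w i)"
  unfolding interface_edges_def by (rule card_Un_le)
 also have "card (\<Union>i\<in>J. ?w i) <= (\<Sum>i\<in>J. card (?w i))" by (rule card_UN_le[OF J])
 finally have "real (card ?G) <= real (card ?F) + (\<Sum>i\<in>J. real (card (?w i)))"
  by (simp flip: of_nat_sum of_nat_add)
 also have "... <= ?D*real (card ?X) + (\<Sum>i\<in>J. ?D*real (card (?Y i)))"
  using F w by (intro add_mono sum_mono) auto
 also have "... <= ?D*(2*dl*((\<Prod>k\<in>-{j}. hi k - lo k + 2*dl) - (\<Sum>i\<in>J. \<Prod>k\<in>-{j}. b i k - a i k - 2*dl)))
   + (\<Sum>i\<in>J. ?D*(2*(\<kappa> i + dl)*((\<Prod>k\<in>-{j}. b i k - a i k + 2*dl) - (\<Prod>k\<in>-{j}. b i k - a i k - 2*dl))))"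
  using cX cY by (intro add_mono sum_mono mult_left_mono lattice_degree_nonneg) auto
 also have "... = ?D*interface_bound dl j (%k. hi k - lo k) J (%i k. b i k - a i k) \<kappa>"
  by (simp add: interface_bound_def distrib_left sum_distrib_left)
 finally show ?thesis .
qed

section \<open>Sums of independent copies\<close>

context prob_space
begin

definition iid_copies :: "('a => real) => 'i set => ('i => 'a => real) => bool" where
 "iid_copies Y J X \<longleftrightarrow> finite J & indep_vars (%_. borel) X J &
   (\<forall>i\<in>J. distr M borel (X i) = distr M borel Y) & (\<forall>i\<in>J. \<forall>w\<in>space M. 0 <= X i w)"

definition nonneg_rv :: "('a => real) => bool" where
 "nonneg_rv Y \<longleftrightarrow> random_variable borel Y & (\<forall>w\<in>space M. 0 <= Y w)"

lemma iid_copies_rv: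
 assumes "iid_copies Y J X" "i \<in> J"
 shows "random_variable borel (X i)"
 using assms unfolding iid_copies_def indep_vars_def by auto

lemma iid_copies_subset: "iid_copies Y J X ==> K \<subseteq> J ==> iid_copies Y K X"
 unfolding iid_copies_def by (auto intro: finite_subset indep_vars_subset)

context
 fixes Y :: "'a => real" and J :: "'i set" and X :: "'i => 'a => real"
 assumes XY: "iid_copies Y J X" and Y[measurable]: "random_variable borel Y"
begin

lemma copies_expectation:
 assumes i: "i \<in> J" and [measurable]: "g \<in> borel_measurable borel"
 shows "expectation (%w. g (X i w)) = expectation (%w. g (Y w) :: real)"
  "integrable M (%w. g (X i w)) \<longleftrightarrow> integrable M (%w. g (Y w))"
proof -
 have [measurable]: "random_variable borel (X i)" by (rule iid_copies_rv[OF XY i])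
 have d: "distr M borel (X i) = distr M borel Y" using XY i unfolding iid_copies_def by blast
 have "expectation (%w. g (X i w)) = integral\<^sup>L (distr M borel (X i)) g"
  by (subst integral_distr) auto
 also have "... = expectation (%w. g (Y w))" unfolding d by (subst integral_distr) auto
 finally show "expectation (%w. g (X i w)) = expectation (%w. g (Y w))" .
 have "integrable M (%w. g (X i w)) \<longleftrightarrow> integrable (distr M borel (X i)) g"
  by (subst integrable_distr_eq) auto
 also have "... \<longleftrightarrow> integrable M (%w. g (Y w))" unfolding d by (subst integrable_distr_eq) auto
 finally show "integrable M (%w. g (X i w)) \<longleftrightarrow> integrable M (%w. g (Y w))" .
qed

lemma copies_prob:
 assumes i: "i \<in> J" and S: "S \<in> sets borel"
 shows "prob {w \<in> space M. X i w \<in> S} = prob {w \<in> space M. Y w \<in> S}"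
proof -
 have [measurable]: "random_variable borel (X i)" by (rule iid_copies_rv[OF XY i])
 have d: "distr M borel (X i) = distr M borel Y" using XY i unfolding iid_copies_def by blast
 have "prob {w \<in> space M. X i w \<in> S} = measure (distr M borel (X i)) S"
  using S by (subst measure_distr) (auto intro!: arg_cong[where f = prob])
 also have "... = prob {w \<in> space M. Y w \<in> S}"
  unfolding d using S by (subst measure_distr) (auto intro!: arg_cong[where f = prob])
 finally show ?thesis .
qed

lemma copies_compose:
 assumes g[measurable]: "g \<in> borel_measurable borel" and pos: "!!y. 0 <= y ==> 0 <= (g y :: real)"
 shows "iid_copies (%w. g (Y w)) J (%i w. g (X i w))"
proof -
 have "indep_vars (%_. borel) (%i w. g (X i w)) J"
 proof (rule indep_vars_compose2[where M' = "%_. borel" and N = "%_. borel" and X = X and Y = "%_. g"])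
  show "indep_vars (%_. borel) X J" using XY unfolding iid_copies_def by blast
 qed (rule g)
 moreover have "distr M borel (%w. g (X i w)) = distr M borel (%w. g (Y w))" if i: "i \<in> J" for i
 proof -
  have [measurable]: "random_variable borel (X i)" by (rule iid_copies_rv[OF XY i])
  have d: "distr M borel (X i) = distr M borel Y" using XY i unfolding iid_copies_def by blast
  have "distr M borel (%w. g (X i w)) = distr (distr M borel (X i)) borel g"
   by (subst distr_distr) (auto simp: o_def)
  also have "... = distr M borel (%w. g (Y w))"
   unfolding d by (subst distr_distr) (auto simp: o_def)
  finally show ?thesis .
 qed
 ultimately show ?thesis using XY pos unfolding iid_copies_def by blast
qed

end

lemma nonneg_rv_bounded_integrable:
 assumes "nonneg_rv Y" "!!w. w \<in> space M ==> Y w <= b"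
 shows "integrable M Y"
 using assms by (intro integrable_const_bound[of _ b]) (auto simp: nonneg_rv_def)

lemma exp_le_quadratic:
 assumes "0 <= x" "x <= (c::real)"
 shows "exp x <= 1 + x + x\<^sup>2*exp c"
proof -
 have "1 - x <= exp (- x)" using exp_ge_add_one_self[of "-x"] by simp
 then have "(1 - x)*exp x <= exp (- x)*exp x" by (rule mult_right_mono) simp
 then have a: "exp x - 1 <= x*exp x" by (simp add: exp_minus algebra_simps)
 have "exp x - 1 - x <= x*(exp x - 1)" using a by (simp add: algebra_simps)
 also have "... <= x*(x*exp x)" using assms a by (intro mult_left_mono) auto
 also have "... <= x*(x*exp c)" using assms by (intro mult_left_mono) auto
 finally show ?thesis by (simp add: power2_eq_square algebra_simps)
qed

text \<open>A quadratic bound for the exponential function controls the exponential moment of a bounded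
  variable.\<close>

lemma chernoff_bounded:
 assumes XY: "iid_copies Y J X" and Y: "nonneg_rv Y" and b: "!!w. w \<in> space M ==> Y w <= b"
  and Xb: "!!i w. i \<in> J ==> w \<in> space M ==> X i w <= b"
  and N: "real (card J) <= N" and l: "0 < l"
 shows "prob {w \<in> space M. N*expectation Y + e <= (\<Sum>i\<in>J. X i w)}
  <= exp (- l*e + N*(l\<^sup>2*exp (l*b)*expectation (%w. (Y w)\<^sup>2)))"
proof -
 have Yrv[measurable]: "random_variable borel Y" using Y by (simp add: nonneg_rv_def)
 have Ypos: "0 <= Y w" if "w \<in> space M" for w using Y that by (simp add: nonneg_rv_def)
 have fin: "finite J" and ind: "indep_vars (%_. borel) X J" using XY by (auto simp: iid_copies_def)
 have Xrv: "random_variable borel (X i)" if "i \<in> J" for i by (rule iid_copies_rv[OF XY that])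
 have Xpos: "0 <= X i w" if "i \<in> J" "w \<in> space M" for i w using XY that by (auto simp: iid_copies_def)
 let ?m = "expectation Y" and ?s = "expectation (%w. (Y w)\<^sup>2)"
 have m0: "0 <= ?m" using Ypos by (intro integral_nonneg_AE) auto
 have s0: "0 <= ?s" by simp
 let ?q = "l*?m + l\<^sup>2*exp (l*b)*?s"
 have q0: "0 <= ?q" using l m0 s0 by (intro add_nonneg_nonneg mult_nonneg_nonneg) auto
 have intY: "integrable M Y" by (rule nonneg_rv_bounded_integrable[OF Y b])
 have intY2: "integrable M (%w. (Y w)\<^sup>2)"
  using Ypos b by (intro integrable_const_bound[of _ "b\<^sup>2"]) (auto intro!: power_mono)
 have iexp: "integrable M (%w. exp (l*X i w))" if "i \<in> J" for i
  using Xb[OF that] l Xrv[OF that] by (intro integrable_const_bound[of _ "exp (l*b)"]) auto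
 have iexpY: "integrable M (%w. exp (l*Y w))"
  using b l by (intro integrable_const_bound[of _ "exp (l*b)"]) auto
 have Eexp: "expectation (%w. exp (l*X i w)) <= exp ?q" if i: "i \<in> J" for i
 proof -
  have "expectation (%w. exp (l*X i w)) = expectation (%w. exp (l*Y w))"
   by (rule copies_expectation(1)[OF XY Yrv i]) measurable
  also have "... <= expectation (%w. 1 + l*Y w + l\<^sup>2*exp (l*b)*(Y w)\<^sup>2)"
  proof (rule integral_mono[OF iexpY])
   show "integrable M (%w. 1 + l*Y w + l\<^sup>2*exp (l*b)*(Y w)\<^sup>2)"
    using intY intY2 by auto
   fix w assume "w \<in> space M"
   then show "exp (l*Y w) <= 1 + l*Y w + l\<^sup>2*exp (l*b)*(Y w)\<^sup>2"
    using exp_le_quadratic[of "l*Y w" "l*b"] Ypos b l by (simp add: power_mult_distrib mult_ac)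
  qed
  also have "... = 1 + ?q" using intY intY2 by (simp add: prob_space)
  also have "... <= exp ?q" using exp_ge_add_one_self[of ?q] by simp
  finally show ?thesis .
 qed
 let ?S = "%w. \<Sum>i\<in>J. X i w"
 have ind': "indep_vars (%_. borel) (%i w. exp (l*X i w)) J"
  by (rule indep_vars_compose2[OF ind]) measurable
 have expS: "exp (l*?S w) = (\<Prod>i\<in>J. exp (l*X i w))" for w
  using fin by (simp add: sum_distrib_left exp_sum)
 have intS: "integrable M (%w. exp (l*?S w))"
  unfolding expS by (rule indep_vars_integrable[OF fin ind' iexp])
 have "expectation (%w. exp (l*?S w)) = (\<Prod>i\<in>J. expectation (%w. exp (l*X i w)))"
  unfolding expS by (rule indep_vars_lebesgue_integral[OF fin ind' iexp])
 also have "... <= (\<Prod>i\<in>J. exp ?q)"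
  using Eexp by (intro prod_mono) auto
 also have "... = exp (real (card J)*?q)" by (simp add: exp_of_nat_mult)
 also have "... <= exp (N*?q)" using N q0 by (auto intro: mult_right_mono)
 finally have ES: "expectation (%w. exp (l*?S w)) <= exp (N*?q)" .
 have "{w \<in> space M. N*?m + e <= ?S w} = {w \<in> space M. exp (l*?S w) >= exp (l*(N*?m + e))}"
  using l by auto
 also have "prob ... <= expectation (%w. exp (l*?S w))/exp (l*(N*?m + e))"
  by (intro integral_Markov_inequality_measure[where A = "space M"] intS) auto
 also have "... <= exp (N*?q)/exp (l*(N*?m + e))"
  using ES by (intro divide_right_mono) auto
 also have "... = exp (- l*e + N*(l\<^sup>2*exp (l*b)*?s))"
  by (simp add: exp_diff[symmetric] algebra_simps)
 finally show ?thesis .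
qed

lemma second_moment_sum:
 assumes XY: "iid_copies Y J X" and Y: "nonneg_rv Y" and b: "!!w. w \<in> space M ==> Y w <= b"
  and Xb: "!!i w. i \<in> J ==> w \<in> space M ==> X i w <= b"
 shows "integrable M (%w. (\<Sum>i\<in>J. X i w - expectation Y)\<^sup>2)"
  "expectation (%w. (\<Sum>i\<in>J. X i w - expectation Y)\<^sup>2) <= real (card J)*expectation (%w. (Y w)\<^sup>2)"
proof -
 have Yrv[measurable]: "random_variable borel Y" using Y by (simp add: nonneg_rv_def)
 have Ypos: "0 <= Y w" if "w \<in> space M" for w using Y that by (simp add: nonneg_rv_def)
 have fin: "finite J" and ind: "indep_vars (%_. borel) X J" using XY by (auto simp: iid_copies_def)
 have Xrv: "random_variable borel (X i)" if "i \<in> J" for i by (rule iid_copies_rv[OF XY that])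
 have Xpos: "0 <= X i w" if "i \<in> J" "w \<in> space M" for i w using XY that by (auto simp: iid_copies_def)
 let ?m = "expectation Y"
 define Z where "Z i w = X i w - ?m" for i w
 have intY: "integrable M Y" by (rule nonneg_rv_bounded_integrable[OF Y b])
 have intY2: "integrable M (%w. (Y w)\<^sup>2)"
  using Ypos b by (intro integrable_const_bound[of _ "b\<^sup>2"]) (auto intro!: power_mono)
 have Zrv: "random_variable borel (Z i)" if "i \<in> J" for i
  using Xrv[OF that] unfolding Z_def[abs_def] by measurable
 have Zb: "\<bar>Z i w\<bar> <= \<bar>b\<bar> + \<bar>?m\<bar>" if "i \<in> J" "w \<in> space M" for i w
  using Xb[OF that] Xpos[OF that] by (auto simp: Z_def)
 have intZ: "integrable M (Z i)" if "i \<in> J" for i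
  using Zb[OF that] Zrv[OF that] by (intro integrable_const_bound[of _ "\<bar>b\<bar> + \<bar>?m\<bar>"]) auto
 have intZZ: "integrable M (%w. Z i w*Z k w)" if ik: "i \<in> J" "k \<in> J" for i k
 proof (rule integrable_const_bound)
  show "AE w in M. norm (Z i w*Z k w) <= (\<bar>b\<bar> + \<bar>?m\<bar>)*(\<bar>b\<bar> + \<bar>?m\<bar>)"
   using Zb[OF ik(1)] Zb[OF ik(2)] by (intro AE_I2) (auto simp: abs_mult intro!: mult_mono)
  show "(%w. Z i w*Z k w) \<in> borel_measurable M" using Zrv[OF ik(1)] Zrv[OF ik(2)] by measurable
 qed
 have EZ: "expectation (Z i) = 0" if "i \<in> J" for i
 proof -
  have "expectation (Z i) = expectation (%w. Y w - ?m)"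
   unfolding Z_def[abs_def] by (rule copies_expectation(1)[OF XY Yrv that, where g = "%y. y - ?m"]) measurable
  then show ?thesis using intY by (simp add: prob_space)
 qed
 have off: "expectation (%w. Z i w*Z k w) = 0" if ik: "i \<in> J" "k \<in> J" "i ~= k" for i k
 proof -
  have "indep_vars (%_. borel) Z {i, k}"
   unfolding Z_def[abs_def]
   by (rule indep_vars_compose2[OF indep_vars_subset[OF ind], where Y = "%_ x. x - ?m"]) (use ik in auto)
  from indep_vars_lebesgue_integral[OF _ this] intZ ik
  have "expectation (%w. \<Prod>l\<in>{i, k}. Z l w) = (\<Prod>l\<in>{i, k}. expectation (Z l))" by blast
  then show ?thesis using ik EZ by simp
 qed
 have diag: "expectation (%w. Z i w*Z i w) <= expectation (%w. (Y w)\<^sup>2)" if i: "i \<in> J" for i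
 proof -
  have "expectation (%w. Z i w*Z i w) = expectation (%w. (Y w - ?m)*(Y w - ?m))"
   unfolding Z_def[abs_def]
   by (rule copies_expectation(1)[OF XY Yrv i, where g = "%y. (y - ?m)*(y - ?m)"]) measurable
  also have "... = expectation (%w. (Y w)\<^sup>2) - ?m\<^sup>2"
   using variance_eq[OF intY intY2] by (simp add: power2_eq_square)
  finally show ?thesis by simp
 qed
 have sq: "(\<Sum>i\<in>J. Z i w)\<^sup>2 = (\<Sum>i\<in>J. \<Sum>k\<in>J. Z i w*Z k w)" for w
  by (simp add: power2_eq_square sum_product)
 show "integrable M (%w. (\<Sum>i\<in>J. X i w - ?m)\<^sup>2)"
  unfolding Z_def[symmetric] sq by (intro Bochner_Integration.integrable_sum intZZ)
 have "expectation (%w. (\<Sum>i\<in>J. Z i w)\<^sup>2) = (\<Sum>i\<in>J. \<Sum>k\<in>J. expectation (%w. Z i w*Z k w))"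
  unfolding sq using intZZ by (simp add: Bochner_Integration.integral_sum Bochner_Integration.integrable_sum)
 also have "... = (\<Sum>i\<in>J. expectation (%w. Z i w*Z i w))"
 proof (intro sum.cong refl)
  fix i assume i: "i \<in> J"
  have "(\<Sum>k\<in>J. expectation (%w. Z i w*Z k w)) = (\<Sum>k\<in>{i}. expectation (%w. Z i w*Z k w))"
   using i off[OF i] fin by (intro sum.mono_neutral_right) auto
  then show "(\<Sum>k\<in>J. expectation (%w. Z i w*Z k w)) = expectation (%w. Z i w*Z i w)" by simp
 qed
 also have "... <= (\<Sum>i\<in>J. expectation (%w. (Y w)\<^sup>2))" by (intro sum_mono diag)
 finally show "expectation (%w. (\<Sum>i\<in>J. X i w - ?m)\<^sup>2) <= real (card J)*expectation (%w. (Y w)\<^sup>2)"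
  unfolding Z_def[symmetric] by simp
qed

lemma excess_expectation_small:
 assumes Y: "nonneg_rv Y" "integrable M Y" and eps: "0 < eps"
 obtains a where "0 <= a" "expectation (%u. max 0 (Y u - a)) <= eps"
proof -
 have Yrv[measurable]: "random_variable borel Y" using Y by (simp add: nonneg_rv_def)
 have Ypos: "0 <= Y u" if "u \<in> space M" for u using Y that by (simp add: nonneg_rv_def)
 have "(%n. expectation (%u. max 0 (Y u - real n))) \<longlonglongrightarrow> expectation (%u. 0)"
 proof (rule integral_dominated_convergence[where w = Y])
  show "AE u in M. (%n. max 0 (Y u - real n)) \<longlonglongrightarrow> 0"
  proof (rule AE_I2)
   fix u
   have "EV n. max 0 (Y u - real n) = 0"
    using eventually_ge_at_top[of "nat \<lceil>Y u\<rceil>"] by eventually_elim linarith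
   then show "(%n. max 0 (Y u - real n)) \<longlonglongrightarrow> 0" by (rule tendsto_eventually)
  qed
  show "AE u in M. norm (max 0 (Y u - real n)) <= Y u" for n
   using Ypos by (intro AE_I2) auto
 qed (use Y in auto)
 then have "EV n. expectation (%u. max 0 (Y u - real n)) < eps"
  using eps by (intro order_tendstoD) auto
 then obtain n where "expectation (%u. max 0 (Y u - real n)) < eps"
  by (auto simp: eventually_sequentially)
 then show ?thesis using that[of "real n"] by simp
qed

text \<open>Values are cut at a high level: the truncated sum concentrates by its variance, and the excess
  is small in mean.\<close>

lemma L1_law_upper:
 assumes Y: "nonneg_rv Y" "integrable M Y" and eps: "0 < eps"
 obtains N0 where "!!(J :: 'i set) X N. iid_copies Y J X ==> real (card J) <= N ==> N0 <= N ==>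
  expectation (%w. max 0 ((\<Sum>i\<in>J. X i w) - N*expectation Y)) <= eps*N"
proof -
 have Yrv[measurable]: "random_variable borel Y" using Y by (simp add: nonneg_rv_def)
 have Ypos: "0 <= Y w" if "w \<in> space M" for w using Y that by (simp add: nonneg_rv_def)
 obtain a where a: "0 <= a" "expectation (%w. max 0 (Y w - a)) <= eps/2"
  using excess_expectation_small[OF Y, of "eps/2"] eps by auto
 have rv: "nonneg_rv (%w. min (Y w) a)" using Ypos a by (auto simp: nonneg_rv_def)
 have mb: "min (Y w) a <= a" if "w \<in> space M" for w by simp
 let ?m = "expectation (%w. min (Y w) a)"
 have intm: "integrable M (%w. min (Y w) a)" by (rule nonneg_rv_bounded_integrable[OF rv mb])
 have inte: "integrable M (%w. max 0 (Y w - a))"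
  by (rule Bochner_Integration.integrable_bound[OF Y(2)]) (use Ypos a in \<open>auto intro!: AE_I2\<close>)
 have mY: "?m <= expectation Y" by (intro integral_mono intm Y) auto
 have m0: "0 <= ?m" using Ypos a by (intro integral_nonneg_AE) auto
 show ?thesis
 proof (rule that[of "max 1 (4*a\<^sup>2/eps\<^sup>2)"])
  fix J :: "'i set" and X and N :: real
  assume XY: "iid_copies Y J X" and N: "real (card J) <= N" "max 1 (4*a\<^sup>2/eps\<^sup>2) <= N"
  have fin: "finite J" using XY by (auto simp: iid_copies_def)
  have Xrv: "random_variable borel (X i)" if "i \<in> J" for i by (rule iid_copies_rv[OF XY that])
  have Nt: "0 < N" "4*a\<^sup>2 <= eps\<^sup>2*N" using N(2) eps by (auto simp: field_simps)
  have XYm: "iid_copies (%w. min (Y w) a) J (%i w. min (X i w) a)"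
   using a by (intro copies_compose[OF XY Yrv, where g = "%y. min y a"]) auto
  note sm = second_moment_sum[OF XYm rv, where b = a, simplified]
  let ?S = "%w. \<Sum>i\<in>J. min (X i w) a - ?m"
  let ?T = "%w. \<Sum>i\<in>J. max 0 (X i w - a)"
  have intX: "integrable M (X i)" if "i \<in> J" for i
   using copies_expectation(2)[OF XY Yrv that, where g = "%y. y"] Y by simp
  have intT: "integrable M ?T"
   using copies_expectation(2)[OF XY Yrv, where g = "%y. max 0 (y - a)"] inte
   by (intro Bochner_Integration.integrable_sum) auto
  have ET: "expectation ?T = real (card J)*expectation (%w. max 0 (Y w - a))"
  proof -
   have "expectation ?T = (\<Sum>i\<in>J. expectation (%w. max 0 (X i w - a)))"
    using copies_expectation(2)[OF XY Yrv, where g = "%y. max 0 (y - a)"] inte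
    by (intro Bochner_Integration.integral_sum) auto
   also have "... = (\<Sum>i\<in>J. expectation (%w. max 0 (Y w - a)))"
    by (intro sum.cong refl copies_expectation(1)[OF XY Yrv, where g = "%y. max 0 (y - a)"]) auto
   finally show ?thesis by simp
  qed
  have pt: "max 0 ((\<Sum>i\<in>J. X i w) - N*expectation Y) <= (?S w)\<^sup>2/(eps*N) + eps*N/4 + ?T w" for w
  proof -
   have "(\<Sum>i\<in>J. X i w) = ?S w + real (card J)*?m + ?T w"
   proof -
    have "X i w = (min (X i w) a - ?m) + ?m + max 0 (X i w - a)" for i by auto
    then have "(\<Sum>i\<in>J. X i w) = (\<Sum>i\<in>J. (min (X i w) a - ?m) + ?m + max 0 (X i w - a))" by simp
    then show ?thesis by (simp add: sum.distrib sum_subtractf)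
   qed
   moreover have "real (card J)*?m <= N*expectation Y"
    using N mY m0 by (intro mult_mono) auto
   moreover have "0 <= ?T w" by (intro sum_nonneg) auto
   moreover have "\<bar>?S w\<bar> <= (?S w)\<^sup>2/(eps*N) + eps*N/4"
   proof -
    define p where "p = eps*N"
    have p: "0 < p" using eps Nt by (simp add: p_def)
    have "0 <= (\<bar>?S w\<bar> - p/2)\<^sup>2" by simp
    then have "\<bar>?S w\<bar>*p <= (?S w)\<^sup>2 + p*p/4"
     by (simp add: power2_diff power2_eq_square algebra_simps)
    then show ?thesis using p unfolding p_def[symmetric] by (simp add: field_simps)
   qed
   ultimately show ?thesis by simp
  qed
  have "expectation (%w. max 0 ((\<Sum>i\<in>J. X i w) - N*expectation Y))
    <= expectation (%w. (?S w)\<^sup>2/(eps*N) + eps*N/4 + ?T w)"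
   using intX sm(1) intT pt by (intro integral_mono) (auto intro!: integrable_max)
  also have "... = expectation (%w. (?S w)\<^sup>2)/(eps*N) + eps*N/4 + expectation ?T"
   using sm(1) intT by (simp add: prob_space)
  also have "expectation (%w. (?S w)\<^sup>2)/(eps*N) <= eps*N/4"
  proof -
   have "expectation (%w. (min (Y w) a)\<^sup>2) <= expectation (%w. a\<^sup>2)"
    using Ypos a by (intro integral_mono integrable_const_bound[of _ "a\<^sup>2"] AE_I2) (auto intro!: power_mono)
   then have "expectation (%w. (min (Y w) a)\<^sup>2) <= a\<^sup>2" by (simp add: prob_space)
   then have "real (card J)*expectation (%w. (min (Y w) a)\<^sup>2) <= N*a\<^sup>2"
    using N Nt by (intro mult_mono) auto
   then have "expectation (%w. (?S w)\<^sup>2) <= N*a\<^sup>2" using sm(2) by simp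
   also have "... <= N*(eps\<^sup>2*N/4)" using Nt by (intro mult_left_mono) auto
   finally show ?thesis using eps Nt by (simp add: field_simps power2_eq_square)
  qed
  also have "expectation ?T <= N*(eps/2)"
   unfolding ET using N a Nt by (intro mult_mono integral_nonneg_AE) auto
  finally show "expectation (%w. max 0 ((\<Sum>i\<in>J. X i w) - N*expectation Y)) <= eps*N"
   by (simp add: algebra_simps)
 qed
qed

end

lemma geometric_below:
 fixes q y :: real
 assumes "2 <= q" "0 <= y"
 shows "(\<Sum>k<K. if q^k < y then q^k else 0) <= 2*y"
proof (induction K)
 case (Suc K)
 show ?case
 proof (cases "q^K < y")
  case True
  have "(\<Sum>k<K. if q^k < y then q^k else 0) <= (\<Sum>k<K. q^k)"
   using assms by (intro sum_mono) auto
  also have "... <= q^K"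
  proof (induction K)
   case (Suc K)
   have "2*q^K <= q*q^K" using assms by (intro mult_right_mono) auto
   then show ?case using Suc by simp
  qed simp
  finally show ?thesis using True by simp
 qed (use Suc in simp)
qed (use assms in simp)

lemma geometric_above:
 fixes q y :: real
 assumes q: "2 <= q" and y: "0 <= y"
 shows "(\<Sum>k<K. if y <= q^k then y\<^sup>2/q^k else 0) <= 2*y"
proof -
 have q0: "0 < q^k" for k using q by simp
 have "(\<Sum>k<K. if y <= q^k then y\<^sup>2/q^k else 0) + (if y <= q^K then 2*y\<^sup>2/q^K else 0) <= 2*y"
 proof (induction K)
  case 0
  then show ?case using y by (auto simp: power2_eq_square mult_left_le)
 next
  case (Suc K)
  show ?case
  proof (cases "y <= q^K")
   case True
   have "y <= q^Suc K" 
   proof -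
    have "1*q^K <= q*q^K" using q q0[of K] by (intro mult_right_mono) auto
    then show ?thesis using True by simp
   qed
   have "2*y\<^sup>2/q^Suc K <= y\<^sup>2/q^K"
   proof -
    have "2*(y\<^sup>2/q^K) <= q*(y\<^sup>2/q^K)" using q q0[of K] by (intro mult_right_mono) auto
    then show ?thesis using q by (simp add: field_simps)
   qed
   then show ?thesis using Suc True \<open>y <= q^Suc K\<close> by simp
  next
   case False
   have "q^k <= q^K" if "k < K" for k using that q by (intro power_increasing) auto
   then have "\<not> y <= q^k" if "k < K" for k using that False by force
   then have z: "(\<Sum>k<K. if y <= q^k then y\<^sup>2/q^k else 0) = 0" by (intro sum.neutral) auto
   have "2*y\<^sup>2/q^Suc K <= 2*y" if "y <= q^Suc K"
   proof -
    have "y*y <= y*q^Suc K" using that y by (intro mult_left_mono) auto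
    then show ?thesis using q0[of "Suc K"] by (simp add: field_simps power2_eq_square)
   qed
   then show ?thesis using z False y by simp
  qed
 qed
 moreover have "0 <= (if y <= q^K then 2*y\<^sup>2/q^K else 0)" using q0[of K] by simp
 ultimately show ?thesis by linarith
qed

definition cutoff :: "real => real => real" where
 "cutoff b y = (if y <= b then y else 0)"

lemma cutoff_measurable[measurable]: "cutoff b \<in> borel_measurable borel"
 unfolding cutoff_def[abs_def] by measurable

lemma cutoff_bounds: "0 <= y ==> 0 <= cutoff b y" "0 <= b ==> cutoff b y <= b" "0 <= y ==> cutoff b y <= y"
 by (auto simp: cutoff_def)

context prob_space
begin

lemma summable_of_expectations:
 assumes f: "!!k. integrable M (f k)" "!!k w. w \<in> space M ==> 0 <= f k w"
  and Z: "integrable M Z" "!!K w. w \<in> space M ==> (\<Sum>k<K. f k w) <= Z w"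
 shows "summable (%k. expectation (f k :: 'a => real))"
proof (rule summableI_nonneg_bounded)
 show "0 <= expectation (f k)" for k using f(2) by (intro integral_nonneg_AE AE_I2)
 show "(\<Sum>k<K. expectation (f k)) <= expectation Z" for K
 proof -
  have "(\<Sum>k<K. expectation (f k)) = expectation (%w. \<Sum>k<K. f k w)"
   using f(1) by (simp add: Bochner_Integration.integral_sum)
  also have "... <= expectation Z"
   using f(1) Z by (intro integral_mono Bochner_Integration.integrable_sum) auto
  finally show ?thesis .
 qed
qed

lemma expectation_threshold:
 assumes [measurable]: "random_variable borel Y"
 shows "expectation (%w. if b < Y w then c else 0) = c*prob {w \<in> space M. (b::real) < Y w}"
  "integrable M (%w. if b < Y w then c else (0::real))"
proof -
 show "integrable M (%w. if b < Y w then c else (0::real))"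
  by (rule integrable_const_bound[of _ "\<bar>c\<bar>"]) auto
 have "expectation (%w. if b < Y w then c else 0)
   = expectation (%w. c*indicat_real {w \<in> space M. b < Y w} w)"
  by (intro Bochner_Integration.integral_cong) (auto simp: indicator_def)
 also have "... = c*prob {w \<in> space M. b < Y w}"
  by (simp add: Collect_conj_eq Int_absorb1)
 finally show "expectation (%w. if b < Y w then c else 0) = c*prob {w \<in> space M. b < Y w}" .
qed

text \<open>The union bound.\<close>

lemma some_copy_large:
 assumes XY: "iid_copies Y J X" and Y[measurable]: "random_variable borel Y"
 shows "{w \<in> space M. \<exists>i\<in>J. b < X i w} \<in> events"
  "prob {w \<in> space M. \<exists>i\<in>J. (b::real) < X i w} <= real (card J)*prob {w \<in> space M. b < Y w}"
proof -
 have fin: "finite J" using XY by (simp add: iid_copies_def)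
 have Xrv: "random_variable borel (X i)" if "i \<in> J" for i by (rule iid_copies_rv[OF XY that])
 have ev: "{w \<in> space M. b < X i w} \<in> events" if "i \<in> J" for i using Xrv[OF that] by measurable
 have eq: "{w \<in> space M. \<exists>i\<in>J. b < X i w} = (\<Union>i\<in>J. {w \<in> space M. b < X i w})" by blast
 show "{w \<in> space M. \<exists>i\<in>J. b < X i w} \<in> events" unfolding eq using fin ev by blast
 have "prob {w \<in> space M. \<exists>i\<in>J. b < X i w} <= (\<Sum>i\<in>J. prob {w \<in> space M. b < X i w})"
  unfolding eq using fin ev by (intro finite_measure_subadditive_finite) auto
 also have "... = (\<Sum>i\<in>J. prob {w \<in> space M. b < Y w})"
 proof (intro sum.cong refl)
  fix i assume "i \<in> J"
  from copies_prob[OF XY Y this, of "{b<..}"]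
  show "prob {w \<in> space M. b < X i w} = prob {w \<in> space M. b < Y w}" by simp
 qed
 finally show "prob {w \<in> space M. \<exists>i\<in>J. b < X i w} <= real (card J)*prob {w \<in> space M. b < Y w}" by simp
qed

lemma cutoff_rv: "nonneg_rv Y ==> nonneg_rv (%w. cutoff b (Y w))"
 by (auto simp: nonneg_rv_def cutoff_bounds)

lemma cutoff_copies:
 "iid_copies Y J X ==> nonneg_rv Y ==> iid_copies (%w. cutoff b (Y w)) J (%i w. cutoff b (X i w))"
 using copies_compose[OF _ _ cutoff_measurable cutoff_bounds(1)] unfolding nonneg_rv_def by blast

lemma cutoff_expectation_le:
 assumes "nonneg_rv Y" "integrable M Y" "0 <= b"
 shows "expectation (%w. cutoff b (Y w)) <= expectation Y" "0 <= expectation (%w. cutoff b (Y w))"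
  "0 <= expectation Y"
proof -
 have pos: "0 <= Y w" if "w \<in> space M" for w using assms(1) that by (simp add: nonneg_rv_def)
 have "integrable M (%w. cutoff b (Y w))"
  by (rule nonneg_rv_bounded_integrable[OF cutoff_rv[OF assms(1)], of b b]) (use assms cutoff_bounds in auto)
 then show "expectation (%w. cutoff b (Y w)) <= expectation Y"
  using assms pos by (intro integral_mono) (auto simp: cutoff_bounds)
 show "0 <= expectation (%w. cutoff b (Y w))" "0 <= expectation Y"
  using pos by (auto intro!: integral_nonneg_AE AE_I2 simp: cutoff_bounds)
qed

text \<open>The copies in \<open>E k\<close> are cut at \<open>q ^ k\<close>. Summed over \<open>k\<close>,
  the probabilities of a larger copy and the second moments below the level form geometric series that are
  dominated by the first moment.\<close>

lemma dyadic_sums_bound: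
 assumes XY: "!!k. iid_copies Y (E k) X" and Y: "nonneg_rv Y" "integrable M Y"
  and card: "!!k. real (card (E k)) <= C*q^k" and q: "2 <= q" and C: "0 <= C" and dl: "0 < dl"
 shows "AE w in M. EV k. (\<Sum>i\<in>E k. X i w) <= (C*expectation Y + dl)*q^k"
proof -
 have Yrv[measurable]: "random_variable borel Y" using Y by (simp add: nonneg_rv_def)
 have Ypos: "0 <= Y w" if "w \<in> space M" for w using Y that by (simp add: nonneg_rv_def)
 have q0: "0 < q^k" for k using q by simp
 let ?g = "%k. cutoff (q^k)"
 let ?S = "%k w. \<Sum>i\<in>E k. ?g k (X i w) - expectation (%w. ?g k (Y w))"
 define A1 where "A1 k = {w \<in> space M. \<exists>i\<in>E k. q^k < X i w}" for k
 define A2 where "A2 k = {w \<in> space M. \<bar>?S k w\<bar> >= dl*q^k}" for k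
 have Xpos: "0 <= X i w" if "i \<in> E k" "w \<in> space M" for i k w
  using XY[of k] that unfolding iid_copies_def by blast
 have cb: "?g k y <= q^k" for k y using q0[of k] by (intro cutoff_bounds) auto
 have Xrv: "random_variable borel (X i)" if "i \<in> E k" for i k by (rule iid_copies_rv[OF XY that])
 note sm = second_moment_sum[OF cutoff_copies[OF XY Y(1)] cutoff_rv[OF Y(1)] cb cb]
 have A1: "A1 k \<in> events" "prob (A1 k) <= C*(q^k*prob {w \<in> space M. q^k < Y w})" for k
 proof -
  show "A1 k \<in> events" unfolding A1_def by (rule some_copy_large[OF XY Yrv])
  have "prob (A1 k) <= real (card (E k))*prob {w \<in> space M. q^k < Y w}"
   unfolding A1_def by (rule some_copy_large[OF XY Yrv])
  also have "... <= (C*q^k)*prob {w \<in> space M. q^k < Y w}"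
   using card by (intro mult_right_mono) auto
  finally show "prob (A1 k) <= C*(q^k*prob {w \<in> space M. q^k < Y w})" by (simp add: mult_ac)
 qed
 have Srv: "random_variable borel (?S k)" for k
  by (intro borel_measurable_sum borel_measurable_diff borel_measurable_const
    measurable_compose[OF Xrv cutoff_measurable])
 have A2: "A2 k \<in> events" "prob (A2 k) <= C/dl\<^sup>2*(expectation (%w. (?g k (Y w))\<^sup>2)/q^k)" for k
 proof -
  show "A2 k \<in> events" unfolding A2_def using Srv[of k] by measurable
  have "prob (A2 k) <= expectation (%w. (?S k w)\<^sup>2)/(dl*q^k)\<^sup>2"
   unfolding A2_def by (rule second_moment_method[OF Srv sm(1)]) (use dl q0 in auto)
  also have "... <= (C*q^k*expectation (%w. (?g k (Y w))\<^sup>2))/(dl*q^k)\<^sup>2"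
   by (intro divide_right_mono order_trans[OF sm(2)] mult_right_mono card) auto
  also have "... = C/dl\<^sup>2*(expectation (%w. (?g k (Y w))\<^sup>2)/q^k)"
   using q0[of k] dl by (simp add: power2_eq_square field_simps)
  finally show "prob (A2 k) <= C/dl\<^sup>2*(expectation (%w. (?g k (Y w))\<^sup>2)/q^k)" .
 qed
 have s1: "summable (%k. q^k*prob {w \<in> space M. q^k < Y w})"
 proof -
  have "summable (%k. expectation (%w. if q^k < Y w then q^k else 0))"
   by (rule summable_of_expectations[where Z = "%w. 2*Y w"])
    (use Y(2) expectation_threshold(2)[OF Yrv] geometric_below[OF q Ypos] q0 in \<open>auto simp: less_imp_le\<close>)
  then show ?thesis by (simp add: expectation_threshold(1)[OF Yrv])
 qed
 have s2: "summable (%k. expectation (%w. (?g k (Y w))\<^sup>2)/q^k)"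
 proof -
  have "summable (%k. expectation (%w. (?g k (Y w))\<^sup>2/q^k))"
  proof (rule summable_of_expectations[where Z = "%w. 2*Y w"])
   fix k
   show "integrable M (%w. (?g k (Y w))\<^sup>2/q^k)"
    using cb[of k] Ypos q0[of k]
    by (intro integrable_const_bound[of _ "(q^k)\<^sup>2/q^k"] AE_I2)
     (auto intro!: divide_right_mono power_mono simp: cutoff_bounds)
  next
   fix K w assume w: "w \<in> space M"
   have "(\<Sum>k<K. (?g k (Y w))\<^sup>2/q^k) = (\<Sum>k<K. if Y w <= q^k then (Y w)\<^sup>2/q^k else 0)"
    by (intro sum.cong) (auto simp: cutoff_def)
   then show "(\<Sum>k<K. (?g k (Y w))\<^sup>2/q^k) <= 2*Y w"
    using geometric_above[OF q Ypos[OF w]] by simp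
  qed (use Y q0 in \<open>auto simp: less_imp_le\<close>)
  then show ?thesis by simp
 qed
 have "summable (%k. prob (A1 k \<union> A2 k))"
 proof (rule summable_comparison_test)
  show "summable (%k. C*(q^k*prob {w \<in> space M. q^k < Y w})
    + C/dl\<^sup>2*(expectation (%w. (?g k (Y w))\<^sup>2)/q^k))"
   by (intro summable_add summable_mult s1 s2)
  have "prob (A1 k \<union> A2 k) <= prob (A1 k) + prob (A2 k)" for k
   using A1(1) A2(1) by (rule measure_Un_le)
  then have "prob (A1 k \<union> A2 k) <= C*(q^k*prob {w \<in> space M. q^k < Y w})
    + C/dl\<^sup>2*(expectation (%w. (?g k (Y w))\<^sup>2)/q^k)" for k
   using A1(2)[of k] A2(2)[of k] by (meson add_mono order_trans)
  then show "\<exists>N. \<forall>k\<ge>N. norm (prob (A1 k \<union> A2 k)) <= C*(q^k*prob {w \<in> space M. q^k < Y w})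
    + C/dl\<^sup>2*(expectation (%w. (?g k (Y w))\<^sup>2)/q^k)" by auto
 qed
 then have "AE w in M. EV k. w \<in> space M - (A1 k \<union> A2 k)"
  using A1(1) A2(1) by (intro borel_cantelli_AE1) (auto simp: less_top[symmetric])
 then show ?thesis
 proof (eventually_elim)
  fix w assume ev: "EV k. w \<in> space M - (A1 k \<union> A2 k)"
  show "EV k. (\<Sum>i\<in>E k. X i w) <= (C*expectation Y + dl)*q^k"
   using ev
  proof eventually_elim
   case (elim k)
   then have w: "w \<in> space M" and n1: "!!i. i \<in> E k ==> X i w <= q^k" and n2: "?S k w <= dl*q^k"
    by (auto simp: A1_def A2_def not_less)
   have "(\<Sum>i\<in>E k. X i w) = (\<Sum>i\<in>E k. ?g k (X i w))" using n1 by (intro sum.cong) (auto simp: cutoff_def)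
   also have "... = ?S k w + real (card (E k))*expectation (%w. ?g k (Y w))"
    by (simp add: sum_subtractf)
   also have "real (card (E k))*expectation (%w. ?g k (Y w)) <= (C*q^k)*expectation Y"
    using card[of k] cutoff_expectation_le[OF Y, of "q^k"] q0[of k] C
    by (intro mult_mono) (auto simp: less_imp_le)
   finally show ?case using n2 by (simp add: algebra_simps)
  qed
 qed
qed

lemma power_sum_threshold:
 fixes y \<theta> :: real
 assumes D: "1 <= D" and y: "0 <= y" and \<theta>: "0 < \<theta>"
 shows "(\<Sum>n<N. if \<theta>*real n^D < y then real n^D else 0) <= (y/\<theta>) powr (1 + 1/real D)"
proof -
 let ?z = "y/\<theta>" let ?w = "?z powr (1/real D)"
 have z: "0 <= ?z" using y \<theta> by simp
 have iff: "\<theta>*real n^D < y \<longleftrightarrow> real n^D < ?z" for n using \<theta> by (simp add: field_simps)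
 let ?B = "{n. 1 <= n & n < N & real n^D < ?z}"
 have w: "real n <= ?w" if "n \<in> ?B" for n
 proof -
  have "real n = (real n^D) powr (1/real D)"
   using that D by (simp add: powr_realpow[symmetric] powr_powr)
  also have "... <= ?w" using that by (intro powr_mono2) auto
  finally show ?thesis .
 qed
 have "?B \<subseteq> {1..nat \<lfloor>?w\<rfloor>}" using w by (auto simp: le_nat_floor)
 then have "card ?B <= nat \<lfloor>?w\<rfloor>" using card_mono[of "{1..nat \<lfloor>?w\<rfloor>}" ?B] by simp
 moreover have "real (nat \<lfloor>?w\<rfloor>) <= ?w" by (simp add: of_nat_floor)
 ultimately have cB: "real (card ?B) <= ?w" by linarith
 have "(\<Sum>n<N. if \<theta>*real n^D < y then real n^D else 0) = (\<Sum>n\<in>?B. real n^D)"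
  unfolding iff using D by (intro sum.mono_neutral_cong_right) (auto simp: not_le)
 also have "... <= (\<Sum>n\<in>?B. ?z)" by (intro sum_mono) auto
 also have "... = real (card ?B)*?z" by simp
 also have "... <= ?w*?z" using cB z by (intro mult_right_mono) auto
 also have "... = ?z powr (1 + 1/real D)"
 proof -
  have "u powr a*u = u powr (1 + a)" if "0 <= u" for u a :: real
   using that by (cases "u = 0") (auto simp: powr_add)
  from this[OF z] show ?thesis .
 qed
 finally show ?thesis .
qed

end

context prob_space
begin

lemma cutoff_second_moment:
 assumes Y: "nonneg_rv Y" and p: "0 < p" "p <= 2" "integrable M (%w. Y w powr p)" and b: "0 < b"
 shows "expectation (%w. (cutoff b (Y w))\<^sup>2) <= b powr (2 - p)*expectation (%w. Y w powr p)"
proof -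
 have Yrv[measurable]: "random_variable borel Y" using Y by (simp add: nonneg_rv_def)
 have Ypos: "0 <= Y w" if "w \<in> space M" for w using Y that by (simp add: nonneg_rv_def)
 have "expectation (%w. (cutoff b (Y w))\<^sup>2) <= expectation (%w. b powr (2 - p)*Y w powr p)"
 proof (rule integral_mono)
  show "integrable M (%w. (cutoff b (Y w))\<^sup>2)"
   using Ypos b by (intro integrable_const_bound[of _ "b\<^sup>2"] AE_I2)
    (auto intro!: power_mono simp: cutoff_bounds)
  show "integrable M (%w. b powr (2 - p)*Y w powr p)" using p by simp
  fix w assume w: "w \<in> space M"
  show "(cutoff b (Y w))\<^sup>2 <= b powr (2 - p)*Y w powr p"
  proof (cases "0 < Y w & Y w <= b")
   case True
   have "(Y w)\<^sup>2 = Y w powr (2 - p)*Y w powr p"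
    using True by (simp add: powr_add[symmetric] powr_numeral)
   also have "... <= b powr (2 - p)*Y w powr p"
    using True p by (intro mult_right_mono powr_mono2) auto
   finally show ?thesis using True by (simp add: cutoff_def)
  next
   case False
   then have "cutoff b (Y w) = 0" using Ypos[OF w] by (auto simp: cutoff_def)
   then show ?thesis by simp
  qed
 qed
 then show ?thesis by simp
qed

text \<open>Under the moment of order \<open>1 + 1 / D\<close> sums of about \<open>n ^ D\<close> copies satisfy a strong law for
  arrays with arbitrary dependence between the rows: no copy in row \<open>n\<close> exceeds a small multiple
  of \<open>n ^ D\<close>, and below that level an exponential bound with an exponent of order
  \<open>ln n / n ^ D\<close> is summable.\<close>

lemma moment_array_bound:
 fixes J :: "nat => 'i set"
 assumes D: "1 <= D" and Y: "nonneg_rv Y" "integrable M Y"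
  and mom: "integrable M (%w. Y w powr (1 + 1/real D))"
  and XY: "!!n. iid_copies Y (J n) (X n)"
  and card: "EV n. real (card (J n)) <= \<alpha>*real n^D" and \<alpha>: "0 <= \<alpha>" and eps: "0 < eps"
 shows "AE w in M. EV n. (\<Sum>i\<in>J n. X n i w) <= (\<alpha>*expectation Y + eps)*real n^D"
proof -
 have Yrv[measurable]: "random_variable borel Y" using Y by (simp add: nonneg_rv_def)
 have Ypos: "0 <= Y w" if "w \<in> space M" for w using Y that by (simp add: nonneg_rv_def)
 define p where "p = 1 + 1/real D"
 have p: "1 < p" "p <= 2" using D by (auto simp: p_def)
 have Dp: "real D*(2 - p) = real D - 1" using D by (simp add: p_def field_simps)
 have momp: "integrable M (%w. Y w powr p)" using mom by (simp only: p_def)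
 define K where "K = expectation (%w. Y w powr p)"
 have K: "0 <= K" by (simp add: K_def)
 define a where "a = 2/eps"
 define \<theta> where "\<theta> = 1/(2*a)"
 have a: "0 < a" "0 < \<theta>" "a*\<theta> = 1/2" "a*eps = 2" using eps by (auto simp: a_def \<theta>_def)
 define b where "b n = \<theta>*real n^D" for n
 let ?g = "%n. cutoff (b n)"
 define A1 where "A1 n = {w \<in> space M. \<exists>i\<in>J n. b n < X n i w}" for n
 define A2 where "A2 n = {w \<in> space M. \<alpha>*real n^D*expectation (%w. ?g n (Y w)) + eps*real n^D
   <= (\<Sum>i\<in>J n. ?g n (X n i w))}" for n
 have Xrv: "random_variable borel (X n i)" if "i \<in> J n" for i n by (rule iid_copies_rv[OF XY that])
 have A1e: "A1 n \<in> events" for n unfolding A1_def by (rule some_copy_large[OF XY Yrv])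
 have A2e: "A2 n \<in> events" for n
 proof -
  have "random_variable borel (%w. \<Sum>i\<in>J n. ?g n (X n i w))"
   by (intro borel_measurable_sum measurable_compose[OF Xrv cutoff_measurable])
  then show ?thesis unfolding A2_def by measurable
 qed
 have s1: "summable (%n. real n^D*prob {w \<in> space M. b n < Y w})"
 proof -
  have "summable (%n. expectation (%w. if b n < Y w then real n^D else 0))"
  proof (rule summable_of_expectations[where Z = "%w. (Y w/\<theta>) powr p"])
   have "integrable M (%w. Y w powr p/\<theta> powr p)" using mom by (simp add: p_def)
   then show "integrable M (%w. (Y w/\<theta>) powr p)" by (simp add: powr_divide)
  qed (use power_sum_threshold[OF D Ypos a(2)] expectation_threshold(2)[OF Yrv] in \<open>auto simp: b_def p_def\<close>)
  then show ?thesis by (simp add: expectation_threshold(1)[OF Yrv])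
 qed
 define C where "C = \<alpha>*a\<^sup>2*\<theta> powr (2 - p)*K"
 have C: "0 <= C" using \<alpha> K by (simp add: C_def)
 have "((%x. C*((ln x)\<^sup>2*x powr (-(1/2)))) \<longlongrightarrow> C*0) at_top"
  by (intro tendsto_mult tendsto_const) real_asymp
 then have "(%n. C*((ln (real n))\<^sup>2*real n powr (-(1/2)))) \<longlonglongrightarrow> 0"
  using filterlim_compose[OF _ filterlim_real_sequentially] by simp
 then have small: "EV n. C*((ln (real n))\<^sup>2*real n powr (-(1/2))) < 1"
  by (intro order_tendstoD) auto
 have A2p: "EV n. prob (A2 n) <= exp 1*inverse (real n^2)"
  using small card eventually_ge_at_top[of 2]
 proof eventually_elim
  case (elim n)
  define N where "N = real n^D"
  define l where "l = a*ln (real n)/N"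
  have N: "0 < N" using elim by (simp add: N_def)
  have l: "0 < l" using elim a N by (simp add: l_def)
  have bn: "b n = \<theta>*N" "0 < b n" using N a by (auto simp: b_def N_def)
  have cb: "?g n y <= b n" for y using bn by (intro cutoff_bounds) auto
  have "prob (A2 n) <= exp (- l*(eps*N) + \<alpha>*N*(l\<^sup>2*exp (l*b n)*expectation (%w. (?g n (Y w))\<^sup>2)))"
   unfolding A2_def N_def[symmetric]
   by (rule chernoff_bounded[OF cutoff_copies[OF XY Y(1)] cutoff_rv[OF Y(1)] cb cb _ l])
    (use elim in \<open>simp add: N_def\<close>)
  also have "... <= exp (- 2*ln (real n) + 1)"
  proof -
   have "l*(eps*N) = 2*ln (real n)" using N a(4) by (simp add: l_def mult_ac)
   moreover have "\<alpha>*N*(l\<^sup>2*exp (l*b n)*expectation (%w. (?g n (Y w))\<^sup>2)) <= 1"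
   proof -
    have "expectation (%w. (?g n (Y w))\<^sup>2) <= b n powr (2 - p)*K"
     unfolding K_def using p by (intro cutoff_second_moment Y momp bn) simp_all
    also have "b n powr (2 - p) = \<theta> powr (2 - p)*real n powr (real D - 1)"
    proof -
     have "N powr (2 - p) = real n powr (real D*(2 - p))"
     proof -
      have "0 < real n" using elim by simp
      then have "N = real n powr real D" by (simp add: N_def powr_realpow)
      then show ?thesis by (simp add: powr_powr)
     qed
     then show ?thesis unfolding bn(1) Dp using N a by (simp add: powr_mult)
    qed
    finally have e: "expectation (%w. (?g n (Y w))\<^sup>2) <= \<theta> powr (2 - p)*real n powr (real D - 1)*K" .
    have x: "exp (l*b n) = real n powr (1/2)"
    proof -
     have "l*b n = (a*\<theta>)*ln (real n)" using N by (simp add: l_def bn(1))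
     then show ?thesis using elim a(3) by (simp add: powr_def)
    qed
    have nD: "real n powr (real D - 1) = N/real n"
     using elim by (simp add: N_def powr_diff powr_realpow)
    have "\<alpha>*N*(l\<^sup>2*exp (l*b n)*expectation (%w. (?g n (Y w))\<^sup>2))
      <= \<alpha>*N*(l\<^sup>2*exp (l*b n)*(\<theta> powr (2 - p)*real n powr (real D - 1)*K))"
     using e \<alpha> N by (intro mult_left_mono) auto
    also have "... = C*((ln (real n))\<^sup>2*(real n powr (1/2)/real n))"
     unfolding x nD using N by (simp add: l_def C_def power2_eq_square field_simps)
    also have "real n powr (1/2)/real n = real n powr (-(1/2))"
     using elim powr_diff[of "real n" "1/2" 1] by simp
    finally show ?thesis using elim by simp
   qed
   ultimately show ?thesis by simp
  qed
  also have "... = exp 1*inverse (real n^2)"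
  proof -
   have "exp (2*ln (real n)) = real n^2"
    using elim by (simp add: exp_double)
   then show ?thesis by (simp add: exp_diff divide_inverse)
  qed
  finally show ?case .
 qed
 have "summable (%n. prob (A1 n \<union> A2 n))"
 proof (rule summable_comparison_test_ev)
  show "summable (%n. \<alpha>*(real n^D*prob {w \<in> space M. b n < Y w}) + exp 1*inverse (real n^2))"
   by (intro summable_add summable_mult s1 inverse_power_summable) auto
  show "EV n. norm (prob (A1 n \<union> A2 n))
    <= \<alpha>*(real n^D*prob {w \<in> space M. b n < Y w}) + exp 1*inverse (real n^2)"
   using A2p card
  proof eventually_elim
   case (elim n)
   have "prob (A1 n) <= real (card (J n))*prob {w \<in> space M. b n < Y w}"
    unfolding A1_def by (rule some_copy_large[OF XY Yrv])
   also have "... <= (\<alpha>*real n^D)*prob {w \<in> space M. b n < Y w}"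
    using elim by (intro mult_right_mono) auto
   finally have "prob (A1 n) <= \<alpha>*(real n^D*prob {w \<in> space M. b n < Y w})" by (simp add: mult_ac)
   moreover have "prob (A1 n \<union> A2 n) <= prob (A1 n) + prob (A2 n)"
    using A1e A2e by (rule measure_Un_le)
   ultimately show ?case using elim by simp
  qed
 qed
 then have "AE w in M. EV n. w \<in> space M - (A1 n \<union> A2 n)"
  using A1e A2e by (intro borel_cantelli_AE1) (auto simp: less_top[symmetric])
 then show ?thesis
 proof (eventually_elim)
  fix w assume ev: "EV n. w \<in> space M - (A1 n \<union> A2 n)"
  show "EV n. (\<Sum>i\<in>J n. X n i w) <= (\<alpha>*expectation Y + eps)*real n^D"
   using ev
  proof eventually_elim
   case (elim n)
   then have n1: "!!i. i \<in> J n ==> X n i w <= b n"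
    and n2: "(\<Sum>i\<in>J n. ?g n (X n i w)) <= \<alpha>*real n^D*expectation (%w. ?g n (Y w)) + eps*real n^D"
    by (auto simp: A1_def A2_def not_less)
   have "(\<Sum>i\<in>J n. X n i w) = (\<Sum>i\<in>J n. ?g n (X n i w))" using n1 by (intro sum.cong) (auto simp: cutoff_def)
   also note n2
   also have "\<alpha>*real n^D*expectation (%w. ?g n (Y w)) <= \<alpha>*real n^D*expectation Y"
    using cutoff_expectation_le[OF Y, of "b n"] a \<alpha> by (intro mult_left_mono) (auto simp: b_def)
   finally show ?case by (simp add: algebra_simps)
  qed
 qed
qed

lemma power2_above: "1 <= n ==> \<exists>k. n <= 2^k & 2^k <= 2*(n::nat)"
proof -
 assume n: "1 <= n"
 define k where "k = (LEAST k. n <= 2^k)"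
 have ex: "n <= 2^n" by (simp add: less_imp_le)
 then have k: "n <= 2^k" unfolding k_def by (rule LeastI)
 have "2^k <= 2*n"
 proof (cases k)
  case (Suc k')
  then have "\<not> n <= 2^k'" using not_less_Least[of k' "%k. n <= 2^k"] by (simp add: k_def)
  then show ?thesis using Suc by simp
 qed (use n in simp)
 with k show ?thesis by blast
qed

text \<open>With a first moment only, the same holds for sums over parts of a fixed family of slowly
  growing sets: below a high level the exponential bound applies, and the excess over that level
  is controlled for the whole sets along powers of two.\<close>

lemma nested_array_bound:
 fixes J :: "nat => 'i set"
 assumes D: "1 <= D" and Y: "nonneg_rv Y" "integrable M Y"
  and XY: "!!k. iid_copies Y (E k) X"
  and cE: "!!k. real (card (E k)) <= C*real ((2^k)^D)" and C: "0 <= C"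
  and JE: "!!n k. n <= 2^k ==> J n \<subseteq> E k"
  and card: "EV n. real (card (J n)) <= \<alpha>*real n^D" and \<alpha>: "0 <= \<alpha>" and eps: "0 < eps"
 shows "AE w in M. EV n. (\<Sum>i\<in>J n. X i w) <= (\<alpha>*expectation Y + eps)*real n^D"
proof -
 have Yrv[measurable]: "random_variable borel Y" using Y by (simp add: nonneg_rv_def)
 have Ypos: "0 <= Y w" if "w \<in> space M" for w using Y that by (simp add: nonneg_rv_def)
 define q where "q = (2::real)^D"
 have q: "2 <= q" using D power_increasing[of 1 D "2::real"] by (simp add: q_def)
 have qk: "real ((2^k)^D) = q^k" for k by (simp add: q_def power_mult[symmetric] mult.commute)
 define eps' where "eps' = eps/(4*q*(C + 1))"
 have eps': "0 < eps'" "q*(C*eps' + eps/(4*q)) <= eps/2"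
 proof -
  show "0 < eps'" using eps q C by (simp add: eps'_def)
  have "q*(C*eps') = q/q*(C/(C + 1))*(eps/4)" by (simp add: eps'_def)
  also have "... = (C/(C + 1))*(eps/4)" using q by simp
  also have "... <= 1*(eps/4)" using C eps by (intro mult_right_mono) (auto simp: field_simps)
  finally show "q*(C*eps' + eps/(4*q)) <= eps/2" using q by (simp add: distrib_left)
 qed
 obtain a where a: "0 <= a" "expectation (%w. max 0 (Y w - a)) <= eps'"
  using excess_expectation_small[OF Y eps'(1)] by auto
 let ?e = "%y. max 0 (y - a)" and ?m = "%y. min y a"
 have ecop: "iid_copies (%w. ?e (Y w)) (E k) (%i w. ?e (X i w))" for k
  by (rule copies_compose[OF XY Yrv, where g = ?e]) auto
 have erv: "nonneg_rv (%w. ?e (Y w))" by (simp add: nonneg_rv_def)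
 have eint: "integrable M (%w. ?e (Y w))"
  by (rule Bochner_Integration.integrable_bound[OF Y(2)]) (use Ypos a in \<open>auto intro!: AE_I2\<close>)
 have "AE w in M. EV k.
   (\<Sum>i\<in>E k. ?e (X i w)) <= (C*expectation (%w. ?e (Y w)) + eps/(4*q))*q^k"
  by (rule dyadic_sums_bound[OF ecop erv eint _ q C]) (use cE qk eps q in auto)
 then have big: "AE w in M. EV k. (\<Sum>i\<in>E k. ?e (X i w)) <= (C*eps' + eps/(4*q))*q^k"
 proof eventually_elim
  case (elim w)
  then show ?case
  proof eventually_elim
   case (elim k)
   have "C*expectation (%w. ?e (Y w)) <= C*eps'" using C a by (intro mult_left_mono) auto
   then have "(C*expectation (%w. ?e (Y w)) + eps/(4*q))*q^k <= (C*eps' + eps/(4*q))*q^k"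
    using q by (intro mult_right_mono) auto
   with elim show ?case by linarith
  qed
 qed
 have JXY: "iid_copies Y (J n) X" for n
  using iid_copies_subset[OF XY JE[of n n]] less_exp[of n] by (simp add: less_imp_le)
 have mcop: "iid_copies (%w. ?m (Y w)) (J n) (%i w. ?m (X i w))" for n
  by (rule copies_compose[OF JXY Yrv, where g = ?m]) (use a in auto)
 have mrv: "nonneg_rv (%w. ?m (Y w))" using Ypos a by (auto simp: nonneg_rv_def)
 define s where "s = expectation (%w. (?m (Y w))\<^sup>2)"
 have s: "0 <= s" by (simp add: s_def)
 define B where "B = \<alpha>*exp a * s"
 have B: "0 <= B" using \<alpha> s by (simp add: B_def)
 define l where "l = min 1 (eps/4/(B + 1))"
 have l: "0 < l" "l <= 1" "l*B <= eps/4"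
 proof -
  show "0 < l" "l <= 1" using eps B by (auto simp: l_def)
  have B1: "B + 1 ~= 0" using B by simp
  have "l*B <= eps/4/(B + 1)*(B + 1)" using B eps by (intro mult_mono) (auto simp: l_def)
  also have "... = eps/4" using B1 by (metis nonzero_eq_divide_eq)
  finally show "l*B <= eps/4" .
 qed
 define A where "A n = {w \<in> space M. \<alpha>*real n^D*expectation (%w. ?m (Y w)) + eps/2*real n^D
   <= (\<Sum>i\<in>J n. ?m (X i w))}" for n
 have Ae: "A n \<in> events" for n
 proof -
  have Xrv: "random_variable borel (X i)" if "i \<in> J n" for i by (rule iid_copies_rv[OF JXY that])
  have "random_variable borel (%w. \<Sum>i\<in>J n. ?m (X i w))"
   by (intro borel_measurable_sum borel_measurable_min Xrv) auto
  then show ?thesis unfolding A_def by measurable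
 qed
 have "summable (%n. prob (A n))"
 proof (rule summable_comparison_test_ev)
  show "summable (%n. exp (- (l*eps/4))^n)" using l eps by (intro summable_geometric) auto
  show "EV n. norm (prob (A n)) <= exp (- (l*eps/4))^n"
   using card eventually_ge_at_top[of 1]
  proof eventually_elim
   case (elim n)
   define N where "N = real n^D"
   have N: "real n <= N" using elim D power_increasing[of 1 D "real n"] by (simp add: N_def)
   have "prob (A n) <= exp (- l*(eps/2*N) + \<alpha>*N*(l\<^sup>2*exp (l*a) * s))"
    unfolding A_def N_def[symmetric] s_def
    by (rule chernoff_bounded[OF mcop mrv _ _ _ l(1)]) (use elim in \<open>auto simp: N_def\<close>)
   also have "... <= exp (- (l*eps/4)*real n)"
   proof -
    have "\<alpha>*N*(l\<^sup>2*exp (l*a) * s) <= \<alpha>*N*(l\<^sup>2*exp a * s)"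
    proof (intro mult_left_mono mult_right_mono)
     show "exp (l*a) <= exp a" using l a by (simp add: mult_left_le_one_le)
    qed (use \<alpha> N s in auto)
    also have "... = l*N*(l*B)" by (simp add: B_def power2_eq_square mult_ac)
    also have "... <= l*N*(eps/4)" using l N by (intro mult_left_mono) auto
    finally have "- l*(eps/2*N) + \<alpha>*N*(l\<^sup>2*exp (l*a) * s) <= - (l*eps/4)*N"
     by (simp add: algebra_simps)
    also have "... <= - (l*eps/4)*real n" using N l eps by (intro mult_left_mono_neg) auto
    finally show ?thesis by simp
   qed
   also have "... = exp (- (l*eps/4))^n" by (simp add: exp_of_nat_mult[symmetric] mult.commute)
   finally show ?case by simp
  qed
 qed
 then have "AE w in M. EV n. w \<in> space M - A n"
  using Ae by (intro borel_cantelli_AE1) (auto simp: less_top[symmetric])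
 with big show ?thesis
 proof (eventually_elim)
  case (elim w)
  from elim(1) obtain k0 where k0: "!!k. k0 <= k ==> (\<Sum>i\<in>E k. ?e (X i w)) <= (C*eps' + eps/(4*q))*q^k"
   by (auto simp: eventually_sequentially)
  show ?case
   using elim(2) eventually_ge_at_top[of "max 1 (2^k0)"]
  proof eventually_elim
   case (elim n)
   then have w: "w \<in> space M"
    and n2: "(\<Sum>i\<in>J n. ?m (X i w)) <= \<alpha>*real n^D*expectation (%w. ?m (Y w)) + eps/2*real n^D"
    by (auto simp: A_def)
   obtain k where k: "n <= 2^k" "2^k <= 2*n" using power2_above[of n] order_trans[of 1 "2^k0" n] elim by auto
   have "(2::nat)^k0 <= 2^k" using elim k by linarith
   then have "k0 <= k" by (simp add: power_increasing_iff)
   have finE: "finite (E k)" using XY[of k] by (simp add: iid_copies_def)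
   have qn: "q^k <= q*real n^D"
   proof -
    have "real ((2^k)^D) <= real ((2*n)^D)" unfolding of_nat_le_iff using k by (intro power_mono) auto
    then show ?thesis unfolding qk by (simp add: q_def power_mult_distrib)
   qed
   have "(\<Sum>i\<in>J n. ?e (X i w)) <= (\<Sum>i\<in>E k. ?e (X i w))"
    by (intro sum_mono2 finE JE k) auto
   also have "... <= (C*eps' + eps/(4*q))*q^k" by (rule k0[OF \<open>k0 <= k\<close>])
   also have "... <= (C*eps' + eps/(4*q))*(q*real n^D)"
    using C eps' eps q qn by (intro mult_left_mono) auto
   also have "... = (q*(C*eps' + eps/(4*q)))*real n^D" by (simp add: mult_ac)
   also have "... <= eps/2*real n^D" using eps' by (intro mult_right_mono) auto
   finally have n1: "(\<Sum>i\<in>J n. ?e (X i w)) <= eps/2*real n^D" .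
   have mY: "expectation (%w. ?m (Y w)) <= expectation Y"
    using Y a by (intro integral_mono nonneg_rv_bounded_integrable[OF mrv, of a]) auto
   have "(\<Sum>i\<in>J n. X i w) = (\<Sum>i\<in>J n. ?m (X i w) + ?e (X i w))" by (intro sum.cong) auto
   also have "... = (\<Sum>i\<in>J n. ?m (X i w)) + (\<Sum>i\<in>J n. ?e (X i w))" by (rule sum.distrib)
   also have "... <= \<alpha>*real n^D*expectation (%w. ?m (Y w)) + eps/2*real n^D + eps/2*real n^D"
    using n1 n2 by linarith
   also have "\<alpha>*real n^D*expectation (%w. ?m (Y w)) <= \<alpha>*real n^D*expectation Y"
    using \<alpha> mY by (intro mult_left_mono) auto
   finally show ?case by (simp add: algebra_simps)
  qed
 qed
qed

section \<open>Almost sure convergence of a subadditive sequence along powers of two\<close>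

lemma power_tangent:
 fixes u \<mu> :: real
 assumes "0 <= u" "0 <= \<mu>"
 shows "\<mu>^(n + 2) + real (n + 2)*\<mu>^(n + 1)*(u - \<mu>) + \<mu>^n*(u - \<mu>)\<^sup>2 <= u^(n + 2)"
proof (induction n)
 case 0
 show ?case by (simp add: power2_eq_square algebra_simps)
next
 case (Suc n)
 define d where "d = u - \<mu>"
 have u: "u = \<mu> + d" by (simp add: d_def)
 have "u*(\<mu>^(n + 2) + real (n + 2)*\<mu>^(n + 1)*d + \<mu>^n*d\<^sup>2) <= u*u^(n + 2)"
  using Suc assms unfolding d_def by (intro mult_left_mono) auto
 moreover have "u*(\<mu>^(n + 2) + real (n + 2)*\<mu>^(n + 1)*d + \<mu>^n*d\<^sup>2)
   = (\<mu>^(n + 3) + real (n + 3)*\<mu>^(n + 2)*d + \<mu>^(n + 1)*d\<^sup>2)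
    + \<mu>^n*d\<^sup>2*(real (n + 1)*\<mu> + u)"
  unfolding u by (simp add: power2_eq_square algebra_simps eval_nat_numeral)
 moreover have "0 <= \<mu>^n*d\<^sup>2*(real (n + 1)*\<mu> + u)" using assms by simp
 ultimately have le: "\<mu>^(n + 3) + real (n + 3)*\<mu>^(n + 2)*d + \<mu>^(n + 1)*d\<^sup>2 <= u*u^(n + 2)"
  by (smt (verit))
 have e: "n + 1 + 2 = n + 3" "n + 1 + 1 = n + 2" "u^(n + 3) = u*u^(n + 2)"
  by (simp_all add: eval_nat_numeral)
 show ?case using le unfolding Suc_eq_plus1 e d_def[symmetric] .
qed

text \<open>The function \<open>\<phi> x = x + exp (- x)\<close> is increasing and strictly convex but grows only
  linearly.  Passing from scale \<open>k\<close> to scale \<open>k + 1\<close> the expectation of \<open>\<phi> (Z k)\<close> decreases by the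
  Jensen gap for an average of independent copies, up to a summable error.  As it cannot decrease
  for ever, the Jensen gaps are summable, and they control the variances of
  \<open>exp (- Z k / m)\<close>.\<close>

lemma averaging_variances_summable:
 fixes Z :: "nat => 'a => real" and I :: "'i set"
 assumes m: "card I = m" "2 <= m"
  and Z: "!!k. nonneg_rv (Z k)" "!!k. integrable M (Z k)" "!!k. expectation (Z k) <= B"
  and W: "!!k. nonneg_rv (W k)" "!!k. integrable M (W k)" "summable (%k. expectation (W k))"
  and cop: "!!k. iid_copies (Z k) I (X k)"
  and sub: "!!k u. u \<in> space M ==> Z (Suc k) u <= (\<Sum>i\<in>I. X k i u)/real m + W k u"
 shows "summable (%k. variance (%u. exp (- Z k u/real m)))"
proof -
 obtain n where n: "m = n + 2" using m(2) by (metis add.commute le_Suc_ex)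
 have fin: "finite I" using m by (metis card.infinite not_numeral_le_zero)
 have m0: "0 < real m" using m by simp
 define \<phi> where "\<phi> x = x + exp (- x)" for x :: real
 have \<phi>mono: "\<phi> x <= \<phi> (y + w)" "\<phi> (y + w) <= \<phi> y + w" if "0 <= x" "x <= y + w" "0 <= y" "0 <= w" for x y w
 proof -
  show "\<phi> (y + w) <= \<phi> y + w" using that by (simp add: \<phi>_def)
  have "exp (- x) - exp (- (y + w)) <= (y + w) - x"
  proof -
   have "1 - exp (- (y + w - x)) <= y + w - x" using exp_ge_add_one_self[of "- (y + w - x)"] by linarith
   moreover have "exp (- x) - exp (- (y + w)) = exp (- x)*(1 - exp (- (y + w - x)))"
    by (simp add: right_diff_distrib exp_add[symmetric])
   moreover have "exp (- x)*(1 - exp (- (y + w - x))) <= 1*(1 - exp (- (y + w - x)))"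
    using that by (intro mult_right_mono) auto
   ultimately show ?thesis by (metis mult_1 order_trans)
  qed
  then show "\<phi> x <= \<phi> (y + w)" by (simp add: \<phi>_def)
 qed
 have Zrv[measurable]: "random_variable borel (Z k)" for k using Z(1) by (simp add: nonneg_rv_def)
 have Zpos: "0 <= Z k u" if "u \<in> space M" for k u using Z(1) that by (simp add: nonneg_rv_def)
 have Wpos: "0 <= W k u" if "u \<in> space M" for k u using W(1) that by (simp add: nonneg_rv_def)
 have Xpos: "0 <= X k i u" if "i \<in> I" "u \<in> space M" for k i u using cop[of k] that by (simp add: iid_copies_def)
 have Xrv: "random_variable borel (X k i)" if "i \<in> I" for k i by (rule iid_copies_rv[OF cop that])
 define U where "U k u = exp (- Z k u/real m)" for k u
 define \<mu> where "\<mu> k = expectation (U k)" for k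
 have Ub: "0 <= U k u" "U k u <= 1" if "u \<in> space M" for k u
  using Zpos[OF that, of k] m0 by (auto simp: U_def)
 have Urv[measurable]: "random_variable borel (U k)" for k unfolding U_def[abs_def] by measurable
 have Uint: "integrable M (%u. U k u^r)" for k r
  using Ub by (intro integrable_const_bound[of _ 1] AE_I2) (auto simp: power_le_one)
 have Uint1: "integrable M (U k)" for k using Uint[of k 1] by simp
 have \<mu>0: "0 <= \<mu> k" for k unfolding \<mu>_def using Ub by (intro integral_nonneg_AE AE_I2)
 have \<mu>B: "exp (- B/real m) <= \<mu> k" for k
 proof -
  let ?b = "exp (- B/real m)"
  have "?b <= ?b*(1 - (expectation (Z k) - B)/real m)"
   using Z(3)[of k] m0 by (simp add: divide_nonpos_pos)
  also have "... = expectation (%u. ?b*(1 - (Z k u - B)/real m))"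
   using Z(2)[of k] m0 by (simp add: prob_space)
  also have "... <= \<mu> k"
   unfolding \<mu>_def
  proof (rule integral_mono)
   show "integrable M (%u. ?b*(1 - (Z k u - B)/real m))" using Z(2)[of k] by auto
   fix u
   have "1 - t <= exp (- t)" for t :: real using exp_ge_add_one_self[of "- t"] by simp
   from this[of "(Z k u - B)/real m"]
   have "1 - (Z k u - B)/real m <= exp (- (Z k u - B)/real m)"
    unfolding minus_divide_left .
   then have "?b*(1 - (Z k u - B)/real m) <= ?b*exp (- (Z k u - B)/real m)"
    by (intro mult_left_mono) auto
   also have "... = U k u" using m0 by (simp add: U_def exp_add[symmetric] field_simps)
   finally show "?b*(1 - (Z k u - B)/real m) <= U k u" .
  qed (rule Uint1)
  finally show ?thesis .
 qed
 define c where "c = exp (- B/real m)^n"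
 have c: "0 < c" by (simp add: c_def)
 have gap: "c * variance (U k) <= expectation (%u. U k u^m) - \<mu> k^m" for k
 proof -
  have iv: "integrable M (%u. (U k u - \<mu> k)\<^sup>2)"
  proof (rule integrable_const_bound[of _ "(1 + \<mu> k)\<^sup>2"])
   have "(U k u - \<mu> k)\<^sup>2 <= (1 + \<mu> k)\<^sup>2" if "u \<in> space M" for u
    unfolding abs_le_square_iff[symmetric] using Ub[OF that, of k] \<mu>0[of k] by linarith
   then show "AE u in M. norm ((U k u - \<mu> k)\<^sup>2) <= (1 + \<mu> k)\<^sup>2" by (intro AE_I2) simp
  qed measurable
  have "expectation (%u. \<mu> k^(n + 2) + real (n + 2)*\<mu> k^(n + 1)*(U k u - \<mu> k) + \<mu> k^n*(U k u - \<mu> k)\<^sup>2)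
    <= expectation (%u. U k u^(n + 2))"
  proof (rule integral_mono)
   show "integrable M (%u. \<mu> k^(n + 2) + real (n + 2)*\<mu> k^(n + 1)*(U k u - \<mu> k) + \<mu> k^n*(U k u - \<mu> k)\<^sup>2)"
    using iv Uint1[of k] by auto
   show "integrable M (%u. U k u^(n + 2))" by (rule Uint)
  qed (rule power_tangent[OF Ub(1) \<mu>0])
  also have "expectation (%u. \<mu> k^(n + 2) + real (n + 2)*\<mu> k^(n + 1)*(U k u - \<mu> k) + \<mu> k^n*(U k u - \<mu> k)\<^sup>2)
    = \<mu> k^m + \<mu> k^n * variance (U k)"
   using iv Uint1[of k] by (simp add: prob_space n \<mu>_def[symmetric] del: power_Suc)
  finally have "\<mu> k^n * variance (U k) <= expectation (%u. U k u^m) - \<mu> k^m" by (simp add: n)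
  moreover have "c * variance (U k) <= \<mu> k^n * variance (U k)"
   unfolding c_def using \<mu>B[of k] by (intro mult_right_mono power_mono) auto
  ultimately show ?thesis by linarith
 qed
 define f where "f k = expectation (Z k) + expectation (%u. U k u^m)" for k
 have Um: "U k u^m = exp (- Z k u)" for k u
  using m0 by (simp add: U_def exp_of_nat_mult[symmetric])
 have step: "f (Suc k) <= f k - c * variance (U k) + expectation (W k)" for k
 proof -
  let ?A = "%u. (\<Sum>i\<in>I. X k i u)/real m"
  have intX: "integrable M (X k i)" if "i \<in> I" for i
   using copies_expectation(2)[OF cop Zrv that, where g = "%y. y"] Z(2) by simp
  have intA: "integrable M ?A" using intX by auto
  have eA: "exp (- ?A u) = (\<Prod>i\<in>I. exp (- X k i u/real m))" for u
   using fin by (simp add: exp_sum[symmetric] sum_negf sum_divide_distrib)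
  have ind: "indep_vars (%_. borel) (%i u. exp (- X k i u/real m)) I"
   by (rule indep_vars_compose2[where M' = "%_. borel" and X = "X k" and Y = "%_ x. exp (- x/real m)"])
    (use cop[of k] in \<open>auto simp: iid_copies_def\<close>)
  have ie: "integrable M (%u. exp (- X k i u/real m))" if "i \<in> I" for i
   using Xpos[OF that] Xrv[OF that] by (intro integrable_const_bound[of _ 1] AE_I2) auto
  have inteA: "integrable M (%u. exp (- ?A u))"
   unfolding eA by (rule indep_vars_integrable[OF fin ind ie])
  have EeA: "expectation (%u. exp (- ?A u)) = \<mu> k^m"
  proof -
   have "expectation (%u. exp (- ?A u)) = (\<Prod>i\<in>I. expectation (%u. exp (- X k i u/real m)))"
    unfolding eA by (rule indep_vars_lebesgue_integral[OF fin ind ie])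
   also have "... = (\<Prod>i\<in>I. \<mu> k)"
    unfolding \<mu>_def U_def[abs_def]
    by (intro prod.cong refl copies_expectation(1)[OF cop Zrv, where g = "%y. exp (- y/real m)"]) auto
   finally show ?thesis by (simp add: m)
  qed
  have EA: "expectation ?A = expectation (Z k)"
  proof -
   have "expectation ?A = (\<Sum>i\<in>I. expectation (X k i))/real m" using intX by simp
   also have "(\<Sum>i\<in>I. expectation (X k i)) = (\<Sum>i\<in>I. expectation (Z k))"
    by (intro sum.cong refl copies_expectation(1)[OF cop Zrv, where g = "%y. y"]) auto
   finally show ?thesis using m0 by (simp add: m)
  qed
  have "f (Suc k) = expectation (%u. \<phi> (Z (Suc k) u))"
   unfolding f_def \<phi>_def Um[symmetric] using Z(2) Uint by (subst Bochner_Integration.integral_add) auto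
  also have "... <= expectation (%u. ?A u + exp (- ?A u) + W k u)"
  proof (rule integral_mono)
   show "integrable M (%u. \<phi> (Z (Suc k) u))"
    unfolding \<phi>_def Um[symmetric] using Z(2) Uint by (intro Bochner_Integration.integrable_add)
   show "integrable M (%u. ?A u + exp (- ?A u) + W k u)" using intA inteA W(2) by auto
   fix u assume u: "u \<in> space M"
   have "0 <= ?A u" using Xpos u by (auto intro!: divide_nonneg_nonneg sum_nonneg)
   from order_trans[OF \<phi>mono[OF Zpos[OF u] sub[OF u] this Wpos[OF u]]]
   show "\<phi> (Z (Suc k) u) <= ?A u + exp (- ?A u) + W k u" by (simp add: \<phi>_def)
  qed
  also have "... = expectation (Z k) + \<mu> k^m + expectation (W k)"
   using intA inteA W(2)[of k] EA EeA by simp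
  finally show ?thesis using gap[of k] by (simp add: f_def)
 qed
 have fpos: "0 <= f k" for k
  unfolding f_def using Zpos Ub by (intro add_nonneg_nonneg integral_nonneg_AE AE_I2) auto
 have wpos: "0 <= expectation (W k)" for k using Wpos by (intro integral_nonneg_AE AE_I2)
 have tel: "f K + (\<Sum>k<K. c * variance (U k)) <= f 0 + (\<Sum>k<K. expectation (W k))" for K
  by (induction K) (use step in \<open>auto simp: algebra_simps intro: order_trans\<close>, smt (verit) step)
 have "summable (%k. c * variance (U k))"
 proof (rule summableI_nonneg_bounded)
  show "0 <= c * variance (U k)" for k using c by simp
  fix K
  have "(\<Sum>k<K. expectation (W k)) <= suminf (%k. expectation (W k))"
   using W(3) wpos by (intro sum_le_suminf) auto
  then show "(\<Sum>k<K. c * variance (U k)) <= f 0 + suminf (%k. expectation (W k))"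
   using tel[of K] fpos[of K] by linarith
 qed
 then have "summable (%k. variance (U k))" using c by simp
 then show ?thesis unfolding U_def[abs_def] .
qed

text \<open>Chebyshev and Borel-Cantelli along the summable variances. Since these only involve the marginal
  laws, the bound passes to every sequence with the same marginals.\<close>

lemma averaging_almost_sure_lower_bound:
 fixes Z Z' :: "nat => 'a => real"
 assumes m: "0 < m" and Z: "!!k. nonneg_rv (Z k)" "!!k. integrable M (Z k)"
  and L1: "(%k. expectation (%w. \<bar>Z k w - \<nu>\<bar>)) \<longlonglongrightarrow> 0" and \<nu>: "0 <= \<nu>"
  and var: "summable (%k. variance (%w. exp (- Z k w/real m)))"
  and Z': "!!k. random_variable borel (Z' k)" "!!k. distr M borel (Z' k) = distr M borel (Z k)"
  and eps: "0 < eps"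
 shows "AE w in M. EV k. \<nu> - eps <= Z' k w"
proof -
 have Zrv[measurable]: "random_variable borel (Z k)" for k using Z(1) by (simp add: nonneg_rv_def)
 have Zpos: "0 <= Z k w" if "w \<in> space M" for k w using Z(1) that by (simp add: nonneg_rv_def)
 have m0: "0 < real m" using m by simp
 define U where "U k w = exp (- Z k w/real m)" for k w
 have Urv[measurable]: "random_variable borel (U k)" for k unfolding U_def[abs_def] by measurable
 have Ub: "0 <= U k w" "U k w <= 1" if "w \<in> space M" for k w
  using Zpos[OF that, of k] m0 by (auto simp: U_def)
 have Uint: "integrable M (U k)" for k using Ub by (intro integrable_const_bound[of _ 1] AE_I2) auto
 have lip: "exp (- x/real m) - exp (- y/real m) <= \<bar>x - y\<bar>" if "0 <= x" "0 <= y" for x y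
 proof -
  have "exp (- x/real m) - exp (- y/real m) = exp (- x/real m)*(1 - exp ((x - y)/real m))"
   using m0 by (simp add: right_diff_distrib exp_add[symmetric] field_simps)
  also have "... <= \<bar>x - y\<bar>"
  proof (cases "x <= y")
   case True
   have "1 - exp ((x - y)/real m) <= (y - x)/real m"
    using exp_ge_add_one_self[of "(x - y)/real m"] unfolding diff_divide_distrib by linarith
   also have "... <= (y - x)/1" using True m by (intro frac_le) auto
   finally have "1 - exp ((x - y)/real m) <= (y - x)/1" .
   moreover have "(x - y)/real m <= 0" using True m0 by (intro divide_nonpos_pos) auto
   ultimately have "exp (- x/real m)*(1 - exp ((x - y)/real m)) <= 1*((y - x)/1)"
    using that m0 True by (intro mult_mono) auto
   then show ?thesis using True by simp
  next
   case False
   then have "1 - exp ((x - y)/real m) <= 0" using m0 by simp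
   then have "exp (- x/real m)*(1 - exp ((x - y)/real m)) <= 0" by (intro mult_nonneg_nonpos) auto
   then show ?thesis by simp
  qed
  finally show ?thesis .
 qed
 define dl where "dl = (exp (- (\<nu> - eps)/real m) - exp (- \<nu>/real m))/2"
 have dl: "0 < dl"
 proof -
  have "- \<nu>/real m < - (\<nu> - eps)/real m" using eps m0 by (intro divide_strict_right_mono) auto
  then have "exp (- \<nu>/real m) < exp (- (\<nu> - eps)/real m)" by (rule exp_less_mono)
  then show ?thesis unfolding dl_def by (intro divide_pos_pos) linarith+
 qed
 have "EV k. expectation (%w. \<bar>Z k w - \<nu>\<bar>) < dl"
  using L1 dl by (intro order_tendstoD) auto
 then have EU: "EV k. expectation (U k) <= exp (- \<nu>/real m) + dl"
 proof eventually_elim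
  case (elim k)
  have "expectation (U k) - exp (- \<nu>/real m) = expectation (%w. U k w - exp (- \<nu>/real m))"
   using Uint[of k] by (simp add: prob_space)
  also have "... <= expectation (%w. \<bar>Z k w - \<nu>\<bar>)"
  proof (rule integral_mono)
   show "integrable M (%w. U k w - exp (- \<nu>/real m))" using Uint[of k] by auto
   show "integrable M (%w. \<bar>Z k w - \<nu>\<bar>)" using Z(2)[of k] by auto
   show "U k w - exp (- \<nu>/real m) <= \<bar>Z k w - \<nu>\<bar>" if "w \<in> space M" for w
    unfolding U_def by (rule lip[OF Zpos[OF that] \<nu>])
  qed
  finally show ?case using elim by simp
 qed
 define A where "A k = {w \<in> space M. Z' k w < \<nu> - eps}" for k
 have Ae: "A k \<in> events" for k unfolding A_def using Z'(1) by measurable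
 have "summable (%k. prob (A k))"
 proof (rule summable_comparison_test_ev)
  show "summable (%k. variance (U k)/dl\<^sup>2)" using var unfolding U_def[abs_def] by simp
  show "EV k. norm (prob (A k)) <= variance (U k)/dl\<^sup>2"
   using EU
  proof eventually_elim
   case (elim k)
   have "prob (A k) = measure (distr M borel (Z' k)) {..<\<nu> - eps}"
    using Z'(1) by (subst measure_distr) (auto simp: A_def intro!: arg_cong[where f = prob])
   also have "... = prob {w \<in> space M. Z k w < \<nu> - eps}"
    unfolding Z'(2) by (subst measure_distr) (auto intro!: arg_cong[where f = prob])
   also have "... <= prob {w \<in> space M. \<bar>U k w - expectation (U k)\<bar> >= dl}"
   proof (rule finite_measure_mono)
    show "{w \<in> space M. Z k w < \<nu> - eps} \<subseteq> {w \<in> space M. \<bar>U k w - expectation (U k)\<bar> >= dl}"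
    proof
     fix w assume "w \<in> {w \<in> space M. Z k w < \<nu> - eps}"
     then have w: "w \<in> space M" "Z k w < \<nu> - eps" by auto
     have "exp (- (\<nu> - eps)/real m) <= U k w"
     proof -
      have "- (\<nu> - eps)/real m <= - Z k w/real m" using w(2) m0 by (intro divide_right_mono) auto
      then show ?thesis unfolding U_def by (simp only: exp_le_cancel_iff)
     qed
     then have "dl <= U k w - expectation (U k)" using elim by (simp add: dl_def field_simps)
     then show "w \<in> {w \<in> space M. \<bar>U k w - expectation (U k)\<bar> >= dl}" using w(1) by simp
    qed
   qed measurable
   also have "... <= variance (U k)/dl\<^sup>2"
   proof (rule Chebyshev_inequality[OF Urv _ dl])
    show "integrable M (%w. (U k w)\<^sup>2)"
     using Ub by (intro integrable_const_bound[of _ 1] AE_I2) (auto simp: power_le_one)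
   qed
   finally show ?case by simp
  qed
 qed
 then have "AE w in M. EV k. w \<in> space M - A k"
  using Ae by (intro borel_cantelli_AE1) (auto simp: less_top[symmetric])
 then show ?thesis
 proof eventually_elim
  case (elim w)
  then show ?case by eventually_elim (auto simp: A_def)
 qed
qed

end

section \<open>Translates of a cylinder\<close>

lemma integer_points_add: "x \<in> integer_points ==> y \<in> integer_points ==> x + y \<in> integer_points"
 by (auto simp: integer_points_def)

lemma integer_points_diff: "x \<in> integer_points ==> y \<in> integer_points ==> x - y \<in> integer_points"
 by (auto simp: integer_points_def)

lemma integer_points_shift:
 "z \<in> integer_points ==> z + x \<in> integer_points \<longleftrightarrow> x \<in> integer_points"
 using integer_points_add[of z x] integer_points_diff[of "z + x" z] by auto

lemma lattice_edges_shift: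
 assumes z: "z \<in> integer_points"
 shows "(+) z ` e \<in> lattice_edges \<longleftrightarrow> e \<in> lattice_edges"
proof -
 have *: "(+) z ` e \<in> lattice_edges" if ez: "e \<in> lattice_edges" "z \<in> integer_points" for e and z :: "real^'a"
 proof -
  obtain x y where "e = {x, y}" "x \<in> integer_points" "y \<in> integer_points" "dist x y = 1"
   using ez(1) by (rule lattice_edge_cases)
  then have "(+) z ` e = {z + x, z + y}" "z + x \<in> integer_points" "z + y \<in> integer_points" "dist (z + x) (z + y) = 1"
   using ez(2) by (auto simp: integer_points_shift)
  then show ?thesis unfolding lattice_edges_def by blast
 qed
 have "- z \<in> integer_points" using z by (auto simp: integer_points_def)
 moreover have "(+) (- z) ` (+) z ` e = e" by (simp add: image_image)
 ultimately show ?thesis using *[of e z] *[of "(+) z ` e" "- z"] z by auto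
qed

lemma inj_image_shift: "inj ((`) ((+) (z :: 'a::ab_group_add)))"
 by (simp add: inj_image_eq_iff inj_def)

lemma induced_edges_shift:
 assumes z: "z \<in> integer_points"
 shows "induced_edges ((+) z ` V) = (`) ((+) z) ` induced_edges V"
proof (intro equalityI subsetI)
 fix e assume e: "e \<in> induced_edges ((+) z ` V)"
 let ?e = "(+) (- z) ` e"
 have eq: "e = (+) z ` ?e" by (simp add: image_image)
 have "?e \<in> lattice_edges" using e lattice_edges_shift[OF z, of ?e] eq by (simp add: induced_edges_def)
 moreover have "?e \<subseteq> V" using e by (force simp: induced_edges_def)
 ultimately show "e \<in> (`) ((+) z) ` induced_edges V"
  by (subst eq) (simp add: induced_edges_def)
next
 fix e assume "e \<in> (`) ((+) z) ` induced_edges V"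
 then obtain e' where e': "e = (+) z ` e'" "e' \<in> lattice_edges" "e' \<subseteq> V"
  by (auto simp: induced_edges_def)
 then have "e \<in> lattice_edges" using lattice_edges_shift[OF z, of e'] by simp
 then show "e \<in> induced_edges ((+) z ` V)" using e' by (auto simp: induced_edges_def)
qed

lemma boundary_vertex_shift:
 assumes z: "z \<in> integer_points"
 shows "boundary_vertex ((+) z ` V) (z + x) \<longleftrightarrow> boundary_vertex V x"
proof
 assume "boundary_vertex ((+) z ` V) (z + x)"
 then obtain y where y: "y \<in> integer_points" "y \<notin> (+) z ` V" "{z + x, y} \<in> lattice_edges"
  by (auto simp: boundary_vertex_def)
 have "{z + x, y} = (+) z ` {x, y - z}" by simp
 then have "{x, y - z} \<in> lattice_edges" using y(3) lattice_edges_shift[OF z, of "{x, y - z}"] by simp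
 moreover have "y - z \<in> integer_points" using y(1) z by (rule integer_points_diff)
 moreover have "y - z \<notin> V" using y(2) by (auto simp: image_iff)
 ultimately show "boundary_vertex V x" by (auto simp: boundary_vertex_def)
next
 assume "boundary_vertex V x"
 then obtain y where y: "y \<in> integer_points" "y \<notin> V" "{x, y} \<in> lattice_edges"
  by (auto simp: boundary_vertex_def)
 have "{z + x, z + y} \<in> lattice_edges" using y(3) lattice_edges_shift[OF z, of "{x, y}"] by simp
 moreover have "z + y \<in> integer_points" using y(1) z by (simp add: integer_points_shift)
 moreover have "z + y \<notin> (+) z ` V" using y(2) by auto
 ultimately show "boundary_vertex ((+) z ` V) (z + x)" by (auto simp: boundary_vertex_def)
qed

lemma separating_shift:
 assumes z: "z \<in> integer_points"
 shows "separating v ((+) z ` V) (r + v \<bullet> z) ((+) z ` S) \<longleftrightarrow> separating v V r S"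
 unfolding separating_def
 by (auto simp: boundary_vertex_shift[OF z] inner_right_distrib inj_image_subset_iff inj_def image_iff)

lemma min_cut_shift:
 assumes z: "z \<in> integer_points"
 shows "min_cut v ((+) z ` V) (r + v \<bullet> z) c = min_cut v V r (%e. c ((+) z ` e))"
proof -
 let ?V = "(+) z ` V" and ?r = "r + v \<bullet> z"
 have cost: "cut_cost (induced_edges ?V) c ((+) z ` S) = cut_cost (induced_edges V) (%e. c ((+) z ` e)) S" for S
 proof -
  have "cut_edges (induced_edges ?V) ((+) z ` S) = (`) ((+) z) ` cut_edges (induced_edges V) S"
  proof -
   have *: "(+) z ` e \<inter> (+) z ` S ~= {} & \<not> (+) z ` e \<subseteq> (+) z ` S \<longleftrightarrow> e \<inter> S ~= {} & \<not> e \<subseteq> S" for e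
    by auto
   have "{e \<in> (`) ((+) z) ` F. e \<inter> (+) z ` S ~= {} & \<not> e \<subseteq> (+) z ` S}
     = (`) ((+) z) ` {e \<in> F. e \<inter> S ~= {} & \<not> e \<subseteq> S}" (is "?L = ?R") for F
   proof (intro equalityI subsetI)
    fix x assume "x \<in> ?L"
    then obtain e where e: "e \<in> F" "x = (+) z ` e" "x \<inter> (+) z ` S ~= {} & \<not> x \<subseteq> (+) z ` S" by blast
    then show "x \<in> ?R" using *[of e] by blast
   next
    fix x assume "x \<in> ?R"
    then obtain e where e: "e \<in> F" "x = (+) z ` e" "e \<inter> S ~= {} & \<not> e \<subseteq> S" by blast
    then show "x \<in> ?L" using *[of e] by blast
   qed
   then show ?thesis unfolding cut_edges_def induced_edges_shift[OF z] .
  qed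
  then show ?thesis
   unfolding cut_cost_def by (simp add: sum.reindex[OF inj_on_subset[OF inj_image_shift]])
 qed
 have seps: "{S. separating v ?V ?r S} = (`) ((+) z) ` {S. separating v V r S}"
 proof (intro equalityI subsetI)
  fix S assume "S \<in> {S. separating v ?V ?r S}"
  moreover have eq: "S = (+) z ` (+) (- z) ` S" by (simp add: image_image)
  ultimately have "separating v V r ((+) (- z) ` S)"
   using separating_shift[OF z, of v V r "(+) (- z) ` S"] by simp
  then show "S \<in> (`) ((+) z) ` {S. separating v V r S}" using eq by blast
 qed (use separating_shift[OF z] in auto)
 show ?thesis unfolding min_cut_def seps image_image cost ..
qed

lemma lattice_points_shift:
 fixes Q :: "real^'d => real^'d"
 assumes Q: "orthogonal_transformation Q" and z: "z \<in> integer_points"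
 shows "lattice_points v (prism Q j (%k. lo k + Q z $ k) (%k. hi k + Q z $ k)) (r + v \<bullet> z) h
  = (+) z ` lattice_points v (prism Q j lo hi) r h"
proof -
 have lin: "linear Q" using Q by (simp add: orthogonal_transformation_linear)
 have iff: "z + x \<in> lattice_points v (prism Q j (%k. lo k + Q z $ k) (%k. hi k + Q z $ k)) (r + v \<bullet> z) h
   \<longleftrightarrow> x \<in> lattice_points v (prism Q j lo hi) r h" for x
  by (auto simp: lattice_points_def prism_def integer_points_shift[OF z] linear_add[OF lin] inner_right_distrib)
 show ?thesis
 proof (intro equalityI subsetI)
  fix y assume y: "y \<in> lattice_points v (prism Q j (%k. lo k + Q z $ k) (%k. hi k + Q z $ k)) (r + v \<bullet> z) h"
  then show "y \<in> (+) z ` lattice_points v (prism Q j lo hi) r h"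
   using iff[of "y - z"] by (intro image_eqI[of _ _ "y - z"]) auto
 qed (use iff in auto)
qed

lemma min_cut_cong:
 assumes "!!e. e \<in> induced_edges V ==> c e = c' e"
 shows "min_cut v V r c = min_cut v V r c'"
proof -
 have "cut_cost (induced_edges V) c S = cut_cost (induced_edges V) c' S" for S
  unfolding cut_cost_def by (intro sum.cong refl assms) (auto simp: cut_edges_def)
 then show ?thesis unfolding min_cut_def by simp
qed

lemma min_cut_le_sum:
 assumes "finite V" "!!e. e \<in> lattice_edges ==> 0 <= c e"
 shows "min_cut v V r c <= (\<Sum>e\<in>induced_edges V. c e)"
proof -
 have "min_cut v V r c <= cut_cost (induced_edges V) c {x \<in> V. v \<bullet> x > r}"
  by (rule min_cut_le[OF assms(1) separating_upper])
 also have "... <= (\<Sum>e\<in>induced_edges V. c e)"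
  unfolding cut_cost_def using assms
  by (intro sum_mono2 finite_induced_edges) (auto simp: cut_edges_def induced_edges_def)
 finally show ?thesis .
qed

lemma min_cut_measurable:
 fixes V :: "(real^'d) set"
 assumes V: "finite V"
 shows "(%c. min_cut v V r c) \<in> borel_measurable (PiM (induced_edges V) (%_. borel))"
proof -
 have [measurable]: "(%c. c e) \<in> borel_measurable (PiM (induced_edges V) (%_. borel :: real measure))"
  if "e \<in> induced_edges V" for e using that by measurable
 have "(%c. cut_cost (induced_edges V) c S) \<in> borel_measurable (PiM (induced_edges V) (%_. borel))" for S
  unfolding cut_cost_def by (intro borel_measurable_sum measurable_component_singleton) (auto simp: cut_edges_def)
 then show ?thesis
  unfolding min_cut_def using finite_separating[OF V] by (intro borel_measurable_Min) auto
qed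

section \<open>The random capacities\<close>

locale percolation_capacities = prob_space M
 for M :: "'w measure" +
 fixes t :: "(real^'d) set => 'w => real" and v :: "real^'d" and j :: 'd
 assumes dim: "2 <= CARD('d)"
  and indep: "indep_vars (%_. borel) t lattice_edges"
  and capacity_nonneg: "!!e w. e \<in> lattice_edges ==> w \<in> space M ==> 0 <= t e w"
  and same_law: "!!e e'. e \<in> lattice_edges ==> e' \<in> lattice_edges ==> distr M borel (t e) = distr M borel (t e')"
  and capacity_integrable: "!!e. e \<in> lattice_edges ==> integrable M (t e)"
begin

definition base_edge :: "(real^'d) set" where
 "base_edge = {0, axis j 1}"

lemma base_edge: "base_edge \<in> lattice_edges"
proof -
 have "(0 :: real^'d) \<in> integer_points" "(axis j 1 :: real^'d) \<in> integer_points"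
  by (auto simp: integer_points_def axis_def)
 moreover have "dist 0 (axis j 1 :: real^'d) = 1"
  by (simp add: norm_eq_1 inner_axis)
 ultimately show ?thesis unfolding base_edge_def lattice_edges_def by blast
qed

definition flow :: "(real^'d) set => real => 'w => real" where
 "flow V r w = min_cut v V r (%e. t e w)"

lemma capacity_rv: "e \<in> lattice_edges ==> random_variable borel (t e)"
 using indep by (simp add: indep_vars_def)

lemma base_capacity: "nonneg_rv (t base_edge)" "integrable M (t base_edge)"
 using capacity_rv capacity_nonneg capacity_integrable base_edge by (auto simp: nonneg_rv_def)

lemma capacities_iid: "finite G ==> G \<subseteq> lattice_edges ==> iid_copies (t base_edge) G t"
 unfolding iid_copies_def
 using indep_vars_subset[OF indep] same_law base_edge capacity_nonneg by blast

lemma capacity_sum_expectation: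
 assumes "finite G" "G \<subseteq> lattice_edges"
 shows "expectation (%w. \<Sum>e\<in>G. t e w) = real (card G)*expectation (t base_edge)"
  "integrable M (%w. \<Sum>e\<in>G. t e w)"
proof -
 note iid = capacities_iid[OF assms]
 have rv: "random_variable borel (t base_edge)" using base_capacity by (simp add: nonneg_rv_def)
 show "integrable M (%w. \<Sum>e\<in>G. t e w)"
  using assms capacity_integrable by (intro Bochner_Integration.integrable_sum) auto
 have "expectation (%w. \<Sum>e\<in>G. t e w) = (\<Sum>e\<in>G. expectation (t e))"
  using assms capacity_integrable by (intro Bochner_Integration.integral_sum) auto
 also have "... = (\<Sum>e\<in>G. expectation (t base_edge))"
  by (intro sum.cong refl copies_expectation(1)[OF iid rv, where g = "%y. y"]) auto
 finally show "expectation (%w. \<Sum>e\<in>G. t e w) = real (card G)*expectation (t base_edge)" by simp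
qed

lemma flow_rv: "finite V ==> random_variable borel (flow V r)"
proof -
 assume V: "finite V"
 have sub: "induced_edges V \<subseteq> lattice_edges" by (auto simp: induced_edges_def)
 have "(%w. \<lambda>e\<in>induced_edges V. t e w) \<in> measurable M (PiM (induced_edges V) (%_. borel))"
  using capacity_rv sub by (intro measurable_restrict) auto
 from measurable_compose[OF this min_cut_measurable[OF V]]
 have "random_variable borel (%w. min_cut v V r (\<lambda>e\<in>induced_edges V. t e w))" .
 moreover have "min_cut v V r (\<lambda>e\<in>induced_edges V. t e w) = flow V r w" for w
  unfolding flow_def by (rule min_cut_cong) simp
 ultimately show ?thesis by simp
qed

lemma flow_nonneg: "finite V ==> w \<in> space M ==> 0 <= flow V r w"
 unfolding flow_def using capacity_nonneg by (intro min_cut_nonneg) auto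

lemma flow_le_sum: "finite V ==> w \<in> space M ==> flow V r w <= (\<Sum>e\<in>induced_edges V. t e w)"
 unfolding flow_def using capacity_nonneg by (intro min_cut_le_sum) auto

lemma flow_nonneg_rv: "finite V ==> nonneg_rv (flow V r)"
 using flow_rv flow_nonneg by (auto simp: nonneg_rv_def)

lemma flow_integrable: "finite V ==> integrable M (flow V r)"
proof -
 assume V: "finite V"
 have sub: "induced_edges V \<subseteq> lattice_edges" by (auto simp: induced_edges_def)
 show ?thesis
 proof (rule Bochner_Integration.integrable_bound)
  show "integrable M (%w. \<Sum>e\<in>induced_edges V. t e w)"
   by (rule capacity_sum_expectation(2)[OF finite_induced_edges[OF V] sub])
  show "random_variable borel (flow V r)" by (rule flow_rv[OF V])
  have "norm (flow V r w) <= norm (\<Sum>e\<in>induced_edges V. t e w)" if "w \<in> space M" for w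
   using flow_nonneg[OF V that, of r] flow_le_sum[OF V that, of r] by simp
  then show "AE w in M. norm (flow V r w) <= norm (\<Sum>e\<in>induced_edges V. t e w)" by (intro AE_I2)
 qed
qed

text \<open>The capacities read off at translated edges have the same joint law.\<close>

lemma flow_translate_law:
 assumes V: "finite V" and z: "z \<in> integer_points"
 shows "distr M borel (flow ((+) z ` V) (r + v \<bullet> z)) = distr M borel (flow V r)"
proof (cases "induced_edges V = {}")
 case True
 then have "flow V r w = min_cut v V r (%_. 0)" "flow ((+) z ` V) (r + v \<bullet> z) w = min_cut v V r (%_. 0)" for w
  unfolding flow_def min_cut_shift[OF z] by (auto intro!: min_cut_cong)
 then have "flow ((+) z ` V) (r + v \<bullet> z) = flow V r" by (intro ext) simp
 then show ?thesis by simp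
next
 case False
 let ?E = "induced_edges V"
 have sub: "?E \<subseteq> lattice_edges" by (auto simp: induced_edges_def)
 have law: "distr M (PiM ?E (%_. borel)) (%w. \<lambda>e\<in>?E. t ((+) z ` e) w)
   = PiM ?E (%_. distr M borel (t base_edge))" if z: "z \<in> integer_points" for z
 proof -
  have inL: "(+) z ` e \<in> lattice_edges" if "e \<in> ?E" for e
   using that sub lattice_edges_shift[OF z, of e] by auto
  have "indep_vars (%e. PiM {(+) z ` e} (%_. borel)) (%e w. restrict (%i. t i w) {(+) z ` e}) ?E"
  proof (rule indep_vars_restrict[OF indep])
   show "disjoint_family_on (%e. {(+) z ` e}) ?E"
    using inj_image_shift[of z] by (auto simp: disjoint_family_on_def dest: injD)
  qed (use inL in auto)
  from indep_vars_compose2[OF this, of "%e c. c ((+) z ` e)" "%_. borel"]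
  have ind: "indep_vars (%_. borel) (%e. t ((+) z ` e)) ?E" by (simp add: eta_contract_eq)
  have "distr M (PiM ?E (%_. borel)) (%w. \<lambda>e\<in>?E. t ((+) z ` e) w)
    = PiM ?E (%e. distr M borel (t ((+) z ` e)))"
   using ind capacity_rv inL by (subst indep_vars_iff_distr_eq_PiM'[symmetric]) (use False in auto)
  also have "... = PiM ?E (%_. distr M borel (t base_edge))"
   using same_law[OF inL base_edge] by (intro PiM_cong) auto
  finally show ?thesis .
 qed
 have flow_z: "distr M borel (flow ((+) z ` V) (r + v \<bullet> z))
   = distr (PiM ?E (%_. distr M borel (t base_edge))) borel (%c. min_cut v V r c)"
  if z: "z \<in> integer_points" for z
 proof -
  have inL: "(+) z ` e \<in> lattice_edges" if "e \<in> ?E" for e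
   using that sub lattice_edges_shift[OF z, of e] by auto
  have "min_cut v V r (%e. t ((+) z ` e) w) = min_cut v V r (\<lambda>e\<in>?E. t ((+) z ` e) w)" for w
   by (rule min_cut_cong) simp
  then have "flow ((+) z ` V) (r + v \<bullet> z) = (%c. min_cut v V r c) \<circ> (%w. \<lambda>e\<in>?E. t ((+) z ` e) w)"
   unfolding flow_def[abs_def] min_cut_shift[OF z] by (simp add: o_def)
  then have "distr M borel (flow ((+) z ` V) (r + v \<bullet> z))
    = distr M borel ((%c. min_cut v V r c) \<circ> (%w. \<lambda>e\<in>?E. t ((+) z ` e) w))" by simp
  also have "... = distr (distr M (PiM ?E (%_. borel)) (%w. \<lambda>e\<in>?E. t ((+) z ` e) w)) borel (%c. min_cut v V r c)"
   using capacity_rv inL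
   by (intro distr_distr[symmetric] min_cut_measurable V measurable_restrict) auto
  finally show ?thesis unfolding law[OF z] .
 qed
 have 0: "(0 :: real^'d) \<in> integer_points" by (simp add: integer_points_def)
 have "(+) (0 :: real^'d) ` V = V" by auto
 then show ?thesis using flow_z[OF z] flow_z[OF 0] by simp
qed

text \<open>Disjoint vertex sets induce disjoint edge sets.\<close>

lemma flows_independent:
 assumes W: "!!i. i \<in> J ==> finite (W i)" "disjoint_family_on W J"
 shows "indep_vars (%_. borel) (%i. flow (W i) (\<rho> i)) J"
proof -
 have "indep_vars (%i. PiM (induced_edges (W i)) (%_. borel))
   (%i w. restrict (%e. t e w) (induced_edges (W i))) J"
 proof (rule indep_vars_restrict[OF indep])
  show "induced_edges (W i) \<subseteq> lattice_edges" for i by (auto simp: induced_edges_def)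
  show "disjoint_family_on (%i. induced_edges (W i)) J"
   unfolding disjoint_family_on_def
  proof (intro ballI impI)
   fix i k assume ik: "i \<in> J" "k \<in> J" "i ~= k"
   then have "W i \<inter> W k = {}" using W(2) by (auto simp: disjoint_family_on_def)
   then show "induced_edges (W i) \<inter> induced_edges (W k) = {}"
    using induced_edgesD[of _ "W i"] by (fastforce simp: induced_edges_def)
  qed
 qed
 from indep_vars_compose2[OF this min_cut_measurable[OF W(1)]]
 have "indep_vars (%_. borel)
   (%i w. min_cut v (W i) (\<rho> i) (restrict (%e. t e w) (induced_edges (W i)))) J" .
 moreover have "min_cut v (W i) (\<rho> i) (restrict (%e. t e w) (induced_edges (W i))) = flow (W i) (\<rho> i) w" for i w
  unfolding flow_def by (rule min_cut_cong) simp
 ultimately show ?thesis by (simp add: eta_contract_eq)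
qed

lemma flows_iid:
 assumes J: "finite J" and V: "finite V" and z: "!!i. i \<in> J ==> z i \<in> integer_points"
  and dis: "disjoint_family_on (%i. (+) (z i) ` V) J"
 shows "iid_copies (flow V r) J (%i. flow ((+) (z i) ` V) (r + v \<bullet> z i))"
 unfolding iid_copies_def
 using J V z dis flows_independent[of J "%i. (+) (z i) ` V"] flow_translate_law flow_nonneg by auto

end

section \<open>Tiling a rectangle by integer translates of another one\<close>

definition round_point :: "real^'d => real^'d" where
 "round_point w = (\<chi> i. of_int (round (w $ i)))"

lemma round_point: "round_point w \<in> integer_points" "norm (round_point w - w) <= real CARD('d)"
 for w :: "real^'d"
proof -
 show "round_point w \<in> integer_points" by (simp add: round_point_def integer_points_def)
 have "norm (round_point w - w) <= (\<Sum>i\<in>UNIV. \<bar>(round_point w - w) $ i\<bar>)" by (rule norm_le_l1_cart)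
 also have "... <= (\<Sum>i\<in>(UNIV :: 'd set). 1)"
 proof (rule sum_mono)
  fix i show "\<bar>(round_point w - w) $ i\<bar> <= 1"
   using of_int_round_abs_le[of "w $ i"] by (simp add: round_point_def)
 qed
 finally show "norm (round_point w - w) <= real CARD('d)" by simp
qed

text \<open>An integer vector close to the point with given coordinates in the frame \<open>P\<close>.\<close>

definition integer_near :: "(real^'d => real^'d) => ('d => real) => real^'d" where
 "integer_near P x = round_point (inv P (\<chi> k. x k))"

lemma integer_near:
 fixes P :: "real^'d => real^'d"
 assumes P: "orthogonal_transformation P"
 shows "integer_near P x \<in> integer_points" "\<bar>P (integer_near P x) $ k - x k\<bar> <= cell_margin TYPE('d)"
proof -
 show "integer_near P x \<in> integer_points" by (simp add: integer_near_def round_point)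
 let ?w = "inv P (\<chi> k. x k)"
 have "P ?w = (\<chi> k. x k)" using orthogonal_transformation_surj[OF P] by (rule surj_f_inv_f)
 then have "\<bar>P (integer_near P x) $ k - x k\<bar> = \<bar>P (integer_near P x) $ k - P ?w $ k\<bar>" by simp
 also have "... <= dist (integer_near P x) ?w" by (rule frame_dist[OF P])
 also have "... <= real CARD('d)" unfolding integer_near_def dist_norm by (rule round_point)
 finally show "\<bar>P (integer_near P x) $ k - x k\<bar> <= cell_margin TYPE('d)" by (simp add: cell_margin_def)
qed

lemma prism_height_shift:
 fixes P Q :: "real^'d => real^'d"
 assumes Q: "orthogonal_transformation Q" "Q v = axis j 1"
 shows "x + s *\<^sub>R v \<in> prism Q j lo hi \<longleftrightarrow> x \<in> prism Q j lo hi"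
proof -
 have lin: "linear Q" using Q(1) by (simp add: orthogonal_transformation_linear)
 have "Q (x + s *\<^sub>R v) $ i = Q x $ i" if "i ~= j" for i
  using that by (simp add: linear_add[OF lin] linear_cmul[OF lin] Q(2) axis_def)
 then show ?thesis by (auto simp: prism_def)
qed

definition tile_spacing :: "real => ('d => real) => ('d => real) => 'd => real" where
 "tile_spacing dl a b k = b k - a k + 4*dl"

context
 fixes P Q :: "real^'d => real^'d" and v :: "real^'d" and j :: 'd
  and a b lo hi off :: "'d => real" and dl :: real
 assumes P: "orthogonal_transformation P" "P v = axis j 1"
  and Q: "orthogonal_transformation Q" "Q v = axis j 1"
  and dl: "dl = cell_margin TYPE('d)"
  and ab: "!!k. k ~= j ==> a k + 2*dl <= b k"
begin

lemma dl_pos: "1 < dl" by (simp add: dl cell_margin_def)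

abbreviation spacing :: "'d => real" where "spacing == tile_spacing dl a b"

lemma spacing_pos: "k ~= j ==> 0 < spacing k" using ab[of k] dl_pos by (simp add: tile_spacing_def)

text \<open>A cell exceeds the tile by twice the rounding error on every side, so that the tile stays inside
  when it moves to an integer position.\<close>

definition cell :: "('d => int) => (real^'d) set" where
 "cell l = prism P j (%k. a k + off k + spacing k * of_int (l k) - 2*dl)
   (%k. a k + off k + spacing k * of_int (l k) - 2*dl + spacing k)"

definition tile_pos :: "real => ('d => int) => real^'d" where
 "tile_pos \<rho> l = integer_near P (%k. if k = j then \<rho> else off k + spacing k * of_int (l k))"

definition tile :: "real => ('d => int) => (real^'d) set" where
 "tile \<rho> l = prism P j (%k. a k + P (tile_pos \<rho> l) $ k) (%k. b k + P (tile_pos \<rho> l) $ k)"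

definition tile_indices :: "('d => int) set" where
 "tile_indices = {l. l j = 0 & cell l \<subseteq> prism Q j (%k. lo k + 1) (%k. hi k - 1)}"

lemma tile_pos:
 "tile_pos \<rho> l \<in> integer_points"
 "k ~= j ==> \<bar>P (tile_pos \<rho> l) $ k - (off k + spacing k * of_int (l k))\<bar> <= dl"
 "\<bar>v \<bullet> tile_pos \<rho> l - \<rho>\<bar> <= dl"
proof -
 let ?x = "%k. if k = j then \<rho> else off k + spacing k * of_int (l k)"
 note near = integer_near(2)[OF P(1), of ?x, folded dl tile_pos_def]
 show "tile_pos \<rho> l \<in> integer_points" unfolding tile_pos_def by (rule integer_near(1)[OF P(1)])
 show "\<bar>P (tile_pos \<rho> l) $ k - (off k + spacing k * of_int (l k))\<bar> <= dl" if "k ~= j"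
  using near[of k] that by simp
 show "\<bar>v \<bullet> tile_pos \<rho> l - \<rho>\<bar> <= dl"
  using near[of j] axis_frame[OF P, of "tile_pos \<rho> l"] by simp
qed

lemma tile_in_cell: "tile \<rho> l \<subseteq> cell l"
 unfolding tile_def cell_def
proof (rule prism_mono)
 fix k assume "k ~= j"
 from tile_pos(2)[OF this, of \<rho> l] show
  "a k + off k + spacing k * of_int (l k) - 2*dl <= a k + P (tile_pos \<rho> l) $ k"
  "b k + P (tile_pos \<rho> l) $ k <= a k + off k + spacing k * of_int (l k) - 2*dl + spacing k"
  using dl_pos by (auto simp: tile_spacing_def abs_le_iff)
qed

lemma tiles_disjoint:
 assumes "l j = l' j" "l ~= l'"
 shows "tile \<rho> l \<inter> tile \<rho> l' = {}"
proof -
 obtain k where k: "l k ~= l' k" using assms(2) by blast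
 then have kj: "k ~= j" using assms(1) by auto
 have *: False if lt: "m k < m' k" and x: "x \<in> tile \<rho> m" "x \<in> tile \<rho> m'" for m m' x
 proof -
  have "P x $ k <= b k + P (tile_pos \<rho> m) $ k" "a k + P (tile_pos \<rho> m') $ k <= P x $ k"
   using x kj by (auto simp: tile_def prism_def)
  moreover have "P (tile_pos \<rho> m) $ k <= off k + spacing k * of_int (m k) + dl"
    "off k + spacing k * of_int (m' k) - dl <= P (tile_pos \<rho> m') $ k"
   using tile_pos(2)[OF kj, of \<rho> m] tile_pos(2)[OF kj, of \<rho> m'] by (auto simp: abs_le_iff)
  moreover have "spacing k * of_int (m k) + spacing k <= spacing k * of_int (m' k)"
  proof -
   have "real_of_int (m k) + 1 <= of_int (m' k)" using lt by linarith
   then have "spacing k*(real_of_int (m k) + 1) <= spacing k * of_int (m' k)"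
    using spacing_pos[OF kj] by (intro mult_left_mono) auto
   then show ?thesis by (simp add: distrib_left)
  qed
  ultimately show False using dl_pos by (simp add: tile_spacing_def)
 qed
 show ?thesis
 proof (rule ccontr)
  assume "tile \<rho> l \<inter> tile \<rho> l' ~= {}"
  then obtain x where x: "x \<in> tile \<rho> l" "x \<in> tile \<rho> l'" by blast
  show False using *[of l l' x] *[of l' l x] x k by (meson linorder_neqE)
 qed
qed

lemma tile_in_rect: "l \<in> tile_indices ==> tile \<rho> l \<subseteq> prism Q j lo hi"
 using tile_in_cell[of \<rho> l] prism_mono[of j lo "%k. lo k + 1" "%k. hi k - 1" hi Q]
 unfolding tile_indices_def by auto

lemma finite_tiles_volume:
 assumes F: "finite F" "F \<subseteq> tile_indices" and le: "!!k. k ~= j ==> lo k <= hi k"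
 shows "real (card F)*(\<Prod>k\<in>-{j}. b k - a k) <= (\<Prod>k\<in>-{j}. hi k - lo k)"
proof -
 let ?T = "%l. slab P v j (%k. a k + P (tile_pos 0 l) $ k) (%k. b k + P (tile_pos 0 l) $ k) 0 (1/2)"
 have le': "a k + P (tile_pos 0 l) $ k <= b k + P (tile_pos 0 l) $ k" if "k ~= j" for k l
  using ab[OF that] dl_pos by simp
 have T: "?T l \<in> sets borel" "emeasure lborel (?T l) = ennreal (\<Prod>k\<in>-{j}. b k - a k)" for l
  using slab_volume(1,2)[OF P le'[of _ l], where w = "1/2" and r = 0] by simp_all
 have R: "slab Q v j lo hi 0 (1/2) \<in> sets borel"
   "emeasure lborel (slab Q v j lo hi 0 (1/2)) = ennreal (\<Prod>k\<in>-{j}. hi k - lo k)"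
  using slab_volume(1,2)[OF Q le, where w = "1/2" and r = 0] by simp_all
 have p0: "0 <= (\<Prod>k\<in>-{j}. b k - a k)" "0 <= (\<Prod>k\<in>-{j}. hi k - lo k)"
  using ab dl_pos le by (force intro!: prod_nonneg)+
 have "ennreal (real (card F)*(\<Prod>k\<in>-{j}. b k - a k)) = (\<Sum>l\<in>F. emeasure lborel (?T l))"
  using p0 by (simp add: T ennreal_mult' ennreal_of_nat_eq_real_of_nat)
 also have "... = emeasure lborel (\<Union>l\<in>F. ?T l)"
 proof (intro sum_emeasure F(1))
  show "disjoint_family_on ?T F"
   unfolding disjoint_family_on_def
  proof (intro ballI impI)
   fix l l' assume "l \<in> F" "l' \<in> F" "l ~= l'"
   then have "l \<in> tile_indices" "l' \<in> tile_indices" using F(2) by auto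
   then have "tile 0 l \<inter> tile 0 l' = {}" using \<open>l ~= l'\<close>
    by (intro tiles_disjoint) (simp_all add: tile_indices_def)
   then show "?T l \<inter> ?T l' = {}" by (auto simp: slab_def tile_def)
  qed
 qed (use T in auto)
 also have "... <= emeasure lborel (slab Q v j lo hi 0 (1/2))"
  using tile_in_rect[of _ 0] F(2) R(1) by (intro emeasure_mono) (auto simp: slab_def tile_def)
 finally show ?thesis unfolding R(2) using p0 by (simp add: ennreal_le_iff)
qed

lemma sides_prod_pos: "0 < (\<Prod>k\<in>-{j}. b k - a k)"
 using ab dl_pos by (intro prod_pos) force

lemma finite_tile_indices:
 assumes le: "!!k. k ~= j ==> lo k <= hi k"
 shows "finite tile_indices"
proof (rule ccontr)
 assume inf: "infinite tile_indices"
 obtain n :: nat where n: "(\<Prod>k\<in>-{j}. hi k - lo k)/(\<Prod>k\<in>-{j}. b k - a k) < real n"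
  using reals_Archimedean2 by blast
 obtain F where F: "finite F" "F \<subseteq> tile_indices" "card F = n"
  using infinite_arbitrarily_large[OF inf] by blast
 have "real n*(\<Prod>k\<in>-{j}. b k - a k) <= (\<Prod>k\<in>-{j}. hi k - lo k)"
  using finite_tiles_volume[OF F(1,2) le] F(3) by simp
 with n sides_prod_pos show False by (simp add: field_simps)
qed

lemma cells_cover:
 assumes y: "y \<in> prism Q j (%k. lo k + (1 + (\<Sum>k\<in>-{j}. spacing k))) (%k. hi k - (1 + (\<Sum>k\<in>-{j}. spacing k)))"
 shows "\<exists>l\<in>tile_indices. y \<in> cell l"
proof -
 define l where "l k = (if k = j then 0 else \<lfloor>(P y $ k - a k - off k + 2*dl)/spacing k\<rfloor>)" for k
 have ycell: "y \<in> cell l"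
  unfolding cell_def prism_def
 proof (intro CollectI allI impI)
  fix k assume k: "k ~= j"
  let ?q = "(P y $ k - a k - off k + 2*dl)/spacing k"
  have "of_int (l k) <= ?q" "?q <= of_int (l k) + 1" using k by (simp_all add: l_def)
  then have "spacing k * of_int (l k) <= spacing k*?q" "spacing k*?q <= spacing k*(of_int (l k) + 1)"
   using spacing_pos[OF k] by (intro mult_left_mono; simp)+
  moreover have "spacing k*?q = P y $ k - a k - off k + 2*dl" using spacing_pos[OF k] by simp
  ultimately show "a k + off k + spacing k * of_int (l k) - 2*dl <= P y $ k &
    P y $ k <= a k + off k + spacing k * of_int (l k) - 2*dl + spacing k"
   by (simp add: distrib_left)
 qed
 have "cell l \<subseteq> prism Q j (%k. lo k + 1) (%k. hi k - 1)"
 proof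
  fix x assume x: "x \<in> cell l"
  define x' where "x' = x + (v \<bullet> y - v \<bullet> x) *\<^sub>R v"
  have vv: "v \<bullet> v = 1" using axis_frame[OF P, of v] P(2) by simp
  have x': "x' \<in> cell l" using x unfolding x'_def cell_def by (simp add: prism_height_shift[OF P])
  have hx: "v \<bullet> x' = v \<bullet> y" by (simp add: x'_def inner_right_distrib vv)
  have "dist x' y = norm (P (x' - y))" using P(1) by (simp add: orthogonal_transformation_norm dist_norm)
  also have "... <= (\<Sum>k\<in>UNIV. \<bar>P (x' - y) $ k\<bar>)" by (rule norm_le_l1_cart)
  also have "... = (\<Sum>k\<in>-{j}. \<bar>P (x' - y) $ k\<bar>)"
   using hx axis_frame[OF P, of "x' - y"] by (intro sum.mono_neutral_right) (auto simp: inner_diff_right)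
  also have "... <= (\<Sum>k\<in>-{j}. spacing k)"
  proof (rule sum_mono)
   fix k assume k: "k \<in> -{j}"
   have lin: "linear P" using P(1) by (simp add: orthogonal_transformation_linear)
   show "\<bar>P (x' - y) $ k\<bar> <= spacing k"
    using x' ycell k unfolding linear_diff[OF lin] cell_def prism_def by (auto simp: abs_le_iff dest!: spec[of _ k])
  qed
  finally have d: "dist y x' <= (\<Sum>k\<in>-{j}. spacing k)" by (simp add: dist_commute)
  have "y \<in> prism Q j (%k. (lo k + 1) + (\<Sum>k\<in>-{j}. spacing k)) (%k. (hi k - 1) - (\<Sum>k\<in>-{j}. spacing k))"
   using y by (simp add: prism_def algebra_simps)
  from prism_near'[OF Q(1) this d] have "x' \<in> prism Q j (%k. lo k + 1) (%k. hi k - 1)" .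
  then show "x \<in> prism Q j (%k. lo k + 1) (%k. hi k - 1)"
   unfolding x'_def by (simp add: prism_height_shift[OF Q])
 qed
 then have "l \<in> tile_indices" by (simp add: tile_indices_def l_def)
 with ycell show ?thesis by blast
qed

text \<open>The cells that meet the rectangle shrunk by their size lie inside the rectangle, so the cells
  inside fill the shrunk rectangle.\<close>

lemma tile_count_lower:
 assumes le: "!!k. k ~= j ==> lo k + 2*(1 + (\<Sum>k\<in>-{j}. spacing k)) <= hi k"
 shows "(\<Prod>k\<in>-{j}. hi k - lo k - 2*(1 + (\<Sum>k\<in>-{j}. spacing k)))
  <= real (card tile_indices)*(\<Prod>k\<in>-{j}. spacing k)"
proof -
 let ?s = "1 + (\<Sum>k\<in>-{j}. spacing k)"
 have s0: "0 <= ?s" using spacing_pos by (intro add_nonneg_nonneg sum_nonneg) (auto simp: less_imp_le)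
 have le0: "lo k <= hi k" if "k ~= j" for k using le[OF that] s0 by simp
 have fin: "finite tile_indices" by (rule finite_tile_indices[OF le0])
 let ?R = "slab Q v j (%k. lo k + ?s) (%k. hi k - ?s) 0 (1/2)"
 let ?C = "%l. slab P v j (%k. a k + off k + spacing k * of_int (l k) - 2*dl)
   (%k. a k + off k + spacing k * of_int (l k) - 2*dl + spacing k) 0 (1/2)"
 have le1: "lo k + ?s <= hi k - ?s" if "k ~= j" for k using le[OF that] by simp
 have le2: "a k + off k + spacing k * of_int (l k) - 2*dl <= a k + off k + spacing k * of_int (l k) - 2*dl + spacing k"
  if "k ~= j" for k l using spacing_pos[OF that] by simp
 have R: "emeasure lborel ?R = ennreal (\<Prod>k\<in>-{j}. hi k - lo k - 2*?s)"
 proof -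
  have "emeasure lborel ?R = ennreal (2*(1/2)*(\<Prod>k\<in>-{j}. (hi k - ?s) - (lo k + ?s)))"
   by (rule slab_volume(2)[OF Q le1]) auto
  then show ?thesis by (simp add: algebra_simps)
 qed
 have C: "?C l \<in> sets borel" "emeasure lborel (?C l) = ennreal (\<Prod>k\<in>-{j}. spacing k)" for l
  using slab_volume(1,2)[OF P le2[of _ l], where w = "1/2" and r = 0] by simp_all
 have p0: "0 <= (\<Prod>k\<in>-{j}. spacing k)" using spacing_pos by (intro prod_nonneg) (auto simp: less_imp_le)
 have "emeasure lborel ?R <= emeasure lborel (\<Union>l\<in>tile_indices. ?C l)"
 proof (rule emeasure_mono)
  show "?R \<subseteq> (\<Union>l\<in>tile_indices. ?C l)"
   using cells_cover by (fastforce simp: slab_def cell_def)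
  show "(\<Union>l\<in>tile_indices. ?C l) \<in> sets lborel" using fin C(1) by auto
 qed
 also have "... <= (\<Sum>l\<in>tile_indices. emeasure lborel (?C l))"
  using fin C(1) by (intro emeasure_subadditive_finite) auto
 also have "... = ennreal (real (card tile_indices)*(\<Prod>k\<in>-{j}. spacing k))"
  using p0 by (simp add: C ennreal_mult' ennreal_of_nat_eq_real_of_nat)
 finally show ?thesis unfolding R using p0 by (simp add: ennreal_le_iff)
qed

lemma tile_indices_bounds:
 assumes PQ: "P = Q" and l: "l j = 0"
 shows "l \<in> tile_indices \<longleftrightarrow> (\<forall>k. k ~= j --> lo k + 1 <= a k + off k + spacing k * of_int (l k) - 2*dl &
   a k + off k + spacing k * of_int (l k) - 2*dl + spacing k <= hi k - 1)" (is "_ \<longleftrightarrow> ?B")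
proof
 assume ?B
 then have "cell l \<subseteq> prism P j (%k. lo k + 1) (%k. hi k - 1)"
  unfolding cell_def by (intro prism_mono) auto
 then have "cell l \<subseteq> prism Q j (%k. lo k + 1) (%k. hi k - 1)"
  by (simp only: PQ[symmetric])
 then show "l \<in> tile_indices" using l by (simp add: tile_indices_def)
next
 assume "l \<in> tile_indices"
 then have sub: "cell l \<subseteq> prism Q j (%k. lo k + 1) (%k. hi k - 1)" by (simp add: tile_indices_def)
 have corner: "\<forall>k. k ~= j --> lo k + 1 <= y k & y k <= hi k - 1"
  if y: "!!k. k ~= j ==> a k + off k + spacing k * of_int (l k) - 2*dl <= y k &
   y k <= a k + off k + spacing k * of_int (l k) - 2*dl + spacing k" for y
 proof -
  obtain x where x: "P x = (\<chi> k. y k)"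
   using orthogonal_transformation_surj[OF P(1)] by (metis surjD)
  then have "x \<in> cell l" using y by (simp add: cell_def prism_def)
  then have "x \<in> prism Q j (%k. lo k + 1) (%k. hi k - 1)" using sub by blast
  then show ?thesis using x by (simp add: prism_def PQ)
 qed
 have sp: "0 <= spacing k" if "k ~= j" for k using spacing_pos[OF that] by simp
 show ?B
  using corner[of "%k. a k + off k + spacing k * of_int (l k) - 2*dl"]
   corner[of "%k. a k + off k + spacing k * of_int (l k) - 2*dl + spacing k"] sp by simp
qed

lemma tile_indices_zero: "l \<in> tile_indices ==> l j = 0"
 by (simp add: tile_indices_def)

lemma tile_points:
 "lattice_points v (tile \<rho> l) (r + v \<bullet> tile_pos \<rho> l) h
  = (+) (tile_pos \<rho> l) ` lattice_points v (prism P j a b) r h"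
 unfolding tile_def by (rule lattice_points_shift[OF P(1) tile_pos(1)])

text \<open>The flow through a big cylinder is at most the sum of the flows through the tiles, of fixed
  height \<open>hT\<close>, and of the capacities near the gaps between the tiles.\<close>

lemma tiling_inequality:
 fixes r rT h hT :: real
 defines "V == lattice_points v (prism Q j lo hi) r h"
  and "T == lattice_points v (prism P j a b) rT hT"
  and "z == tile_pos (r - rT)"
 assumes le: "!!k. k ~= j ==> lo k <= hi k"
  and hT: "2*dl + 2 <= hT" and h: "hT + dl + 1 <= h"
  and c: "!!e. e \<in> lattice_edges ==> 0 <= c e"
 defines "G == interface_edges v V r tile_indices (%l. (+) (z l) ` T) (%_. dl)"
 shows "min_cut v V r c <= (\<Sum>l\<in>tile_indices. min_cut v ((+) (z l) ` T) (rT + v \<bullet> z l) c) + (\<Sum>e\<in>G. c e)"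
  "disjoint_family_on (%l. (+) (z l) ` T) tile_indices"
  "real (card G) <= lattice_degree TYPE('d) *
    interface_bound dl j (%k. hi k - lo k) tile_indices (%_ k. b k - a k) (%_. dl)"
proof -
 let ?\<rho> = "r - rT"
 have v1: "norm v = 1" by (rule frame_norm[OF P])
 have fin: "finite tile_indices" by (rule finite_tile_indices[OF le])
 have W: "(+) (z l) ` T = lattice_points v (tile ?\<rho> l) (rT + v \<bullet> z l) hT" for l
  unfolding z_def T_def by (rule tile_points[symmetric])
 have off: "\<bar>rT + v \<bullet> z l - r\<bar> <= dl" for l using tile_pos(3)[of ?\<rho> l] by (simp add: z_def algebra_simps)
 have WV: "(+) (z l) ` T \<subseteq> V" if "l \<in> tile_indices" for l
  unfolding W V_def using tile_in_rect[OF that, of ?\<rho>] off[of l] h dl_pos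
  by (force simp: lattice_points_def)
 have disT: "disjoint_family_on (tile ?\<rho>) tile_indices"
  unfolding disjoint_family_on_def by (auto simp: tile_indices_def intro!: tiles_disjoint)
 then show dis: "disjoint_family_on (%l. (+) (z l) ` T) tile_indices"
  unfolding W by (auto simp: disjoint_family_on_def lattice_points_def)
 have finV: "finite V" unfolding V_def by (rule finite_lattice_points[OF Q])
 show "min_cut v V r c <= (\<Sum>l\<in>tile_indices. min_cut v ((+) (z l) ` T) (rT + v \<bullet> z l) c) + (\<Sum>e\<in>G. c e)"
  unfolding G_def
 proof (rule min_cut_gluing[OF v1 finV _ fin WV dis off _ c])
  show "V \<subseteq> integer_points" by (auto simp: V_def lattice_points_def)
  fix l x assume l: "l \<in> tile_indices" and x: "x \<in> (+) (z l) ` T" and bv: "boundary_vertex V x"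
  obtain y where y: "y \<in> integer_points" "y \<notin> V" "{x, y} \<in> lattice_edges"
   using bv by (auto simp: boundary_vertex_def)
  have x': "x \<in> tile ?\<rho> l" "\<bar>v \<bullet> x - (rT + v \<bullet> z l)\<bar> <= hT" using x unfolding W by (auto simp: lattice_points_def)
  have "x \<in> prism Q j (%k. lo k + 1) (%k. hi k - 1)"
   using x'(1) tile_in_cell[of ?\<rho> l] l by (auto simp: tile_indices_def)
  then have "y \<in> prism Q j lo hi"
   using prism_near'[OF Q(1), of x j lo 1 hi y] lattice_edgeD(3)[OF y(3)] by simp
  moreover have "\<bar>v \<bullet> y - r\<bar> <= h"
   using height_neighbour[OF v1 y(3)] x'(2) off[of l] h by linarith
  ultimately have "y \<in> V" using y(1) by (simp add: V_def lattice_points_def)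
  with y(2) show "rT + v \<bullet> z l = r" by blast
 qed
 have "real (card (interface_edges v V r tile_indices (%l. lattice_points v (tile ?\<rho> l) (rT + v \<bullet> z l) hT) (%_. dl)))
   <= lattice_degree TYPE('d)*interface_bound dl j (%k. hi k - lo k) tile_indices
    (%l k. (b k + P (tile_pos ?\<rho> l) $ k) - (a k + P (tile_pos ?\<rho> l) $ k)) (%_. dl)"
  unfolding V_def tile_def
 proof (rule card_interface_edges[where v = v, folded dl, OF Q P fin])
  fix l assume l: "l \<in> tile_indices"
  show "prism P j (%k. a k + P (tile_pos ?\<rho> l) $ k) (%k. b k + P (tile_pos ?\<rho> l) $ k) \<subseteq> prism Q j lo hi"
   using tile_in_rect[OF l, of ?\<rho>] unfolding tile_def .
  show "\<bar>rT + v \<bullet> z l - r\<bar> <= dl" by (rule off)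
  show "a k + P (tile_pos ?\<rho> l) $ k + 2*dl <= b k + P (tile_pos ?\<rho> l) $ k" if "k ~= j" for k
   using ab[OF that] by simp
  show "2*dl + 2 <= hT" by (rule hT)
 next
  show "disjoint_family_on (%l. prism P j (%k. a k + P (tile_pos ?\<rho> l) $ k) (%k. b k + P (tile_pos ?\<rho> l) $ k)) tile_indices"
   using disT unfolding tile_def .
 qed (rule le)
 then show "real (card G) <= lattice_degree TYPE('d) *
    interface_bound dl j (%k. hi k - lo k) tile_indices (%_ k. b k - a k) (%_. dl)"
  unfolding G_def W by simp
qed

end

lemma interface_edge_height:
 assumes "norm v = 1" "e \<in> interface_edges v V r J W \<kappa>" "!!i. i \<in> J ==> W i \<subseteq> V" "!!i. i \<in> J ==> \<kappa> i <= w" "0 <= w"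
 shows "\<exists>x\<in>V. x \<in> e & \<bar>v \<bullet> x - r\<bar> <= w + 1"
proof -
 consider "e \<in> flat_edges v (V - (\<Union>i\<in>J. W i)) r" | i where "i \<in> J" "e \<in> wall_edges v V r (W i) (\<kappa> i)"
  using assms(2) by (auto simp: interface_edges_def)
 then show ?thesis
 proof cases
  case 1
  then obtain x y where "e = {x, y}" "{x, y} \<in> lattice_edges" "x \<in> V" "r < v \<bullet> x" "v \<bullet> y <= r"
   by (auto simp: flat_edges_def)
  moreover from this have "\<bar>v \<bullet> x - v \<bullet> y\<bar> <= 1" using height_neighbour[OF assms(1)] by blast
  ultimately have "x \<in> V" "x \<in> e" "\<bar>v \<bullet> x - r\<bar> <= w + 1" using assms(5) by auto
  then show ?thesis by blast
 next
  case 2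
  then obtain x y where "e = {x, y}" "x \<in> W i" "\<bar>v \<bullet> x - r\<bar> <= \<kappa> i + 1"
   by (auto simp: wall_edges_def)
  then have "x \<in> V" "x \<in> e" "\<bar>v \<bullet> x - r\<bar> <= w + 1" using assms(3,4)[OF 2(1)] by auto
  then show ?thesis by blast
 qed
qed

section \<open>The flow constant of a direction\<close>

text \<open>Orthonormal coordinates in which \<open>v\<close> is the axis \<open>j\<close>.\<close>

definition (in percolation_capacities) frame :: "(real^'d => real^'d) => bool" where
 "frame Q \<longleftrightarrow> orthogonal_transformation Q & Q v = axis j 1"

lemma tendsto_shift_ratio:
 fixes L :: "nat => real"
 assumes "filterlim L at_top sequentially"
 shows "(%n. (L n + c)/L n) \<longlonglongrightarrow> 1"
proof -
 have "(%n. 1 + c/L n) \<longlonglongrightarrow> 1 + 0"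
  by (rule tendsto_add[OF tendsto_const
     tendsto_divide_0[OF tendsto_const filterlim_at_top_imp_at_infinity[OF assms]]])
 moreover have "EV n. 1 + c/L n = (L n + c)/L n"
  using filterlim_at_top_dense[THEN iffD1, OF assms, rule_format, of 0]
  by eventually_elim (simp add: field_simps)
 ultimately show ?thesis by (simp add: tendsto_cong)
qed

context percolation_capacities
begin

definition margin :: real where "margin = cell_margin TYPE('d)"

lemma card_other_axes: "card (- {j}) = CARD('d) - 1" "1 <= card (- {j})"
proof -
 show "card (- {j}) = CARD('d) - 1" unfolding Compl_eq_Diff_UNIV by (rule card_Diff_singleton) simp
 then show "1 <= card (- {j})" using dim by simp
qed

lemma other_axis: obtains k where "k ~= j"
proof -
 have "- {j} ~= {}" using card_other_axes(2) by (intro notI) simp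
 then show ?thesis using that by blast
qed

lemma margin_gt_1: "1 < margin" by (simp add: margin_def cell_margin_def)

definition \<mu> :: real where "\<mu> = expectation (t base_edge)"

lemma \<mu>_nonneg: "0 <= \<mu>"
 unfolding \<mu>_def using base_capacity by (intro integral_nonneg_AE AE_I2) (simp add: nonneg_rv_def)

definition cylinder_points :: "(real^'d => real^'d) => ('d => real) => ('d => real) => real => real => (real^'d) set" where
 "cylinder_points Q lo hi r h = lattice_points v (prism Q j lo hi) r h"

definition cylinder_flow :: "(real^'d => real^'d) => ('d => real) => ('d => real) => real => real => 'w => real" where
 "cylinder_flow Q lo hi r h = flow (cylinder_points Q lo hi r h) r"

definition area :: "('d => real) => ('d => real) => real" where
 "area lo hi = (\<Prod>k\<in>-{j}. hi k - lo k)"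

lemma area_pos: "(!!k. k ~= j ==> lo k < hi k) ==> 0 < area lo hi"
 unfolding area_def by (intro prod_pos) auto

lemma finite_cylinder_points: "frame Q ==> finite (cylinder_points Q lo hi r h)"
 unfolding cylinder_points_def frame_def by (intro finite_lattice_points) auto

lemma cylinder_flow_rv: "frame Q ==> nonneg_rv (cylinder_flow Q lo hi r h)" "frame Q ==> integrable M (cylinder_flow Q lo hi r h)"
 unfolding cylinder_flow_def using finite_cylinder_points flow_nonneg_rv flow_integrable by blast+

lemma cylinder_flow_expectation_nonneg: "frame Q ==> 0 <= expectation (cylinder_flow Q lo hi r h)"
 using cylinder_flow_rv(1)[of Q lo hi r h] by (intro integral_nonneg_AE AE_I2) (simp add: nonneg_rv_def)

definition tiles where
 "tiles P Q a b lo hi off = tile_indices P Q j a b lo hi off margin"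

definition tile_shift where
 "tile_shift P a b off \<rho> = tile_pos P j a b off margin \<rho>"

definition tile_flow where
 "tile_flow P a b off rT hT r l = flow ((+) (tile_shift P a b off (r - rT) l) ` cylinder_points P a b rT hT)
   (rT + v \<bullet> tile_shift P a b off (r - rT) l)"

definition gap_edges where
 "gap_edges P Q a b lo hi off rT hT r h = interface_edges v (cylinder_points Q lo hi r h) r (tiles P Q a b lo hi off)
   (%l. (+) (tile_shift P a b off (r - rT) l) ` cylinder_points P a b rT hT) (%_. margin)"

text \<open>The number of gap edges per unit area, in the limit of large rectangles, for tiles with sides
  \<open>s\<close>.\<close>

definition tile_error :: "('d => real) => real" where
 "tile_error s = lattice_degree TYPE('d) *
   (2*margin*(1 - (\<Prod>k\<in>-{j}. (s k - 2*margin)/(s k + 4*margin)))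
   + 4*margin*((\<Prod>k\<in>-{j}. (s k + 2*margin)/s k) - (\<Prod>k\<in>-{j}. (s k - 2*margin)/s k)))"

context
 fixes P Q :: "real^'d => real^'d" and a b off :: "'d => real"
 assumes P: "frame P" and Q: "frame Q" and ab: "!!k. k ~= j ==> a k + 2*margin <= b k"
begin

lemmas P' = P[unfolded frame_def, THEN conjunct1] P[unfolded frame_def, THEN conjunct2]
lemmas Q' = Q[unfolded frame_def, THEN conjunct1] Q[unfolded frame_def, THEN conjunct2]

lemma finite_tiles: "(!!k. k ~= j ==> lo k <= hi k) ==> finite (tiles P Q a b lo hi off)"
 unfolding tiles_def by (rule finite_tile_indices[OF P' Q' margin_def ab])

lemma card_tiles_le:
 "(!!k. k ~= j ==> lo k <= hi k) ==> real (card (tiles P Q a b lo hi off))*area a b <= area lo hi"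
proof -
 assume le: "!!k. k ~= j ==> lo k <= hi k"
 show ?thesis
  unfolding tiles_def area_def
 proof (rule finite_tiles_volume[OF P' Q' margin_def _ _ subset_refl])
  show "finite (tile_indices P Q j a b lo hi off margin)" using finite_tiles[OF le] by (simp add: tiles_def)
 qed (use ab le in auto)
qed

context
 fixes lo hi :: "'d => real" and rT hT r h :: real
 assumes le: "!!k. k ~= j ==> lo k <= hi k" and hT: "2*margin + 2 <= hT" and h: "hT + margin + 1 <= h"
begin

lemma cylinder_flow_tiling:
 assumes "w \<in> space M"
 shows "cylinder_flow Q lo hi r h w
  <= (\<Sum>l\<in>tiles P Q a b lo hi off. tile_flow P a b off rT hT r l w)
   + (\<Sum>e\<in>gap_edges P Q a b lo hi off rT hT r h. t e w)"
 unfolding cylinder_flow_def tiles_def tile_flow_def gap_edges_def tile_shift_def flow_def cylinder_points_def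
 by (rule tiling_inequality(1)[OF P' Q' margin_def ab le hT h]) (use capacity_nonneg assms in auto)

lemma tile_flows_iid:
 "iid_copies (cylinder_flow P a b rT hT) (tiles P Q a b lo hi off) (tile_flow P a b off rT hT r)"
 unfolding cylinder_flow_def tile_flow_def
proof (rule flows_iid[OF finite_tiles[OF le] finite_cylinder_points[OF P]])
 show "tile_shift P a b off (r - rT) l \<in> integer_points" for l
  unfolding tile_shift_def by (rule tile_pos(1)[OF P' Q' margin_def ab])
 show "disjoint_family_on (%l. (+) (tile_shift P a b off (r - rT) l) ` cylinder_points P a b rT hT) (tiles P Q a b lo hi off)"
  unfolding tiles_def tile_shift_def cylinder_points_def
  by (rule tiling_inequality(2)[OF P' Q' margin_def ab le hT h, where c = "%_. 0"]) auto
qed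

lemma gap_edges_card:
 "real (card (gap_edges P Q a b lo hi off rT hT r h)) <= lattice_degree TYPE('d) *
   (2*margin*((\<Prod>k\<in>-{j}. hi k - lo k + 2*margin) - real (card (tiles P Q a b lo hi off))*(\<Prod>k\<in>-{j}. b k - a k - 2*margin))
   + real (card (tiles P Q a b lo hi off))*(4*margin*((\<Prod>k\<in>-{j}. b k - a k + 2*margin) - (\<Prod>k\<in>-{j}. b k - a k - 2*margin))))"
proof -
 have "real (card (gap_edges P Q a b lo hi off rT hT r h)) <= lattice_degree TYPE('d) *
   interface_bound margin j (%k. hi k - lo k) (tiles P Q a b lo hi off) (%_ k. b k - a k) (%_. margin)"
  unfolding gap_edges_def tiles_def tile_shift_def cylinder_points_def
  by (rule tiling_inequality(3)[OF P' Q' margin_def ab le hT h, where c = "%_. 0"]) auto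
 then show ?thesis by (simp add: interface_bound_def)
qed

lemma gap_edges_sub: "gap_edges P Q a b lo hi off rT hT r h \<subseteq> lattice_edges"
 by (auto simp: gap_edges_def interface_edges_def flat_edges_def wall_edges_def)

lemma tile_points_sub:
 assumes l: "l \<in> tiles P Q a b lo hi off"
 shows "(+) (tile_shift P a b off (r - rT) l) ` cylinder_points P a b rT hT \<subseteq> cylinder_points Q lo hi r h"
proof -
 have eq: "(+) (tile_shift P a b off (r - rT) l) ` cylinder_points P a b rT hT
   = lattice_points v (tile P j a b off margin (r - rT) l) (rT + v \<bullet> tile_shift P a b off (r - rT) l) hT"
  unfolding tile_shift_def cylinder_points_def by (rule tile_points[OF P' Q' margin_def ab, symmetric])
 have "tile P j a b off margin (r - rT) l \<subseteq> prism Q j lo hi"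
  by (rule tile_in_rect[OF P' Q' margin_def ab]) (use l in \<open>auto simp: tiles_def\<close>)
 moreover have "\<bar>v \<bullet> tile_shift P a b off (r - rT) l - (r - rT)\<bar> <= margin"
  unfolding tile_shift_def by (rule tile_pos(3)[OF P' Q' margin_def ab])
 ultimately show ?thesis
  unfolding eq unfolding cylinder_points_def using h margin_gt_1 by (force simp: lattice_points_def)
qed

lemma finite_gap_edges: "finite (gap_edges P Q a b lo hi off rT hT r h)"
proof (rule finite_subset)
 show "gap_edges P Q a b lo hi off rT hT r h \<subseteq> Pow (cylinder_points Q lo hi r h)"
  using tile_points_sub unfolding gap_edges_def interface_edges_def flat_edges_def wall_edges_def by fast
qed (use finite_cylinder_points[OF Q] in simp)

end

text \<open>The walls contribute in proportion to the number of tiles, and the tiles with their margins fill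
  the rectangle asymptotically.\<close>

lemma gap_edges_asymptotic:
 fixes lo hi :: "nat => 'd => real" and r h :: "nat => real"
 assumes grow: "!!k. k ~= j ==> filterlim (%n. hi n k - lo n k) at_top sequentially"
  and h: "filterlim h at_top sequentially" and hT: "2*margin + 2 <= hT"
  and \<eta>: "tile_error (%k. b k - a k) < \<eta>"
 shows "EV n.
  real (card (gap_edges P Q a b (lo n) (hi n) off rT hT (r n) (h n))) <= \<eta>*area (lo n) (hi n)"
proof -
 let ?D = "lattice_degree TYPE('d)"
 define s where "s k = b k - a k" for k
 define \<sigma> where "\<sigma> k = s k + 4*margin" for k
 have spc: "tile_spacing margin a b = \<sigma>" by (auto simp: tile_spacing_def \<sigma>_def s_def)
 have s: "2*margin <= s k" if "k ~= j" for k using ab[OF that] by (simp add: s_def)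
 have s0: "0 < s k" "0 < \<sigma> k" if "k ~= j" for k using s[OF that] margin_gt_1 by (auto simp: \<sigma>_def)
 define S where "S = 1 + (\<Sum>k\<in>-{j}. \<sigma> k)"
 have S: "0 < S" unfolding S_def using s0(2) by (intro add_pos_nonneg sum_nonneg) (auto simp: less_imp_le)
 define L where "L n k = hi n k - lo n k" for n k
 define u where "u n = 2*margin*((\<Prod>k\<in>-{j}. (L n k + 2*margin)/L n k)
   - (\<Prod>k\<in>-{j}. (L n k + (- 2*S))/L n k)*(\<Prod>k\<in>-{j}. (s k - 2*margin)/\<sigma> k))
  + 4*margin*((\<Prod>k\<in>-{j}. (s k + 2*margin)/s k) - (\<Prod>k\<in>-{j}. (s k - 2*margin)/s k))" for n
 have "(%n. ?D*u n) \<longlonglongrightarrow> ?D*(2*margin*((\<Prod>k\<in>-{j}. 1)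
   - (\<Prod>k\<in>-{j}. 1)*(\<Prod>k\<in>-{j}. (s k - 2*margin)/\<sigma> k))
  + 4*margin*((\<Prod>k\<in>-{j}. (s k + 2*margin)/s k) - (\<Prod>k\<in>-{j}. (s k - 2*margin)/s k)))"
  unfolding u_def
  by (intro tendsto_mult tendsto_add tendsto_diff tendsto_const tendsto_prod tendsto_shift_ratio)
   (use grow in \<open>auto simp: L_def\<close>)
 then have "(%n. ?D*u n) \<longlonglongrightarrow> tile_error s"
  by (simp add: tile_error_def \<sigma>_def)
 then have "EV n. ?D*u n < \<eta>"
  using \<eta> unfolding s_def[symmetric] by (intro order_tendstoD)
 moreover have "EV n. \<forall>k\<in>-{j}. 2*S <= L n k"
  using grow by (subst eventually_ball_finite_distrib) (auto simp: L_def filterlim_at_top)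
 moreover have "EV n. hT + margin + 1 <= h n"
  using h by (simp add: filterlim_at_top)
 ultimately show ?thesis
 proof eventually_elim
  case (elim n)
  let ?J = "tiles P Q a b (lo n) (hi n) off"
  have L: "2*S <= L n k" "0 < L n k" if "k ~= j" for k using elim(2) that S by force+
  have le: "lo n k <= hi n k" if "k ~= j" for k using L(2)[OF that] by (simp add: L_def)
  have A: "area (lo n) (hi n) = (\<Prod>k\<in>-{j}. L n k)" by (simp add: area_def L_def)
  have A0: "0 < (\<Prod>k\<in>-{j}. L n k)" using L by (intro prod_pos) auto
  have ps: "0 < (\<Prod>k\<in>-{j}. s k)" "0 < (\<Prod>k\<in>-{j}. \<sigma> k)" using s0 by (auto intro!: prod_pos)
  have p1: "0 <= (\<Prod>k\<in>-{j}. s k - 2*margin)" using s by (intro prod_nonneg) auto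
  have p2: "(\<Prod>k\<in>-{j}. s k - 2*margin) <= (\<Prod>k\<in>-{j}. s k + 2*margin)" using s margin_gt_1 by (intro prod_mono) auto
  have up: "real (card ?J)*(\<Prod>k\<in>-{j}. s k) <= (\<Prod>k\<in>-{j}. L n k)"
   using card_tiles_le[OF le] by (simp add: area_def s_def L_def)
  have low: "(\<Prod>k\<in>-{j}. L n k - 2*S) <= real (card ?J)*(\<Prod>k\<in>-{j}. \<sigma> k)"
  proof -
   have "(\<Prod>k\<in>-{j}. hi n k - lo n k - 2*(1 + (\<Sum>k\<in>-{j}. tile_spacing margin a b k)))
     <= real (card (tile_indices P Q j a b (lo n) (hi n) off margin))*(\<Prod>k\<in>-{j}. tile_spacing margin a b k)"
    by (rule tile_count_lower[OF P' Q' margin_def ab])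
     (use L in \<open>auto simp: spc S_def[symmetric] L_def algebra_simps\<close>)
   then show ?thesis by (simp add: spc S_def[symmetric] L_def tiles_def)
  qed
  have e1: "(\<Prod>k\<in>-{j}. L n k - 2*S)/(\<Prod>k\<in>-{j}. \<sigma> k)*(\<Prod>k\<in>-{j}. s k - 2*margin)
    <= real (card ?J)*(\<Prod>k\<in>-{j}. s k - 2*margin)"
   using low ps p1 by (intro mult_right_mono) (auto simp: field_simps)
  have e2: "real (card ?J) <= (\<Prod>k\<in>-{j}. L n k)/(\<Prod>k\<in>-{j}. s k)"
   using up ps by (simp add: field_simps)
  have "real (card (gap_edges P Q a b (lo n) (hi n) off rT hT (r n) (h n))) <= ?D *
   (2*margin*((\<Prod>k\<in>-{j}. L n k + 2*margin) - real (card ?J)*(\<Prod>k\<in>-{j}. s k - 2*margin))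
   + real (card ?J)*(4*margin*((\<Prod>k\<in>-{j}. s k + 2*margin) - (\<Prod>k\<in>-{j}. s k - 2*margin))))"
   using gap_edges_card[OF le hT elim(3), where rT = rT and r = "r n"] by (simp add: L_def s_def)
  also have "... <= ?D*(2*margin*((\<Prod>k\<in>-{j}. L n k + 2*margin)
     - (\<Prod>k\<in>-{j}. L n k - 2*S)/(\<Prod>k\<in>-{j}. \<sigma> k)*(\<Prod>k\<in>-{j}. s k - 2*margin))
   + (\<Prod>k\<in>-{j}. L n k)/(\<Prod>k\<in>-{j}. s k)*(4*margin*((\<Prod>k\<in>-{j}. s k + 2*margin) - (\<Prod>k\<in>-{j}. s k - 2*margin))))"
  proof (rule mult_left_mono[OF add_mono lattice_degree_nonneg])
   show "2*margin*((\<Prod>k\<in>-{j}. L n k + 2*margin) - real (card ?J)*(\<Prod>k\<in>-{j}. s k - 2*margin))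
    <= 2*margin*((\<Prod>k\<in>-{j}. L n k + 2*margin)
     - (\<Prod>k\<in>-{j}. L n k - 2*S)/(\<Prod>k\<in>-{j}. \<sigma> k)*(\<Prod>k\<in>-{j}. s k - 2*margin))"
    using margin_gt_1 by (intro mult_left_mono diff_left_mono e1) auto
   show "real (card ?J)*(4*margin*((\<Prod>k\<in>-{j}. s k + 2*margin) - (\<Prod>k\<in>-{j}. s k - 2*margin)))
    <= (\<Prod>k\<in>-{j}. L n k)/(\<Prod>k\<in>-{j}. s k)*(4*margin*((\<Prod>k\<in>-{j}. s k + 2*margin) - (\<Prod>k\<in>-{j}. s k - 2*margin)))"
    using p2 margin_gt_1 by (intro mult_right_mono e2) auto
  qed
  also have "... = (?D*u n)*(\<Prod>k\<in>-{j}. L n k)"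
  proof -
   have gen: "D*(2*m*(A - B/g*c) + l/p*(4*m*(e - c)))
     = D*(2*m*(A/l - B/l*(c/g)) + 4*m*(e/p - c/p))*l"
    if "l ~= 0" "g ~= 0" "p ~= 0" for A B c e g l p m D :: real
    using that by (simp add: field_simps)
   have neg: "L n k + (- 2*S) = L n k - 2*S" for k by simp
   show ?thesis unfolding u_def neg prod_dividef by (rule gen) (use A0 ps in linarith)+
  qed
  also have "... <= \<eta>*(\<Prod>k\<in>-{j}. L n k)" using elim(1) A0 by (intro mult_right_mono) auto
  finally show ?case unfolding A .
 qed
qed

end

lemma tile_error_tendsto:
 assumes "!!k. k ~= j ==> filterlim (%m. s m k) at_top sequentially"
 shows "(%m. tile_error (s m)) \<longlonglongrightarrow> 0"
proof -
 have r: "(%m. (s m k - 2*margin)/(s m k + 4*margin)) \<longlonglongrightarrow> 1" if k: "k ~= j" for k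
 proof -
  have "filterlim (%m. s m k + 4*margin) at_top sequentially"
   using filterlim_tendsto_add_at_top[OF tendsto_const assms[OF k], of "4*margin"] by (simp add: add.commute)
  from tendsto_shift_ratio[OF this, of "- 6*margin"] show ?thesis by simp
 qed
 have r1: "(%m. (s m k + 2*margin)/s m k) \<longlonglongrightarrow> 1" "(%m. (s m k - 2*margin)/s m k) \<longlonglongrightarrow> 1" if k: "k ~= j" for k
  using tendsto_shift_ratio[OF assms[OF k], of "2*margin"] tendsto_shift_ratio[OF assms[OF k], of "- 2*margin"] by simp_all
 have "(%m. tile_error (s m)) \<longlonglongrightarrow> lattice_degree TYPE('d) *
   (2*margin*(1 - (\<Prod>k\<in>-{j}. 1)) + 4*margin*((\<Prod>k\<in>-{j}. 1) - (\<Prod>k\<in>-{j}. 1)))"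
  unfolding tile_error_def
  by (intro tendsto_mult tendsto_add tendsto_diff tendsto_const tendsto_prod r r1) auto
 then show ?thesis by simp
qed

definition growing :: "(nat => 'd => real) => (nat => 'd => real) => (nat => real) => bool" where
 "growing lo hi h \<longleftrightarrow> (\<forall>k. k ~= j --> filterlim (%n. hi n k - lo n k) at_top sequentially) &
   filterlim h at_top sequentially"

lemma growing_eventually:
 assumes "growing lo hi h"
 shows "EV n. (\<forall>k. k ~= j --> lo n k + B <= hi n k) & B <= h n"
proof -
 have "EV n. \<forall>k\<in>-{j}. B <= hi n k - lo n k"
  using assms by (subst eventually_ball_finite_distrib) (auto simp: growing_def filterlim_at_top)
 moreover have "EV n. B <= h n" using assms by (auto simp: growing_def filterlim_at_top)
 ultimately show ?thesis by eventually_elim (force simp: algebra_simps)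
qed

text \<open>Comparison of a large cylinder with a fixed one.  The independent flows through the tiles
  average out, and the gaps contribute a fraction of the area that vanishes for large tiles.\<close>

lemma flow_excess_over_tile:
 assumes P: "frame P" and Q: "frame Q" and ab': "\<forall>k. k ~= j --> a k + 2*margin <= b k" and hT: "2*margin + 2 <= hT"
  and grow: "growing lo hi h" and eps: "0 < eps"
 shows "EV n.
  expectation (%w. max 0 (cylinder_flow Q (lo n) (hi n) (r n) (h n) w
    - expectation (cylinder_flow P a b rT hT)/area a b*area (lo n) (hi n)))
  <= (tile_error (%k. b k - a k)*\<mu> + eps)*area (lo n) (hi n)"
proof -
 have ab: "a k + 2*margin <= b k" if "k ~= j" for k using ab' that by blast
 let ?Y = "cylinder_flow P a b rT hT" and ?off = "%_ :: 'd. 0 :: real"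
 have A0: "0 < area a b" using ab margin_gt_1 by (intro area_pos) force
 have g: "!!k. k ~= j ==> filterlim (%n. hi n k - lo n k) at_top sequentially" "filterlim h at_top sequentially"
  using grow by (auto simp: growing_def)
 define eps1 where "eps1 = eps/2*area a b"
 define eps2 where "eps2 = eps/(2*(\<mu> + 1))"
 have e: "0 < eps1" "0 < eps2" "eps2*\<mu> <= eps/2"
  using eps A0 \<mu>_nonneg by (auto simp: eps1_def eps2_def field_simps)
 obtain N0 where N0: "!!(J :: ('d => int) set) X N. iid_copies ?Y J X ==> real (card J) <= N ==> N0 <= N ==>
  expectation (%w. max 0 ((\<Sum>i\<in>J. X i w) - N*expectation ?Y)) <= eps1*N"
  using L1_law_upper[OF cylinder_flow_rv[OF P] e(1)] by blast
 define B where "B = Max {1, N0*area a b, hT + margin + 1}"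
 have B: "1 <= B" "N0*area a b <= B" "hT + margin + 1 <= B" by (auto simp: B_def)
 have "EV n. real (card (gap_edges P Q a b (lo n) (hi n) ?off rT hT (r n) (h n)))
   <= (tile_error (%k. b k - a k) + eps2)*area (lo n) (hi n)"
  by (rule gap_edges_asymptotic[OF P Q ab g hT]) (use e in auto)
 with growing_eventually[OF grow, of B] show ?thesis
 proof eventually_elim
  case (elim n)
  let ?J = "tiles P Q a b (lo n) (hi n) ?off" and ?G = "gap_edges P Q a b (lo n) (hi n) ?off rT hT (r n) (h n)"
  let ?X = "tile_flow P a b ?off rT hT (r n)"
  let ?F = "cylinder_flow Q (lo n) (hi n) (r n) (h n)"
  have L: "B <= hi n k - lo n k" if "k ~= j" for k using elim(1) that by force
  have le: "lo n k <= hi n k" if "k ~= j" for k using L[OF that] B by simp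
  have hn: "hT + margin + 1 <= h n" using elim(1) B by linarith
  define N where "N = area (lo n) (hi n)/area a b"
  have An: "B <= area (lo n) (hi n)"
  proof -
   obtain k0 where k0: "k0 ~= j" by (rule other_axis)
   have "area (lo n) (hi n) = (hi n k0 - lo n k0)*(\<Prod>k\<in>-{j} - {k0}. hi n k - lo n k)"
    unfolding area_def using k0 by (intro prod.remove) auto
   moreover have "1 <= (\<Prod>k\<in>-{j} - {k0}. hi n k - lo n k)"
    using L B by (intro prod_ge_1) force
   moreover have "B*1 <= (hi n k0 - lo n k0)*(\<Prod>k\<in>-{j} - {k0}. hi n k - lo n k)"
    using L[OF k0] B calculation by (intro mult_mono) auto
   ultimately show ?thesis by simp
  qed
  have N: "N0 <= N" using An B A0 by (simp add: N_def field_simps)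
  have cJ: "real (card ?J) <= N"
   using card_tiles_le[where P = P and Q = Q and a = a and b = b and lo = "lo n" and hi = "hi n" and off = ?off, OF P Q ab le] A0 by (simp add: N_def field_simps)
  note iid = tile_flows_iid[OF P Q ab le hT hn, where off = ?off and rT = rT and r = "r n"]
  have finJ: "finite ?J" using iid by (simp add: iid_copies_def)
  have Xint: "integrable M (?X l)" if "l \<in> ?J" for l
   unfolding tile_flow_def by (intro flow_integrable finite_imageI finite_cylinder_points P)
  have finG: "finite ?G" by (rule finite_gap_edges[OF P Q ab le hT hn])
  have subG: "?G \<subseteq> lattice_edges" by (rule gap_edges_sub[OF P Q ab le hT hn])
  note gs = capacity_sum_expectation[OF finG subG, folded \<mu>_def]
  have i1: "integrable M (%w. max 0 ((\<Sum>l\<in>?J. ?X l w) - N*expectation ?Y))"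
   using Xint by (intro integrable_max) auto
  have "expectation (%w. max 0 (?F w - expectation ?Y/area a b*area (lo n) (hi n)))
    <= expectation (%w. max 0 ((\<Sum>l\<in>?J. ?X l w) - N*expectation ?Y) + (\<Sum>e\<in>?G. t e w))"
  proof (rule integral_mono)
   show "integrable M (%w. max 0 (?F w - expectation ?Y/area a b*area (lo n) (hi n)))"
    using cylinder_flow_rv(2)[OF Q] by (intro integrable_max) auto
   show "integrable M (%w. max 0 ((\<Sum>l\<in>?J. ?X l w) - N*expectation ?Y) + (\<Sum>e\<in>?G. t e w))"
    using i1 gs(2) by auto
   fix w assume w: "w \<in> space M"
   have "?F w <= (\<Sum>l\<in>?J. ?X l w) + (\<Sum>e\<in>?G. t e w)"
    by (rule cylinder_flow_tiling[OF P Q ab le hT hn w])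
   moreover have "0 <= (\<Sum>e\<in>?G. t e w)" using subG capacity_nonneg[OF _ w] by (intro sum_nonneg) auto
   moreover have "expectation ?Y/area a b*area (lo n) (hi n) = N*expectation ?Y" by (simp add: N_def)
   ultimately show "max 0 (?F w - expectation ?Y/area a b*area (lo n) (hi n))
     <= max 0 ((\<Sum>l\<in>?J. ?X l w) - N*expectation ?Y) + (\<Sum>e\<in>?G. t e w)" by linarith
  qed
  also have "... <= eps1*N + real (card ?G)*\<mu>"
   using i1 gs N0[OF iid cJ N] by simp
  also have "... <= eps/2*area (lo n) (hi n) + ((tile_error (%k. b k - a k) + eps2)*area (lo n) (hi n))*\<mu>"
  proof (intro add_mono mult_right_mono)
   show "eps1*N <= eps/2*area (lo n) (hi n)" using A0 by (simp add: eps1_def N_def)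
  qed (use elim(2) \<mu>_nonneg in auto)
  also have "... = (tile_error (%k. b k - a k)*\<mu> + (eps/2 + eps2*\<mu>))*area (lo n) (hi n)"
   by (simp add: algebra_simps)
  also have "... <= (tile_error (%k. b k - a k)*\<mu> + eps)*area (lo n) (hi n)"
   using e An B by (intro mult_right_mono) auto
  finally show ?case .
 qed
qed

definition tile_bounds :: "real set" where
 "tile_bounds = {expectation (cylinder_flow P a b rT hT)/area a b + tile_error (%k. b k - a k)*\<mu> | P a b rT hT.
   frame P & (\<forall>k. k ~= j --> a k + 2*margin <= b k) & 2*margin + 2 <= hT}"

text \<open>Every tile bounds the mean flow per area through all large cylinders from above, up to the
  error caused by the gaps, and every large cylinder is itself such a tile.  So the infimum of
  these bounds is the limit for all sequences of growing cylinders at once.\<close>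

definition flow_density :: real where
 "flow_density = Inf tile_bounds"

lemma tile_error_nonneg: "(!!k. k ~= j ==> 2*margin <= s k) ==> 0 <= tile_error s"
proof -
 assume s: "!!k. k ~= j ==> 2*margin <= s k"
 have "(\<Prod>k\<in>-{j}. (s k - 2*margin)/(s k + 4*margin)) <= (\<Prod>k\<in>-{j}. 1)"
  using s margin_gt_1 by (intro prod_mono) (force simp: field_simps)
 moreover have "(\<Prod>k\<in>-{j}. (s k - 2*margin)/s k) <= (\<Prod>k\<in>-{j}. (s k + 2*margin)/s k)"
  using s margin_gt_1 by (intro prod_mono conjI divide_nonneg_nonneg divide_right_mono) force+
 ultimately show ?thesis
  unfolding tile_error_def using margin_gt_1 by (intro mult_nonneg_nonneg add_nonneg_nonneg lattice_degree_nonneg) auto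
qed

lemma tile_bounds_nonneg: "x \<in> tile_bounds ==> 0 <= x"
proof -
 assume "x \<in> tile_bounds"
 then obtain P a b rT hT where x: "x = expectation (cylinder_flow P a b rT hT)/area a b + tile_error (%k. b k - a k)*\<mu>"
   "frame P" and ab: "!!k. k ~= j ==> a k + 2*margin <= b k" by (auto simp: tile_bounds_def)
 have "0 < area a b" using ab margin_gt_1 by (intro area_pos) force
 moreover have "0 <= tile_error (%k. b k - a k)" using ab by (intro tile_error_nonneg) force
 ultimately show ?thesis
  unfolding x(1) using cylinder_flow_expectation_nonneg[OF x(2)] \<mu>_nonneg
  by (intro add_nonneg_nonneg divide_nonneg_nonneg mult_nonneg_nonneg) auto
qed

lemma flow_density_le: "x \<in> tile_bounds ==> flow_density <= x"
 unfolding flow_density_def using tile_bounds_nonneg by (intro cInf_lower bdd_belowI) auto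

context
 fixes Q :: "real^'d => real^'d" and lo hi :: "nat => 'd => real" and r h :: "nat => real"
 assumes Q: "frame Q" and grow: "growing lo hi h"
begin

lemma area_eventually_pos: "EV n. 0 < area (lo n) (hi n)"
 using growing_eventually[OF grow, of 1] by eventually_elim (intro area_pos, force)

lemma mean_flow_tendsto:
 "(%n. expectation (cylinder_flow Q (lo n) (hi n) (r n) (h n))/area (lo n) (hi n)) \<longlonglongrightarrow> flow_density"
proof (rule order_tendstoI)
 have g: "!!k. k ~= j ==> filterlim (%n. hi n k - lo n k) at_top sequentially"
  using grow by (auto simp: growing_def)
 let ?e = "%n. expectation (cylinder_flow Q (lo n) (hi n) (r n) (h n))/area (lo n) (hi n)"
 have large: "EV n. ?e n + tile_error (%k. hi n k - lo n k)*\<mu> \<in> tile_bounds"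
  using growing_eventually[OF grow, of "2*margin + 2"]
 proof eventually_elim
  case (elim n)
  then have "!!k. k ~= j ==> lo n k + 2*margin <= hi n k" by force
  then show ?case unfolding tile_bounds_def using elim Q by blast
 qed
 have err: "(%n. tile_error (%k. hi n k - lo n k)*\<mu>) \<longlonglongrightarrow> 0*\<mu>"
  by (intro tendsto_mult tendsto_const tile_error_tendsto g)
 fix x assume "x < flow_density"
 then have "EV n. tile_error (%k. hi n k - lo n k)*\<mu> < flow_density - x"
  using err by (intro order_tendstoD) auto
 with large show "EV n. x < ?e n"
  by eventually_elim (use flow_density_le in force)
next
 let ?e = "%n. expectation (cylinder_flow Q (lo n) (hi n) (r n) (h n))/area (lo n) (hi n)"
 fix x assume x: "flow_density < x"
 have ne: "tile_bounds ~= {}"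
 proof -
  have "EV n. (\<forall>k. k ~= j --> lo n k + (2*margin + 2) <= hi n k) & 2*margin + 2 <= h n"
   by (rule growing_eventually[OF grow])
  then obtain n where "(\<forall>k. k ~= j --> lo n k + (2*margin + 2) <= hi n k) & 2*margin + 2 <= h n"
   using eventually_happens' sequentially_bot by blast
  then have "(\<forall>k. k ~= j --> lo n k + 2*margin <= hi n k) & 2*margin + 2 <= h n" by force
  then show ?thesis using Q unfolding tile_bounds_def by blast
 qed
 obtain y where y: "y \<in> tile_bounds" "y < x"
  using x cInf_lessD[OF ne] unfolding flow_density_def by blast
 then obtain P a b rT hT where yP: "y = expectation (cylinder_flow P a b rT hT)/area a b + tile_error (%k. b k - a k)*\<mu>"
  "frame P" "\<forall>k. k ~= j --> a k + 2*margin <= b k" "2*margin + 2 <= hT" by (auto simp: tile_bounds_def)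
 define eps where "eps = (x - y)/2"
 have eps: "0 < eps" using y by (simp add: eps_def)
 show "EV n. ?e n < x"
  using flow_excess_over_tile[where P = P and a = a and b = b and r = r and rT = rT, OF yP(2) Q yP(3,4) grow eps] area_eventually_pos
 proof eventually_elim
  case (elim n)
  let ?F = "cylinder_flow Q (lo n) (hi n) (r n) (h n)" and ?A = "area (lo n) (hi n)"
  let ?c = "expectation (cylinder_flow P a b rT hT)/area a b*?A"
  have "expectation ?F - ?c = expectation (%w. ?F w - ?c)"
   using cylinder_flow_rv(2)[OF Q] by (simp add: prob_space)
  also have "... <= expectation (%w. max 0 (?F w - ?c))"
   using cylinder_flow_rv(2)[OF Q] by (intro integral_mono integrable_max) auto
  finally have "expectation ?F <= (y + eps)*?A" using elim(1) by (simp add: yP(1) algebra_simps)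
  then have "?e n <= y + eps" using elim(2) by (simp add: field_simps)
  then show ?case using y by (simp add: eps_def field_simps)
 qed
qed

end

lemma flow_density_nonneg:
 assumes "frame Q"
 shows "0 <= flow_density"
proof -
 let ?lo = "%(n::nat) (k::'d). 0 :: real" and ?hi = "%(n::nat) (k::'d). real n"
 have "growing ?lo ?hi real" by (simp add: growing_def filterlim_real_sequentially)
 from mean_flow_tendsto[OF assms this, of "%_. 0"] show ?thesis
 proof (rule LIMSEQ_le_const)
  show "\<exists>N. \<forall>n\<ge>N. 0 <= expectation (cylinder_flow Q (?lo n) (?hi n) 0 (real n))/area (?lo n) (?hi n)"
   using cylinder_flow_expectation_nonneg[OF assms]
   by (auto simp: area_def intro!: divide_nonneg_nonneg prod_nonneg)
 qed
qed

text \<open>Once the mean converges, convergence in mean only needs an upper bound for the positive part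
  of the deviation.\<close>

lemma flow_L1_tendsto:
 fixes lo hi :: "nat => 'd => real"
 assumes Q: "frame Q" and grow: "growing lo hi h"
 shows "(%n. expectation (%w. \<bar>cylinder_flow Q (lo n) (hi n) (r n) (h n) w/area (lo n) (hi n) - flow_density\<bar>)) \<longlonglongrightarrow> 0"
proof -
 let ?F = "%n. cylinder_flow Q (lo n) (hi n) (r n) (h n)" and ?A = "%n. area (lo n) (hi n)"
 let ?Z = "%n w. ?F n w/?A n"
 have iZ: "integrable M (?Z n)" for n using cylinder_flow_rv(2)[OF Q] by auto
 have pos: "(%n. expectation (%w. max 0 (?Z n w - flow_density))) \<longlonglongrightarrow> 0"
 proof (rule order_tendstoI)
  fix x :: real assume "x < 0"
  moreover have "0 <= expectation (%w. max 0 (?Z n w - flow_density))" for n by (intro integral_nonneg_AE AE_I2) auto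
  ultimately show "EV n. x < expectation (%w. max 0 (?Z n w - flow_density))"
   by (intro always_eventually allI) (use less_le_trans in blast)
 next
  fix x :: real assume x: "0 < x"
  define eps where "eps = x/4"
  have eps: "0 < eps" using x by (simp add: eps_def)
  let ?e = "%n. expectation (?F n)/?A n"
  have g: "!!k. k ~= j ==> filterlim (%n. hi n k - lo n k) at_top sequentially" using grow by (auto simp: growing_def)
  have "(%n. tile_error (%k. hi n k - lo n k)*\<mu>) \<longlonglongrightarrow> 0*\<mu>"
   by (intro tendsto_mult tendsto_const tile_error_tendsto g)
  then have "EV n. tile_error (%k. hi n k - lo n k)*\<mu> < eps"
   using eps by (intro order_tendstoD) auto
  moreover have "EV n. ?e n < flow_density + eps"
   using eps by (intro order_tendstoD[OF mean_flow_tendsto[OF Q grow]]) auto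
  ultimately have "EV n. tile_error (%k. hi n k - lo n k)*\<mu> < eps & ?e n < flow_density + eps &
    (\<forall>k. k ~= j --> lo n k + (2*margin + 2) <= hi n k) & 2*margin + 2 <= h n"
   using growing_eventually[OF grow, of "2*margin + 2"] by eventually_elim blast
  then obtain m where m: "tile_error (%k. hi m k - lo m k)*\<mu> < eps" "?e m < flow_density + eps"
    "!!k. k ~= j ==> lo m k + (2*margin + 2) <= hi m k" "2*margin + 2 <= h m"
   using eventually_happens' sequentially_bot by blast
  have m3: "\<forall>k. k ~= j --> lo m k + 2*margin <= hi m k" using m(3) by force
  show "EV n. expectation (%w. max 0 (?Z n w - flow_density)) < x"
   using flow_excess_over_tile[where a = "lo m" and b = "hi m" and r = r and rT = "r m", OF Q Q m3 m(4) grow eps] area_eventually_pos[OF Q grow]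
  proof eventually_elim
   case (elim n)
   have "expectation (%w. max 0 (?Z n w - flow_density))
     <= expectation (%w. max 0 (?F n w - ?e m*?A n)/?A n + eps)"
   proof (rule integral_mono)
    show "integrable M (%w. max 0 (?Z n w - flow_density))" using iZ by (intro integrable_max) auto
    show "integrable M (%w. max 0 (?F n w - ?e m*?A n)/?A n + eps)"
     using cylinder_flow_rv(2)[OF Q] by (intro Bochner_Integration.integrable_add integrable_divide integrable_max) auto
    fix w
    have "max 0 (?F n w - ?e m*?A n)/?A n = max 0 (?Z n w - ?e m)"
     using elim(2) by (simp add: max_def field_simps)
    then show "max 0 (?Z n w - flow_density) <= max 0 (?F n w - ?e m*?A n)/?A n + eps"
     using m(2) eps by (simp add: max_def)
   qed
   also have "... = expectation (%w. max 0 (?F n w - ?e m*?A n))/?A n + eps"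
    using cylinder_flow_rv(2)[OF Q] by (subst Bochner_Integration.integral_add) (auto intro!: integrable_max simp: prob_space)
   also have "... <= (tile_error (%k. hi m k - lo m k)*\<mu> + eps) + eps"
   proof -
    have "expectation (%w. max 0 (?F n w - ?e m*?A n))/?A n <= tile_error (%k. hi m k - lo m k)*\<mu> + eps"
     using elim by (simp only: pos_divide_le_eq)
    then show ?thesis by simp
   qed
   also have "... < x" using m(1) x by (simp add: eps_def)
   finally show ?case .
  qed
 qed
 have eq: "expectation (%w. \<bar>?Z n w - flow_density\<bar>)
   = 2*expectation (%w. max 0 (?Z n w - flow_density)) - (expectation (?F n)/?A n - flow_density)" for n
 proof -
  have "expectation (%w. \<bar>?Z n w - flow_density\<bar>)
    = expectation (%w. 2*max 0 (?Z n w - flow_density) - (?Z n w - flow_density))"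
   by (intro Bochner_Integration.integral_cong) (auto simp: max_def)
  also have "... = 2*expectation (%w. max 0 (?Z n w - flow_density)) - expectation (%w. ?Z n w - flow_density)"
   using iZ by (subst Bochner_Integration.integral_diff) (auto intro!: integrable_max)
  also have "expectation (%w. ?Z n w - flow_density) = expectation (?F n)/?A n - flow_density"
   using iZ[of n] by (simp add: prob_space)
  finally show ?thesis .
 qed
 have "(%n. 2*expectation (%w. max 0 (?Z n w - flow_density)) - (expectation (?F n)/?A n - flow_density))
   \<longlonglongrightarrow> 2*0 - (flow_density - flow_density)"
  by (intro tendsto_intros pos mean_flow_tendsto[OF Q grow])
 then show ?thesis unfolding eq by simp
qed

end

section \<open>The almost sure upper bound\<close>

lemma card_integer_box:
 fixes N :: nat and j :: "'d::finite"
 defines "S == {l :: 'd => int. l j = 0 & (\<forall>k. k ~= j --> \<bar>l k\<bar> <= int N)}"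
 shows "finite S" "card S <= (2*N + 1)^card (- {j})"
proof -
 let ?f = "%l :: 'd => int. restrict l (- {j})"
 have inj: "inj_on ?f S"
 proof (rule inj_onI)
  fix l l' assume l: "l \<in> S" "l' \<in> S" "?f l = ?f l'"
  have "l k = l' k" for k
  proof (cases "k = j")
   case True then show ?thesis using l by (simp add: S_def)
  next
   case False then show ?thesis using l(3) by (metis ComplI restrict_apply' singletonD)
  qed
  then show "l = l'" by blast
 qed
 have sub: "?f ` S \<subseteq> (- {j}) \<rightarrow>\<^sub>E {- int N..int N}" 
 proof
  fix f assume "f \<in> ?f ` S"
  then obtain l where l: "l \<in> S" "f = ?f l" by blast
  show "f \<in> (- {j}) \<rightarrow>\<^sub>E {- int N..int N}"
   unfolding l(2)
  proof (rule PiE_I)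
   fix k assume k: "k \<in> - {j}"
   then have "\<bar>l k\<bar> <= int N" using l(1) by (simp add: S_def)
   then show "?f l k \<in> {- int N..int N}" using k by (simp add: abs_le_iff)
  qed simp
 qed
 have fin: "finite ((- {j}) \<rightarrow>\<^sub>E {- int N..int N})" by (intro finite_PiE) auto
 show "finite S" using finite_imageD[OF finite_subset[OF sub fin] inj] .
 have "card S = card (?f ` S)" using inj by (simp add: card_image)
 also have "... <= card ((- {j}) \<rightarrow>\<^sub>E {- int N..int N})" by (rule card_mono[OF fin sub])
 also have "... = (2*N + 1)^card (- {j})"
 proof -
  have "card {- int N..int N} = 2*N + 1" by simp
  then show ?thesis by (simp add: card_PiE del: card_atLeastAtMost_int)
 qed
 finally show "card S <= (2*N + 1)^card (- {j})" .
qed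

context percolation_capacities
begin

definition scale :: "real => ('d => real) => 'd => real" where "scale c f k = c*f k"

abbreviation D :: nat where "D == card (- {j})"

lemma D: "1 <= D" by (rule card_other_axes(2))

lemma area_scale: "area (scale c lo) (scale c hi) = c^D*area lo hi"
proof -
 have "area (scale c lo) (scale c hi) = (\<Prod>k\<in>-{j}. c*(hi k - lo k))"
  by (simp add: area_def scale_def right_diff_distrib)
 then show ?thesis by (simp add: area_def prod.distrib)
qed

lemma growing_scale:
 assumes "!!k. k ~= j ==> lo k < hi k" "filterlim h at_top sequentially"
 shows "growing (%n. scale (real n) lo) (%n. scale (real n) hi) h"
 unfolding growing_def
proof (intro conjI allI impI assms(2))
 fix k assume "k ~= j"
 then have "0 < hi k - lo k" using assms(1) by simp
 then have "filterlim (%n. (hi k - lo k)*real n) at_top sequentially"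
  by (intro filterlim_tendsto_pos_mult_at_top[OF tendsto_const _ filterlim_real_sequentially])
 then show "filterlim (%n. scale (real n) hi k - scale (real n) lo k) at_top sequentially"
  by (simp add: scale_def algebra_simps)
qed

text \<open>A strong upper law for sums over index sets of size at most \<open>\<alpha> * n ^ D\<close>. It
  is where the moment of order \<open>1 + 1 / D\<close>, or else the position of the hyperplane,
  enters.\<close>

definition bounded_averages :: "('w => real) => (nat => 'i set) => (nat => 'i => 'w => real) => bool" where
 "bounded_averages Y J X \<longleftrightarrow> (\<forall>\<alpha> eps. 0 <= \<alpha> --> 0 < eps -->
   (EV n. real (card (J n)) <= \<alpha>*real n^D) -->
   (AE w in M. EV n. (\<Sum>i\<in>J n. X n i w) <= (\<alpha>*expectation Y + eps)*real n^D))"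

lemma iid_copies_empty: "iid_copies Y {} X"
 unfolding iid_copies_def indep_vars_def indep_sets_def by auto

lemma bounded_averages_eventually:
 assumes ev: "EV n. J n = J' n"
  and b: "bounded_averages Y J' X"
 shows "bounded_averages Y J X"
 unfolding bounded_averages_def
proof (intro allI impI)
 fix \<alpha> eps :: real
 assume a: "0 <= \<alpha>" "0 < eps" "EV n. real (card (J n)) <= \<alpha>*real n^D"
 have "EV n. real (card (J' n)) <= \<alpha>*real n^D"
  using ev a(3) by eventually_elim simp
 then have "AE w in M. EV n. (\<Sum>i\<in>J' n. X n i w) <= (\<alpha>*expectation Y + eps)*real n^D"
  using b a unfolding bounded_averages_def by blast
 then show "AE w in M. EV n. (\<Sum>i\<in>J n. X n i w) <= (\<alpha>*expectation Y + eps)*real n^D"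
 proof eventually_elim
  case (elim w)
  with ev show ?case by eventually_elim simp
 qed
qed

lemma bounded_averages_moment:
 assumes Y: "nonneg_rv Y" "integrable M Y" "integrable M (%w. Y w powr (1 + 1/real D))"
  and XY: "EV n. iid_copies Y (J n) (X n)"
 shows "bounded_averages Y J X"
proof (rule bounded_averages_eventually)
 let ?J = "%n. if iid_copies Y (J n) (X n) then J n else {}"
 show "EV n. J n = ?J n" using XY by eventually_elim simp
 have "iid_copies Y (?J n) (X n)" for n by (simp add: iid_copies_empty)
 then show "bounded_averages Y ?J X"
  unfolding bounded_averages_def using moment_array_bound[OF D Y, of ?J X] by blast
qed

lemma bounded_averages_nested:
 assumes Y: "nonneg_rv Y" "integrable M Y" and XY: "!!k. iid_copies Y (E k) X"
  and cE: "!!k. real (card (E k)) <= C*real ((2^k)^D)" and C: "0 <= C"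
  and JE: "EV n. \<forall>k. n <= 2^k --> J n \<subseteq> E k"
 shows "bounded_averages Y J (%_. X)"
proof (rule bounded_averages_eventually)
 let ?J = "%n. if \<forall>k. n <= 2^k --> J n \<subseteq> E k then J n else {}"
 show "EV n. J n = ?J n" using JE by eventually_elim simp
 have "?J n \<subseteq> E k" if "n <= 2^k" for n k using that by auto
 then show "bounded_averages Y ?J (%_. X)"
  unfolding bounded_averages_def using nested_array_bound[OF D Y XY cE C, of ?J] by blast
qed

lemma base_powr_integrable:
 assumes "integrable M (%w. t base_edge w powr p)" "e \<in> lattice_edges"
 shows "integrable M (%w. t e w powr p)"
proof -
 have "iid_copies (t base_edge) {e} t" by (rule capacities_iid) (use assms in auto)
 from copies_expectation(2)[OF this, of e "%y. y powr p"] show ?thesis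
  using assms base_capacity(1) by (simp add: nonneg_rv_def)
qed

text \<open>The flow is at most the number of edges times the largest capacity.\<close>

lemma flow_powr_integrable:
 assumes V: "finite V" and p: "0 < p" and mom: "integrable M (%w. t base_edge w powr p)"
 shows "integrable M (%w. flow V r w powr p)"
proof (rule Bochner_Integration.integrable_bound)
 let ?E = "induced_edges V"
 let ?c = "real (card ?E)"
 have sub: "?E \<subseteq> lattice_edges" by (auto simp: induced_edges_def)
 have finE: "finite ?E" by (rule finite_induced_edges[OF V])
 show "integrable M (%w. \<Sum>e\<in>?E. ?c powr p*t e w powr p)"
  using base_powr_integrable[OF mom] sub by (intro Bochner_Integration.integrable_sum integrable_mult_right) auto
 show "random_variable borel (%w. flow V r w powr p)" using flow_rv[OF V] by measurable
 have "norm (flow V r w powr p) <= norm (\<Sum>e\<in>?E. ?c powr p*t e w powr p)" if w: "w \<in> space M" for w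
 proof -
  have tpos: "0 <= t e w" if "e \<in> ?E" for e using capacity_nonneg[OF _ w] sub that by auto
  have f: "0 <= flow V r w" "flow V r w <= (\<Sum>e\<in>?E. t e w)"
   using flow_nonneg[OF V w] flow_le_sum[OF V w] by auto
  have "flow V r w powr p <= (\<Sum>e\<in>?E. ?c powr p*t e w powr p)"
  proof (cases "?E = {}")
   case True
   then show ?thesis using f by simp
  next
   case False
   define m where "m = Max ((%e. t e w) ` ?E)"
   have "m \<in> (%e. t e w) ` ?E" unfolding m_def using finE False by (intro Max_in) auto
   then obtain e where e: "e \<in> ?E" "m = t e w" by blast
   have "(\<Sum>e\<in>?E. t e w) <= (\<Sum>e\<in>?E. m)"
    unfolding m_def using finE by (intro sum_mono Max_ge) auto
   then have "flow V r w <= ?c*t e w" using f e by simp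
   then have "flow V r w powr p <= (?c*t e w) powr p" using f p by (intro powr_mono2) auto
   also have "... = ?c powr p*t e w powr p" by (simp add: powr_mult)
   also have "... <= (\<Sum>e\<in>?E. ?c powr p*t e w powr p)"
    using finE e(1) by (intro member_le_sum) auto
   finally show ?thesis .
  qed
  then show ?thesis by simp
 qed
 then show "AE w in M. norm (flow V r w powr p) <= norm (\<Sum>e\<in>?E. ?c powr p*t e w powr p)" by (intro AE_I2)
qed

lemma edges_bounded_averages_moment:
 assumes "integrable M (%w. t base_edge w powr (1 + 1/real D))"
  and "EV n. finite (G n) & G n \<subseteq> lattice_edges"
 shows "bounded_averages (t base_edge) G (%_. t)"
proof (rule bounded_averages_moment[OF base_capacity assms(1)])
 show "EV n. iid_copies (t base_edge) (G n) t"
  using assms(2) by eventually_elim (intro capacities_iid, auto)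
qed

text \<open>If the edges stay at bounded height, those for all \<open>n \<le> 2 ^ k\<close> lie in one
  family of about \<open>2 ^ (k * D)\<close> edges.\<close>

lemma edges_bounded_averages_nested:
 assumes Q: "frame Q" and B: "0 <= B" and w: "0 <= w"
  and G: "EV n. G n \<subseteq> lattice_edges &
   (\<forall>e\<in>G n. \<exists>x\<in>e. \<bar>v \<bullet> x\<bar> <= w & (\<forall>k. k ~= j --> \<bar>Q x $ k\<bar> <= B*real n))"
 shows "bounded_averages (t base_edge) G (%_. t)"
proof -
 let ?d = "real CARD('d)" and ?deg = "lattice_degree TYPE('d)"
 have Q': "orthogonal_transformation Q" "Q v = axis j 1" using Q by (auto simp: frame_def)
 have v1: "norm v = 1" by (rule frame_norm[OF Q'])
 define K where "K k = (%_ :: 'd. B*2^k)" for k :: nat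
 define X where "X k = lattice_points v (prism Q j (%i. - K k i) (K k)) 0 w" for k
 define E where "E k = {e \<in> lattice_edges. \<exists>x\<in>X k. x \<in> e}" for k
 have finX: "finite (X k)" for k unfolding X_def by (rule finite_lattice_points[OF Q'])
 have cX: "real (card (X k)) <= 2*(w + ?d)*(2*B + 2*?d)^D*real ((2^k)^D)" for k
 proof -
  let ?P = "slab Q v j (%i. - K k i - ?d) (%i. K k i + ?d) 0 (w + ?d)"
  have K0: "0 <= K k i" for i using B by (simp add: K_def)
  have le: "- K k i - ?d <= K k i + ?d" if "i ~= j" for i using K0[of i] by linarith
  have wd: "0 <= w + ?d" using w by simp
  have "real (card (X k)) <= 2*(w + ?d)*(\<Prod>i\<in>-{j}. (K k i + ?d) - (- K k i - ?d)) - 0"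
  proof (rule card_lattice_le_volume[OF finX _ slab_volume(1)[OF Q' le wd] _ _ slab_volume(2)[OF Q' le wd]])
   show "X k \<subseteq> integer_points" by (auto simp: X_def lattice_points_def)
   show "{} \<in> sets borel" "{} \<subseteq> ?P" "emeasure lborel {} = ennreal 0" "(0::real) <= 0" by auto
   show "0 <= 2*(w + ?d)*(\<Prod>i\<in>-{j}. (K k i + ?d) - (- K k i - ?d))"
    by (rule slab_volume(3)[OF Q' le wd])
   fix x y assume "x \<in> X k" and d: "dist x y <= ?d"
   then have x: "x \<in> prism Q j (%i. - K k i) (K k)" "\<bar>v \<bullet> x - 0\<bar> <= w" by (auto simp: X_def lattice_points_def)
   show "y \<in> ?P & y \<notin> {}"
    using prism_near[OF Q'(1) x(1) d] x(2) inner_dist[OF v1, of x y] d by (auto simp: slab_def)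
  qed
  moreover have "(\<Prod>i\<in>-{j}. (K k i + ?d) - (- K k i - ?d)) = (2*(B*2^k) + 2*?d)^D"
   by (simp add: K_def algebra_simps)
  moreover have "(2*(B*2^k) + 2*?d)^D <= ((2*B + 2*?d)*2^k)^D"
  proof (intro power_mono)
   have "2*?d*1 <= 2*?d*2^k" by (intro mult_left_mono) auto
   then show "2*(B*2^k) + 2*?d <= (2*B + 2*?d)*2^k" by (simp add: algebra_simps)
  qed (use B in simp)
  ultimately have "real (card (X k)) <= 2*(w + ?d)*((2*B + 2*?d)*2^k)^D"
   using mult_left_mono[of "(2*(B*2^k) + 2*?d)^D" "((2*B + 2*?d)*2^k)^D" "2*(w + ?d)"] wd by simp
  then show ?thesis by (simp add: power_mult_distrib)
 qed
 have E: "finite (E k)" "real (card (E k)) <= ?deg*real (card (X k))" for k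
  using card_incident_edges[OF finX, of "E k"] by (auto simp: E_def)
 show ?thesis
 proof (rule bounded_averages_nested[OF base_capacity])
  show "iid_copies (t base_edge) (E k) t" for k by (rule capacities_iid[OF E(1)]) (auto simp: E_def)
  show "real (card (E k)) <= (?deg*(2*(w + ?d)*(2*B + 2*?d)^D))*real ((2^k)^D)" for k
   using order_trans[OF E(2) mult_left_mono[OF cX lattice_degree_nonneg]] by (simp add: mult_ac)
  show "0 <= ?deg*(2*(w + ?d)*(2*B + 2*?d)^D)"
   using w B by (intro mult_nonneg_nonneg lattice_degree_nonneg zero_le_power) auto
  show "EV n. \<forall>k. n <= 2^k --> G n \<subseteq> E k"
   using G
  proof eventually_elim
   case (elim n)
   show ?case
   proof (intro allI impI subsetI)
    fix k e assume nk: "n <= 2^k" and e: "e \<in> G n"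
    then have eL: "e \<in> lattice_edges" using elim by blast
    obtain x where x: "x \<in> e" "\<bar>v \<bullet> x\<bar> <= w" "!!i. i ~= j ==> \<bar>Q x $ i\<bar> <= B*real n"
     using elim e by blast
    have "x \<in> integer_points" using eL x(1) by (metis lattice_edge_cases insert_iff empty_iff)
    moreover have "B*real n <= B*2^k"
     using nk B by (intro mult_left_mono) (metis of_nat_le_iff of_nat_numeral of_nat_power, simp)
    then have "x \<in> prism Q j (%i. - K k i) (K k)"
     using x(3) unfolding prism_def K_def by (force simp: abs_le_iff)
    ultimately have "x \<in> X k" using x(2) by (simp add: X_def lattice_points_def)
    then show "e \<in> E k" using eL x(1) by (auto simp: E_def)
   qed
  qed
 qed
qed

text \<open>At level 0 the position of a tile does not depend on \<open>n\<close>, so the tiles for \<open>n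
  \<le> 2 ^ k\<close> belong to one family of about \<open>2 ^ (k * D)\<close> tiles.\<close>

lemma tiles_bounded_averages_nested:
 assumes Q: "frame Q" and ab: "!!k. k ~= j ==> a k + 2*margin <= b k"
 shows "bounded_averages (cylinder_flow Q a b 0 hT)
  (%n. tiles Q Q a b (scale (real n) lo) (scale (real n) hi) (%_. 0)) (%_. tile_flow Q a b (%_. 0) 0 hT 0)"
proof -
 note Q' = Q[unfolded frame_def, THEN conjunct1] Q[unfolded frame_def, THEN conjunct2]
 define \<sigma> where "\<sigma> = tile_spacing margin a b"
 have \<sigma>: "0 < \<sigma> k" if "k ~= j" for k using ab[OF that] margin_gt_1 by (simp add: \<sigma>_def tile_spacing_def)
 obtain N :: nat where N: "(\<Sum>k\<in>-{j}. (\<bar>lo k\<bar> + \<bar>hi k\<bar> + \<bar>a k\<bar> + 2*margin + \<sigma> k)/\<sigma> k) <= real N"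
  using real_arch_simple by blast
 have nonneg: "0 <= (\<bar>lo k\<bar> + \<bar>hi k\<bar> + \<bar>a k\<bar> + 2*margin + \<sigma> k)/\<sigma> k" if "k \<in> - {j}" for k
  using \<sigma>[of k] that margin_gt_1 by (intro divide_nonneg_pos) auto
 have Nk: "\<bar>lo k\<bar> + \<bar>hi k\<bar> + \<bar>a k\<bar> + 2*margin + \<sigma> k <= real N*\<sigma> k" if k: "k ~= j" for k
 proof -
  have "(\<bar>lo k\<bar> + \<bar>hi k\<bar> + \<bar>a k\<bar> + 2*margin + \<sigma> k)/\<sigma> k
    <= (\<Sum>k\<in>-{j}. (\<bar>lo k\<bar> + \<bar>hi k\<bar> + \<bar>a k\<bar> + 2*margin + \<sigma> k)/\<sigma> k)"
  proof (rule member_le_sum[where f = "%k. (\<bar>lo k\<bar> + \<bar>hi k\<bar> + \<bar>a k\<bar> + 2*margin + \<sigma> k)/\<sigma> k"])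
   show "0 <= (\<bar>lo i\<bar> + \<bar>hi i\<bar> + \<bar>a i\<bar> + 2*margin + \<sigma> i)/\<sigma> i" if "i \<in> - {j} - {k}" for i
    by (rule nonneg) (use that in blast)
  qed (use k in simp_all)
  from order_trans[OF this N] show ?thesis using \<sigma>[OF k] by (simp only: pos_divide_le_eq)
 qed
 define E where "E k = {l :: 'd => int. l j = 0 & (\<forall>i. i ~= j --> \<bar>l i\<bar> <= int (N*2^k))}" for k :: nat
 have E: "finite (E k)" "card (E k) <= (2*(N*2^k) + 1)^D" for k
  unfolding E_def by (rule card_integer_box)+
 show ?thesis
 proof (rule bounded_averages_nested[OF cylinder_flow_rv[OF Q]])
  show "iid_copies (cylinder_flow Q a b 0 hT) (E k) (tile_flow Q a b (%_. 0) 0 hT 0)" for k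
   unfolding cylinder_flow_def tile_flow_def
  proof (rule flows_iid[OF E(1) finite_cylinder_points[OF Q]])
   show "tile_shift Q a b (%_. 0) (0 - 0) l \<in> integer_points" for l
    unfolding tile_shift_def by (rule tile_pos(1)[OF Q' Q' margin_def ab])
   have "tile Q j a b (%_. 0) margin (0 - 0) l \<inter> tile Q j a b (%_. 0) margin (0 - 0) l' = {}"
    if "l \<in> E k" "l' \<in> E k" "l ~= l'" for l l'
    by (rule tiles_disjoint[OF Q' Q' margin_def ab]) (use that in \<open>auto simp: E_def\<close>)
   moreover have "(+) (tile_shift Q a b (%_. 0) (0 - 0) l) ` cylinder_points Q a b 0 hT
     \<subseteq> tile Q j a b (%_. 0) margin (0 - 0) l" for l
   proof -
    have eq: "(+) (tile_shift Q a b (%_. 0) (0 - 0) l) ` cylinder_points Q a b 0 hT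
      = lattice_points v (tile Q j a b (%_. 0) margin (0 - 0) l) (0 + v \<bullet> tile_shift Q a b (%_. 0) (0 - 0) l) hT"
     unfolding tile_shift_def cylinder_points_def by (rule tile_points[OF Q' Q' margin_def ab, symmetric])
    show ?thesis unfolding eq by (auto simp: lattice_points_def)
   qed
   ultimately show "disjoint_family_on (%l. (+) (tile_shift Q a b (%_. 0) (0 - 0) l) ` cylinder_points Q a b 0 hT) (E k)"
    unfolding disjoint_family_on_def by blast
  qed
  show "real (card (E k)) <= (2*real N + 1)^D*real ((2^k)^D)" for k
  proof -
   have "2*(N*2^k) + 1 <= (2*N + 1)*2^k" by (simp add: algebra_simps)
   then have "(2*(N*2^k) + 1)^D <= ((2*N + 1)*2^k)^D" by (intro power_mono) auto
   then have "card (E k) <= ((2*N + 1)*2^k)^D" using E(2)[of k] by (rule order_trans[rotated])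
   then have "card (E k) <= (2*N + 1)^D*(2^k)^D" by (simp only: power_mult_distrib)
   then have "real (card (E k)) <= real ((2*N + 1)^D*(2^k)^D)" by (simp only: of_nat_le_iff)
   then show ?thesis by (simp add: add.commute)
  qed
  show "0 <= (2*real N + 1)^D" by simp
  show "EV n. \<forall>k. n <= 2^k --> tiles Q Q a b (scale (real n) lo) (scale (real n) hi) (%_. 0) \<subseteq> E k"
   using eventually_ge_at_top[of 1]
  proof eventually_elim
   case (elim n)
   show ?case
   proof (intro allI impI subsetI)
    fix k l assume nk: "n <= 2^k" and l: "l \<in> tiles Q Q a b (scale (real n) lo) (scale (real n) hi) (%_. 0)"
    have lj: "l j = 0"
     by (rule tile_indices_zero[OF Q' Q' margin_def ab]) (use l in \<open>auto simp: tiles_def\<close>)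
    have iff: "l \<in> tiles Q Q a b (scale (real n) lo) (scale (real n) hi) (%_. 0) \<longleftrightarrow>
      (\<forall>k. k ~= j --> scale (real n) lo k + 1 <= a k + 0 + tile_spacing margin a b k * of_int (l k) - 2*margin &
       a k + 0 + tile_spacing margin a b k * of_int (l k) - 2*margin + tile_spacing margin a b k <= scale (real n) hi k - 1)"
     unfolding tiles_def by (rule tile_indices_bounds[OF Q' Q' margin_def]) (use ab lj in auto)
    have "\<bar>l i\<bar> <= int (N*2^k)" if i: "i ~= j" for i
    proof -
     have bd: "real n*lo i + 1 <= a i + \<sigma> i * of_int (l i) - 2*margin"
      "a i + \<sigma> i * of_int (l i) - 2*margin + \<sigma> i <= real n*hi i - 1"
      using l[unfolded iff] i
      by (auto simp: scale_def \<sigma>_def)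
     have n1: "1 <= real n" using elim by simp
     have x: "u <= real n*u" if "0 <= u" for u using n1 that by (simp add: mult_le_cancel_right1)
     have "\<bar>\<sigma> i * of_int (l i)\<bar> <= real n*\<bar>lo i\<bar> + real n*\<bar>hi i\<bar> + \<bar>a i\<bar> + 2*margin + \<sigma> i"
     proof -
      have "real n*(- \<bar>lo i\<bar>) <= real n*lo i" "real n*hi i <= real n*\<bar>hi i\<bar>"
       by (intro mult_left_mono; linarith)+
      then have "- (real n*\<bar>lo i\<bar>) <= real n*lo i" "real n*hi i <= real n*\<bar>hi i\<bar>" by simp_all
      moreover have "0 <= real n*\<bar>lo i\<bar>" "0 <= real n*\<bar>hi i\<bar>" by simp_all
      ultimately show ?thesis using bd margin_gt_1 \<sigma>[OF i] by linarith
     qed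
     also have "... <= real n*(\<bar>lo i\<bar> + \<bar>hi i\<bar> + \<bar>a i\<bar> + 2*margin + \<sigma> i)"
     proof -
      have "\<bar>a i\<bar> <= real n*\<bar>a i\<bar>" "2*margin <= real n*(2*margin)" "\<sigma> i <= real n*\<sigma> i"
       by (rule x; use margin_gt_1 \<sigma>[OF i] in simp)+
      then show ?thesis unfolding distrib_left by linarith
     qed
     also have "... <= real n*(real N*\<sigma> i)" using Nk[OF i] by (intro mult_left_mono) auto
     finally have "\<sigma> i*\<bar>of_int (l i)\<bar> <= \<sigma> i*(real n*real N)"
      using \<sigma>[OF i] by (simp add: abs_mult mult_ac)
     then have "\<bar>real_of_int (l i)\<bar> <= real n*real N" using \<sigma>[OF i] by simp
     then have "real_of_int \<bar>l i\<bar> <= real_of_int (int (n*N))" by simp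
     then have "\<bar>l i\<bar> <= int (n*N)" by (simp only: of_int_le_iff)
     also have "... <= int (N*2^k)" using mult_le_mono2[OF nk, of N] by (simp only: of_nat_le_iff mult.commute)
     finally show ?thesis .
    qed
    with lj show "l \<in> E k" by (simp add: E_def)
   qed
  qed
 qed
qed

text \<open>The rectangle is tiled by a scaled copy of itself so large that its mean flow per area is close
  to the limit and the share of the gaps is small.\<close>

lemma flow_upper_bound_as:
 assumes Q: "frame Q" and lohi: "!!k. k ~= j ==> lo k < hi k" and h: "filterlim h at_top sequentially"
  and tame_tiles: "!!m hT. [|\<forall>k. k ~= j --> scale (real m) lo k + 2*margin <= scale (real m) hi k; 2*margin + 2 <= hT|] ==>
   bounded_averages (cylinder_flow Q (scale (real m) lo) (scale (real m) hi) (real m*r) hT)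
    (%n. tiles Q Q (scale (real m) lo) (scale (real m) hi) (scale (real n) lo) (scale (real n) hi) (%_. 0))
    (%n. tile_flow Q (scale (real m) lo) (scale (real m) hi) (%_. 0) (real m*r) hT (real n*r))"
  and tame_gaps: "!!m hT. [|\<forall>k. k ~= j --> scale (real m) lo k + 2*margin <= scale (real m) hi k; 2*margin + 2 <= hT|] ==>
   bounded_averages (t base_edge)
    (%n. gap_edges Q Q (scale (real m) lo) (scale (real m) hi) (scale (real n) lo) (scale (real n) hi) (%_. 0)
     (real m*r) hT (real n*r) (h n)) (%_. t)"
  and eps: "0 < eps"
 shows "AE w in M. EV n.
  cylinder_flow Q (scale (real n) lo) (scale (real n) hi) (real n*r) (h n) w
   <= (flow_density*area lo hi + eps)*real n^D"
proof -
 let ?A = "area lo hi"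
 have A: "0 < ?A" by (rule area_pos[OF lohi])
 let ?lo = "%n::nat. scale (real n) lo" and ?hi = "%n::nat. scale (real n) hi"
 have grow: "growing ?lo ?hi real" by (rule growing_scale[OF lohi filterlim_real_sequentially])
 define eps1 where "eps1 = eps/(4*?A)"
 define \<eta> where "\<eta> = eps/4/(?A*(\<mu> + 1))"
 have e: "0 < eps1" "0 < \<eta>" "eps1*?A = eps/4" "\<eta>*?A*\<mu> <= eps/4"
 proof -
  have m1: "0 < \<mu> + 1" using \<mu>_nonneg by simp
  show "0 < eps1" "0 < \<eta>" "eps1*?A = eps/4" using A eps m1 by (auto simp: eps1_def \<eta>_def)
  have "\<eta>*?A*\<mu> <= \<eta>*?A*(\<mu> + 1)" using A \<open>0 < \<eta>\<close> by (intro mult_left_mono) auto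
  also have "... = eps/4/(?A*(\<mu> + 1))*(?A*(\<mu> + 1))" by (simp only: \<eta>_def mult.assoc)
  also have "... = eps/4"
  proof -
   have "?A*(\<mu> + 1) ~= 0" using A m1 by simp
   then show ?thesis by (metis nonzero_eq_divide_eq)
  qed
  finally show "\<eta>*?A*\<mu> <= eps/4" .
 qed
 let ?e = "%m. expectation (cylinder_flow Q (?lo m) (?hi m) (real m*r) (real m))/area (?lo m) (?hi m)"
 have "(%m. tile_error (%k. ?hi m k - ?lo m k)) \<longlonglongrightarrow> 0"
  using grow by (intro tile_error_tendsto) (auto simp: growing_def)
 then have "EV m. tile_error (%k. ?hi m k - ?lo m k) < \<eta>"
  using e by (intro order_tendstoD) auto
 moreover have "EV m. ?e m < flow_density + eps1"
  using e by (intro order_tendstoD[OF mean_flow_tendsto[OF Q grow]]) auto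
 ultimately have "EV m. tile_error (%k. ?hi m k - ?lo m k) < \<eta> & ?e m < flow_density + eps1 &
   (\<forall>k. k ~= j --> ?lo m k + (2*margin + 2) <= ?hi m k) & 2*margin + 2 <= real m"
  using growing_eventually[OF grow, of "2*margin + 2"] by eventually_elim blast
 then obtain m where m: "tile_error (%k. ?hi m k - ?lo m k) < \<eta>" "?e m < flow_density + eps1"
   "!!k. k ~= j ==> ?lo m k + (2*margin + 2) <= ?hi m k" "2*margin + 2 <= real m"
  using eventually_happens' sequentially_bot by blast
 have ab': "\<forall>k. k ~= j --> ?lo m k + 2*margin <= ?hi m k" using m(3) by force
 have ab: "?lo m k + 2*margin <= ?hi m k" if "k ~= j" for k using ab' that by blast
 let ?Y = "cylinder_flow Q (?lo m) (?hi m) (real m*r) (real m)"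
 let ?J = "%n. tiles Q Q (?lo m) (?hi m) (?lo n) (?hi n) (%_. 0)"
 let ?X = "%n. tile_flow Q (?lo m) (?hi m) (%_. 0) (real m*r) (real m) (real n*r)"
 let ?G = "%n. gap_edges Q Q (?lo m) (?hi m) (?lo n) (?hi n) (%_. 0) (real m*r) (real m) (real n*r) (h n)"
 have Am: "0 < area (?lo m) (?hi m)" using ab margin_gt_1 by (intro area_pos) force
 have le: "?lo n k <= ?hi n k" if "k ~= j" for n k
  using lohi[OF that] by (simp add: scale_def mult_left_mono)
 define \<alpha> where "\<alpha> = ?A/area (?lo m) (?hi m)"
 have \<alpha>: "0 <= \<alpha>" using A Am by (simp add: \<alpha>_def)
 have cJ: "real (card (?J n)) <= \<alpha>*real n^D" for n
 proof -
  have "real (card (?J n))*area (?lo m) (?hi m) <= area (?lo n) (?hi n)"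
   by (rule card_tiles_le[OF Q Q]) (use ab le in auto)
  then show ?thesis using Am by (simp add: \<alpha>_def area_scale[of "real n"] field_simps)
 qed
 have "bounded_averages ?Y ?J ?X" by (rule tame_tiles[OF ab' m(4)])
 then have as1: "AE w in M. EV n. (\<Sum>l\<in>?J n. ?X n l w) <= (\<alpha>*expectation ?Y + eps/4)*real n^D"
  using \<alpha> eps cJ unfolding bounded_averages_def by (auto intro: always_eventually)
 have cG: "EV n. real (card (?G n)) <= (\<eta>*?A)*real n^D"
 proof -
  have g: "!!k. k ~= j ==> filterlim (%n. ?hi n k - ?lo n k) at_top sequentially" using grow by (simp add: growing_def)
  have "EV n. real (card (?G n)) <= \<eta>*area (?lo n) (?hi n)"
   by (rule gap_edges_asymptotic[OF Q Q ab g h m(4) m(1)])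
  then show ?thesis by (simp add: area_scale mult_ac)
 qed
 have "bounded_averages (t base_edge) ?G (%_. t)" by (rule tame_gaps[OF ab' m(4)])
 then have as2: "AE w in M. EV n. (\<Sum>l\<in>?G n. t l w) <= (\<eta>*?A*\<mu> + eps/4)*real n^D"
  using e A eps cG unfolding bounded_averages_def \<mu>_def by auto
 have hh: "EV n. real m + margin + 1 <= h n" using h by (simp add: filterlim_at_top)
 from as1 as2 AE_space show ?thesis
 proof eventually_elim
  case (elim w)
  from elim(1,2) hh show ?case
  proof eventually_elim
   case (elim n)
   have "cylinder_flow Q (?lo n) (?hi n) (real n*r) (h n) w <= (\<Sum>l\<in>?J n. ?X n l w) + (\<Sum>l\<in>?G n. t l w)"
    by (rule cylinder_flow_tiling[OF Q Q ab le m(4) elim(3) \<open>w \<in> space M\<close>])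
   also have "... <= (\<alpha>*expectation ?Y + eps/4)*real n^D + (\<eta>*?A*\<mu> + eps/4)*real n^D"
    using elim by (intro add_mono)
   also have "... = (\<alpha>*expectation ?Y + eps/4 + (\<eta>*?A*\<mu> + eps/4))*real n^D"
    by (simp add: distrib_right)
   also have "... <= (flow_density*?A + eps)*real n^D"
   proof (intro mult_right_mono)
    have "\<alpha>*expectation ?Y = ?A*?e m" by (simp add: \<alpha>_def)
    also have "... <= ?A*(flow_density + eps1)" using m(2) A by (intro mult_left_mono) auto
    finally have "\<alpha>*expectation ?Y <= flow_density*?A + eps/4" using e(3) by (simp add: algebra_simps)
    then show "\<alpha>*expectation ?Y + eps/4 + (\<eta>*?A*\<mu> + eps/4) <= flow_density*?A + eps"
     using e(4) by linarith
   qed simp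
   finally show ?case .
  qed
 qed
qed

end

section \<open>The almost sure lower bound along powers of two\<close>

text \<open>Products of bounded affine functions are Lipschitz.\<close>

lemma prod_affine_lipschitz:
 fixes s :: "'d => real"
 assumes "finite I"
 obtains C where "0 <= C" "!!x. 0 <= x ==> x <= 1 ==> (\<Prod>k\<in>I. s k + p*x) - (\<Prod>k\<in>I. s k + q*x) <= C*x"
proof -
 define B where "B = (\<Sum>k\<in>I. \<bar>s k\<bar>) + \<bar>p\<bar> + \<bar>q\<bar> + 1"
 have sB: "\<bar>s k\<bar> <= (\<Sum>k\<in>I. \<bar>s k\<bar>)" if "k \<in> I" for k using assms that by (intro member_le_sum) auto
 have B: "0 < B" unfolding B_def by (intro add_nonneg_pos add_nonneg_nonneg sum_nonneg) auto
 define C where "C = B^card I*(real (card I)*(\<bar>p - q\<bar>/B))"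
 show ?thesis
 proof (rule that[of C])
  show "0 <= C" using B by (simp add: C_def)
  fix x :: real assume x: "0 <= x" "x <= 1"
  have b: "\<bar>(s k + c*x)/B\<bar> <= 1" if "k \<in> I" "c = p \<or> c = q" for k c
  proof -
   have "\<bar>c*x\<bar> <= \<bar>c\<bar>" using x by (simp add: abs_mult mult_left_le)
   then have "\<bar>s k + c*x\<bar> <= B" using sB[OF that(1)] that(2) unfolding B_def by linarith
   then show ?thesis using B by simp
  qed
  have "norm ((\<Prod>k\<in>I. (s k + p*x)/B) - (\<Prod>k\<in>I. (s k + q*x)/B))
    <= (\<Sum>k\<in>I. norm ((s k + p*x)/B - (s k + q*x)/B))"
   using b by (intro norm_prod_diff) auto
  also have "... = (\<Sum>k\<in>I. \<bar>p - q\<bar>*x/B)"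
  proof (intro sum.cong refl)
   fix k
   have "(s k + p*x)/B - (s k + q*x)/B = (p - q)*x/B" by (simp add: diff_divide_distrib[symmetric] algebra_simps)
   then show "norm ((s k + p*x)/B - (s k + q*x)/B) = \<bar>p - q\<bar>*x/B" using x B by (simp add: abs_mult)
  qed
  finally have "(\<Prod>k\<in>I. (s k + p*x)/B) - (\<Prod>k\<in>I. (s k + q*x)/B) <= real (card I)*(\<bar>p - q\<bar>*x/B)"
   by simp
  then have "((\<Prod>k\<in>I. s k + p*x) - (\<Prod>k\<in>I. s k + q*x))/B^card I <= real (card I)*(\<bar>p - q\<bar>*x/B)"
   by (simp add: prod_dividef diff_divide_distrib)
  then have "(\<Prod>k\<in>I. s k + p*x) - (\<Prod>k\<in>I. s k + q*x) <= (real (card I)*(\<bar>p - q\<bar>*x/B))*B^card I"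
   using B by (subst (asm) pos_divide_le_eq) auto
  then show "(\<Prod>k\<in>I. s k + p*x) - (\<Prod>k\<in>I. s k + q*x) <= C*x"
   by (simp add: C_def mult_ac)
 qed
qed

lemma card_binary_corners:
 fixes j :: "'d::finite"
 defines "S == {l :: 'd => int. l j = 0 & (\<forall>k. k ~= j --> 0 <= l k & l k <= 1)}"
 shows "card S = 2^card (- {j})"
proof -
 let ?f = "%l :: 'd => int. restrict l (- {j})" and ?g = "%l k. if k = j then 0 else (l k :: int)"
 have "bij_betw ?f S ((- {j}) \<rightarrow>\<^sub>E {0..1})"
 proof (rule bij_betwI[where g = ?g])
  show "?f \<in> S \<rightarrow> ((- {j}) \<rightarrow>\<^sub>E {0..1})"
  proof
   fix l assume l: "l \<in> S"
   show "?f l \<in> (- {j}) \<rightarrow>\<^sub>E {0..1}"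
   proof (rule PiE_I)
    fix k assume k: "k \<in> - {j}"
    then have "0 <= l k & l k <= 1" using l by (simp add: S_def)
    then show "?f l k \<in> {0..1}" using k by simp
   qed simp
  qed
  show "?g \<in> ((- {j}) \<rightarrow>\<^sub>E {0..1}) \<rightarrow> S"
  proof
   fix l :: "'d => int" assume l: "l \<in> (- {j}) \<rightarrow>\<^sub>E {0..1}"
   have "0 <= l k & l k <= 1" if "k ~= j" for k
    using PiE_mem[OF l, of k] that by simp
   then show "?g l \<in> S" by (simp add: S_def)
  qed
  show "?g (?f l) = l" if "l \<in> S" for l using that by (auto simp: S_def fun_eq_iff)
  show "?f (?g l) = l" if "l \<in> (- {j}) \<rightarrow>\<^sub>E {0..1}" for l
  proof (rule ext)
   fix k show "?f (?g l) k = l k"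
    using PiE_arb[OF that, of k] by (cases "k = j") auto
  qed
 qed
 then have "card S = card ((- {j}) \<rightarrow>\<^sub>E {0..1::int})" by (rule bij_betw_same_card)
 also have "... = 2^card (- {j})" by (simp add: card_PiE)
 finally show ?thesis .
qed

context percolation_capacities
begin

text \<open>Side lengths that double up to a constant, so that the larger rectangle contains exactly two
  translates of the smaller one along each axis, with room to move them to integer positions.\<close>

definition doubling_side :: "('d => real) => nat => 'd => real" where
 "doubling_side s k i = 2^k * s i - (8*margin + 2)"

context
 fixes Q :: "real^'d => real^'d" and s :: "'d => real" and H :: "nat => real"
 assumes Q: "frame Q" and s: "!!i. i ~= j ==> 0 < s i"
  and H: "2*margin + 2 <= H 0" "!!k. H k + margin + 1 <= H (Suc k)"
begin

lemmas Q_frame = Q[unfolded frame_def, THEN conjunct1] Q[unfolded frame_def, THEN conjunct2]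

lemma heights: "2*margin + 2 <= H k" "real k <= H k"
proof -
 have "2*margin + 2 + real k <= H k"
 proof (induction k)
  case (Suc k)
  then show ?case using H(2)[of k] margin_gt_1 by simp
 qed (use H(1) in simp)
 then show "2*margin + 2 <= H k" "real k <= H k" using margin_gt_1 by auto
qed

lemma doubling_tiles:
 assumes L: "!!i. i ~= j ==> 2*margin <= doubling_side s k i"
 shows "tiles Q Q (%_. 0) (doubling_side s k) (%_. 0) (doubling_side s (Suc k)) (%_. 2*margin + 1)
  = {l. l j = 0 & (\<forall>i. i ~= j --> 0 <= l i & l i <= 1)}" (is "?T = ?S")
proof (rule set_eqI)
 fix l :: "'d => int"
 have L': "(0::real) + 2*margin <= doubling_side s k i" if "i ~= j" for i using L[OF that] by simp
 show "l \<in> ?T \<longleftrightarrow> l \<in> ?S"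
 proof (cases "l j = 0")
  case False
  have "l j = 0" if "l \<in> ?T"
   by (rule tile_indices_zero[OF Q_frame Q_frame margin_def L']) (use that in \<open>auto simp: tiles_def\<close>)
  then show ?thesis using False by auto
 next
  case True
  let ?\<sigma> = "%i. doubling_side s k i + 4*margin"
  have "(0 + 1 <= 0 + (2*margin + 1) + tile_spacing margin (%_. 0) (doubling_side s k) i * of_int (l i) - 2*margin &
    0 + (2*margin + 1) + tile_spacing margin (%_. 0) (doubling_side s k) i * of_int (l i) - 2*margin
     + tile_spacing margin (%_. 0) (doubling_side s k) i <= doubling_side s (Suc k) i - 1)
    \<longleftrightarrow> 0 <= l i & l i <= 1" if i: "i ~= j" for i
  proof -
   have \<sigma>: "0 < ?\<sigma> i" using L[OF i] margin_gt_1 by simp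
   have sp: "tile_spacing margin (%_. 0) (doubling_side s k) i = ?\<sigma> i" by (simp add: tile_spacing_def)
   have big: "doubling_side s (Suc k) i = 2*?\<sigma> i + 2" by (simp add: doubling_side_def algebra_simps)
   have "(0 <= ?\<sigma> i * of_int (l i)) \<longleftrightarrow> 0 <= l i" using \<sigma> by (simp add: zero_le_mult_iff)
   moreover have "(?\<sigma> i * of_int (l i) <= ?\<sigma> i) \<longleftrightarrow> l i <= 1"
   proof -
    have "(?\<sigma> i * of_int (l i) <= ?\<sigma> i*1) \<longleftrightarrow> real_of_int (l i) <= 1" using \<sigma> by (simp only: mult_le_cancel_left_pos)
    then show ?thesis by simp
   qed
   ultimately show ?thesis unfolding sp big by auto
  qed
  moreover have iff: "l \<in> ?T \<longleftrightarrow> (\<forall>i. i ~= j --> 0 + 1 <= 0 + (2*margin + 1) + tile_spacing margin (%_. 0) (doubling_side s k) i * of_int (l i) - 2*margin &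
    0 + (2*margin + 1) + tile_spacing margin (%_. 0) (doubling_side s k) i * of_int (l i) - 2*margin
     + tile_spacing margin (%_. 0) (doubling_side s k) i <= doubling_side s (Suc k) i - 1)"
   unfolding tiles_def by (rule tile_indices_bounds[OF Q_frame Q_frame margin_def]) (use L' True in auto)
  ultimately show ?thesis
   unfolding iff using True by auto
 qed
qed

lemma doubling_eventually: "EV k. \<forall>i\<in>-{j}. B <= doubling_side s k i"
proof -
 have "EV k. B <= doubling_side s k i" if "i \<in> - {j}" for i
 proof -
  have "filterlim (%k. 2^k :: real) at_top sequentially"
   by (rule filterlim_at_top_mono[OF filterlim_real_sequentially])
    (auto intro!: always_eventually order.strict_implies_order of_nat_less_two_power)
  then have "filterlim (%k. s i*2^k) at_top sequentially"
   using s[of i] that by (intro filterlim_tendsto_pos_mult_at_top[OF tendsto_const]) auto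
  then have "EV k. B + (8*margin + 2) <= s i*2^k" by (simp add: filterlim_at_top)
  then show ?thesis by eventually_elim (simp add: doubling_side_def mult.commute)
 qed
 then show ?thesis by (subst eventually_ball_finite_distrib) auto
qed

lemma doubling_area: "area (%_. 0) (doubling_side s k) = 2^(k*D)*(\<Prod>i\<in>-{j}. s i + (- (8*margin + 2))*(1/2)^k)"
proof -
 have "doubling_side s k i - 0 = 2^k*(s i + (- (8*margin + 2))*(1/2)^k)" for i
  by (simp add: doubling_side_def algebra_simps power_one_over)
 then show ?thesis unfolding area_def by (simp add: prod.distrib power_mult)
qed

text \<open>The gaps and walls have the order of the boundary, a share \<open>2 ^ - k\<close> of the
  area.\<close>

lemma doubling_gaps_summable:
 assumes L: "!!k i. k0 <= k ==> i ~= j ==> 2*margin <= doubling_side s k i"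
 defines "G == %k. gap_edges Q Q (%_. 0) (doubling_side s k) (%_. 0) (doubling_side s (Suc k)) (%_. 2*margin + 1) 0 (H k) 0 (H (Suc k))"
 shows "summable (%k. real (card (G (k + k0)))/2^(Suc (k + k0)*D))"
proof -
 let ?c = "8*margin + 2" and ?deg = "lattice_degree TYPE('d)"
 obtain C1 where C1: "0 <= C1" "!!x. 0 <= x ==> x <= 1 ==>
   (\<Prod>i\<in>-{j}. s i + ((2*margin - ?c)/2)*x) - (\<Prod>i\<in>-{j}. s i + (- (?c + 2*margin))*x) <= C1*x"
  using prod_affine_lipschitz[of "- {j}" s "(2*margin - ?c)/2" "- (?c + 2*margin)"] by auto
 obtain C2 where C2: "0 <= C2" "!!x. 0 <= x ==> x <= 1 ==>
   (\<Prod>i\<in>-{j}. s i + (2*margin - ?c)*x) - (\<Prod>i\<in>-{j}. s i + (- (?c + 2*margin))*x) <= C2*x"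
  using prod_affine_lipschitz[of "- {j}" s "2*margin - ?c" "- (?c + 2*margin)"] by auto
 define C where "C = ?deg*(2*margin*C1 + 4*margin*C2)"
 have bound: "real (card (G k))/2^(Suc k*D) <= C*(1/2)^k" if k: "k0 <= k" for k
 proof -
  define x where "x = ((1::real)/2)^k"
  have x: "0 <= x" "x <= 1" by (auto simp: x_def power_le_one)
  have x2: "2^k*x = 1" by (simp add: x_def power_one_over)
  have x3: "2^k*(u + c*x) = 2^k*u + c" for u c
  proof -
   have "2^k*(u + c*x) = 2^k*u + c*(2^k*x)" by (simp add: algebra_simps)
   then show ?thesis by (simp only: x2 mult_1_right)
  qed
  have Lk: "(0::real) + 2*margin <= doubling_side s k i" if "i ~= j" for i using L[OF k that] by simp
  have LS: "(0::real) <= doubling_side s (Suc k) i" if "i ~= j" for i using L[of "Suc k" i] k that margin_gt_1 by simp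
  have cT: "card (tiles Q Q (%_. 0) (doubling_side s k) (%_. 0) (doubling_side s (Suc k)) (%_. 2*margin + 1)) = 2^D"
   using L[OF k] by (subst doubling_tiles) (auto simp: card_binary_corners)
  have p1: "(\<Prod>i\<in>-{j}. doubling_side s (Suc k) i - 0 + 2*margin)
    = 2^(Suc k*D)*(\<Prod>i\<in>-{j}. s i + ((2*margin - ?c)/2)*x)"
  proof -
   have "doubling_side s (Suc k) i - 0 + 2*margin = 2^Suc k*(s i + ((2*margin - ?c)/2)*x)" for i
    unfolding power_Suc mult.assoc x3 by (simp add: doubling_side_def)
   then show ?thesis by (simp only: prod.distrib prod_constant power_mult)
  qed
  have p2: "(\<Prod>i\<in>-{j}. doubling_side s k i - 0 - 2*margin)
    = 2^(k*D)*(\<Prod>i\<in>-{j}. s i + (- (?c + 2*margin))*x)"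
  proof -
   have "doubling_side s k i - 0 - 2*margin = 2^k*(s i + (- (?c + 2*margin))*x)" for i
    unfolding power_Suc mult.assoc x3 by (simp add: doubling_side_def)
   then show ?thesis by (simp only: prod.distrib prod_constant power_mult)
  qed
  have p3: "(\<Prod>i\<in>-{j}. doubling_side s k i - 0 + 2*margin)
    = 2^(k*D)*(\<Prod>i\<in>-{j}. s i + (2*margin - ?c)*x)"
  proof -
   have "doubling_side s k i - 0 + 2*margin = 2^k*(s i + (2*margin - ?c)*x)" for i
    unfolding power_Suc mult.assoc x3 by (simp add: doubling_side_def)
   then show ?thesis by (simp only: prod.distrib prod_constant power_mult)
  qed
  have dd: "(2::real)^D*2^(k*D) = 2^(Suc k*D)" by (simp add: power_add)
  let ?A = "\<Prod>i\<in>-{j}. s i + ((2*margin - ?c)/2)*x" and ?B = "\<Prod>i\<in>-{j}. s i + (- (?c + 2*margin))*x"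
   and ?E = "\<Prod>i\<in>-{j}. s i + (2*margin - ?c)*x" and ?q = "2^(Suc k*D) :: real"
  have "real (card (G k)) <= ?deg*(2*margin*(?q*?A - 2^D*(2^(k*D)*?B))
    + 2^D*(4*margin*(2^(k*D)*?E - 2^(k*D)*?B)))"
  proof -
   let ?T = "tiles Q Q (%_. 0) (doubling_side s k) (%_. 0) (doubling_side s (Suc k)) (%_. 2*margin + 1)"
   have "real (card (G k)) <= ?deg*(2*margin*((\<Prod>i\<in>-{j}. doubling_side s (Suc k) i - 0 + 2*margin)
      - real (card ?T)*(\<Prod>i\<in>-{j}. doubling_side s k i - 0 - 2*margin))
     + real (card ?T)*(4*margin*((\<Prod>i\<in>-{j}. doubling_side s k i - 0 + 2*margin)
      - (\<Prod>i\<in>-{j}. doubling_side s k i - 0 - 2*margin))))"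
    unfolding G_def by (rule gap_edges_card[OF Q Q _ _ heights(1) H(2)]) (use Lk LS in auto)
   then show ?thesis unfolding p1 p2 p3 cT by simp
  qed
  also have "... = ?deg*(2*margin*(?A - ?B) + 4*margin*(?E - ?B))*?q"
   unfolding dd[symmetric] by (simp add: algebra_simps)
  also have "... <= ?deg*(2*margin*(C1*x) + 4*margin*(C2*x))*?q"
   using C1(2)[OF x] C2(2)[OF x] margin_gt_1
   by (intro mult_right_mono mult_left_mono add_mono lattice_degree_nonneg) auto
  finally have "real (card (G k)) <= C*x*?q" by (simp add: C_def algebra_simps)
  then show ?thesis by (simp add: x_def field_simps)
 qed
 show ?thesis
 proof (rule summable_comparison_test)
  have "summable (%k. (C*(1/2)^k0)*(1/2)^k)" by (intro summable_mult summable_geometric) auto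
  then show "summable (%k. C*(1/2)^(k + k0))" by (simp add: power_add mult_ac)
  show "\<exists>N. \<forall>k\<ge>N. norm (real (card (G (k + k0)))/2^(Suc (k + k0)*D)) <= C*(1/2)^(k + k0)"
   using bound by auto
 qed
qed

definition doubling_flow :: "nat => 'w => real" where
 "doubling_flow k = cylinder_flow Q (%_. 0) (doubling_side s k) 0 (H k)"

lemma doubling_L1:
 "(%k. expectation (%w. \<bar>doubling_flow k w/2^(k*D) - flow_density*(\<Prod>i\<in>-{j}. s i)\<bar>)) \<longlonglongrightarrow> 0"
proof -
 let ?A = "%k. area (%_. 0) (doubling_side s k)" and ?p = "%k. \<Prod>i\<in>-{j}. s i + (- (8*margin + 2))*(1/2)^k"
 have grow: "growing (%_ _. 0) (doubling_side s) H"
  unfolding growing_def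
 proof (intro conjI allI impI)
  show "filterlim (%n. doubling_side s n k - 0) at_top sequentially" if "k ~= j" for k
   unfolding filterlim_at_top
  proof
   fix B show "EV n. B <= doubling_side s n k - 0"
    using doubling_eventually[of B] by eventually_elim (use that in simp)
  qed
  show "filterlim H at_top sequentially"
   by (rule filterlim_at_top_mono[OF filterlim_real_sequentially]) (use heights(2) in auto)
 qed
 have p: "?p \<longlonglongrightarrow> (\<Prod>i\<in>-{j}. s i + (- (8*margin + 2))*0)"
  by (intro tendsto_prod tendsto_add tendsto_mult tendsto_const LIMSEQ_realpow_zero) auto
 have L1: "(%k. expectation (%w. \<bar>doubling_flow k w/?A k - flow_density\<bar>)) \<longlonglongrightarrow> 0"
  unfolding doubling_flow_def by (rule flow_L1_tendsto[OF Q grow, of "%_. 0"])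
 have up: "(%k. \<bar>?p k\<bar>*expectation (%w. \<bar>doubling_flow k w/?A k - flow_density\<bar>)
   + \<bar>flow_density*(?p k - (\<Prod>i\<in>-{j}. s i))\<bar>) \<longlonglongrightarrow> \<bar>\<Prod>i\<in>-{j}. s i + (- (8*margin + 2))*0\<bar>*0
   + \<bar>flow_density*((\<Prod>i\<in>-{j}. s i + (- (8*margin + 2))*0) - (\<Prod>i\<in>-{j}. s i))\<bar>"
  by (intro tendsto_add tendsto_mult tendsto_rabs tendsto_diff tendsto_const p L1)
 show ?thesis
 proof (rule tendsto_sandwich[OF _ _ tendsto_const])
  show "EV k. 0 <= expectation (%w. \<bar>doubling_flow k w/2^(k*D) - flow_density*(\<Prod>i\<in>-{j}. s i)\<bar>)"
   by (intro always_eventually allI integral_nonneg_AE AE_I2) auto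
  show "(%k. \<bar>?p k\<bar>*expectation (%w. \<bar>doubling_flow k w/?A k - flow_density\<bar>)
   + \<bar>flow_density*(?p k - (\<Prod>i\<in>-{j}. s i))\<bar>) \<longlonglongrightarrow> 0" using up by simp
  show "EV k. expectation (%w. \<bar>doubling_flow k w/2^(k*D) - flow_density*(\<Prod>i\<in>-{j}. s i)\<bar>)
   <= \<bar>?p k\<bar>*expectation (%w. \<bar>doubling_flow k w/?A k - flow_density\<bar>)
   + \<bar>flow_density*(?p k - (\<Prod>i\<in>-{j}. s i))\<bar>"
   using area_eventually_pos[OF Q grow]
  proof eventually_elim
   case (elim k)
   have int: "integrable M (doubling_flow k)" unfolding doubling_flow_def by (rule cylinder_flow_rv(2)[OF Q])
   have "expectation (%w. \<bar>doubling_flow k w/2^(k*D) - flow_density*(\<Prod>i\<in>-{j}. s i)\<bar>)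
    <= expectation (%w. \<bar>?p k\<bar>*\<bar>doubling_flow k w/?A k - flow_density\<bar> + \<bar>flow_density*(?p k - (\<Prod>i\<in>-{j}. s i))\<bar>)"
   proof (rule integral_mono)
    fix w
    have "doubling_flow k w/2^(k*D) = ?p k*(doubling_flow k w/?A k)"
    proof -
     have "?p k ~= 0" using elim unfolding doubling_area by (metis mult_zero_right less_irrefl)
     moreover have "x/c = p*(x/(c*p))" if "p ~= 0" for x c p :: real using that by simp
     ultimately show ?thesis unfolding doubling_area by blast
    qed
    then have "doubling_flow k w/2^(k*D) - flow_density*(\<Prod>i\<in>-{j}. s i)
      = ?p k*(doubling_flow k w/?A k - flow_density) + flow_density*(?p k - (\<Prod>i\<in>-{j}. s i))"
     by (simp only: right_diff_distrib) (simp add: mult.commute)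
    then show "\<bar>doubling_flow k w/2^(k*D) - flow_density*(\<Prod>i\<in>-{j}. s i)\<bar>
      <= \<bar>?p k\<bar>*\<bar>doubling_flow k w/?A k - flow_density\<bar> + \<bar>flow_density*(?p k - (\<Prod>i\<in>-{j}. s i))\<bar>"
     by (simp only: abs_mult[symmetric] abs_triangle_ineq)
   qed (use int in auto)
   also have "... = \<bar>?p k\<bar>*expectation (%w. \<bar>doubling_flow k w/?A k - flow_density\<bar>)
     + \<bar>flow_density*(?p k - (\<Prod>i\<in>-{j}. s i))\<bar>"
    using int by (simp add: prob_space)
   finally show ?case .
  qed
 qed
qed

text \<open>The flow through the doubled rectangle is at most a sum over \<open>2 ^ D\<close> independent
  copies. The translations \<open>z k\<close> leave the law of each flow unchanged.\<close>

lemma doubling_flow_lower_as: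
 assumes z: "!!k. z k \<in> integer_points" and eps: "0 < eps"
 shows "AE w in M. EV k. flow_density*(\<Prod>i\<in>-{j}. s i) - eps
  <= flow ((+) (z k) ` cylinder_points Q (%_. 0) (doubling_side s k) 0 (H k)) (v \<bullet> z k) w/2^(k*D)"
proof -
 obtain k0 where k0: "!!k i. k0 <= k ==> i ~= j ==> 2*margin <= doubling_side s k i"
  using doubling_eventually[of "2*margin"] by (auto simp: eventually_sequentially)
 let ?N = "%k. 2^((k + k0)*D) :: real" and ?\<nu> = "flow_density*(\<Prod>i\<in>-{j}. s i)"
 define Z where "Z k w = doubling_flow (k + k0) w/?N k" for k w
 define I where "I = {l :: 'd => int. l j = 0 & (\<forall>i. i ~= j --> 0 <= l i & l i <= 1)}"
 have cI: "card I = 2^D" unfolding I_def by (rule card_binary_corners)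
 have D2: "(2::nat) <= 2^D" using D power_increasing[of 1 D "2::nat"] by simp
 let ?off = "%_ :: 'd. 2*margin + 1"
 define X where "X k l w = tile_flow Q (%_. 0) (doubling_side s (k + k0)) ?off 0 (H (k + k0)) 0 l w/?N k" for k l w
 define G where "G k = gap_edges Q Q (%_. 0) (doubling_side s k) (%_. 0) (doubling_side s (Suc k)) ?off 0 (H k) 0 (H (Suc k))" for k
 define W where "W k w = (\<Sum>e\<in>G (k + k0). t e w)/2^(Suc (k + k0)*D)" for k w
 have Lk: "(0::real) + 2*margin <= doubling_side s (k + k0) i" if "i ~= j" for i k using k0[of "k + k0"] that by simp
 have LS: "(0::real) <= doubling_side s (Suc (k + k0)) i" if "i ~= j" for i k
  using k0[of "Suc (k + k0)" i] that margin_gt_1 by simp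
 have tI: "tiles Q Q (%_. 0) (doubling_side s (k + k0)) (%_. 0) (doubling_side s (Suc (k + k0))) ?off = I" for k
  unfolding I_def by (rule doubling_tiles) (use k0 in auto)
 have fl: "nonneg_rv (doubling_flow k)" "integrable M (doubling_flow k)" for k
  unfolding doubling_flow_def by (rule cylinder_flow_rv[OF Q])+
 have Z: "nonneg_rv (Z k)" "integrable M (Z k)" for k
  using fl[of "k + k0"] by (auto simp: Z_def[abs_def] nonneg_rv_def)
 have L1: "(%k. expectation (%w. \<bar>Z k w - ?\<nu>\<bar>)) \<longlonglongrightarrow> 0"
  unfolding Z_def using LIMSEQ_ignore_initial_segment[OF doubling_L1, of k0] .
 have "Bseq (%k. expectation (%w. \<bar>Z k w - ?\<nu>\<bar>))" using L1 by (intro convergent_imp_Bseq) (auto simp: convergent_def)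
 then obtain B where B: "!!k. \<bar>expectation (%w. \<bar>Z k w - ?\<nu>\<bar>)\<bar> <= B" by (auto simp: Bseq_def)
 have ZB: "expectation (Z k) <= ?\<nu> + B" for k
 proof -
  have "expectation (Z k) - ?\<nu> = expectation (%w. Z k w - ?\<nu>)" using Z(2)[of k] by (simp add: prob_space)
  also have "... <= expectation (%w. \<bar>Z k w - ?\<nu>\<bar>)" using Z(2)[of k] by (intro integral_mono) auto
  finally show ?thesis using B[of k] by simp
 qed
 have finG: "finite (G (k + k0))" "G (k + k0) \<subseteq> lattice_edges" for k
  unfolding G_def using finite_gap_edges[OF Q Q Lk LS heights(1) H(2)] gap_edges_sub[OF Q Q Lk LS heights(1) H(2)] by auto
 have W: "nonneg_rv (W k)" "integrable M (W k)" for k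
 proof -
  have "random_variable borel (%w. \<Sum>e\<in>G (k + k0). t e w)" using capacity_rv finG(2)[of k] by (intro borel_measurable_sum) auto
  moreover have "0 <= (\<Sum>e\<in>G (k + k0). t e w)" if "w \<in> space M" for w
   using capacity_nonneg[OF _ that] finG(2)[of k] by (intro sum_nonneg) auto
  ultimately show "nonneg_rv (W k)" by (auto simp: nonneg_rv_def W_def[abs_def])
  show "integrable M (W k)" unfolding W_def[abs_def] using capacity_sum_expectation(2)[OF finG[of k]] by auto
 qed
 have sW: "summable (%k. expectation (W k))"
 proof -
  have "expectation (W k) = \<mu>*(real (card (G (k + k0)))/2^(Suc (k + k0)*D))" for k
   unfolding W_def[abs_def] using capacity_sum_expectation[OF finG[of k]] by (simp add: \<mu>_def)
  then show ?thesis
   using summable_mult[OF doubling_gaps_summable[of k0], of \<mu>] k0 unfolding G_def by simp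
 qed
 have cop: "iid_copies (Z k) I (X k)" for k
 proof -
  have rv: "random_variable borel (doubling_flow (k + k0))" using fl(1) by (simp add: nonneg_rv_def)
  have "iid_copies (doubling_flow (k + k0)) I (tile_flow Q (%_. 0) (doubling_side s (k + k0)) ?off 0 (H (k + k0)) 0)"
   unfolding doubling_flow_def tI[of k, symmetric]
   by (rule tile_flows_iid[OF Q Q _ _ heights(1) H(2)]) (use Lk LS in auto)
  from copies_compose[OF this rv, where g = "%y. y/?N k"] show ?thesis
   unfolding Z_def[abs_def] X_def[abs_def] by simp
 qed
 have sub: "Z (Suc k) w <= (\<Sum>i\<in>I. X k i w)/real (2^D) + W k w" if w: "w \<in> space M" for k w
 proof -
  have "doubling_flow (Suc (k + k0)) w
    <= (\<Sum>l\<in>I. tile_flow Q (%_. 0) (doubling_side s (k + k0)) ?off 0 (H (k + k0)) 0 l w) + (\<Sum>e\<in>G (k + k0). t e w)"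
   unfolding doubling_flow_def G_def tI[of k, symmetric]
   by (rule cylinder_flow_tiling[OF Q Q _ _ heights(1) H(2) w]) (use Lk LS in auto)
  then have "doubling_flow (Suc (k + k0)) w/2^(Suc (k + k0)*D)
    <= ((\<Sum>l\<in>I. tile_flow Q (%_. 0) (doubling_side s (k + k0)) ?off 0 (H (k + k0)) 0 l w) + (\<Sum>e\<in>G (k + k0). t e w))/2^(Suc (k + k0)*D)"
   by (intro divide_right_mono) auto
  also have "... = (\<Sum>l\<in>I. tile_flow Q (%_. 0) (doubling_side s (k + k0)) ?off 0 (H (k + k0)) 0 l w)/2^(Suc (k + k0)*D) + W k w"
   by (simp add: add_divide_distrib W_def)
  also have "(\<Sum>l\<in>I. tile_flow Q (%_. 0) (doubling_side s (k + k0)) ?off 0 (H (k + k0)) 0 l w)/2^(Suc (k + k0)*D)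
    = (\<Sum>i\<in>I. X k i w)/real (2^D)"
   by (simp add: X_def sum_divide_distrib[symmetric] power_add mult_ac)
  finally show ?thesis by (simp add: Z_def)
 qed
 have var: "summable (%k. variance (%w. exp (- Z k w/real (2^D))))"
  by (rule averaging_variances_summable[OF cI D2 Z(1,2) ZB W sW cop sub])
 define Z' where "Z' k w = flow ((+) (z (k + k0)) ` cylinder_points Q (%_. 0) (doubling_side s (k + k0)) 0 (H (k + k0)))
   (v \<bullet> z (k + k0)) w/?N k" for k w
 have fr: "random_variable borel (flow ((+) (z k) ` cylinder_points Q (%_. 0) (doubling_side s k) 0 (H k)) (v \<bullet> z k))" for k
  by (intro flow_rv finite_imageI finite_cylinder_points Q)
 have Z'rv: "random_variable borel (Z' k)" for k unfolding Z'_def[abs_def] using fr[of "k + k0"] by measurable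
 have law: "distr M borel (Z' k) = distr M borel (Z k)" for k
 proof -
  have rv: "random_variable borel (doubling_flow (k + k0))" using fl(1) by (simp add: nonneg_rv_def)
  let ?f = "flow ((+) (z (k + k0)) ` cylinder_points Q (%_. 0) (doubling_side s (k + k0)) 0 (H (k + k0))) (v \<bullet> z (k + k0))"
  have "distr M borel ?f = distr M borel (doubling_flow (k + k0))"
   unfolding doubling_flow_def cylinder_flow_def
   using flow_translate_law[OF finite_cylinder_points[OF Q] z, where r = 0] by simp
  then have "distr (distr M borel ?f) borel (%y. y/?N k) = distr (distr M borel (doubling_flow (k + k0))) borel (%y. y/?N k)"
   by simp
  then show ?thesis
   using fr[of "k + k0"] rv by (simp add: distr_distr o_def Z'_def[abs_def] Z_def[abs_def])
 qed
 have \<nu>0: "0 <= ?\<nu>" using flow_density_nonneg[OF Q] s by (intro mult_nonneg_nonneg prod_nonneg) (auto simp: less_imp_le)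
 have "AE w in M. EV k. ?\<nu> - eps <= Z' k w"
  by (rule averaging_almost_sure_lower_bound[OF _ Z L1 \<nu>0 var Z'rv law eps]) simp
 then show ?thesis
 proof eventually_elim
  case (elim w)
  then show ?case
   unfolding Z'_def by (subst eventually_sequentially_seg[symmetric, where k = k0]) simp
 qed
qed

end

end

section \<open>Interpolation between the dyadic scales\<close>

text \<open>A cut of the lower cylinder separates the taller one as well, with every additional vertex
  placed by its height; this is gluing with a single small cylinder, where no interface edges arise.\<close>

lemma min_cut_taller:
 fixes Q :: "real^'d => real^'d"
 assumes Q: "orthogonal_transformation Q" "Q v = axis j 1" and h: "2 <= h" "h <= h'"
  and c: "!!e. e \<in> lattice_edges ==> 0 <= c e"
 shows "min_cut v (lattice_points v (prism Q j lo hi) r h') r c <= min_cut v (lattice_points v (prism Q j lo hi) r h) r c"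
proof -
 let ?V = "lattice_points v (prism Q j lo hi) r h'" and ?W = "lattice_points v (prism Q j lo hi) r h"
 have v1: "norm v = 1" by (rule frame_norm[OF Q])
 have inW: "x \<in> ?W" if "x \<in> ?V" "\<bar>v \<bullet> x - r\<bar> <= 2" for x
  using that h by (auto simp: lattice_points_def)
 have empty: "interface_edges v ?V r {()} (%_. ?W) (%_. 0) = {}"
 proof -
  have flat: "flat_edges v (?V - ?W) r = {}"
  proof (rule ccontr)
   assume "flat_edges v (?V - ?W) r ~= {}"
   then obtain x y where xy: "{x, y} \<in> lattice_edges" "x \<in> ?V - ?W" "r < v \<bullet> x" "v \<bullet> y <= r"
    by (auto simp: flat_edges_def)
   then have "\<bar>v \<bullet> x - r\<bar> <= 2" using height_neighbour[OF v1 xy(1)] by linarith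
   then show False using inW[of x] xy(2) by blast
  qed
  have wall: "wall_edges v ?V r ?W 0 = {}"
  proof (rule ccontr)
   assume "wall_edges v ?V r ?W 0 ~= {}"
   then obtain x y where xy: "{x, y} \<in> lattice_edges" "y \<in> ?V - ?W" "\<bar>v \<bullet> x - r\<bar> <= 0 + 1"
    unfolding wall_edges_def by blast
   then have "\<bar>v \<bullet> y - r\<bar> <= 2" using height_neighbour[OF v1 xy(1)] by linarith
   then show False using inW[of y] xy(2) by blast
  qed
  show ?thesis using flat wall by (simp add: interface_edges_def)
 qed
 have "min_cut v ?V r c <= (\<Sum>i\<in>{()}. min_cut v ?W r c) + (\<Sum>e\<in>interface_edges v ?V r {()} (%_. ?W) (%_. 0). c e)"
 proof (rule min_cut_gluing[OF v1 finite_lattice_points[OF Q]])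
  show "?V \<subseteq> integer_points" by (auto simp: lattice_points_def)
  show "?W \<subseteq> ?V" using h by (auto simp: lattice_points_def)
  show "disjoint_family_on (%_. ?W) {()}" by (simp add: disjoint_family_on_def)
 qed (use c in auto)
 then show ?thesis unfolding empty by simp
qed

lemma dyadic_position:
 fixes n q :: nat
 assumes n: "1 <= n" and q: "1 <= q"
 obtains k i where "i < q" "2^k*(1 + real i/real q) <= real n" "real n <= 2^k*(1 + real (Suc i)/real q)"
proof -
 define k where "k = (LEAST k. n < 2^Suc k)"
 have ex: "n < 2^Suc n" using less_exp[of n] unfolding power_Suc by linarith
 have k1: "n < 2^Suc k" unfolding k_def by (rule LeastI[of _ n]) (rule ex)
 have k2: "2^k <= n"
 proof (cases k)
  case 0
  then show ?thesis using n by simp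
 next
  case (Suc k')
  have "\<not> n < 2^Suc k'" using not_less_Least[of k' "%k. n < 2^Suc k"] Suc unfolding k_def by simp
  then show ?thesis using Suc by simp
 qed
 define i where "i = nat \<lfloor>(real n/2^k - 1)*real q\<rfloor>"
 have r1: "2^k <= real n" using k2 by (metis of_nat_le_iff of_nat_numeral of_nat_power)
 have "real n < real (2^Suc k)" using k1 by (simp only: of_nat_less_iff)
 then have r2: "real n < 2*2^k" by simp
 have x0: "0 <= (real n/2^k - 1)*real q" using r1 by simp
 have x1: "(real n/2^k - 1)*real q < 1*real q"
  using r2 q by (intro mult_strict_right_mono) (auto simp: field_simps)
 have i: "real i <= (real n/2^k - 1)*real q" "(real n/2^k - 1)*real q <= real (Suc i)"
  using x0 unfolding i_def by linarith+
 have q0: "0 < real q" using q by simp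
 show ?thesis
 proof (rule that)
  show "i < q" using i(1) x1 by linarith
  have "real i/real q <= real n/2^k - 1" using i(1) q0 by (simp add: pos_divide_le_eq)
  then have "2^k*(1 + real i/real q) <= 2^k*(real n/2^k)" by (intro mult_left_mono) auto
  then show "2^k*(1 + real i/real q) <= real n" by simp
  have "real n/2^k - 1 <= real (Suc i)/real q" using i(2) q0 by (simp add: pos_le_divide_eq)
  then have "2^k*(real n/2^k) <= 2^k*(1 + real (Suc i)/real q)" by (intro mult_left_mono) auto
  then show "real n <= 2^k*(1 + real (Suc i)/real q)" by simp
 qed
qed

context percolation_capacities
begin

text \<open>The small cylinder is made at least \<open>2 * \<kappa> + 2\<close> high, as the counting of the
  interface requires; this can only decrease its flow.\<close>

definition padding_edges :: "(real^'d => real^'d) => ('d => real) => ('d => real) => real => real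
  => ('d => real) => ('d => real) => real => real => real => (real^'d) set set" where
 "padding_edges Q lo hi r h lo' hi' r' h' \<kappa> = interface_edges v (cylinder_points Q lo' hi' r' h') r' {()}
   (%_. cylinder_points Q lo hi r (max h (2*\<kappa> + 2))) (%_. \<kappa>)"

lemma padding_edges_sub: "padding_edges Q lo hi r h lo' hi' r' h' \<kappa> \<subseteq> lattice_edges"
 by (auto simp: padding_edges_def interface_edges_def flat_edges_def wall_edges_def)

context
 fixes Q :: "real^'d => real^'d" and lo hi lo' hi' :: "'d => real" and r h r' h' \<kappa> :: real
 assumes Q: "frame Q" and h2: "2 <= h" and wide: "!!k. k ~= j ==> lo k + 2*margin <= hi k"
  and inside: "!!k. k ~= j ==> lo' k + 1 <= lo k" "!!k. k ~= j ==> hi k + 1 <= hi' k"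
  and \<kappa>: "\<bar>r - r'\<bar> <= \<kappa>" and h': "max h (2*\<kappa> + 2) + \<kappa> + 1 <= h'"
begin

lemma padding_inside: "cylinder_points Q lo hi r (max h (2*\<kappa> + 2)) \<subseteq> cylinder_points Q lo' hi' r' h'"
proof -
 have "prism Q j lo hi \<subseteq> prism Q j lo' hi'"
  using inside by (intro prism_mono) fastforce+
 then show ?thesis using \<kappa> h' unfolding cylinder_points_def lattice_points_def by fastforce
qed

lemma finite_padding_edges: "finite (padding_edges Q lo hi r h lo' hi' r' h' \<kappa>)"
proof (rule finite_subset[OF _ finite_induced_edges[of "cylinder_points Q lo' hi' r' h'"]])
 show "padding_edges Q lo hi r h lo' hi' r' h' \<kappa> \<subseteq> induced_edges (cylinder_points Q lo' hi' r' h')"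
  using padding_inside unfolding padding_edges_def interface_edges_def flat_edges_def wall_edges_def induced_edges_def by fast
qed (use finite_cylinder_points[OF Q] in simp)

lemma padding_edges_near:
 assumes "e \<in> padding_edges Q lo hi r h lo' hi' r' h' \<kappa>"
 shows "\<exists>x\<in>cylinder_points Q lo' hi' r' h'. x \<in> e & \<bar>v \<bullet> x - r'\<bar> <= \<kappa> + 1"
proof (rule interface_edge_height[OF _ assms[unfolded padding_edges_def]])
 show "norm v = 1" using Q frame_norm unfolding frame_def by blast
 show "0 <= \<kappa>" using \<kappa> by simp
qed (use padding_inside in auto)

lemma cylinder_flow_padding:
 assumes w: "w \<in> space M"
 shows "cylinder_flow Q lo' hi' r' h' w <= cylinder_flow Q lo hi r h w + (\<Sum>e\<in>padding_edges Q lo hi r h lo' hi' r' h' \<kappa>. t e w)"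
proof -
 note Q' = Q[unfolded frame_def, THEN conjunct1] Q[unfolded frame_def, THEN conjunct2]
 let ?V = "cylinder_points Q lo' hi' r' h'" and ?h = "max h (2*\<kappa> + 2)"
 let ?W = "cylinder_points Q lo hi r ?h" and ?c = "%e. t e w"
 have v1: "norm v = 1" by (rule frame_norm[OF Q'])
 have "min_cut v ?V r' ?c <= (\<Sum>i\<in>{()}. min_cut v ?W r ?c) + (\<Sum>e\<in>padding_edges Q lo hi r h lo' hi' r' h' \<kappa>. ?c e)"
  unfolding padding_edges_def
 proof (rule min_cut_gluing[OF v1 finite_cylinder_points[OF Q]])
  show "?V \<subseteq> integer_points" by (auto simp: cylinder_points_def lattice_points_def)
  show "disjoint_family_on (%_. ?W) {()}" by (simp add: disjoint_family_on_def)
  fix x assume x: "x \<in> ?W" and bv: "boundary_vertex ?V x"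
  obtain y where y: "y \<in> integer_points" "y \<notin> ?V" "{x, y} \<in> lattice_edges"
   using bv by (auto simp: boundary_vertex_def)
  have x': "x \<in> prism Q j lo hi" "\<bar>v \<bullet> x - r\<bar> <= ?h" using x by (auto simp: cylinder_points_def lattice_points_def)
  have "prism Q j lo hi \<subseteq> prism Q j (%k. lo' k + 1) (%k. hi' k - 1)"
   using inside by (intro prism_mono) fastforce+
  then have "y \<in> prism Q j lo' hi'"
   using prism_near'[OF Q'(1), of x j lo' 1 hi' y] x'(1) lattice_edgeD(3)[OF y(3)] by auto
  moreover have "\<bar>v \<bullet> y - r'\<bar> <= h'"
   using height_neighbour[OF v1 y(3)] x'(2) \<kappa> h' by linarith
  ultimately have "y \<in> ?V" using y(1) by (simp add: cylinder_points_def lattice_points_def)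
  with y(2) show "r = r'" by blast
 qed (use padding_inside \<kappa> capacity_nonneg w in auto)
 moreover have "min_cut v ?W r ?c <= min_cut v (cylinder_points Q lo hi r h) r ?c"
  unfolding cylinder_points_def by (rule min_cut_taller[OF Q' h2]) (use capacity_nonneg w in auto)
 ultimately show ?thesis by (simp add: cylinder_flow_def flow_def)
qed

lemma card_padding_edges:
 "real (card (padding_edges Q lo hi r h lo' hi' r' h' \<kappa>)) <= lattice_degree TYPE('d) *
   (2*margin*((\<Prod>k\<in>-{j}. hi' k - lo' k + 2*margin) - (\<Prod>k\<in>-{j}. hi k - lo k - 2*margin))
   + 2*(\<kappa> + margin)*((\<Prod>k\<in>-{j}. hi k - lo k + 2*margin) - (\<Prod>k\<in>-{j}. hi k - lo k - 2*margin)))"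
proof -
 note Q' = Q[unfolded frame_def, THEN conjunct1] Q[unfolded frame_def, THEN conjunct2]
 have "real (card (padding_edges Q lo hi r h lo' hi' r' h' \<kappa>))
  <= lattice_degree TYPE('d)*interface_bound (cell_margin TYPE('d)) j (%k. hi' k - lo' k) {()} (%_ k. hi k - lo k) (%_. \<kappa>)"
  unfolding padding_edges_def cylinder_points_def
 proof (rule card_interface_edges[OF Q'])
  show "prism Q j lo hi \<subseteq> prism Q j lo' hi'" using inside by (intro prism_mono) fastforce+
  show "lo' k <= hi' k" if "k ~= j" for k using inside[OF that] wide[OF that] margin_gt_1 by linarith
  show "lo k + 2*cell_margin TYPE('d) <= hi k" if "k ~= j" for k using wide[OF that] by (simp add: margin_def)
 qed (use Q' \<kappa> in \<open>auto simp: disjoint_family_on_def\<close>)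
 then show ?thesis by (simp add: interface_bound_def margin_def[symmetric])
qed

end


context
 fixes Q :: "real^'d => real^'d" and lo hi :: "'d => real" and r :: real and h :: "nat => real"
 assumes Q: "frame Q" and lohi: "!!l. l ~= j ==> lo l < hi l"
begin

definition extent :: real where "extent = 1 + (\<Sum>l\<in>-{j}. \<bar>lo l\<bar> + \<bar>hi l\<bar>)"

lemma extent: "1 <= extent" "l ~= j ==> \<bar>lo l\<bar> <= extent" "l ~= j ==> \<bar>hi l\<bar> <= extent"
proof -
 show "1 <= extent" unfolding extent_def by (simp add: sum_nonneg)
 assume "l ~= j"
 then have "\<bar>lo l\<bar> + \<bar>hi l\<bar> <= (\<Sum>l\<in>-{j}. \<bar>lo l\<bar> + \<bar>hi l\<bar>)" by (intro member_le_sum) auto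
 then show "\<bar>lo l\<bar> <= extent" "\<bar>hi l\<bar> <= extent" unfolding extent_def by linarith+
qed

definition dilation :: "nat => nat => real" where "dilation q i = 1 + real i/real q"

definition enclosing_side :: "nat => nat => 'd => real" where
 "enclosing_side q i l = dilation q i*(hi l - lo l) + 4*(extent/real q)"

definition level_gap :: "nat => nat => real" where "level_gap q k = 2^k/real q*\<bar>r\<bar> + margin"

text \<open>Above the heights of all cylinders in the block, and increasing in \<open>k\<close> by more than
  the rounding error, as the doubling requires.\<close>

definition enclosing_height :: "nat => nat => real" where
 "enclosing_height q k = (\<Sum>n\<le>2^Suc k. \<bar>h n\<bar>) + 3*level_gap q k + 3 + (real k + 2)*(margin + 1)"

text \<open>The lower corner of the enclosing rectangle, moved to an integer point. The margin \<open>2 *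
  extent / q\<close> on each side, at scale \<open>2 ^ k\<close>, exceeds the variation of the rectangle
  within a slot.\<close>

definition corner :: "nat => nat => nat => real^'d" where
 "corner q k i = integer_near Q (%l. if l = j then 2^k*dilation q i*r
   else 2^k*dilation q i*lo l - 2*(2^k/real q*extent))"

definition enclosing_lo :: "nat => nat => nat => 'd => real" where
 "enclosing_lo q k i l = 0 + Q (corner q k i) $ l"

definition enclosing_hi :: "nat => nat => nat => 'd => real" where
 "enclosing_hi q k i l = doubling_side (enclosing_side q i) k l + Q (corner q k i) $ l"

definition boundary_layer :: "nat => nat => nat => nat => (real^'d) set set" where
 "boundary_layer q n k i = padding_edges Q (scale (real n) lo) (scale (real n) hi) (real n*r) (h n)
   (enclosing_lo q k i) (enclosing_hi q k i) (0 + v \<bullet> corner q k i) (enclosing_height q k) (level_gap q k)"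

text \<open>The number \<open>n\<close> lies in part \<open>i\<close> of \<open>q\<close> equal parts,
  counted from 0, of the block from \<open>2 ^ k\<close> to \<open>2 ^ Suc k\<close>.\<close>

definition dyadic_slot :: "nat => nat => nat => nat => bool" where
 "dyadic_slot q n k i \<longleftrightarrow> i < q & 2^k*dilation q i <= real n & real n <= 2^k*dilation q (Suc i)"

definition large_scale :: "nat => nat => bool" where
 "large_scale q n \<longleftrightarrow> 2 <= h n & (\<forall>l. l ~= j --> scale (real n) lo l + 2*margin <= scale (real n) hi l)
   & 2*(9*margin + 3)*real q <= real n"

lemma dilation_ge_1: "1 <= dilation q i" by (simp add: dilation_def)

lemma enclosing_side_pos: "1 <= q ==> l ~= j ==> 0 < enclosing_side q i l"
 unfolding enclosing_side_def using dilation_ge_1[of q i] lohi[of l] extent(1)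
 by (intro add_pos_pos mult_pos_pos divide_pos_pos) auto

lemma enclosing_heights:
 "2*margin + 2 <= enclosing_height q 0" "enclosing_height q k + margin + 1 <= enclosing_height q (Suc k)"
proof -
 have nn: "0 <= (\<Sum>n\<in>A. \<bar>h n\<bar>)" for A :: "nat set" by (simp add: sum_nonneg)
 have g0: "margin <= level_gap q k" for k by (simp add: level_gap_def)
 show "2*margin + 2 <= enclosing_height q 0"
  using nn[of "{..2^Suc 0}"] g0[of 0] margin_gt_1 by (simp add: enclosing_height_def)
 have "2^k/real q*\<bar>r\<bar> <= 2^Suc k/real q*\<bar>r\<bar>" by (intro mult_right_mono divide_right_mono) auto
 then have g: "level_gap q k <= level_gap q (Suc k)" by (simp add: level_gap_def)
 have "(2::nat)^Suc k <= 2^Suc (Suc k)" by simp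
 then have s: "(\<Sum>n\<le>2^Suc k. \<bar>h n\<bar>) <= (\<Sum>n\<le>2^Suc (Suc k). \<bar>h n\<bar>)"
  by (intro sum_mono2) auto
 have "(real (Suc k) + 2)*(margin + 1) = (real k + 2)*(margin + 1) + margin + 1" by (simp add: algebra_simps)
 then show "enclosing_height q k + margin + 1 <= enclosing_height q (Suc k)"
  using g s unfolding enclosing_height_def by linarith
qed

context
 fixes q n k i :: nat
 assumes q: "1 <= q" and slot: "dyadic_slot q n k i"
begin

lemma slot_scale: "2^k <= real n" "real n <= 2*2^k" "n <= 2^Suc k"
proof -
 have "2^k*1 <= 2^k*dilation q i" using dilation_ge_1 by (intro mult_left_mono) auto
 then show "2^k <= real n" using slot unfolding dyadic_slot_def by linarith
 have "real (Suc i)/real q <= 1" using slot q by (simp add: dyadic_slot_def)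
 then have "2^k*dilation q (Suc i) <= 2^k*2" unfolding dilation_def by (intro mult_left_mono) auto
 then show n: "real n <= 2*2^k" using slot unfolding dyadic_slot_def by linarith
 have "real n <= real (2^Suc k)" using n by simp
 then show "n <= 2^Suc k" by (simp only: of_nat_le_iff)
qed

lemma slot_near: "\<bar>real n*u - 2^k*dilation q i*u\<bar> <= 2^k/real q*\<bar>u\<bar>"
proof -
 have "2^k*dilation q (Suc i) = 2^k*dilation q i + 2^k/real q"
  by (simp add: dilation_def add_divide_distrib algebra_simps)
 then have "\<bar>real n - 2^k*dilation q i\<bar> <= 2^k/real q" using slot by (simp add: dyadic_slot_def)
 then have "\<bar>real n - 2^k*dilation q i\<bar>*\<bar>u\<bar> <= 2^k/real q*\<bar>u\<bar>" by (intro mult_right_mono) auto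
 then show ?thesis by (simp only: abs_mult[symmetric] left_diff_distrib)
qed

lemma corner_near:
 "l ~= j ==> \<bar>Q (corner q k i) $ l - (2^k*dilation q i*lo l - 2*(2^k/real q*extent))\<bar> <= margin"
 "\<bar>v \<bullet> corner q k i - 2^k*dilation q i*r\<bar> <= margin"
proof -
 note Q' = Q[unfolded frame_def, THEN conjunct1] Q[unfolded frame_def, THEN conjunct2]
 note near = integer_near(2)[OF Q'(1), of "%l. if l = j then 2^k*dilation q i*r
   else 2^k*dilation q i*lo l - 2*(2^k/real q*extent)", folded corner_def margin_def]
 show "\<bar>Q (corner q k i) $ l - (2^k*dilation q i*lo l - 2*(2^k/real q*extent))\<bar> <= margin" if "l ~= j"
  using near[of l] that by simp
 show "\<bar>v \<bullet> corner q k i - 2^k*dilation q i*r\<bar> <= margin"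
  using near[of j] axis_frame[OF Q', of "corner q k i"] by simp
qed

lemma level_near: "\<bar>real n*r - (0 + v \<bullet> corner q k i)\<bar> <= level_gap q k"
 using slot_near[of r] corner_near(2) unfolding level_gap_def by linarith

context
 assumes large: "large_scale q n"
begin

lemma slot_large: "9*margin + 3 <= 2^k/real q*extent"
proof -
 have "2*(9*margin + 3)*real q <= 2*2^k" using large slot_scale(2) unfolding large_scale_def by linarith
 then have "(9*margin + 3)*real q <= 2^k" by linarith
 then have "9*margin + 3 <= 2^k/real q" using q by (simp add: pos_le_divide_eq)
 also have "... <= 2^k/real q*extent" using mult_left_mono[OF extent(1), of "2^k/real q"] by simp
 finally show ?thesis .
qed

lemma enclosing:
 assumes l: "l ~= j"
 shows "enclosing_lo q k i l + 1 <= scale (real n) lo l" "scale (real n) hi l + 1 <= enclosing_hi q k i l"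
proof -
 let ?e = "2^k/real q*extent"
 have e: "2^k/real q*\<bar>lo l\<bar> <= ?e" "2^k/real q*\<bar>hi l\<bar> <= ?e"
  by (intro mult_left_mono extent l; simp)+
 show "enclosing_lo q k i l + 1 <= scale (real n) lo l"
  using corner_near(1)[OF l] slot_near[of "lo l"] e(1) slot_large margin_gt_1
  unfolding enclosing_lo_def scale_def by linarith
 have "doubling_side (enclosing_side q i) k l
   = 2^k*dilation q i*hi l - 2^k*dilation q i*lo l + 4*?e - (8*margin + 2)"
  by (simp add: doubling_side_def enclosing_side_def algebra_simps)
 then show "scale (real n) hi l + 1 <= enclosing_hi q k i l"
  using corner_near(1)[OF l] slot_near[of "hi l"] e(2) slot_large
  unfolding enclosing_hi_def scale_def by linarith
qed

lemma enclosing_height_bound: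
 "max (h n) (2*level_gap q k + 2) + level_gap q k + 1 <= enclosing_height q k"
proof -
 have "\<bar>h n\<bar> <= (\<Sum>n\<le>2^Suc k. \<bar>h n\<bar>)" using slot_scale(3) by (intro member_le_sum) auto
 moreover have "0 <= level_gap q k" using margin_gt_1 by (simp add: level_gap_def)
 moreover have "0 <= (real k + 2)*(margin + 1)" using margin_gt_1 by simp
 ultimately show ?thesis unfolding enclosing_height_def by linarith
qed

lemma wide: "l ~= j ==> scale (real n) lo l + 2*margin <= scale (real n) hi l"
 using large by (simp add: large_scale_def)

lemma h2: "2 <= h n" using large by (simp add: large_scale_def)

lemma boundary_layer_bound:
 assumes "w \<in> space M"
 shows "cylinder_flow Q (enclosing_lo q k i) (enclosing_hi q k i) (0 + v \<bullet> corner q k i) (enclosing_height q k) w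
  <= cylinder_flow Q (scale (real n) lo) (scale (real n) hi) (real n*r) (h n) w + (\<Sum>e\<in>boundary_layer q n k i. t e w)"
 unfolding boundary_layer_def
 by (rule cylinder_flow_padding[OF Q h2 _ _ _ level_near enclosing_height_bound assms]) (use enclosing wide in auto)

lemma finite_boundary_layer: "finite (boundary_layer q n k i)"
 unfolding boundary_layer_def
 by (rule finite_padding_edges[OF Q h2 _ _ _ level_near enclosing_height_bound]) (use enclosing wide in auto)

lemma boundary_layer_near:
 assumes r: "r = 0" and e: "e \<in> boundary_layer q n k i"
 shows "\<exists>x\<in>e. \<bar>v \<bullet> x\<bar> <= 2*margin + 1 & (\<forall>l. l ~= j --> \<bar>Q x $ l\<bar> <= 12*extent*real n)"
proof -
 obtain x where x: "x \<in> cylinder_points Q (enclosing_lo q k i) (enclosing_hi q k i) (0 + v \<bullet> corner q k i) (enclosing_height q k)"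
   "x \<in> e" "\<bar>v \<bullet> x - (0 + v \<bullet> corner q k i)\<bar> <= level_gap q k + 1"
  using padding_edges_near[OF Q h2 _ _ _ level_near enclosing_height_bound e[unfolded boundary_layer_def]] enclosing wide
  by auto
 have "level_gap q k = margin" "2^k*dilation q i*r = 0" unfolding level_gap_def using r by simp_all
 then have "\<bar>v \<bullet> x\<bar> <= 2*margin + 1" using x(3) corner_near(2) by linarith
 moreover have "\<bar>Q x $ l\<bar> <= 12*extent*real n" if l: "l ~= j" for l
 proof -
  let ?e = "2^k/real q*extent"
  have b: "enclosing_lo q k i l <= Q x $ l" "Q x $ l <= enclosing_hi q k i l"
   using x(1) l by (auto simp: cylinder_points_def lattice_points_def prism_def)
  have ext0: "0 <= extent" using extent(1) by simp
  have en: "?e <= extent*real n"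
  proof -
   have "2^k/real q <= 2^k/1" using q by (intro divide_left_mono) auto
   then have "2^k/real q <= real n" using slot_scale(1) by linarith
   then have "?e <= real n*extent" by (rule mult_right_mono[OF _ ext0])
   then show ?thesis by (simp only: mult.commute)
  qed
  have d: "\<bar>2^k*dilation q i*u\<bar> <= extent*real n" if u: "\<bar>u\<bar> <= extent" for u
  proof -
   have "\<bar>2^k*dilation q i\<bar> <= real n" using slot dilation_ge_1[of q i] by (simp add: dyadic_slot_def abs_mult)
   then have "\<bar>2^k*dilation q i\<bar>*\<bar>u\<bar> <= real n*extent" using u by (intro mult_mono) auto
   then show ?thesis by (simp add: abs_mult mult.commute)
  qed
  have "doubling_side (enclosing_side q i) k l
    = 2^k*dilation q i*hi l - 2^k*dilation q i*lo l + 4*?e - (8*margin + 2)"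
   by (simp add: doubling_side_def enclosing_side_def algebra_simps)
  then show ?thesis
   using b corner_near(1)[OF l] d[OF extent(2)[OF l]] d[OF extent(3)[OF l]] en slot_large margin_gt_1
   unfolding enclosing_lo_def enclosing_hi_def by linarith
 qed
 ultimately show ?thesis using x(2) by blast
qed

end

end

text \<open>The layer between a rectangle and the dyadic rectangle that encloses it.  The constant does not depend
  on the fineness \<open>q\<close> of the interpolation.\<close>

lemma boundary_layer_card:
 obtains C where "0 <= C" "!!q n k i. 1 <= q ==> dyadic_slot q n k i ==> large_scale q n ==>
  real (card (boundary_layer q n k i)) <= C/real q*real n^D"
proof -
 let ?deg = "lattice_degree TYPE('d)" and ?L = "%l. hi l - lo l"
 obtain C1 where C1: "0 <= C1" "!!x. 0 <= x ==> x <= 1 ==> (\<Prod>l\<in>-{j}. ?L l + (4*extent)*x) - (\<Prod>l\<in>-{j}. ?L l + 0*x) <= C1*x"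
  using prod_affine_lipschitz[of "- {j}" ?L "4*extent" 0] by auto
 obtain C2 where C2: "0 <= C2" "!!x. 0 <= x ==> x <= 1 ==> (\<Prod>l\<in>-{j}. ?L l + (2*margin)*x) - (\<Prod>l\<in>-{j}. ?L l + (- (2*margin))*x) <= C2*x"
  using prod_affine_lipschitz[of "- {j}" ?L "2*margin" "- (2*margin)"] by auto
 obtain C3 where C3: "0 <= C3" "!!x. 0 <= x ==> x <= 1 ==> (\<Prod>l\<in>-{j}. ?L l + 0*x) - (\<Prod>l\<in>-{j}. ?L l + (- (2*margin))*x) <= C3*x"
  using prod_affine_lipschitz[of "- {j}" ?L 0 "- (2*margin)"] by auto
 define C where "C = ?deg*(2*margin*(C1 + C3) + 2*((\<bar>r\<bar> + 1)*C2))"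
 show ?thesis
 proof (rule that)
  show "0 <= C" unfolding C_def using C1 C2 C3 margin_gt_1
   by (intro mult_nonneg_nonneg add_nonneg_nonneg lattice_degree_nonneg) auto
  fix q n k i assume q: "1 <= q" and slot: "dyadic_slot q n k i" and large: "large_scale q n"
  let ?x = "1/real q" and ?y = "1/real n" and ?N = "real n^D"
  note sc = slot_scale[OF q slot]
  have n0: "0 < real n" using sc(1) by (rule less_le_trans[rotated]) simp
  have mq: "2*margin*real q <= real n" "real q <= real n"
  proof -
   have "2*margin*real q <= 2*(9*margin + 3)*real q" using margin_gt_1 by (intro mult_right_mono) auto
   then show *: "2*margin*real q <= real n" using large unfolding large_scale_def by linarith
   have "1*real q <= 2*margin*real q" using margin_gt_1 by (intro mult_right_mono) auto
   then show "real q <= real n" using*by simp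
  qed
  have x: "0 <= ?x" "?x <= 1" using q by auto
  have y: "0 <= ?y" "?y <= 1" using sc(1) n0 by (auto simp: divide_simps)
  have yx: "?y <= ?x" "2*margin*?y <= ?x" using mq n0 q by (auto simp: divide_simps mult.commute)
  have e1: "(\<Prod>l\<in>-{j}. scale (real n) hi l - scale (real n) lo l + c) = ?N*(\<Prod>l\<in>-{j}. ?L l + c*?y)" for c
  proof -
   have "scale (real n) hi l - scale (real n) lo l + c = real n*(?L l + c*?y)" for l
    using n0 by (simp add: scale_def algebra_simps)
   then show ?thesis by (simp only: prod.distrib prod_constant)
  qed
  have e2: "(\<Prod>l\<in>-{j}. enclosing_hi q k i l - enclosing_lo q k i l + 2*margin) <= ?N*(\<Prod>l\<in>-{j}. ?L l + (4*extent)*?x)"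
  proof -
   have "(\<Prod>l\<in>-{j}. enclosing_hi q k i l - enclosing_lo q k i l + 2*margin) <= (\<Prod>l\<in>-{j}. real n*(?L l + (4*extent)*?x))"
   proof (rule prod_mono)
    fix l assume "l \<in> - {j}"
    then have l: "l ~= j" by simp
    have "0 <= enclosing_hi q k i l - enclosing_lo q k i l + 2*margin"
     using enclosing[OF q slot large l] wide[OF q slot large l] margin_gt_1 by linarith
    moreover have "enclosing_hi q k i l - enclosing_lo q k i l + 2*margin
     = (2^k*dilation q i)*?L l + 2^k*((4*extent)*?x) - (6*margin + 2)"
     by (simp add: enclosing_hi_def enclosing_lo_def doubling_side_def enclosing_side_def algebra_simps)
    moreover have "(2^k*dilation q i)*?L l <= real n*?L l"
     using slot lohi[OF l] by (intro mult_right_mono) (auto simp: dyadic_slot_def)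
    moreover have "2^k*((4*extent)*?x) <= real n*((4*extent)*?x)"
     using sc(1) extent(1) by (intro mult_right_mono) auto
    ultimately show "0 <= enclosing_hi q k i l - enclosing_lo q k i l + 2*margin &
      enclosing_hi q k i l - enclosing_lo q k i l + 2*margin <= real n*(?L l + (4*extent)*?x)"
     using margin_gt_1 unfolding distrib_left by linarith
   qed
   then show ?thesis by (simp only: prod.distrib prod_constant)
  qed
  let ?A = "\<Prod>l\<in>-{j}. ?L l + (4*extent)*?x" and ?B = "\<Prod>l\<in>-{j}. ?L l + (- (2*margin))*?y"
   and ?E = "\<Prod>l\<in>-{j}. ?L l + (2*margin)*?y"
  have AB: "?A - ?B <= (C1 + C3)*?x"
  proof -
   have "?A - ?B <= C1*?x + C3*?y" using C1(2)[OF x] C3(2)[OF y] by simp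
   moreover have "C3*?y <= C3*?x" using yx(1) C3(1) by (rule mult_left_mono)
   ultimately show ?thesis unfolding distrib_right by linarith
  qed
  have g0: "0 <= level_gap q k + margin" "0 <= level_gap q k" using margin_gt_1 by (auto simp: level_gap_def)
  have EB: "(level_gap q k + margin)*(?E - ?B) <= (\<bar>r\<bar> + 1)*C2*?x"
  proof -
   have "(level_gap q k + margin)*(?E - ?B) <= (level_gap q k + margin)*(C2*?y)"
    by (rule mult_left_mono[OF C2(2)[OF y] g0(1)])
   also have "... = C2*((level_gap q k + margin)*?y)" by (simp add: mult_ac)
   also have "... <= C2*((\<bar>r\<bar> + 1)*?x)"
   proof (rule mult_left_mono[OF _ C2(1)])
    have "level_gap q k + margin <= real n*(\<bar>r\<bar>*?x) + 2*margin"
     using mult_right_mono[OF sc(1), of "\<bar>r\<bar>*?x"] by (simp add: level_gap_def)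
    then have "(level_gap q k + margin)*?y <= (real n*(\<bar>r\<bar>*?x) + 2*margin)*?y"
     by (intro mult_right_mono) auto
    also have "... = \<bar>r\<bar>*?x + 2*margin*?y" using n0 by (simp add: field_simps)
    also have "... <= (\<bar>r\<bar> + 1)*?x" using yx(2) unfolding distrib_right by linarith
    finally show "(level_gap q k + margin)*?y <= (\<bar>r\<bar> + 1)*?x" .
   qed
   finally show ?thesis by (simp add: mult_ac)
  qed
  have N0: "0 <= ?N" by simp
  have "real (card (boundary_layer q n k i)) <= ?deg *
    (2*margin*((\<Prod>l\<in>-{j}. enclosing_hi q k i l - enclosing_lo q k i l + 2*margin)
     - (\<Prod>l\<in>-{j}. scale (real n) hi l - scale (real n) lo l - 2*margin))
    + 2*(level_gap q k + margin)*((\<Prod>l\<in>-{j}. scale (real n) hi l - scale (real n) lo l + 2*margin)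
     - (\<Prod>l\<in>-{j}. scale (real n) hi l - scale (real n) lo l - 2*margin)))"
   unfolding boundary_layer_def
   by (rule card_padding_edges[OF Q h2[OF q slot large] _ _ _ level_near[OF q slot] enclosing_height_bound[OF q slot large]])
    (use enclosing[OF q slot large] wide[OF q slot large] in auto)
  also have "... <= ?deg*(2*margin*(?N*?A - ?N*?B) + 2*(level_gap q k + margin)*(?N*?E - ?N*?B))"
   using e1[of "2*margin"] e1[of "- (2*margin)"] e2 margin_gt_1 g0
   by (intro mult_left_mono add_mono lattice_degree_nonneg) auto
  also have "... = ?deg*(2*margin*(?A - ?B) + 2*((level_gap q k + margin)*(?E - ?B)))*?N"
   by (simp add: algebra_simps)
  also have "... <= ?deg*(2*margin*((C1 + C3)*?x) + 2*((\<bar>r\<bar> + 1)*C2*?x))*?N"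
   using AB EB margin_gt_1 by (intro mult_right_mono[OF _ N0] mult_left_mono[OF _ lattice_degree_nonneg] add_mono mult_left_mono) auto
  also have "... = C/real q*?N" by (simp add: C_def algebra_simps add_divide_distrib)
  finally show "real (card (boundary_layer q n k i)) <= C/real q*?N" .
 qed
qed

lemma large_scale_eventually:
 assumes "filterlim h at_top sequentially"
 shows "EV n. large_scale q n"
proof -
 have h: "EV n. 2 <= h n" using assms by (simp add: filterlim_at_top)
 have w: "EV n. \<forall>l\<in>-{j}. 2*margin <= scale (real n) hi l - scale (real n) lo l"
  unfolding eventually_ball_finite_distrib[OF finite]
 proof
  fix l assume "l \<in> - {j}"
  then show "EV n. 2*margin <= scale (real n) hi l - scale (real n) lo l"
   using growing_scale[OF lohi assms] by (auto simp: growing_def filterlim_at_top)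
 qed
 have n: "EV n. 2*(9*margin + 3)*real q <= real n"
  using filterlim_real_sequentially by (simp add: filterlim_at_top)
 show ?thesis
  using h w n
 proof eventually_elim
  case (elim n)
  then have "scale (real n) lo l + 2*margin <= scale (real n) hi l" if "l ~= j" for l
   using that by (metis ComplI add.commute le_diff_eq singletonD)
  then show ?case using elim by (simp add: large_scale_def)
 qed
qed


lemma flow_enclosing:
 "cylinder_flow Q (enclosing_lo q k i) (enclosing_hi q k i) (0 + v \<bullet> corner q k i) (enclosing_height q k)
  = flow ((+) (corner q k i) ` cylinder_points Q (%_. 0) (doubling_side (enclosing_side q i) k) 0 (enclosing_height q k))
    (v \<bullet> corner q k i)"
proof -
 note Q' = Q[unfolded frame_def, THEN conjunct1] Q[unfolded frame_def, THEN conjunct2]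
 have "corner q k i \<in> integer_points" unfolding corner_def by (rule integer_near(1)[OF Q'(1)])
 then have "cylinder_points Q (enclosing_lo q k i) (enclosing_hi q k i) (0 + v \<bullet> corner q k i) (enclosing_height q k)
   = (+) (corner q k i) ` cylinder_points Q (%_. 0) (doubling_side (enclosing_side q i) k) 0 (enclosing_height q k)"
  unfolding cylinder_points_def enclosing_lo_def[abs_def] enclosing_hi_def[abs_def] by (rule lattice_points_shift[OF Q'(1)])
 then show ?thesis by (simp add: cylinder_flow_def)
qed

text \<open>The flow through the enclosing dyadic rectangle is bounded below almost surely and exceeds the
  flow through the rectangle itself by at most the capacities in the boundary layer, whose number is of
  order \<open>n ^ D / q\<close>.\<close>

lemma flow_lower_bound_as:
 assumes h: "filterlim h at_top sequentially"
  and tame: "r = 0 \<or> integrable M (%w. t base_edge w powr (1 + 1/real D))"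
  and eps: "0 < eps"
 shows "AE w in M. EV n.
  (flow_density*area lo hi - eps)*real n^D
   <= cylinder_flow Q (scale (real n) lo) (scale (real n) hi) (real n*r) (h n) w"
proof -
 obtain C where C: "0 <= C" "!!q n k i. 1 <= q ==> dyadic_slot q n k i ==> large_scale q n ==>
  real (card (boundary_layer q n k i)) <= C/real q*real n^D"
  by (rule boundary_layer_card) (rule that)
 let ?\<Phi> = "flow_density*area lo hi"
 have \<Phi>0: "0 <= ?\<Phi>" using flow_density_nonneg[OF Q] area_pos[OF lohi] by (simp add: less_imp_le)
 \<comment> \<open>the loss of area and the boundary layer together cost at most a third of \<open>eps\<close>\<close>
 define q :: nat where "q = nat \<lceil>3*(C*\<mu> + ?\<Phi>*real D)/eps\<rceil> + 1"
 have q: "1 <= q" by (simp add: q_def)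
 have q0: "0 < real q" using q by simp
 have small: "C/real q*\<mu> + ?\<Phi>*(real D/real q) <= eps/3"
 proof -
  have "3*(C*\<mu> + ?\<Phi>*real D)/eps <= real q" unfolding q_def by linarith
  then have "3*(C*\<mu> + ?\<Phi>*real D) <= real q*eps" using eps by (simp add: pos_divide_le_eq)
  then have "(C*\<mu> + ?\<Phi>*real D)/real q <= eps/3" using q0 by (simp add: pos_divide_le_eq mult_ac)
  then show ?thesis by (simp add: add_divide_distrib)
 qed
 have "\<forall>n. \<exists>k i. 1 <= n --> dyadic_slot q n k i"
  unfolding dyadic_slot_def dilation_def using dyadic_position[OF _ q] by metis
 then obtain kk ii where slot: "!!n. 1 <= n ==> dyadic_slot q n (kk n) (ii n)" by metis
 let ?G = "%n. boundary_layer q n (kk n) (ii n)"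
 have large: "EV n. 1 <= n & large_scale q n"
  using eventually_ge_at_top[of 1] large_scale_eventually[OF h, of q] by eventually_elim simp
 have kk: "filterlim kk at_top sequentially"
  unfolding filterlim_at_top
 proof
  fix K
  show "EV n. K <= kk n"
   using eventually_ge_at_top[of "2^Suc K"]
  proof eventually_elim
   case (elim n)
   have n1: "1 <= n" using elim by (rule order_trans[rotated]) simp
   have "(2::nat)^Suc K <= 2^Suc (kk n)"
    using elim slot_scale(3)[OF q slot[OF n1]] by (rule order_trans)
   then have "Suc K <= Suc (kk n)" by (rule power_le_imp_le_exp[rotated]) simp
   then show ?case by simp
  qed
 qed
 have "bounded_averages (t base_edge) ?G (%_. t)"
  using tame
 proof
  assume r: "r = 0"
  have ex0: "0 <= 12*extent" "0 <= 2*margin + 1" using extent(1) margin_gt_1 by auto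
  show ?thesis
  proof (rule edges_bounded_averages_nested[OF Q ex0])
   show "EV n. ?G n \<subseteq> lattice_edges &
    (\<forall>e\<in>?G n. \<exists>x\<in>e. \<bar>v \<bullet> x\<bar> <= 2*margin + 1 & (\<forall>k. k ~= j --> \<bar>Q x $ k\<bar> <= 12*extent*real n))"
    using large
   proof eventually_elim
    case (elim n)
    have "?G n \<subseteq> lattice_edges" unfolding boundary_layer_def by (rule padding_edges_sub)
    then show ?case using boundary_layer_near[OF q slot _ r] elim by blast
   qed
  qed
 next
  assume "integrable M (%w. t base_edge w powr (1 + 1/real D))"
  then show ?thesis
  proof (rule edges_bounded_averages_moment)
   show "EV n. finite (?G n) & ?G n \<subseteq> lattice_edges"
    using large
   proof eventually_elim
    case (elim n)
    have "?G n \<subseteq> lattice_edges" unfolding boundary_layer_def by (rule padding_edges_sub)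
    then show ?case using finite_boundary_layer[OF q slot] elim by blast
   qed
  qed
 qed
 moreover have "EV n. real (card (?G n)) <= C/real q*real n^D"
  using large by eventually_elim (use C(2)[OF q slot] in blast)
 ultimately have layer: "AE w in M. EV n. (\<Sum>e\<in>?G n. t e w) <= (C/real q*\<mu> + eps/3)*real n^D"
  unfolding bounded_averages_def \<mu>_def using eps C(1) q0 by (meson divide_nonneg_pos divide_pos_pos zero_less_numeral)
 let ?F = "%k i. cylinder_flow Q (enclosing_lo q k i) (enclosing_hi q k i) (0 + v \<bullet> corner q k i) (enclosing_height q k)"
 have "AE w in M. EV k. flow_density*(\<Prod>l\<in>-{j}. enclosing_side q i l) - eps/3 <= ?F k i w/2^(k*D)" for i
  unfolding flow_enclosing
 proof (rule doubling_flow_lower_as[OF Q enclosing_side_pos[OF q] enclosing_heights])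
  show "corner q k i \<in> integer_points" for k
   unfolding corner_def using Q by (intro integer_near(1)) (simp add: frame_def)
 qed (use eps in auto)
 then have "AE w in M. \<forall>i\<in>{..<q}. EV k.
   flow_density*(\<Prod>l\<in>-{j}. enclosing_side q i l) - eps/3 <= ?F k i w/2^(k*D)"
  by (intro AE_finite_allI) auto
 then show ?thesis
  using layer AE_space
 proof eventually_elim
  case (elim w)
  have "EV k. \<forall>i\<in>{..<q}. flow_density*(\<Prod>l\<in>-{j}. enclosing_side q i l) - eps/3 <= ?F k i w/2^(k*D)"
   using elim(1) by (intro eventually_ball_finite) auto
  then have "EV n. \<forall>i\<in>{..<q}. flow_density*(\<Prod>l\<in>-{j}. enclosing_side q i l) - eps/3 <= ?F (kk n) i w/2^(kk n*D)"
   using kk by (rule eventually_compose_filterlim)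
  with elim(2) large show ?case
  proof eventually_elim
   case (elim n)
   let ?k = "kk n" and ?i = "ii n"
   let ?f = "cylinder_flow Q (scale (real n) lo) (scale (real n) hi) (real n*r) (h n) w"
   have sl: "dyadic_slot q n ?k ?i" using slot elim by blast
   have iq: "?i \<in> {..<q}" using sl by (simp add: dyadic_slot_def)
   note sc = slot_scale[OF q sl]
   have pad: "?F ?k ?i w <= ?f + (\<Sum>e\<in>?G n. t e w)"
    using boundary_layer_bound[OF q sl _ \<open>w \<in> space M\<close>] elim by blast
   have side: "dilation q ?i^D*area lo hi <= (\<Prod>l\<in>-{j}. enclosing_side q ?i l)"
   proof -
    have "(\<Prod>l\<in>-{j}. dilation q ?i*(hi l - lo l)) <= (\<Prod>l\<in>-{j}. enclosing_side q ?i l)"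
    proof (rule prod_mono)
     fix l assume "l \<in> - {j}"
     then have "0 <= dilation q ?i*(hi l - lo l)" using dilation_ge_1[of q ?i] lohi[of l] by auto
     then show "0 <= dilation q ?i*(hi l - lo l) & dilation q ?i*(hi l - lo l) <= enclosing_side q ?i l"
      using extent(1) by (simp add: enclosing_side_def)
    qed
    then show ?thesis by (simp add: prod.distrib area_def)
   qed
   have kD: "(2::real)^(?k*D) = (2^?k)^D" by (simp add: power_mult)
   have near: "(1 - 1/real q)*real n <= 2^?k*dilation q ?i"
   proof -
    have "real n*1 - 2^?k*dilation q ?i*1 <= 2^?k/real q*\<bar>1\<bar>" using slot_near[OF q sl, of 1] by linarith
    moreover have "2^?k/real q <= real n/real q" using sc(1) by (intro divide_right_mono) auto
    ultimately have "real n - real n/real q <= 2^?k*dilation q ?i" by simp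
    then show ?thesis by (simp add: left_diff_distrib)
   qed
   have bern: "1 - real D/real q <= (1 - 1/real q)^D"
   proof -
    have "1 + real D*(- (1/real q)) <= (1 + (- (1/real q)))^D"
     using q by (intro Bernoulli_inequality) auto
    then show ?thesis by simp
   qed
   have "?\<Phi>*((1 - real D/real q)*real n^D) <= ?\<Phi>*(2^?k*dilation q ?i)^D"
   proof (rule mult_left_mono[OF _ \<Phi>0])
    have "(1 - real D/real q)*real n^D <= (1 - 1/real q)^D*real n^D"
     using bern by (intro mult_right_mono) auto
    also have "... = ((1 - 1/real q)*real n)^D" by (simp add: power_mult_distrib)
    also have "... <= (2^?k*dilation q ?i)^D" using near q by (intro power_mono) auto
    finally show "(1 - real D/real q)*real n^D <= (2^?k*dilation q ?i)^D" .
   qed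
   also have "... = 2^(?k*D)*(flow_density*(dilation q ?i^D*area lo hi))"
    unfolding kD by (simp add: power_mult_distrib mult_ac)
   also have "... <= 2^(?k*D)*(flow_density*(\<Prod>l\<in>-{j}. enclosing_side q ?i l))"
    using side flow_density_nonneg[OF Q] by (intro mult_left_mono) auto
   also have "... <= 2^(?k*D)*(?F ?k ?i w/2^(?k*D) + eps/3)"
   proof (rule mult_left_mono)
    have "flow_density*(\<Prod>l\<in>-{j}. enclosing_side q ?i l) - eps/3 <= ?F ?k ?i w/2^(?k*D)"
     using elim iq by blast
    then show "flow_density*(\<Prod>l\<in>-{j}. enclosing_side q ?i l) <= ?F ?k ?i w/2^(?k*D) + eps/3" by linarith
   qed simp
   also have "... = ?F ?k ?i w + eps/3*2^(?k*D)" by (simp add: distrib_left)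
   also have "... <= (?f + (C/real q*\<mu> + eps/3)*real n^D) + eps/3*real n^D"
   proof (rule add_mono)
    show "?F ?k ?i w <= ?f + (C/real q*\<mu> + eps/3)*real n^D" using pad elim by linarith
    show "eps/3*2^(?k*D) <= eps/3*real n^D"
     unfolding kD using eps sc(1) by (intro mult_left_mono power_mono) auto
   qed
   finally have "?\<Phi>*((1 - real D/real q)*real n^D) - (C/real q*\<mu> + eps/3 + eps/3)*real n^D <= ?f"
    unfolding distrib_right by linarith
   moreover have "(?\<Phi> - eps)*real n^D <= (?\<Phi>*(1 - real D/real q) - (C/real q*\<mu> + eps/3 + eps/3))*real n^D"
   proof (rule mult_right_mono)
    have "?\<Phi>*(1 - real D/real q) = ?\<Phi> - ?\<Phi>*(real D/real q)" by (simp add: right_diff_distrib)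
    then show "?\<Phi> - eps <= ?\<Phi>*(1 - real D/real q) - (C/real q*\<mu> + eps/3 + eps/3)" using small by linarith
   qed simp
   moreover have "(?\<Phi>*(1 - real D/real q) - (C/real q*\<mu> + eps/3 + eps/3))*real n^D
     = ?\<Phi>*((1 - real D/real q)*real n^D) - (C/real q*\<mu> + eps/3 + eps/3)*real n^D"
    by (simp only: left_diff_distrib mult.assoc)
   ultimately show ?case by linarith
  qed
 qed
qed

end

end

section \<open>Hausdorff measure of rectangles\<close>

definition diameter_cost :: "nat => 'a::metric_space set => ennreal" where
 "diameter_cost s U = (if U = {} then 0 else ennreal (unit_ball_vol (real s)*(diameter U/2)^s))"

definition fine_covers :: "real => 'a::metric_space set => (nat => 'a set) set" where
 "fine_covers dl S = {U. S \<subseteq> (\<Union>i. U i) & (\<forall>i. bounded (U i) & diameter (U i) <= dl)}"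

definition hausdorff_content :: "nat => real => 'a::metric_space set => ennreal" where
 "hausdorff_content s dl S = (INF U\<in>fine_covers dl S. \<Sum>i. diameter_cost s (U i))"

lemma hausdorff_measure_content: "hausdorff_measure s S = (SUP dl\<in>{0<..}. hausdorff_content s dl S)"
 unfolding hausdorff_measure_def hausdorff_content_def fine_covers_def diameter_cost_def ..

lemma diameter_cost_empty [simp]: "diameter_cost s {} = 0" by (simp add: diameter_cost_def)

lemma hausdorff_content_le: "U \<in> fine_covers dl S ==> hausdorff_content s dl S <= (\<Sum>i. diameter_cost s (U i))"
 unfolding hausdorff_content_def by (rule INF_lower)

lemma near_optimal_cover:
 assumes "hausdorff_content s dl S < top" "0 < e"
 obtains U where "U \<in> fine_covers dl S" "(\<Sum>i. diameter_cost s (U i)) <= hausdorff_content s dl S + ennreal e"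
proof -
 have "hausdorff_content s dl S < hausdorff_content s dl S + ennreal e"
  using assms by (simp add: ennreal_add_left_cancel_less less_top)
 then obtain U where "U \<in> fine_covers dl S" "(\<Sum>i. diameter_cost s (U i)) < hausdorff_content s dl S + ennreal e"
  unfolding hausdorff_content_def INF_less_iff by blast
 then show ?thesis using that by (auto intro: less_imp_le)
qed

lemma hausdorff_content_antimono: "dl <= dl' ==> hausdorff_content s dl' S <= hausdorff_content s dl S"
 unfolding hausdorff_content_def by (intro INF_superset_mono) (auto simp: fine_covers_def intro: order_trans)

lemma hausdorff_content_le_measure: "0 < dl ==> hausdorff_content s dl S <= hausdorff_measure s S"
 unfolding hausdorff_measure_content by (intro SUP_upper) auto

lemma hausdorff_content_tendsto:
 "(%n. hausdorff_content s (1/real (Suc n)) S) \<longlonglongrightarrow> hausdorff_measure s S"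
proof -
 let ?f = "%n. hausdorff_content s (1/real (Suc n)) S"
 have "incseq ?f" by (intro incseq_SucI hausdorff_content_antimono) (simp add: frac_le)
 then have "?f \<longlonglongrightarrow> (SUP n. ?f n)" by (rule LIMSEQ_SUP)
 moreover have "(SUP n. ?f n) = hausdorff_measure s S"
 proof (rule antisym)
  show "(SUP n. ?f n) <= hausdorff_measure s S" by (intro SUP_least hausdorff_content_le_measure) simp
  show "hausdorff_measure s S <= (SUP n. ?f n)"
   unfolding hausdorff_measure_content
  proof (rule SUP_least)
   fix dl :: real assume "dl \<in> {0<..}"
   then obtain n where "1/real (Suc n) < dl" using nat_approx_posE[of dl] by auto
   then have "hausdorff_content s dl S <= ?f n" by (intro hausdorff_content_antimono) simp
   also have "... <= (SUP n. ?f n)" by (intro SUP_upper) simp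
   finally show "hausdorff_content s dl S <= (SUP n. ?f n)" .
  qed
 qed
 ultimately show ?thesis by simp
qed

lemma diameter_le_dist:
 assumes "0 <= d" "!!x y. x \<in> S ==> y \<in> S ==> dist x y <= d"
 shows "diameter S <= d" "bounded S"
proof -
 show "diameter S <= d" using assms unfolding diameter_def by (force intro!: cSUP_least)
 show "bounded S" unfolding bounded_def
 proof (cases "S = {}")
  case False
  then obtain x where "x \<in> S" by blast
  then show "\<exists>x e. \<forall>y\<in>S. dist x y <= e" using assms(2) by blast
 qed simp
qed

lemma hausdorff_content_lipschitz:
 assumes c: "0 < c" and dl: "0 < dl" and f: "!!x y. x \<in> S ==> y \<in> S ==> dist (f x) (f y) <= c*dist x y"
 shows "hausdorff_content s (c*dl) (f ` S) <= ennreal (c^s)*hausdorff_content s dl S"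
proof (rule ennreal_le_epsilon)
 fix e :: real assume top: "ennreal (c^s)*hausdorff_content s dl S < top" and e: "0 < e"
 have "hausdorff_content s dl S < top" using top c by (auto simp: ennreal_mult_less_top)
 then obtain U where U: "U \<in> fine_covers dl S" "(\<Sum>i. diameter_cost s (U i)) <= hausdorff_content s dl S + ennreal (e/c^s)"
  using near_optimal_cover[of s dl S "e/c^s"] e c by auto
 define V where "V i = f ` (U i \<inter> S)" for i
 have bU: "bounded (U i)" "diameter (U i) <= dl" for i using U(1) by (auto simp: fine_covers_def)
 have d0: "0 <= diameter (U i)" for i using diameter_ge_0[OF bU(1)] .
 have dV: "dist x y <= c*diameter (U i)" if xy: "x \<in> V i" "y \<in> V i" for x y i
 proof -
  obtain x' y' where x': "x = f x'" "x' \<in> U i" "x' \<in> S" "y = f y'" "y' \<in> U i" "y' \<in> S" using xy by (auto simp: V_def)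
  have "dist x y <= c*dist x' y'" using f x' by simp
  also have "... <= c*diameter (U i)" using diameter_bounded_bound[OF bU(1)] x' c by (intro mult_left_mono) auto
  finally show ?thesis .
 qed
 have V: "diameter (V i) <= c*diameter (U i)" "bounded (V i)" for i
  using diameter_le_dist[of "c*diameter (U i)" "V i"] dV d0 c by auto
 have cost: "diameter_cost s (V i) <= ennreal (c^s)*diameter_cost s (U i)" for i
 proof (cases "V i = {}")
  case False
  then have Ui: "U i ~= {}" by (auto simp: V_def)
  have "unit_ball_vol (real s)*(diameter (V i)/2)^s <= unit_ball_vol (real s)*(c*diameter (U i)/2)^s"
   using V(1)[of i] diameter_ge_0[OF V(2)] by (intro mult_left_mono power_mono divide_right_mono) auto
  also have "... = c^s*(unit_ball_vol (real s)*(diameter (U i)/2)^s)"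
   by (simp add: power_mult_distrib power_divide)
  finally show ?thesis using False Ui c d0
   by (simp add: diameter_cost_def ennreal_mult[symmetric] ennreal_leI)
 qed simp
 have "V \<in> fine_covers (c*dl) (f ` S)"
 proof -
  have "f ` S \<subseteq> (\<Union>i. V i)" using U(1) by (fastforce simp: fine_covers_def V_def)
  moreover have "diameter (V i) <= c*dl" for i
   using order_trans[OF V(1) mult_left_mono[OF bU(2)]] c by simp
  ultimately show ?thesis using V(2) by (auto simp: fine_covers_def)
 qed
 then have "hausdorff_content s (c*dl) (f ` S) <= (\<Sum>i. diameter_cost s (V i))" by (rule hausdorff_content_le)
 also have "... <= (\<Sum>i. ennreal (c^s)*diameter_cost s (U i))" by (intro suminf_le cost) auto
 also have "... = ennreal (c^s)*(\<Sum>i. diameter_cost s (U i))" by (simp add: ennreal_suminf_cmult)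
 also have "... <= ennreal (c^s)*(hausdorff_content s dl S + ennreal (e/c^s))" by (intro mult_left_mono U) simp
 also have "... = ennreal (c^s)*hausdorff_content s dl S + ennreal e"
  using c e by (simp add: distrib_left ennreal_mult[symmetric])
 finally show "hausdorff_content s (c*dl) (f ` S) <= ennreal (c^s)*hausdorff_content s dl S + ennreal e" .
qed

lemma hausdorff_measure_lipschitz:
 assumes c: "0 < c" and f: "!!x y. x \<in> S ==> y \<in> S ==> dist (f x) (f y) <= c*dist x y"
 shows "hausdorff_measure s (f ` S) <= ennreal (c^s)*hausdorff_measure s S"
 unfolding hausdorff_measure_content[of s "f ` S"]
proof (rule SUP_least)
 fix dl :: real assume dl: "dl \<in> {0<..}"
 have "hausdorff_content s (c*(dl/c)) (f ` S) <= ennreal (c^s)*hausdorff_content s (dl/c) S"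
  using dl c f by (intro hausdorff_content_lipschitz) auto
 also have "... <= ennreal (c^s)*hausdorff_measure s S"
  using dl c by (intro mult_left_mono hausdorff_content_le_measure) auto
 finally show "hausdorff_content s dl (f ` S) <= ennreal (c^s)*hausdorff_measure s S" using c by simp
qed

lemma hausdorff_measure_similarity:
 assumes c: "0 < c" and f: "!!x y. x \<in> S ==> y \<in> S ==> dist (f x) (f y) = c*dist x y"
 shows "hausdorff_measure s (f ` S) = ennreal (c^s)*hausdorff_measure s S"
proof (rule antisym)
 show "hausdorff_measure s (f ` S) <= ennreal (c^s)*hausdorff_measure s S"
  by (rule hausdorff_measure_lipschitz[OF c]) (simp add: f)
 have inj: "inj_on f S"
 proof (rule inj_onI)
  fix x y assume "x \<in> S" "y \<in> S" "f x = f y"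
  then have "c*dist x y = 0" using f[of x y] by simp
  then show "x = y" using c by simp
 qed
 let ?g = "inv_into S f"
 have g: "?g ` (f ` S) = S" using inj by (auto simp: image_image)
 have "hausdorff_measure s (?g ` (f ` S)) <= ennreal ((1/c)^s)*hausdorff_measure s (f ` S)"
 proof (rule hausdorff_measure_lipschitz)
  fix x y assume "x \<in> f ` S" "y \<in> f ` S"
  then obtain x' y' where "x' \<in> S" "y' \<in> S" "x = f x'" "y = f y'" by blast
  then show "dist (?g x) (?g y) <= 1/c*dist x y" using inj c f[of x' y'] by simp
 qed (use c in simp)
 then have "ennreal (c^s)*hausdorff_measure s S <= ennreal (c^s)*(ennreal ((1/c)^s)*hausdorff_measure s (f ` S))"
  unfolding g by (intro mult_left_mono) auto
 also have "... = ennreal (c^s*(1/c)^s)*hausdorff_measure s (f ` S)"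
  using c by (simp add: ennreal_mult mult.assoc)
 also have "c^s*(1/c)^s = 1" using c by (simp add: power_mult_distrib[symmetric])
 finally show "ennreal (c^s)*hausdorff_measure s S <= hausdorff_measure s (f ` S)" by simp
qed

lemma hausdorff_measure_mono:
 assumes "S \<subseteq> T"
 shows "hausdorff_measure s S <= hausdorff_measure s T"
 unfolding hausdorff_measure_content hausdorff_content_def
 by (intro SUP_mono' INF_superset_mono) (use assms in \<open>auto simp: fine_covers_def\<close>)

lemma hausdorff_content_Un: "hausdorff_content s dl (A \<union> B) <= hausdorff_content s dl A + hausdorff_content s dl B"
proof (rule ennreal_le_epsilon)
 fix e :: real assume top: "hausdorff_content s dl A + hausdorff_content s dl B < top" and e: "0 < e"
 obtain U where U: "U \<in> fine_covers dl A" "(\<Sum>i. diameter_cost s (U i)) <= hausdorff_content s dl A + ennreal (e/2)"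
  using near_optimal_cover[of s dl A "e/2"] e top by (auto simp: ennreal_add_less_top)
 obtain V where V: "V \<in> fine_covers dl B" "(\<Sum>i. diameter_cost s (V i)) <= hausdorff_content s dl B + ennreal (e/2)"
  using near_optimal_cover[of s dl B "e/2"] e top by (auto simp: ennreal_add_less_top)
 define W where "W = (%(m, n). if m = (0::nat) then U n else if m = 1 then V n else {})"
 have dl0: "0 <= dl"
 proof -
  have "bounded (U 0)" "diameter (U 0) <= dl" using U(1) by (auto simp: fine_covers_def)
  then show ?thesis using diameter_ge_0[of "U 0"] by simp
 qed
 have "(%i. W (prod_decode i)) \<in> fine_covers dl (A \<union> B)"
 proof -
  have "A \<union> B \<subseteq> (\<Union>i. W (prod_decode i))"
  proof
   fix x assume "x \<in> A \<union> B"
   then obtain n where "x \<in> U n \<or> x \<in> V n" using U(1) V(1) unfolding fine_covers_def by blast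
   then have "x \<in> W (0, n) \<or> x \<in> W (1, n)" by (simp add: W_def)
   then obtain p where "x \<in> W p" by blast
   then have "x \<in> W (prod_decode (prod_encode p))" by simp
   then show "x \<in> (\<Union>i. W (prod_decode i))" by blast
  qed
  moreover have "bounded (W p) & diameter (W p) <= dl" for p
   using U(1) V(1) dl0 by (cases p) (auto simp: fine_covers_def W_def)
  ultimately show ?thesis by (auto simp: fine_covers_def)
 qed
 then have "hausdorff_content s dl (A \<union> B) <= (\<Sum>i. diameter_cost s (W (prod_decode i)))" by (rule hausdorff_content_le)
 also have "... = (\<Sum>m. \<Sum>n. diameter_cost s (W (m, n)))"
  using suminf_ennreal_2dimen[of "%m. \<Sum>n. diameter_cost s (W (m, n))" "%p. diameter_cost s (W p)"] by simp
 also have "... = (\<Sum>m\<in>{0, 1}. \<Sum>n. diameter_cost s (W (m, n)))"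
  by (rule suminf_finite) (auto simp: W_def)
 also have "... = (\<Sum>n. diameter_cost s (U n)) + (\<Sum>n. diameter_cost s (V n))" by (simp add: W_def)
 also have "... <= (hausdorff_content s dl A + ennreal (e/2)) + (hausdorff_content s dl B + ennreal (e/2))"
  by (intro add_mono U V)
 also have "... = hausdorff_content s dl A + hausdorff_content s dl B + (ennreal (e/2) + ennreal (e/2))" by (simp add: ac_simps)
 also have "ennreal (e/2) + ennreal (e/2) = ennreal e" using e by (simp add: ennreal_plus[symmetric] del: ennreal_plus)
 finally show "hausdorff_content s dl (A \<union> B) <= hausdorff_content s dl A + hausdorff_content s dl B + ennreal e" .
qed

lemma hausdorff_measure_UN_le:
 assumes "finite I"
 shows "hausdorff_measure s (\<Union>i\<in>I. A i) <= (\<Sum>i\<in>I. hausdorff_measure s (A i))"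
proof -
 have "hausdorff_content s dl (\<Union>i\<in>I. A i) <= (\<Sum>i\<in>I. hausdorff_measure s (A i))" if dl: "0 < dl" for dl
  using assms
 proof (induction I)
  case empty
  have "(%_. {}) \<in> fine_covers dl ({} :: 'b set)" using dl by (simp add: fine_covers_def)
  then show ?case using hausdorff_content_le[of "%_. {}" dl "{} :: 'b set" s] by simp
 next
  case (insert i I)
  have "hausdorff_content s dl (A i \<union> (\<Union>i\<in>I. A i)) <= hausdorff_content s dl (A i) + hausdorff_content s dl (\<Union>i\<in>I. A i)"
   by (rule hausdorff_content_Un)
  also have "... <= hausdorff_measure s (A i) + (\<Sum>i\<in>I. hausdorff_measure s (A i))"
   by (intro add_mono insert.IH hausdorff_content_le_measure dl)
  finally show ?case using insert.hyps by simp
 qed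
 then show ?thesis unfolding hausdorff_measure_content[of s "\<Union>i\<in>I. A i"] by (intro SUP_least) auto
qed

text \<open>A cover by sets smaller than the separation splits into covers of the parts.\<close>

lemma hausdorff_measure_separated:
 assumes I: "finite I" and \<eta>: "0 < \<eta>"
  and sep: "!!i i' x y. i \<in> I ==> i' \<in> I ==> i ~= i' ==> x \<in> A i ==> y \<in> A i' ==> \<eta> <= dist x y"
 shows "(\<Sum>i\<in>I. hausdorff_measure s (A i)) <= hausdorff_measure s (\<Union>i\<in>I. A i)"
proof (rule LIMSEQ_le)
 show "(%n. \<Sum>i\<in>I. hausdorff_content s (1/real (Suc n)) (A i)) \<longlonglongrightarrow> (\<Sum>i\<in>I. hausdorff_measure s (A i))"
  by (intro tendsto_sum hausdorff_content_tendsto)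
 show "(%n. hausdorff_content s (1/real (Suc n)) (\<Union>i\<in>I. A i)) \<longlonglongrightarrow> hausdorff_measure s (\<Union>i\<in>I. A i)"
  by (rule hausdorff_content_tendsto)
 have le: "(\<Sum>i\<in>I. hausdorff_content s dl (A i)) <= hausdorff_content s dl (\<Union>i\<in>I. A i)" if dl: "0 < dl" "dl < \<eta>" for dl
  unfolding hausdorff_content_def[of s dl "\<Union>i\<in>I. A i"]
 proof (rule INF_greatest)
  fix U assume U: "U \<in> fine_covers dl (\<Union>i\<in>I. A i)"
  define V where "V i n = (if U n \<inter> A i = {} then {} else U n)" for i n
  have "V i \<in> fine_covers dl (A i)" if "i \<in> I" for i
  proof -
   have "A i \<subseteq> (\<Union>n. V i n)"
   proof
    fix x assume x: "x \<in> A i"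
    then obtain n where "x \<in> U n" using U \<open>i \<in> I\<close> by (auto simp: fine_covers_def)
    then have "x \<in> V i n" using x by (auto simp: V_def)
    then show "x \<in> (\<Union>n. V i n)" by blast
   qed
   then show ?thesis using U dl by (auto simp: fine_covers_def V_def)
  qed
  then have "(\<Sum>i\<in>I. hausdorff_content s dl (A i)) <= (\<Sum>i\<in>I. \<Sum>n. diameter_cost s (V i n))"
   by (intro sum_mono hausdorff_content_le) auto
  also have "... = (\<Sum>n. \<Sum>i\<in>I. diameter_cost s (V i n))"
   by (rule suminf_sum[symmetric]) auto
  also have "... <= (\<Sum>n. diameter_cost s (U n))"
  proof (rule suminf_le)
   fix n
   show "(\<Sum>i\<in>I. diameter_cost s (V i n)) <= diameter_cost s (U n)"
   proof (cases "\<exists>i\<in>I. U n \<inter> A i ~= {}")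
    case True
    then obtain i x where i: "i \<in> I" "x \<in> U n" "x \<in> A i" by blast
    have "V i' n = {}" if i': "i' \<in> I" "i' ~= i" for i'
    proof (rule ccontr)
     assume "V i' n ~= {}"
     then obtain y where y: "y \<in> U n" "y \<in> A i'" by (auto simp: V_def split: if_splits)
     have "bounded (U n)" "diameter (U n) <= dl" using U by (auto simp: fine_covers_def)
     then have "dist x y <= dl" using diameter_bounded_bound[of "U n" x y] i y by simp
     moreover have "\<eta> <= dist x y" using sep[of i i' x y] i i' y by auto
     ultimately show False using dl by simp
    qed
    then have "(\<Sum>i\<in>I. diameter_cost s (V i n)) = (\<Sum>i\<in>{i}. diameter_cost s (V i n))"
     using I i by (intro sum.mono_neutral_right) auto
    then show ?thesis by (simp add: V_def)
   qed (simp add: V_def)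
  qed auto
  finally show "(\<Sum>i\<in>I. hausdorff_content s dl (A i)) <= (\<Sum>n. diameter_cost s (U n))" .
 qed
 obtain N where N: "1/real (Suc N) < \<eta>" using nat_approx_posE[OF \<eta>] by auto
 have "1/real (Suc n) <= 1/real (Suc N)" if "N <= n" for n using that by (simp add: frac_le)
 then show "\<exists>N. \<forall>n\<ge>N. (\<Sum>i\<in>I. hausdorff_content s (1/real (Suc n)) (A i)) <= hausdorff_content s (1/real (Suc n)) (\<Union>i\<in>I. A i)"
  using N by (intro exI[of _ N] allI impI le) (auto intro: le_less_trans)
qed

lemma hausdorff_content_finite_cover:
 assumes "finite I" and dl: "0 <= dl" and S: "S \<subseteq> (\<Union>i\<in>I. A i)" and A: "!!i. i \<in> I ==> bounded (A i)" "!!i. i \<in> I ==> diameter (A i) <= dl"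
 shows "hausdorff_content s dl S <= (\<Sum>i\<in>I. diameter_cost s (A i))"
proof -
 obtain f where f: "bij_betw f {0..<card I} I" using ex_bij_betw_nat_finite[OF assms(1)] by blast
 define U where "U n = (if n < card I then A (f n) else {})" for n
 have fI: "f n \<in> I" if "n < card I" for n using bij_betwE[OF f] that by simp
 have "S \<subseteq> (\<Union>n. U n)"
 proof
  fix x assume "x \<in> S"
  then obtain i where i: "i \<in> I" "x \<in> A i" using S by blast
  then obtain n where "n < card I" "f n = i" using f by (force simp: bij_betw_def)
  then have "x \<in> U n" using i by (simp add: U_def)
  then show "x \<in> (\<Union>n. U n)" by blast
 qed
 then have "U \<in> fine_covers dl S" using A fI dl by (auto simp: fine_covers_def U_def)
 then have "hausdorff_content s dl S <= (\<Sum>n. diameter_cost s (U n))" by (rule hausdorff_content_le)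
 also have "... = (\<Sum>n\<in>{0..<card I}. diameter_cost s (U n))" by (rule suminf_finite) (auto simp: U_def)
 also have "... = (\<Sum>n\<in>{0..<card I}. diameter_cost s (A (f n)))" by (intro sum.cong) (auto simp: U_def)
 also have "... = (\<Sum>i\<in>I. diameter_cost s (A i))" by (rule sum.reindex_bij_betw[OF f])
 finally show ?thesis .
qed

lemma hausdorff_measure_singleton: "0 < s ==> hausdorff_measure s {x} = 0"
proof -
 assume s: "0 < s"
 have "hausdorff_content s dl {x} <= 0" if "0 < dl" for dl
  using hausdorff_content_finite_cover[of "{()}" dl "{x}" "%_. {x}" s] that s by (simp add: diameter_cost_def zero_power)
 then show ?thesis unfolding hausdorff_measure_content by (intro antisym SUP_least) auto
qed

text \<open>Reduction of rectangles to coordinate boxes.\<close>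

definition flat_box :: "'d => ('d => real) => ('d => real) => (real^'d::finite) set" where
 "flat_box j a b = {x. x $ j = 0 & (\<forall>i. i ~= j --> a i <= x $ i & x $ i <= b i)}"

lemma hausdorff_measure_rect:
 fixes Q :: "real^'d => real^'d"
 assumes Q: "orthogonal_transformation Q"
 shows "hausdorff_measure s (rect Q j lo hi r) = hausdorff_measure s (flat_box j (%_. 0) (%i. hi i - lo i))"
proof -
 let ?p = "\<chi> i. if i = j then r else lo i"
 let ?f = "%x. inv Q (x + ?p)"
 have surj: "Q (inv Q y) = y" for y using orthogonal_transformation_surj[OF Q] by (rule surj_f_inv_f)
 have inv: "inv Q (Q y) = y" for y using orthogonal_transformation_inj[OF Q] by (rule inv_f_f)
 have "rect Q j lo hi r = ?f ` flat_box j (%_. 0) (%i. hi i - lo i)"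
 proof (intro set_eqI iffI)
  fix y assume y: "y \<in> rect Q j lo hi r"
  then have "Q y - ?p \<in> flat_box j (%_. 0) (%i. hi i - lo i)"
   by (auto simp: rect_def prism_def flat_box_def)
  moreover have "y = ?f (Q y - ?p)" by (simp add: inv)
  ultimately show "y \<in> ?f ` flat_box j (%_. 0) (%i. hi i - lo i)" by blast
 next
  fix y assume "y \<in> ?f ` flat_box j (%_. 0) (%i. hi i - lo i)"
  then obtain x where "x \<in> flat_box j (%_. 0) (%i. hi i - lo i)" "Q y = x + ?p" by (auto simp: surj)
  then show "y \<in> rect Q j lo hi r"
   by (auto simp: rect_def prism_def flat_box_def le_diff_eq)
 qed
 moreover have "dist (?f x) (?f y) = 1*dist x y" for x y
 proof -
  have "dist (Q (?f x)) (Q (?f y)) = dist (?f x) (?f y)"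
   using Q by (simp add: orthogonal_transformation dist_norm linear_diff[symmetric])
  then show ?thesis by (simp add: surj)
 qed
 ultimately show ?thesis using hausdorff_measure_similarity[of 1 _ ?f s] by simp
qed

lemma hausdorff_measure_cube:
 fixes j :: "'d::finite"
 assumes c: "0 < c"
 shows "hausdorff_measure s (flat_box j a (%i. a i + c)) = ennreal (c^s)*hausdorff_measure s (flat_box j (%_. 0) (%_. 1))"
proof -
 let ?p = "\<chi> i. if i = j then 0 else a i"
 let ?f = "%x. c *\<^sub>R x + ?p"
 have "flat_box j a (%i. a i + c) = ?f ` flat_box j (%_. 0) (%_. 1)"
 proof (intro set_eqI iffI)
  fix y assume y: "y \<in> flat_box j a (%i. a i + c)"
  then have "(1/c) *\<^sub>R (y - ?p) \<in> flat_box j (%_. 0) (%_. 1)"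
   using c by (auto simp: flat_box_def pos_divide_le_eq)
  moreover have "y = ?f ((1/c) *\<^sub>R (y - ?p))" using c by simp
  ultimately show "y \<in> ?f ` flat_box j (%_. 0) (%_. 1)" by blast
 next
  fix y assume "y \<in> ?f ` flat_box j (%_. 0) (%_. 1)"
  then obtain x where x: "x \<in> flat_box j (%_. 0) (%_. 1)" "y = ?f x" by blast
  show "y \<in> flat_box j a (%i. a i + c)"
   unfolding flat_box_def
  proof (intro CollectI conjI allI impI)
   fix i assume "i ~= j"
   then have "0 <= x $ i" "x $ i <= 1" "y $ i = c*x $ i + a i" using x by (auto simp: flat_box_def)
   then show "a i <= y $ i" "y $ i <= a i + c" using c mult_left_mono[of "x $ i" 1 c] by auto
  qed (use x in \<open>simp add: flat_box_def\<close>)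
 qed
 moreover have "dist (?f x) (?f y) = c*dist x y" for x y :: "real^'d" using c by (simp add: dist_norm flip: scaleR_diff_right)
 ultimately show ?thesis using hausdorff_measure_similarity[OF c, of _ ?f s] by simp
qed

lemma grid_cover:
 fixes L :: "'d::finite => real"
 assumes N: "1 <= (N::nat)"
 shows "flat_box j (%_. 0) L \<subseteq> (\<Union>l\<in>Pi\<^sub>E (- {j}) (%i. {..< nat \<lfloor>real N*L i\<rfloor> + 1}).
  flat_box j (%i. real (l i)/real N) (%i. real (l i)/real N + 1/real N))"
proof
 fix x assume x: "x \<in> flat_box j (%_. 0) L"
 define l where "l = (\<lambda>i\<in>-{j}. nat \<lfloor>real N*x $ i\<rfloor>)"
 have N0: "0 < real N" using N by simp
 have "l \<in> Pi\<^sub>E (- {j}) (%i. {..< nat \<lfloor>real N*L i\<rfloor> + 1})"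
  unfolding l_def
 proof (rule restrict_PiE_iff[THEN iffD2], rule ballI)
  fix i assume "i \<in> - {j}"
  then have "real N*x $ i <= real N*L i" using x N0 by (auto simp: flat_box_def)
  then have "nat \<lfloor>real N*x $ i\<rfloor> <= nat \<lfloor>real N*L i\<rfloor>" by (intro nat_mono floor_mono)
  then show "nat \<lfloor>real N*x $ i\<rfloor> \<in> {..< nat \<lfloor>real N*L i\<rfloor> + 1}" by simp
 qed
 moreover have "x \<in> flat_box j (%i. real (l i)/real N) (%i. real (l i)/real N + 1/real N)"
  unfolding flat_box_def
 proof (intro CollectI conjI allI impI)
  fix i assume i: "i ~= j"
  then have "0 <= real N*x $ i" using x N0 by (auto simp: flat_box_def)
  then have "real (l i) <= real N*x $ i" "real N*x $ i <= real (l i) + 1" using i unfolding l_def by (auto simp: of_nat_nat)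
  then show "real (l i)/real N <= x $ i" "x $ i <= real (l i)/real N + 1/real N"
   using N0 by (auto simp: divide_simps mult.commute)
 qed (use x in \<open>simp add: flat_box_def\<close>)
 ultimately show "x \<in> (\<Union>l\<in>Pi\<^sub>E (- {j}) (%i. {..< nat \<lfloor>real N*L i\<rfloor> + 1}).
  flat_box j (%i. real (l i)/real N) (%i. real (l i)/real N + 1/real N))" by blast
qed

lemma grid_fraction_tendsto: "(%N. real (nat \<lfloor>real N*u\<rfloor>)/real N) \<longlonglongrightarrow> u" if "0 <= u"
proof (rule tendsto_sandwich)
 have b: "real N*u - 1 <= real (nat \<lfloor>real N*u\<rfloor>)" "real (nat \<lfloor>real N*u\<rfloor>) <= real N*u" for N
  using mult_nonneg_nonneg[OF of_nat_0_le_iff that, of N] by linarith+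
 show "EV N. u - 1/real N <= real (nat \<lfloor>real N*u\<rfloor>)/real N"
  using eventually_gt_at_top[of 0]
 proof eventually_elim
  case (elim N)
  then show ?case using divide_right_mono[OF b(1)[of N], of "real N"] by (simp add: diff_divide_distrib)
 qed
 show "EV N. real (nat \<lfloor>real N*u\<rfloor>)/real N <= u"
  using eventually_gt_at_top[of 0]
 proof eventually_elim
  case (elim N)
  then show ?case using divide_right_mono[OF b(2)[of N], of "real N"] by simp
 qed
 have "(%N. u - 1/real N) \<longlonglongrightarrow> u - 0" by (intro tendsto_diff tendsto_const lim_1_over_n)
 then show "(%N. u - 1/real N) \<longlonglongrightarrow> u" by simp
qed (rule tendsto_const)

lemma unit_cube_measure_finite:
 fixes j :: "'d::finite"
 assumes s: "s = card (- {j})"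
 shows "hausdorff_measure s (flat_box j (%_. 0) (%_. 1)) < top"
proof -
 let ?c = "real CARD('d)" and ?S = "flat_box j (%_. 0) (%_. 1)"
 let ?B = "unit_ball_vol (real s)*?c^s"
 have "hausdorff_content s dl ?S <= ennreal ?B" if dl: "0 < dl" for dl
 proof -
  define N where "N = nat \<lceil>?c/dl\<rceil> + 1"
  have N: "1 <= N" by (simp add: N_def)
  then have N0: "0 < real N" by simp
  have "?c/dl <= real N" unfolding N_def by linarith
  then have cN: "?c/real N <= dl" using dl N0 by (simp add: divide_simps mult.commute)
  define I where "I = Pi\<^sub>E (- {j}) (%i. {..< nat \<lfloor>real N*1\<rfloor> + 1})"
  define A where "A l = flat_box j (%i. real (l i)/real N) (%i. real (l i)/real N + 1/real N)" for l :: "'d => nat"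
  have fin: "finite I" unfolding I_def by (intro finite_PiE) auto
  have dA: "dist x y <= ?c/real N" if "x \<in> A l" "y \<in> A l" for x y l
  proof -
   have "norm (x - y) <= (\<Sum>i\<in>UNIV. \<bar>(x - y) $ i\<bar>)" by (rule norm_le_l1_cart)
   also have "... <= (\<Sum>i\<in>(UNIV :: 'd set). 1/real N)"
   proof (rule sum_mono)
    fix i show "\<bar>(x - y) $ i\<bar> <= 1/real N"
    proof (cases "i = j")
     case False
     then have "real (l i)/real N <= x $ i" "x $ i <= real (l i)/real N + 1/real N"
      "real (l i)/real N <= y $ i" "y $ i <= real (l i)/real N + 1/real N"
      using that by (auto simp: A_def flat_box_def)
     then show ?thesis by (simp add: abs_le_iff)
    qed (use that in \<open>simp add: A_def flat_box_def\<close>)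
   qed
   finally show ?thesis by (simp add: dist_norm)
  qed
  have A: "bounded (A l)" "diameter (A l) <= ?c/real N" for l
   using diameter_le_dist[of "?c/real N" "A l"] dA by auto
  have "hausdorff_content s dl ?S <= (\<Sum>l\<in>I. diameter_cost s (A l))"
  proof (rule hausdorff_content_finite_cover[OF fin])
   show "?S \<subseteq> (\<Union>l\<in>I. A l)" unfolding I_def A_def by (rule grid_cover[OF N])
   show "diameter (A l) <= dl" for l using A(2) cN by (rule order_trans)
  qed (use A dl in auto)
  also have "... <= (\<Sum>l\<in>I. ennreal (unit_ball_vol (real s)*(?c/real N/2)^s))"
  proof (rule sum_mono)
   fix l
   have "unit_ball_vol (real s)*(diameter (A l)/2)^s <= unit_ball_vol (real s)*(?c/real N/2)^s"
    using A(2)[of l] diameter_ge_0[OF A(1), of l] by (intro mult_left_mono power_mono divide_right_mono) auto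
   then show "diameter_cost s (A l) <= ennreal (unit_ball_vol (real s)*(?c/real N/2)^s)"
    by (auto simp: diameter_cost_def ennreal_leI)
  qed
  also have "... = ennreal (real (card I)*(unit_ball_vol (real s)*(?c/real N/2)^s))"
   by (simp add: ennreal_mult ennreal_of_nat_eq_real_of_nat)
  also have "... <= ennreal ?B"
  proof (rule ennreal_leI)
   have "card I = (N + 1)^s" by (simp add: I_def card_PiE s)
   then have "real (card I) = (real N + 1)^s" by (simp add: add.commute)
   also have "... <= (2*real N)^s" using N0 N by (intro power_mono) auto
   finally have "real (card I)*(unit_ball_vol (real s)*(?c/real N/2)^s)
     <= (2*real N)^s*(unit_ball_vol (real s)*(?c/real N/2)^s)" by (intro mult_right_mono) auto
   also have "... = unit_ball_vol (real s)*(2*real N*(?c/real N/2))^s"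
    by (simp only: power_mult_distrib mult_ac)
   also have "2*real N*(?c/real N/2) = ?c" using N0 by simp
   finally show "real (card I)*(unit_ball_vol (real s)*(?c/real N/2)^s) <= ?B" .
  qed
  finally show ?thesis .
 qed
 then have "hausdorff_measure s ?S <= ennreal ?B" unfolding hausdorff_measure_content by (intro SUP_least) auto
 then show ?thesis by (rule le_less_trans) simp
qed

text \<open>Thickening a cover of the cube by a unit interval along the axis \<open>j\<close> gives boxes
  that cover a cube of full dimension and whose volumes are proportional to the costs.\<close>

lemma unit_cube_measure_pos:
 fixes j :: "'d::finite"
 assumes s: "s = card (- {j})" "0 < s"
 shows "0 < hausdorff_measure s (flat_box j (%_. 0) (%_. 1))"
proof -
 let ?S = "flat_box j (%_. 0) (%_. 1)" and ?w = "unit_ball_vol (real s)"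
 have w: "0 < ?w" by simp
 have "ennreal (?w/4^s) <= hausdorff_content s 1 ?S"
  unfolding hausdorff_content_def
 proof (rule INF_greatest)
  fix U assume U: "U \<in> fine_covers 1 ?S"
  have bU: "bounded (U n)" for n using U by (auto simp: fine_covers_def)
  define p where "p n = (SOME x. x \<in> U n)" for n
  define lo where "lo n = (\<chi> i. if i = j then 0 else p n $ i - diameter (U n))" for n
  define hi where "hi n = (\<chi> i. if i = j then 1 else p n $ i + diameter (U n))" for n
  define C where "C n = (if U n = {} then {} else cbox (lo n) (hi n))" for n
  have d0: "0 <= diameter (U n)" for n by (rule diameter_ge_0[OF bU])
  have vol: "emeasure lborel (C n) = ennreal (4^s/?w)*diameter_cost s (U n)" for n
  proof (cases "U n = {}")
   case False
   have le: "\<forall>i. lo n $ i <= hi n $ i" using d0 by (simp add: lo_def hi_def)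
   then have ne: "cbox (lo n) (hi n) ~= {}" by (simp add: interval_ne_empty_cart)
   have "(\<Prod>i\<in>UNIV. hi n $ i - lo n $ i) = (\<Prod>i\<in>insert j (- {j}). hi n $ i - lo n $ i)"
    by (rule prod.cong) auto
   also have "... = (\<Prod>i\<in>-{j}. hi n $ i - lo n $ i)" by (simp add: lo_def hi_def)
   also have "... = (\<Prod>i\<in>-{j}. 2*diameter (U n))" by (rule prod.cong) (auto simp: lo_def hi_def)
   finally have "measure lborel (cbox (lo n) (hi n)) = (2*diameter (U n))^s"
    using ne s(1) by (simp add: content_cbox_cart)
   then have "emeasure lborel (C n) = ennreal ((2*diameter (U n))^s)"
    using False emeasure_eq_ennreal_measure[of lborel "cbox (lo n) (hi n)"] emeasure_lborel_cbox_finite[of "lo n" "hi n"]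
    by (simp add: C_def)
   also have "(2*diameter (U n))^s = 4^s/?w*(?w*(diameter (U n)/2)^s)"
   proof -
    have "2*diameter (U n) = 4*(diameter (U n)/2)" by simp
    then have "(2*diameter (U n))^s = 4^s*(diameter (U n)/2)^s" by (metis power_mult_distrib)
    moreover have "a = 4^s*b ==> u ~= 0 ==> a = 4^s/u*(u*b)" for a b u :: real by simp
    ultimately show ?thesis using less_imp_neq[OF w] by metis
   qed
   finally have e: "emeasure lborel (C n) = ennreal (4^s/?w*(?w*(diameter (U n)/2)^s))" .
   have "0 <= 4^s/?w" "0 <= ?w*(diameter (U n)/2)^s" using w d0[of n] by auto
   then show ?thesis unfolding e diameter_cost_def using False by (simp only: ennreal_mult if_False)
  qed (simp add: C_def)
  have sets: "range C \<subseteq> sets lborel" by (auto simp: C_def)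
  have "cbox (0 :: real^'d) (\<chi> i. 1) \<subseteq> (\<Union>n. C n)"
  proof
   fix x :: "real^'d" assume x: "x \<in> cbox 0 (\<chi> i. 1)"
   define y :: "real^'d" where "y = (\<chi> i. if i = j then 0 else x $ i)"
   have "y \<in> ?S" using x by (simp add: flat_box_def y_def mem_box_cart)
   then obtain n where n: "y \<in> U n" using U by (auto simp: fine_covers_def)
   then have pn: "p n \<in> U n" unfolding p_def by (rule someI)
   have "\<bar>y $ i - p n $ i\<bar> <= diameter (U n)" for i
   proof -
    have "\<bar>(y - p n) $ i\<bar> <= norm (y - p n)" by (rule component_le_norm_cart)
    also have "... <= diameter (U n)" using diameter_bounded_bound[OF bU n pn] by (simp add: dist_norm)
    finally show ?thesis by simp
   qed
   then have "p n $ i - diameter (U n) <= y $ i & y $ i <= p n $ i + diameter (U n)" for i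
    by (simp add: abs_le_iff algebra_simps)
   then have "x \<in> cbox (lo n) (hi n)"
    using x unfolding mem_box_cart lo_def hi_def y_def by (auto split: if_splits) (metis)+
   then show "x \<in> (\<Union>n. C n)" using n by (auto simp: C_def)
  qed
  then have "emeasure lborel (cbox (0 :: real^'d) (\<chi> i. 1)) <= emeasure lborel (\<Union>n. C n)"
   using sets by (intro emeasure_mono sets.countable_UN) auto
  also have "... <= (\<Sum>n. emeasure lborel (C n))" using sets by (rule emeasure_subadditive_countably)
  also have "... = ennreal (4^s/?w)*(\<Sum>n. diameter_cost s (U n))" by (simp add: vol ennreal_suminf_cmult)
  finally have "1 <= ennreal (4^s/?w)*(\<Sum>n. diameter_cost s (U n))"
  proof -
   have "emeasure lborel (cbox (0 :: real^'d) (\<chi> i. 1)) = 1"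
   proof -
    have ne: "cbox (0 :: real^'d) (\<chi> i. 1) ~= {}" by (simp add: interval_ne_empty_cart)
    have "measure lborel (cbox (0 :: real^'d) (\<chi> i. 1)) = 1" using ne by (simp add: content_cbox_cart)
    then show ?thesis
     using emeasure_eq_ennreal_measure[of lborel "cbox (0 :: real^'d) (\<chi> i. 1)"]
      emeasure_lborel_cbox_finite[of "0 :: real^'d" "\<chi> i. 1"] by simp
   qed
   then show "1 <= ennreal (4^s/?w)*(\<Sum>n. diameter_cost s (U n))"
    if "emeasure lborel (cbox (0 :: real^'d) (\<chi> i. 1)) <= ennreal (4^s/?w)*(\<Sum>n. diameter_cost s (U n))" using that by simp
  qed
  then have "ennreal (?w/4^s)*1 <= ennreal (?w/4^s)*(ennreal (4^s/?w)*(\<Sum>n. diameter_cost s (U n)))"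
   by (rule mult_left_mono) simp
  also have "... = (\<Sum>n. diameter_cost s (U n))"
  proof -
   have "?w/4^s*(4^s/?w) = 1" using less_imp_neq[OF w] by (simp only: times_divide_times_eq mult.commute) simp
   then show ?thesis using w by (simp only: mult.assoc[symmetric] ennreal_mult[symmetric] divide_nonneg_nonneg less_imp_le zero_le_power zero_le_numeral ennreal_1 mult_1_left)
  qed
  finally show "ennreal (?w/4^s) <= (\<Sum>n. diameter_cost s (U n))" by simp
 qed
 also have "... <= hausdorff_measure s ?S" by (rule hausdorff_content_le_measure) simp
 finally show ?thesis using w by (auto intro: less_le_trans[rotated])
qed

text \<open>A grid of cubes of side \<open>1 / N\<close> covers the box; shrunk by the factor \<open>1 - 1 /
  N\<close>, the cubes inside the box are separated. Both counts approximate the area.\<close>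

lemma hausdorff_measure_flat_box:
 fixes j :: "'d::finite" and L :: "'d => real"
 assumes s: "s = card (- {j})" and L: "!!i. i ~= j ==> 0 < L i"
 shows "hausdorff_measure s (flat_box j (%_. 0) L)
  = ennreal (enn2real (hausdorff_measure s (flat_box j (%_. 0) (%_. 1)))*(\<Prod>i\<in>-{j}. L i))"
proof -
 let ?S = "flat_box j (%_. 0) L" and ?H = "hausdorff_measure s :: (real^'d) set => ennreal"
 define \<kappa> where "\<kappa> = enn2real (?H (flat_box j (%_. 0) (%_. 1)))"
 have \<kappa>: "?H (flat_box j (%_. 0) (%_. 1)) = ennreal \<kappa>" "0 <= \<kappa>"
  using unit_cube_measure_finite[OF s] by (auto simp: \<kappa>_def)
 define m where "m N i = nat \<lfloor>real N*L i\<rfloor>" for N i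
 have cube: "?H (flat_box j a (%i. a i + c)) = ennreal (c^s*\<kappa>)" if "0 < c" for a c
  using hausdorff_measure_cube[OF that, of s j a] \<kappa> that by (simp add: ennreal_mult)
 have prodN: "(\<Prod>i\<in>-{j}. f i)*(c^s*\<kappa>) = \<kappa>*(\<Prod>i\<in>-{j}. f i*c)" for f and c :: real
  by (simp add: prod.distrib s)
 have upper: "?H ?S <= ennreal (\<kappa>*(\<Prod>i\<in>-{j}. real (m N i)/real N + 1/real N))" if N: "1 <= N" for N
 proof -
  define I where "I = Pi\<^sub>E (- {j}) (%i. {..< m N i + 1})"
  have fin: "finite I" unfolding I_def by (intro finite_PiE) auto
  have "?H ?S <= ?H (\<Union>l\<in>I. flat_box j (%i. real (l i)/real N) (%i. real (l i)/real N + 1/real N))"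
   unfolding I_def m_def by (rule hausdorff_measure_mono[OF grid_cover[OF N]])
  also have "... <= (\<Sum>l\<in>I. ?H (flat_box j (%i. real (l i)/real N) (%i. real (l i)/real N + 1/real N)))"
   by (rule hausdorff_measure_UN_le[OF fin])
  also have "... = (\<Sum>l\<in>I. ennreal ((1/real N)^s*\<kappa>))" using cube[of "1/real N"] N by simp
  also have "... = ennreal (real (card I)*((1/real N)^s*\<kappa>))"
   using \<kappa>(2) by (simp add: ennreal_mult ennreal_of_nat_eq_real_of_nat)
  also have "real (card I) = (\<Prod>i\<in>-{j}. real (m N i) + 1)" by (simp add: I_def card_PiE add.commute)
  also have "... * ((1/real N)^s*\<kappa>) = \<kappa>*(\<Prod>i\<in>-{j}. (real (m N i) + 1)*(1/real N))" by (rule prodN)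
  finally show ?thesis by (simp add: add_divide_distrib)
 qed
 have lower: "ennreal (\<kappa>*(\<Prod>i\<in>-{j}. real (m N i)/real N*(1 - 1/real N))) <= ?H ?S" if N: "2 <= N" for N
 proof -
  have N0: "0 < real N" using N by simp
  define c where "c = (1 - 1/real N)/real N"
  have "0 < 1 - 1/real N" using N by (simp add: divide_simps)
  then have c0: "0 < c" using N0 by (simp add: c_def)
  define I where "I = Pi\<^sub>E (- {j}) (%i. {..< m N i})"
  define A where "A l = flat_box j (%i. real (l i)/real N) (%i. real (l i)/real N + c)" for l :: "'d => nat"
  have fin: "finite I" unfolding I_def by (intro finite_PiE) auto
  have c1: "c = 1/real N - 1/(real N*real N)" by (simp add: c_def diff_divide_distrib)
  have sub: "A l \<subseteq> ?S" if "l \<in> I" for l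
  proof
   fix x assume x: "x \<in> A l"
   show "x \<in> ?S" unfolding flat_box_def
   proof (intro CollectI conjI allI impI)
    fix i assume i: "i ~= j"
    then have b: "real (l i)/real N <= x $ i" "x $ i <= real (l i)/real N + c" using x by (auto simp: A_def flat_box_def)
    have "0 <= real (l i)/real N" using N0 by simp
    then show "0 <= x $ i" using b(1) by linarith
    have "l i < m N i" using PiE_mem[OF \<open>l \<in> I\<close>[unfolded I_def], of i] i by simp
    then have "real (l i) + 1 <= real N*L i" using L[OF i] N0 unfolding m_def by linarith
    then have "(real (l i) + 1)/real N <= L i" using N0 by (simp add: pos_divide_le_eq mult.commute)
    moreover have "c <= 1/real N" using c1 by simp
    ultimately show "x $ i <= L i" using b(2) by (simp add: add_divide_distrib)
   qed (use x in \<open>simp add: A_def flat_box_def\<close>)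
  qed
  have "(\<Sum>l\<in>I. ?H (A l)) <= ?H (\<Union>l\<in>I. A l)"
  proof (rule hausdorff_measure_separated[OF fin])
   show "0 < 1/(real N*real N)" using N0 by simp
   fix l l' x y assume l: "l \<in> I" "l' \<in> I" "l ~= l'" and x: "x \<in> A l" "y \<in> A l'"
   obtain i where i: "i ~= j" "l i ~= l' i"
   proof -
    have "\<exists>i\<in>-{j}. l i ~= l' i" using l unfolding I_def by (metis PiE_ext)
    then show ?thesis using that by blast
   qed
   have b: "real (l i)/real N <= x $ i" "x $ i <= real (l i)/real N + c"
     "real (l' i)/real N <= y $ i" "y $ i <= real (l' i)/real N + c"
    using x i(1) by (auto simp: A_def flat_box_def)
   have "1/(real N*real N) <= \<bar>x $ i - y $ i\<bar>"
   proof (cases "l i < l' i")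
    case True
    then have "(real (l i) + 1)/real N <= real (l' i)/real N" using N0 by (intro divide_right_mono) auto
    then show ?thesis using b c1 by (simp add: add_divide_distrib)
   next
    case False
    then have "l' i < l i" using i(2) by simp
    then have "(real (l' i) + 1)/real N <= real (l i)/real N" using N0 by (intro divide_right_mono) auto
    then show ?thesis using b c1 by (simp add: add_divide_distrib)
   qed
   also have "... <= dist x y" using component_le_norm_cart[of "x - y" i] by (simp add: dist_norm)
   finally show "1/(real N*real N) <= dist x y" .
  qed
  also have "... <= ?H ?S" by (rule hausdorff_measure_mono) (use sub in blast)
  also have "(\<Sum>l\<in>I. ?H (A l)) = (\<Sum>l\<in>I. ennreal (c^s*\<kappa>))" by (simp only: A_def cube[OF c0])
  also have "... = ennreal (real (card I)*(c^s*\<kappa>))"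
   using \<kappa>(2) c0 by (simp add: ennreal_mult ennreal_of_nat_eq_real_of_nat)
  also have "real (card I) = (\<Prod>i\<in>-{j}. real (m N i))" by (simp add: I_def card_PiE)
  also have "... * (c^s*\<kappa>) = \<kappa>*(\<Prod>i\<in>-{j}. real (m N i)*c)" by (rule prodN)
  finally show ?thesis by (simp add: c_def)
 qed
 have "?H ?S < top" using upper[of 1] by (rule le_less_trans) simp_all
 then obtain x where x: "?H ?S = ennreal x" "0 <= x" by (cases "?H ?S") auto
 have mN: "(%N. real (m N i)/real N) \<longlonglongrightarrow> L i" if "i \<in> - {j}" for i
  unfolding m_def using grid_fraction_tendsto[of "L i"] L[of i] that by simp
 have "x <= \<kappa>*(\<Prod>i\<in>-{j}. L i + 0)"
 proof (rule LIMSEQ_le_const)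
  show "(%N. \<kappa>*(\<Prod>i\<in>-{j}. real (m N i)/real N + 1/real N)) \<longlonglongrightarrow> \<kappa>*(\<Prod>i\<in>-{j}. L i + 0)"
   by (intro tendsto_mult tendsto_prod tendsto_add tendsto_const mN lim_1_over_n) 
  show "\<exists>N. \<forall>n\<ge>N. x <= \<kappa>*(\<Prod>i\<in>-{j}. real (m n i)/real n + 1/real n)"
  proof (intro exI[of _ 1] allI impI)
   fix N :: nat assume "1 <= N"
   moreover have "0 <= \<kappa>*(\<Prod>i\<in>-{j}. real (m N i)/real N + 1/real N)"
    using \<kappa>(2) by (intro mult_nonneg_nonneg prod_nonneg) auto
   ultimately show "x <= \<kappa>*(\<Prod>i\<in>-{j}. real (m N i)/real N + 1/real N)" using upper[of N] x by simp
  qed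
 qed
 moreover have "\<kappa>*(\<Prod>i\<in>-{j}. L i*(1 - 0)) <= x"
 proof (rule LIMSEQ_le_const2)
  show "(%N. \<kappa>*(\<Prod>i\<in>-{j}. real (m N i)/real N*(1 - 1/real N))) \<longlonglongrightarrow> \<kappa>*(\<Prod>i\<in>-{j}. L i*(1 - 0))"
   by (intro tendsto_mult tendsto_prod tendsto_diff tendsto_const mN lim_1_over_n)
  show "\<exists>N. \<forall>n\<ge>N. \<kappa>*(\<Prod>i\<in>-{j}. real (m n i)/real n*(1 - 1/real n)) <= x"
   using lower x by (intro exI[of _ 2] allI impI) (simp add: ennreal_le_iff)
 qed
 ultimately have "x = \<kappa>*(\<Prod>i\<in>-{j}. L i)" by simp
 then show ?thesis using x by (simp add: \<kappa>_def)
qed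

text \<open>The factor is that of the unit cube; it divides the flow density in the flow constant.\<close>

lemma hausdorff_measure_hyperrectangle:
 fixes j :: "'d::finite"
 assumes d: "2 <= CARD('d)"
 obtains \<kappa> where "0 < \<kappa>"
  "!!(Q :: real^'d => real^'d) (lo :: 'd => real) hi r. orthogonal_transformation Q ==> (\<forall>i. i ~= j --> lo i < hi i) ==>
   enn2real (hausdorff_measure (CARD('d) - 1) (rect Q j lo hi r)) = \<kappa>*(\<Prod>i\<in>-{j}. hi i - lo i)"
proof -
 have s: "CARD('d) - 1 = card (- {j})"
  unfolding Compl_eq_Diff_UNIV by (subst card_Diff_singleton) auto
 have s0: "0 < CARD('d) - 1" using d by simp
 let ?\<kappa> = "enn2real (hausdorff_measure (CARD('d) - 1) (flat_box j (%_. 0) (%_. 1) :: (real^'d) set))"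
 show ?thesis
 proof (rule that)
  show "0 < ?\<kappa>" using unit_cube_measure_pos[OF s s0] unit_cube_measure_finite[OF s] by (simp add: enn2real_positive_iff)
  fix Q :: "real^'d => real^'d" and lo hi :: "'d => real" and r
  assume Q: "orthogonal_transformation Q" and lohi: "\<forall>i. i ~= j --> lo i < hi i"
  have "0 <= ?\<kappa>*(\<Prod>i\<in>-{j}. hi i - lo i)" using lohi by (intro mult_nonneg_nonneg prod_nonneg) (auto simp: less_imp_le)
  moreover have "hausdorff_measure (CARD('d) - 1) (flat_box j (%_. 0) (%i. hi i - lo i) :: (real^'d) set)
    = ennreal (?\<kappa>*(\<Prod>i\<in>-{j}. hi i - lo i))"
   by (rule hausdorff_measure_flat_box[OF s]) (use lohi in auto)
  ultimately show "enn2real (hausdorff_measure (CARD('d) - 1) (rect Q j lo hi r)) = ?\<kappa>*(\<Prod>i\<in>-{j}. hi i - lo i)"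
   unfolding hausdorff_measure_rect[OF Q] by simp
 qed
qed

section \<open>Convergence of the rescaled flow\<close>

context percolation_capacities
begin

context
 fixes Q :: "real^'d => real^'d" and lo hi :: "'d => real" and r :: real and h :: "nat => real"
 assumes Q: "frame Q" and lohi: "!!l. l ~= j ==> lo l < hi l" and h: "filterlim h at_top sequentially"
  and tame: "r = 0 \<or> integrable M (%w. t base_edge w powr (1 + 1/real D))"
begin

text \<open>The two strong laws under the two alternative hypotheses.\<close>

lemma flow_upper_bound_as':
 assumes eps: "0 < eps"
 shows "AE w in M. EV n.
  cylinder_flow Q (scale (real n) lo) (scale (real n) hi) (real n*r) (h n) w
   <= (flow_density*area lo hi + eps)*real n^D"
proof (rule flow_upper_bound_as[OF Q lohi h _ _ eps])
 let ?lo = "%n. scale (real n) lo" and ?hi = "%n. scale (real n) hi"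
 fix m hT assume ab: "\<forall>k. k ~= j --> ?lo m k + 2*margin <= ?hi m k" and hT: "2*margin + 2 <= hT"
 have le: "?lo n k <= ?hi n k" if "k ~= j" for n k
  using lohi[OF that] by (simp add: scale_def mult_left_mono)
 show "bounded_averages (cylinder_flow Q (?lo m) (?hi m) (real m*r) hT)
   (%n. tiles Q Q (?lo m) (?hi m) (?lo n) (?hi n) (%_. 0))
   (%n. tile_flow Q (?lo m) (?hi m) (%_. 0) (real m*r) hT (real n*r))"
  using tame
 proof
  assume "r = 0"
  then have z: "real k*r = 0" for k by simp
  show ?thesis unfolding z by (rule tiles_bounded_averages_nested[OF Q]) (use ab in auto)
 next
  assume "integrable M (%w. t base_edge w powr (1 + 1/real D))"
  moreover have "0 < 1 + 1/real D" by (intro add_pos_nonneg) auto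
  ultimately have "integrable M (%w. cylinder_flow Q (?lo m) (?hi m) (real m*r) hT w powr (1 + 1/real D))"
   unfolding cylinder_flow_def using finite_cylinder_points[OF Q] by (intro flow_powr_integrable)
  then show ?thesis
  proof (rule bounded_averages_moment[OF cylinder_flow_rv[OF Q]], intro always_eventually allI)
   show "iid_copies (cylinder_flow Q (?lo m) (?hi m) (real m*r) hT) (tiles Q Q (?lo m) (?hi m) (?lo n) (?hi n) (%_. 0))
     (tile_flow Q (?lo m) (?hi m) (%_. 0) (real m*r) hT (real n*r))" for n
    by (rule tile_flows_iid[OF Q Q _ _ hT order_refl]) (use ab le in auto)
  qed
 qed
 let ?G = "%n. gap_edges Q Q (?lo m) (?hi m) (?lo n) (?hi n) (%_. 0) (real m*r) hT (real n*r) (h n)"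
 have large: "EV n. hT + margin + 1 <= h n" using h by (simp add: filterlim_at_top)
 show "bounded_averages (t base_edge) ?G (%_. t)"
  using tame
 proof
  assume r: "r = 0"
  have v1: "norm v = 1" using Q frame_norm unfolding frame_def by blast
  have ex: "1 <= extent lo hi" "k ~= j ==> \<bar>lo k\<bar> <= extent lo hi" "k ~= j ==> \<bar>hi k\<bar> <= extent lo hi" for k
   by (rule extent[OF Q]; use lohi in auto)+
  have e0: "0 <= extent lo hi" "0 <= margin + 1" using ex(1) margin_gt_1 by auto
  show ?thesis
  proof (rule edges_bounded_averages_nested[OF Q e0])
   show "EV n. ?G n \<subseteq> lattice_edges &
    (\<forall>e\<in>?G n. \<exists>x\<in>e. \<bar>v \<bullet> x\<bar> <= margin + 1 & (\<forall>k. k ~= j --> \<bar>Q x $ k\<bar> <= extent lo hi*real n))"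
    using large
   proof eventually_elim
    case (elim n)
    have "?G n \<subseteq> lattice_edges"
     by (rule gap_edges_sub[OF Q Q _ _ hT elim]) (use ab le in auto)
    moreover have "\<exists>x\<in>e. \<bar>v \<bullet> x\<bar> <= margin + 1 & (\<forall>k. k ~= j --> \<bar>Q x $ k\<bar> <= extent lo hi*real n)" if e: "e \<in> ?G n" for e
    proof -
     have "\<exists>x\<in>cylinder_points Q (?lo n) (?hi n) (real n*r) (h n). x \<in> e & \<bar>v \<bullet> x - real n*r\<bar> <= margin + 1"
     proof (rule interface_edge_height[OF v1 e[unfolded gap_edges_def]])
      show "(+) (tile_shift Q (?lo m) (?hi m) (%_. 0) (real n*r - real m*r) l) ` cylinder_points Q (?lo m) (?hi m) (real m*r) hT
        \<subseteq> cylinder_points Q (?lo n) (?hi n) (real n*r) (h n)"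
       if "l \<in> tiles Q Q (?lo m) (?hi m) (?lo n) (?hi n) (%_. 0)" for l
       by (rule tile_points_sub[OF Q Q _ _ hT elim that]) (use ab le in auto)
     qed (use margin_gt_1 in auto)
     then obtain x where x: "x \<in> cylinder_points Q (?lo n) (?hi n) (real n*r) (h n)" "x \<in> e" "\<bar>v \<bullet> x - real n*r\<bar> <= margin + 1"
      by blast
     have "\<bar>Q x $ k\<bar> <= extent lo hi*real n" if k: "k ~= j" for k
     proof -
      have b: "real n*lo k <= Q x $ k" "Q x $ k <= real n*hi k"
       using x(1) k by (auto simp: cylinder_points_def lattice_points_def prism_def scale_def)
      have "real n*(- extent lo hi) <= real n*lo k" "real n*hi k <= real n*extent lo hi"
       using ex(2,3)[OF k] by (intro mult_left_mono; simp add: abs_le_iff minus_le_iff)+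
      then show ?thesis using b by (simp add: abs_le_iff mult.commute)
     qed
     then show ?thesis using x r by auto
    qed
    ultimately show ?case by blast
   qed
  qed
 next
  assume "integrable M (%w. t base_edge w powr (1 + 1/real D))"
  then show ?thesis
  proof (rule edges_bounded_averages_moment)
   show "EV n. finite (?G n) & ?G n \<subseteq> lattice_edges"
    using large
   proof eventually_elim
    case (elim n)
    have "?G n \<subseteq> lattice_edges" by (rule gap_edges_sub[OF Q Q _ _ hT elim]) (use ab le in auto)
    moreover have "finite (?G n)" by (rule finite_gap_edges[OF Q Q _ _ hT elim]) (use ab le in auto)
    ultimately show ?case by blast
   qed
  qed
 qed
qed

lemma flow_converges_as:
 "AE w in M. (%n. cylinder_flow Q (scale (real n) lo) (scale (real n) hi) (real n*r) (h n) w
   / area (scale (real n) lo) (scale (real n) hi)) \<longlonglongrightarrow> flow_density"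
proof -
 let ?f = "%n. cylinder_flow Q (scale (real n) lo) (scale (real n) hi) (real n*r) (h n)" and ?\<Phi> = "flow_density*area lo hi"
 have "AE w in M. EV n. ?f n w <= (?\<Phi> + 1/real (Suc m))*real n^D" for m
  by (rule flow_upper_bound_as') simp
 then have up: "AE w in M. \<forall>m. EV n. ?f n w <= (?\<Phi> + 1/real (Suc m))*real n^D"
  by (simp add: AE_all_countable)
 have "AE w in M. EV n. (?\<Phi> - 1/real (Suc m))*real n^D <= ?f n w" for m
  by (rule flow_lower_bound_as[OF Q lohi h tame]) simp_all
 then have low: "AE w in M. \<forall>m. EV n. (?\<Phi> - 1/real (Suc m))*real n^D <= ?f n w"
  by (simp add: AE_all_countable)
 show ?thesis
  using up low
 proof eventually_elim
  case (elim w)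
  have "(%n. ?f n w/real n^D) \<longlonglongrightarrow> ?\<Phi>"
  proof (rule tendstoI)
   fix e :: real assume "0 < e"
   then obtain m where m: "1/real (Suc m) < e" using nat_approx_posE[of e] by auto
   have "EV n. ?f n w <= (?\<Phi> + 1/real (Suc m))*real n^D"
    "EV n. (?\<Phi> - 1/real (Suc m))*real n^D <= ?f n w"
    using elim by auto
   then show "EV n. dist (?f n w/real n^D) ?\<Phi> < e"
    using eventually_gt_at_top[of 0]
   proof eventually_elim
    case (elim n)
    have n: "0 < real n^D" using elim(3) by simp
    have "?f n w/real n^D <= ?\<Phi> + 1/real (Suc m)" using elim(1) n by (subst pos_divide_le_eq)
    moreover have "?\<Phi> - 1/real (Suc m) <= ?f n w/real n^D" using elim(2) n by (subst pos_le_divide_eq)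
    ultimately show ?case using m unfolding dist_real_def by linarith
   qed
  qed
  moreover have pos: "0 < area lo hi" by (rule area_pos) (rule lohi)
  ultimately have "(%n. ?f n w/real n^D/area lo hi) \<longlonglongrightarrow> ?\<Phi>/area lo hi"
   by (intro tendsto_divide tendsto_const) auto
  then show ?case using pos by (simp add: area_scale)
 qed
qed

end

lemma rescaled_flow_eq:
 assumes Q: "frame Q" and lohi: "!!l. l ~= j ==> lo l < hi l" and h: "0 < h n" and n: "0 < n" and w: "w \<in> space M"
  and \<kappa>: "!!lo hi r. (\<forall>i. i ~= j --> lo i < hi i) ==>
   enn2real (hausdorff_measure (CARD('d) - 1) (rect Q j lo hi r)) = \<kappa>*(\<Prod>i\<in>-{j}. hi i - lo i)"
 shows "rescaled_flow t v (rect Q j lo hi r) h n w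
  = cylinder_flow Q (scale (real n) lo) (scale (real n) hi) (real n*r) (h n) w/area (scale (real n) lo) (scale (real n) hi)/\<kappa>"
proof -
 note Q' = Q[unfolded frame_def, THEN conjunct1] Q[unfolded frame_def, THEN conjunct2]
 have A: "(*\<^sub>R) (real n) ` rect Q j lo hi r = rect Q j (scale (real n) lo) (scale (real n) hi) (real n*r)"
  using rect_scale[OF Q'(1), of "real n" j lo hi r] n by (simp add: scale_def[abs_def])
 have lt: "scale (real n) lo i < scale (real n) hi i" if "i ~= j" for i
  using lohi[OF that] n by (simp add: scale_def)
 have "tau (%e. t e w) v (rect Q j (scale (real n) lo) (scale (real n) hi) (real n*r)) (h n)
   = cylinder_flow Q (scale (real n) lo) (scale (real n) hi) (real n*r) (h n) w"
  unfolding cylinder_flow_def flow_def cylinder_points_def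
  by (rule tau_eq_min_cut[OF Q']) (use lt h capacity_nonneg w in auto)
 moreover have "enn2real (hausdorff_measure (CARD('d) - 1) (rect Q j (scale (real n) lo) (scale (real n) hi) (real n*r)))
   = \<kappa>*area (scale (real n) lo) (scale (real n) hi)"
  unfolding area_def using \<kappa> lt by blast
 ultimately show ?thesis unfolding rescaled_flow_def A by (simp add: mult.commute)
qed

text \<open>A point has measure zero, and division by zero yields zero.\<close>

lemma rescaled_flow_zero: "rescaled_flow t v A h 0 w = 0"
proof -
 have "(*\<^sub>R) (real 0) ` A \<subseteq> {0}" by auto
 then have "hausdorff_measure (CARD('d) - 1) ((*\<^sub>R) (real 0) ` A) <= hausdorff_measure (CARD('d) - 1) {0 :: real^'d}"
  by (rule hausdorff_measure_mono)
 also have "... = 0" using dim by (intro hausdorff_measure_singleton) simp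
 finally show ?thesis by (simp add: rescaled_flow_def)
qed

lemma rescaled_flow_convergence:
 assumes A: "hyperrectangle A" and v: "unit_normal v A" and h0: "!!n. 0 < h n" and h: "filterlim h at_top sequentially"
  and \<kappa>: "0 < \<kappa>" "!!Q lo hi r. orthogonal_transformation Q ==> (\<forall>i. i ~= j --> lo i < hi i) ==>
   enn2real (hausdorff_measure (CARD('d) - 1) (rect Q j lo hi r)) = \<kappa>*(\<Prod>i\<in>-{j}. hi i - lo i)"
 shows "(%n. expectation (rescaled_flow t v A h n)) \<longlonglongrightarrow> flow_density/\<kappa>"
  "tendsto_L1 M (rescaled_flow t v A h) (flow_density/\<kappa>)"
  "0 \<in> A \<or> integrable M (%w. t base_edge w powr (1 + 1/real D)) ==>
   AE w in M. (%n. rescaled_flow t v A h n w) \<longlonglongrightarrow> flow_density/\<kappa>"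
proof -
 obtain Q lo hi r where Q': "orthogonal_transformation Q" "Q v = axis j 1"
  and lohi': "\<forall>i. i ~= j --> lo i < hi i" and A_eq: "A = rect Q j lo hi r"
  using hyperrectangle_coords[OF A v, of j] by metis
 have lohi: "!!i. i ~= j ==> lo i < hi i" using lohi' by blast
 have Q: "frame Q" using Q' by (simp add: frame_def)
 let ?Z = "%n w. cylinder_flow Q (scale (real n) lo) (scale (real n) hi) (real n*r) (h n) w
   / area (scale (real n) lo) (scale (real n) hi)"
 have eq: "rescaled_flow t v A h n w = ?Z n w/\<kappa>" if "0 < n" "w \<in> space M" for n w
  unfolding A_eq by (rule rescaled_flow_eq[OF Q lohi h0 that \<kappa>(2)[OF Q'(1)]])
 have grow: "growing (%n. scale (real n) lo) (%n. scale (real n) hi) h" by (rule growing_scale[OF lohi h])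
 have int: "integrable M (?Z n)" for n using cylinder_flow_rv(2)[OF Q] by auto
 show "(%n. expectation (rescaled_flow t v A h n)) \<longlonglongrightarrow> flow_density/\<kappa>"
 proof (rule Lim_transform_eventually)
  show "(%n. expectation (cylinder_flow Q (scale (real n) lo) (scale (real n) hi) (real n*r) (h n))
    / area (scale (real n) lo) (scale (real n) hi)/\<kappa>) \<longlonglongrightarrow> flow_density/\<kappa>"
   using mean_flow_tendsto[OF Q grow, of "%n. real n*r"] \<kappa>(1) by (intro tendsto_divide tendsto_const) auto
  show "EV n. expectation (cylinder_flow Q (scale (real n) lo) (scale (real n) hi) (real n*r) (h n))
    / area (scale (real n) lo) (scale (real n) hi)/\<kappa> = expectation (rescaled_flow t v A h n)"
   using eventually_gt_at_top[of 0]
  proof eventually_elim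
   case (elim n)
   have "expectation (rescaled_flow t v A h n) = expectation (%w. ?Z n w/\<kappa>)"
    by (intro Bochner_Integration.integral_cong refl eq elim)
   then show ?case by simp
  qed
 qed
 show "tendsto_L1 M (rescaled_flow t v A h) (flow_density/\<kappa>)"
  unfolding tendsto_L1_def
 proof (intro conjI allI)
  show "integrable M (rescaled_flow t v A h n)" for n
  proof (cases "n = 0")
   case True
   have "rescaled_flow t v A h 0 = (%_. 0)" by (intro ext rescaled_flow_zero)
   then show ?thesis using True by simp
  next
   case False
   have "integrable M (%w. ?Z n w/\<kappa>)" by (rule Bochner_Integration.integrable_divide_zero) (rule int)
   then show ?thesis using eq[of n] False by (simp cong: Bochner_Integration.integrable_cong)
  qed
  show "(%n. expectation (%w. \<bar>rescaled_flow t v A h n w - flow_density/\<kappa>\<bar>)) \<longlonglongrightarrow> 0"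
  proof (rule Lim_transform_eventually)
   have "(%n. expectation (%w. \<bar>?Z n w - flow_density\<bar>)/\<kappa>) \<longlonglongrightarrow> 0/\<kappa>"
    using flow_L1_tendsto[OF Q grow, of "%n. real n*r"] \<kappa>(1) by (intro tendsto_divide tendsto_const) auto
   then show "(%n. expectation (%w. \<bar>?Z n w - flow_density\<bar>)/\<kappa>) \<longlonglongrightarrow> 0" by simp
   show "EV n. expectation (%w. \<bar>?Z n w - flow_density\<bar>)/\<kappa>
     = expectation (%w. \<bar>rescaled_flow t v A h n w - flow_density/\<kappa>\<bar>)"
    using eventually_gt_at_top[of 0]
   proof eventually_elim
    case (elim n)
    have "expectation (%w. \<bar>rescaled_flow t v A h n w - flow_density/\<kappa>\<bar>) = expectation (%w. \<bar>?Z n w - flow_density\<bar>/\<kappa>)"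
    proof (intro Bochner_Integration.integral_cong refl)
     fix w assume "w \<in> space M"
     then have "rescaled_flow t v A h n w - flow_density/\<kappa> = (?Z n w - flow_density)/\<kappa>"
      using eq[OF elim] by (simp only: diff_divide_distrib)
     then show "\<bar>rescaled_flow t v A h n w - flow_density/\<kappa>\<bar> = \<bar>?Z n w - flow_density\<bar>/\<kappa>"
      using \<kappa>(1) by (simp only: abs_divide abs_of_pos)
    qed
    then show ?case by simp
   qed
  qed
 qed
 assume tame: "0 \<in> A \<or> integrable M (%w. t base_edge w powr (1 + 1/real D))"
 have "r = 0" if "0 \<in> A"
  using that orthogonal_transformation_linear[OF Q'(1)] by (simp add: A_eq rect_def linear_0)
 with tame have tame': "r = 0 \<or> integrable M (%w. t base_edge w powr (1 + 1/real D))" by blast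
 have "AE w in M. (%n. ?Z n w) \<longlonglongrightarrow> flow_density"
  by (rule flow_converges_as[OF Q _ h tame']) (rule lohi)
 then show "AE w in M. (%n. rescaled_flow t v A h n w) \<longlonglongrightarrow> flow_density/\<kappa>"
  using AE_space
 proof eventually_elim
  case (elim w)
  have "(%n. ?Z n w/\<kappa>) \<longlonglongrightarrow> flow_density/\<kappa>" using elim(1) \<kappa>(1) by (intro tendsto_divide tendsto_const) auto
  moreover have "EV n. ?Z n w/\<kappa> = rescaled_flow t v A h n w"
   using eventually_gt_at_top[of 0] by eventually_elim (use eq elim in simp)
  ultimately show ?case by (rule Lim_transform_eventually)
 qed
qed

end

lemma (in prob_space) interval_measure_distribution:
 assumes X: "random_variable borel X" and F: "!!x. F x = prob {w \<in> space M. X w <= (x::real)}"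
 shows "interval_measure F = distr M borel X"
proof -
 have rd: "real_distribution (distr M borel X)" using X by (rule real_distribution_distr)
 interpret D: real_distribution "distr M borel X" by (rule rd)
 have F_eq: "F x = cdf (distr M borel X) x" for x
 proof -
  have "X -` {..x} \<inter> space M = {w \<in> space M. X w <= x}" by auto
  then show ?thesis using X F by (simp add: cdf_def measure_distr)
 qed
 have props: "!!x y. x <= y ==> F x <= F y" "!!a. continuous (at_right a) F" "(F \<longlongrightarrow> 0) at_bot" "(F \<longlongrightarrow> 1) at_top"
  unfolding F_eq[abs_def]
  using D.cdf_nondecreasing D.cdf_is_right_cont D.cdf_lim_at_bot D.cdf_lim_at_top_prob by auto
 show ?thesis
  using cdf_unique[OF real_distribution_interval_measure rd, of F] cdf_interval_measure[of F] props F_eq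
  by (auto simp: fun_eq_iff)
qed

theorem theorem3p8:
  fixes M :: "'w measure"
    and t :: "(real^'d) set \<Rightarrow> 'w \<Rightarrow> real"
    and F :: "real \<Rightarrow> real"
    and h :: "nat \<Rightarrow> real"
    and v :: "real^'d"
    and A :: "(real^'d) set"
  assumes dim: "CARD('d) \<ge> 2"
    and M: "prob_space M"
    and indep: "prob_space.indep_vars M (\<lambda>_. borel) t lattice_edges"
    and nonneg: "\<And>e \<omega>. e \<in> lattice_edges \<Longrightarrow> \<omega> \<in> space M \<Longrightarrow> 0 \<le> t e \<omega>"
    and distr: "\<And>e x. e \<in> lattice_edges \<Longrightarrow> F x = measure M {\<omega> \<in> space M. t e \<omega> \<le> x}"
    and moment: "(\<integral>\<^sup>+ x\<in>{0..}. ennreal x \<partial>interval_measure F) < \<infinity>"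
    and h_pos: "\<And>n. 0 < h n"
    and h_lim: "filterlim h at_top sequentially"
    and A: "hyperrectangle A"
    and v: "unit_normal v A"
  shows "tendsto_L1 M (rescaled_flow t v A h) (flow_constant M t v) \<and>
         (0 \<in> A \<or>
          (\<integral>\<^sup>+ x\<in>{0..}. ennreal (x powr (1 + 1 / (real CARD('d) - 1))) \<partial>interval_measure F) < \<infinity>
          \<longrightarrow> (AE \<omega> in M. (\<lambda>n. rescaled_flow t v A h n \<omega>) \<longlonglongrightarrow> flow_constant M t v))"
proof -
 interpret prob_space M by (rule M)
 define j :: 'd where "j = undefined"
 have rv: "random_variable borel (t e)" if "e \<in> lattice_edges" for e
  using indep that unfolding indep_vars_def by blast
 have law: "interval_measure F = distr M borel (t e)" if "e \<in> lattice_edges" for e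
  by (rule interval_measure_distribution[OF rv[OF that] distr[OF that]])
 have integral: "integrable M (%w. g (t e w))"
  if e: "e \<in> lattice_edges" and fin: "(\<integral>\<^sup>+ x\<in>{0..}. ennreal (g x) \<partial>interval_measure F) < \<infinity>"
   and g: "g \<in> borel_measurable borel" "!!x. 0 <= x ==> 0 <= g x" for e and g :: "real => real"
 proof (rule integrableI_nonneg)
  have m: "(%x. ennreal (g x)*indicator {0..} x) \<in> borel_measurable (distr M borel (t e))" using g(1) by measurable
  show "(%w. g (t e w)) \<in> borel_measurable M" using rv[OF e] g(1) by (rule measurable_compose)
  show "AE w in M. 0 <= g (t e w)" using nonneg[OF e] g(2) by (intro AE_I2) auto
  have "(\<integral>\<^sup>+w. ennreal (g (t e w)) \<partial>M) = (\<integral>\<^sup>+w. ennreal (g (t e w))*indicator {0..} (t e w) \<partial>M)"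
   by (rule nn_integral_cong) (use nonneg[OF e] in simp)
  also have "... = (\<integral>\<^sup>+x. ennreal (g x)*indicator {0..} x \<partial>distr M borel (t e))"
   by (rule nn_integral_distr[OF rv[OF e] m, symmetric])
  finally show "(\<integral>\<^sup>+w. ennreal (g (t e w)) \<partial>M) < \<infinity>" using fin law[OF e] by simp
 qed
 interpret percolation_capacities M t v j
 proof
  show "distr M borel (t e) = distr M borel (t e')" if "e \<in> lattice_edges" "e' \<in> lattice_edges" for e e'
   using law[OF that(1)] law[OF that(2)] by simp
  show "integrable M (t e)" if "e \<in> lattice_edges" for e
   using integral[OF that, of "%x. x"] moment by simp
 qed (use dim indep nonneg in auto)
 obtain \<kappa> where \<kappa>: "0 < \<kappa>"
  "!!(Q :: real^'d => real^'d) (lo :: 'd => real) hi r. orthogonal_transformation Q ==> (\<forall>i. i ~= j --> lo i < hi i) ==>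
   enn2real (hausdorff_measure (CARD('d) - 1) (rect Q j lo hi r)) = \<kappa>*(\<Prod>i\<in>-{j}. hi i - lo i)"
  using hausdorff_measure_hyperrectangle[OF dim, of j] by blast
 note convergence = rescaled_flow_convergence[OF _ _ _ _ \<kappa>]
 have const: "flow_constant M t v = flow_density/\<kappa>"
  unfolding flow_constant_def
 proof (rule the_equality)
  show "\<forall>A h. hyperrectangle A & unit_normal v A & (\<forall>n. 0 < h n) & filterlim h at_top sequentially
    --> (%n. expectation (rescaled_flow t v A h n)) \<longlonglongrightarrow> flow_density/\<kappa>"
   using convergence(1) by blast
  fix L assume "\<forall>A h. hyperrectangle A & unit_normal v A & (\<forall>n. 0 < h n) & filterlim h at_top sequentially
    --> (%n. expectation (rescaled_flow t v A h n)) \<longlonglongrightarrow> L"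
  then have "(%n. expectation (rescaled_flow t v A h n)) \<longlonglongrightarrow> L" using A v h_pos h_lim by blast
  then show "L = flow_density/\<kappa>" using convergence(1)[OF A v h_pos h_lim] by (rule LIMSEQ_unique)
 qed
 have exponent: "real CARD('d) - 1 = real (card (- {j}))" using dim card_other_axes(1) by simp
 have "integrable M (%w. t base_edge w powr (1 + 1/real (card (- {j}))))"
  if "(\<integral>\<^sup>+ x\<in>{0..}. ennreal (x powr (1 + 1/(real CARD('d) - 1))) \<partial>interval_measure F) < \<infinity>"
  using integral[OF base_edge that] unfolding exponent by simp
 then show ?thesis
  unfolding const using convergence(2,3)[OF A v h_pos h_lim] by blast
qed

end
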